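(* Let $q>2$ be a power of a prime $p$, $\mathbb{F}$ a field with $q$ elements, $G=GL_2(\mathbb{F})$, and let $k$ be an integer with $2\le k\le p-1$. Then the two exact sequences of $\mathbb{F}[G]$-modules $$0\to H^0(C_{/\mathbb{F}},\Omega^1_{C_{/\mathbb{F}}})_{-k}\xrightarrow{\iota} H^1_{dR}(C_{/\mathbb{F}})_{-k}\xrightarrow{\pi} H^1(C_{/\mathbb{F}},\mathcal{O}_{C_{/\mathbb{F}}})_{-k}\to 0$$ and $$0\to e\otimes V_{k-2}\xrightarrow{\overline{\theta}_q}\frac{V_{k+(q-1)}}{D(V_k)}\xrightarrow{\pi''}\mathrm{coker}\,\overline{\theta}_q\to 0$$ are isomorphic, i.e. there are vertical isomorphisms of $\mathbb{F}[G]$-modules between corresponding terms making the resulting diagram commute. Furthermore, if $q=p$, then $\mathrm{coker}\,\overline{\theta}_q\simeq e^k\otimes V_{q-1-k}$.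
   Context: $V_j=\mathrm{Sym}^j\mathbb{F}^2$ is the space of homogeneous polynomials of degree $j$ in $\mathbb{F}[X,Y]$, with left $G$-action by algebra automorphisms determined by $\begin{pmatrix} a&b\\c&d\end{pmatrix}\cdot X=aX+cY$, $\begin{pmatrix} a&b\\c&d\end{pmatrix}\cdot Y=bX+dY$; $e$ is the determinant character. $Df=X^q\frac{\partial f}{\partial X}+Y^q\frac{\partial f}{\partial Y}$ is a $G$-map $V_k\to V_{k+(q-1)}$. $\overline{\theta}_q$ is the ($G$-equivariant, injective) map induced by multiplication by $\theta_q=X^qY-XY^q$, and $\pi''$ is the canonical projection. $C$ is the smooth projective plane curve $XY^q-X^qY-Z^{q+1}=0$ over $\mathbb{F}$; $t_1=Y/X$, $t_2=Z/X$. De Rham cohomology $H^1_{dR}(C)$ is computed by Čech cocycles for the cover by $U_0=\{X\ne0\}$, $U_1=\{Y\neq 0\}$: it is the space of triples $(\omega_0,\omega_1,f_{01})$ with $\omega_i\in H^0(U_i\cap C,\Omega^1_C)$, $f_{01}\in H^0(U_0\cap U_1\cap C,\mathcal{O}_C)$, $df_{01}=\omega_0-\omega_1$, modulo triples $(df_0,df_1,f_0-f_1)$ with $f_i\in H^0(U_i\cap C,\mathcal{O}_C)$. The subscript $-k$ denotes the part on which the $(q+1)$-st roots of unity $\zeta$, acting by $Z\mapsto\zeta Z$ on coordinates, act as $\zeta^{-k}$. Explicitly: $H^0(C,\Omega_C^1)_{-k}$ has basis $t_1^at_2^{q-k}dt_2$ ($0\le a\le k-2$); $H^1_{dR}(C)_{-k}$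 has basis $e_{a,q-k}=[(t_1^at_2^{q-k}dt_2,\,t_1^at_2^{q-k}dt_2,\,0)]$ ($0\le a\le k-2$) and $e_{a,q+1-k}=[(-at_1^{q-1+a}t_2^{q-k}dt_2,\,-(a+1-k)t_1^at_2^{q-k}dt_2,\,t_1^at_2^{q+1-k})]$ ($1\le -a\le q-k$); $H^1(C,\mathcal{O}_C)_{-k}$ has basis the classes of $t_1^at_2^{q+1-k}$ ($1\le -a\le q-k$). The map $\iota$ is $\omega\mapsto[(\omega|_{U_0},\omega|_{U_1},0)]$ and $\pi$ is $[(\omega_0,\omega_1,f_{01})]\mapsto f_{01}$. Action of $G$ on the first sequence: $SL_2(\mathbb{F})$ acts through its action on $C$, where $g$ acts on the coordinates $X,Y$ by linear substitution through $h=(g^{-1})^t$ ($X\mapsto h_{11}X+h_{21}Y$, $Y\mapsto h_{12}X+h_{22}Y$) and fixes $Z$. This is extended to $G$ by letting diagonal matrices act by $\begin{pmatrix}x_1&0\\0&x_2\end{pmatrix}e_{a,q-k}=x_1^{a+1}x_2^{k-a-1}e_{a,q-k}$ ($0\le a\le k-2$) and $\begin{pmatrix}x_1&0\\0&x_2\end{pmatrix}e_{a,q+1-k}=x_1^{a+1}x_2^{k-a-1}e_{a,q+1-k}$ ($1\le -a\le q-k$), and correspondingly on the subspace $H^0(C,\Omega^1_C)_{-k}$ and on the quotient $H^1(C,\mathcal{O}_C)_{-k}$. *)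

theory Defs
  imports
    "HOL-Analysis.Determinants"
    "HOL-Computational_Algebra.Polynomial"
    "HOL-Library.Poly_Mapping"
    "HOL-Algebra.Algebraic_Closure_Type"
    "HOL-Algebra.AbelCoset"
    "HOL-Algebra.Module"
begin

hide_const (open) Polynomial.smult

section \<open>Modules over the group algebra of \<open>GL\<^sub>2\<close>\<close>

text \<open>
  The finite field is the type \<open>'a\<close>, its cardinality \<open>q\<close> is \<open>CARD('a)\<close>. An \<open>\<bbbF>[G]\<close>-module is an
  \<open>\<bbbF>\<close>-vector space with a linear action of the invertible matrices; the fields \<open>mult\<close> and \<open>one\<close>,
  which the record type of modules inherits from rings, are meaningless.
\<close>

definition GL2 :: "('a::field ^ 2 ^ 2) set" where "GL2 = {g. invertible g}"

definition SL2 :: "('a::field ^ 2 ^ 2) set" where "SL2 = {g. det g = 1}"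

definition diag2 :: "'a::zero \<Rightarrow> 'a \<Rightarrow> 'a ^ 2 ^ 2" where
  "diag2 x1 x2 = vector [vector [x1, 0], vector [0, x2]]"

record ('a, 'm) gl2_module = "('a, 'm) module" +
  act :: "'a ^ 2 ^ 2 \<Rightarrow> 'm \<Rightarrow> 'm"

definition is_gl2_module :: "('a::field, 'm) gl2_module \<Rightarrow> bool" where
  "is_gl2_module M \<longleftrightarrow>
     Module.module ring_of_type_algebra M \<and>
     (\<forall>g\<in>GL2. \<forall>m\<in>carrier M. act M g m \<in> carrier M) \<and>
     (\<forall>g\<in>GL2. \<forall>m\<in>carrier M. \<forall>n\<in>carrier M.
        act M g (m \<oplus>\<^bsub>M\<^esub> n) = act M g m \<oplus>\<^bsub>M\<^esub> act M g n) \<and>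
     (\<forall>g\<in>GL2. \<forall>c. \<forall>m\<in>carrier M. act M g (c \<odot>\<^bsub>M\<^esub> m) = c \<odot>\<^bsub>M\<^esub> act M g m) \<and>
     (\<forall>m\<in>carrier M. act M (mat 1) m = m) \<and>
     (\<forall>g\<in>GL2. \<forall>h\<in>GL2. \<forall>m\<in>carrier M. act M (g ** h) m = act M g (act M h m))"

definition gl2_hom ::
    "('a::field, 'm) gl2_module \<Rightarrow> ('a, 'n) gl2_module \<Rightarrow> ('m \<Rightarrow> 'n) set" where
  "gl2_hom M N = {f. f ` carrier M \<subseteq> carrier N \<and>
     (\<forall>m\<in>carrier M. \<forall>n\<in>carrier M. f (m \<oplus>\<^bsub>M\<^esub> n) = f m \<oplus>\<^bsub>N\<^esub> f n) \<and>
     (\<forall>c. \<forall>m\<in>carrier M. f (c \<odot>\<^bsub>M\<^esub> m) = c \<odot>\<^bsub>N\<^esub> f m) \<and>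
     (\<forall>g\<in>GL2. \<forall>m\<in>carrier M. f (act M g m) = act N g (f m))}"

definition gl2_iso ::
    "('a::field, 'm) gl2_module \<Rightarrow> ('a, 'n) gl2_module \<Rightarrow> ('m \<Rightarrow> 'n) set" where
  "gl2_iso M N = {f \<in> gl2_hom M N. bij_betw f (carrier M) (carrier N)}"

definition short_exact ::
    "('a::field, 'l) gl2_module \<Rightarrow> ('l \<Rightarrow> 'm) \<Rightarrow> ('a, 'm) gl2_module \<Rightarrow> ('m \<Rightarrow> 'n) \<Rightarrow>
     ('a, 'n) gl2_module \<Rightarrow> bool" where
  "short_exact L i M p N \<longleftrightarrow>
     is_gl2_module L \<and> is_gl2_module M \<and> is_gl2_module N \<and>
     i \<in> gl2_hom L M \<and> p \<in> gl2_hom M N \<and>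
     inj_on i (carrier L) \<and> i ` carrier L = a_kernel M N p \<and> p ` carrier M = carrier N"

definition with_action ::
    "('a, 'm) module \<Rightarrow> ('a ^ 2 ^ 2 \<Rightarrow> 'm \<Rightarrow> 'm) \<Rightarrow> ('a, 'm) gl2_module" where
  "with_action M \<rho> = module.extend M (gl2_module.fields \<rho>)"

definition quot_module ::
    "('a, 'm, 'z) module_scheme \<Rightarrow> 'm set \<Rightarrow> ('a, 'm set) module" where
  "quot_module M W = \<lparr>carrier = a_rcosets\<^bsub>M\<^esub> W, mult = undefined, one = undefined,
     zero = W, add = set_add M, smult = (\<lambda>c U. W <+>\<^bsub>M\<^esub> ((\<lambda>m. c \<odot>\<^bsub>M\<^esub> m) ` U))\<rparr>"

definition quot_gl2_module ::
    "('a, 'm) gl2_module \<Rightarrow> 'm set \<Rightarrow> ('a, 'm set) gl2_module" where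
  "quot_gl2_module M W = with_action (quot_module M W) (\<lambda>g U. act M g ` U)"

text \<open>\<open>twist n M\<close> is \<open>e\<^sup>n \<otimes> M\<close>, where \<open>e\<close> is the determinant character.\<close>

definition twist :: "nat \<Rightarrow> ('a::field, 'm) gl2_module \<Rightarrow> ('a, 'm) gl2_module" where
  "twist n M = M\<lparr>act := (\<lambda>g m. (det g ^ n) \<odot>\<^bsub>M\<^esub> act M g m)\<rparr>"

definition type_module :: "('e \<Rightarrow> 'm \<Rightarrow> 'm) \<Rightarrow> 'm set \<Rightarrow> ('e, 'm::{zero,plus}) module" where
  "type_module sc S = \<lparr>carrier = S, mult = undefined, one = undefined,
     zero = 0, add = (+), smult = sc\<rparr>"


section \<open>Homogeneous polynomials in two variables\<close>

text \<open>\<open>\<bbbF>[X, Y]\<close> is \<open>'e poly poly\<close>, where \<open>X\<close> is the inner and \<open>Y\<close> the outer variable.\<close>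

definition cst2 :: "'e::comm_ring_1 \<Rightarrow> 'e poly poly" where "cst2 c = [:[:c:]:]"
definition varX :: "'e::comm_ring_1 poly poly" where "varX = [:[:0, 1:]:]"
definition varY :: "'e::comm_ring_1 poly poly" where "varY = [:0, 1:]"

text \<open>Substitution \<open>X \<mapsto> x\<close>, \<open>Y \<mapsto> y\<close>, with coefficients transported by the ring homomorphism \<open>h\<close>.\<close>

definition subst2 ::
    "('e::comm_ring_1 \<Rightarrow> 'r::comm_ring_1) \<Rightarrow> 'r \<Rightarrow> 'r \<Rightarrow> 'e poly poly \<Rightarrow> 'r" where
  "subst2 h x y f = poly (map_poly (\<lambda>c. poly (map_poly h c) x) f) y"

definition homog :: "nat \<Rightarrow> 'e::comm_ring_1 poly poly set" where
  "homog n = {f. \<forall>i j. Polynomial.coeff (Polynomial.coeff f j) i \<noteq> 0 \<longrightarrow> i + j = n}"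

definition Sym :: "nat \<Rightarrow> ('a::field, 'a poly poly) gl2_module" where
  "Sym n = with_action (type_module (\<lambda>c f. cst2 c * f) (homog n))
     (\<lambda>g. subst2 cst2 (cst2 (g$1$1) * varX + cst2 (g$2$1) * varY)
                      (cst2 (g$1$2) * varX + cst2 (g$2$2) * varY))"

definition Dq :: "'a::{finite,field} poly poly \<Rightarrow> 'a poly poly" where
  "Dq f = varX ^ CARD('a) * map_poly pderiv f + varY ^ CARD('a) * pderiv f"

definition theta :: "'a::{finite,field} poly poly" where
  "theta = varX ^ CARD('a) * varY - varX * varY ^ CARD('a)"

definition Sym_mod_Dq :: "nat \<Rightarrow> ('a::{finite,field}, 'a poly poly set) gl2_module" where
  "Sym_mod_Dq k = quot_gl2_module (Sym (k + (CARD('a) - 1))) (Dq ` carrier (Sym k))"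

definition theta_bar :: "nat \<Rightarrow> 'a::{finite,field} poly poly \<Rightarrow> 'a poly poly set" where
  "theta_bar k f = Dq ` carrier (Sym k) +>\<^bsub>Sym (k + (CARD('a) - 1))\<^esub> (theta * f)"

definition coker_theta :: "nat \<Rightarrow> ('a::{finite,field}, 'a poly poly set set) gl2_module" where
  "coker_theta k = quot_gl2_module (Sym_mod_Dq k) (theta_bar k ` carrier (Sym (k - 2)))"

definition proj_coker :: "nat \<Rightarrow> 'a::{finite,field} poly poly set \<Rightarrow> 'a poly poly set set" where
  "proj_coker k U = theta_bar k ` carrier (Sym (k - 2)) +>\<^bsub>Sym_mod_Dq k\<^esub> U"


section \<open>Functions on the curve \<open>X Y\<^sup>q - X\<^sup>q Y = Z\<^sup>q\<^sup>+\<^sup>1\<close>\<close>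

text \<open>
  For a field \<open>'e\<close> containing \<open>'a\<close>, the type \<open>('a, 'e) crv\<close> is the coordinate ring
  \<open>'e[u, v] / (u v\<^sup>q - u\<^sup>q v - 1)\<close>, \<open>u = X/Z\<close>, \<open>v = Y/Z\<close>, of the dense affine open part
  \<open>C - {Z = 0}\<close> of the curve \<open>C\<close> over \<open>'e\<close> (the field \<open>'a\<close> only enters through \<open>q\<close>).

  For a nonzero linear form \<open>l\<close> in \<open>X, Y\<close> with coefficients in \<open>'a\<close> let \<open>U\<^sub>l = {l \<noteq> 0}\<close>. Up to a scalar
  \<open>X Y\<^sup>q - X\<^sup>q Y\<close> is the product of these forms, one for each line, so the equation of \<open>C\<close> shows
  that \<open>C - {Z = 0}\<close> is the intersection of all the \<open>U\<^sub>l \<inter> C\<close>, and is obtained from each of them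
  by inverting \<open>Z/l\<close>. This is a nonzero divisor on the smooth curve \<open>U\<^sub>l \<inter> C\<close>, on
  which \<open>\<Omega>\<^sup>1\<close> is locally free. Hence a section of \<open>\<O>\<^sub>C\<close> or \<open>\<Omega>\<^sup>1\<^sub>C\<close> over an intersection of sets
  \<open>U\<^sub>l \<inter> C\<close> is determined by its restriction to \<open>C - {Z = 0}\<close>, by which it is represented here.
  Restriction maps between such open sets thus become inclusions.
\<close>

definition crv_poly :: "'a::{finite,field} itself \<Rightarrow> 'e::field poly poly" where
  "crv_poly _ = varX * varY ^ CARD('a) - varX ^ CARD('a) * varY - 1"

quotient_type (overloaded) ('a, 'e) crv = "'e::field poly poly" /
  "\<lambda>f g. crv_poly TYPE('a::{finite,field}) dvd f - g"
proof (rule equivpI)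
  show "reflp (\<lambda>f g. (crv_poly TYPE('a) :: 'e poly poly) dvd f - g)"
    by (rule reflpI) simp
  show "symp (\<lambda>f g. (crv_poly TYPE('a) :: 'e poly poly) dvd f - g)"
    by (rule sympI) (metis dvd_minus_iff minus_diff_eq)
  show "transp (\<lambda>f g. (crv_poly TYPE('a) :: 'e poly poly) dvd f - g)"
  proof (rule transpI)
    fix f g h :: "'e poly poly"
    assume "crv_poly TYPE('a) dvd f - g" "crv_poly TYPE('a) dvd g - h"
    from dvd_add[OF this] show "crv_poly TYPE('a) dvd f - h" by simp
  qed
qed

lemma degree_crv_poly: "Polynomial.degree (crv_poly TYPE('a::{finite,field}) :: 'e::field poly poly) = CARD('a)"
proof -
  have card: "CARD('a) > 1"
    using card_mono[of UNIV "{0, 1 :: 'a}"] by simp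
  have 1: "crv_poly TYPE('a) =
      - [:1, [:0, 1 :: 'e:] ^ CARD('a):] + Polynomial.monom [:0, 1:] CARD('a)"
    by (simp add: crv_poly_def varX_def varY_def poly_const_pow Polynomial.monom_altdef one_pCons)
  have "Polynomial.degree (- [:1, [:0, 1 :: 'e:] ^ CARD('a):]) < CARD('a)"
    using card by (simp add: degree_pCons_eq_if)
  thus ?thesis
    unfolding 1 by (subst degree_add_eq_right) (simp_all add: degree_monom_eq)
qed

instantiation crv :: ("{finite,field}", field) comm_ring_1
begin

lift_definition zero_crv :: "('a, 'b) crv" is 0 .
lift_definition one_crv :: "('a, 'b) crv" is 1 .
lift_definition plus_crv :: "('a, 'b) crv \<Rightarrow> ('a, 'b) crv \<Rightarrow> ('a, 'b) crv" is "(+)"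
proof -
  fix f f' g g' :: "'b poly poly"
  assume "crv_poly TYPE('a) dvd f - f'" "crv_poly TYPE('a) dvd g - g'"
  from dvd_add[OF this] show "crv_poly TYPE('a) dvd f + g - (f' + g')"
    by (simp add: algebra_simps)
qed
lift_definition minus_crv :: "('a, 'b) crv \<Rightarrow> ('a, 'b) crv \<Rightarrow> ('a, 'b) crv" is "(-)"
proof -
  fix f f' g g' :: "'b poly poly"
  assume "crv_poly TYPE('a) dvd f - f'" "crv_poly TYPE('a) dvd g - g'"
  from dvd_diff[OF this] show "crv_poly TYPE('a) dvd f - g - (f' - g')"
    by (simp add: algebra_simps)
qed
lift_definition uminus_crv :: "('a, 'b) crv \<Rightarrow> ('a, 'b) crv" is uminus
  by (metis minus_diff_eq minus_diff_minus dvd_minus_iff)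
lift_definition times_crv :: "('a, 'b) crv \<Rightarrow> ('a, 'b) crv \<Rightarrow> ('a, 'b) crv" is "(*)"
proof -
  fix f f' g g' :: "'b poly poly"
  assume "crv_poly TYPE('a) dvd f - f'" "crv_poly TYPE('a) dvd g - g'"
  hence "crv_poly TYPE('a) dvd (f - f') * g + f' * (g - g')" by simp
  thus "crv_poly TYPE('a) dvd f * g - f' * g'"
    by (simp add: algebra_simps)
qed

instance
proof
  show "0 \<noteq> (1 :: ('a, 'b) crv)"
  proof
    assume "0 = (1 :: ('a, 'b) crv)"
    hence "crv_poly TYPE('a) dvd (1 :: 'b poly poly)" by transfer simp
    hence "Polynomial.degree (crv_poly TYPE('a) :: 'b poly poly) \<le> 0"
      using dvd_imp_degree_le[of "crv_poly TYPE('a)" "1 :: 'b poly poly"] by simp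
    thus False by (simp add: degree_crv_poly)
  qed
qed (transfer; simp add: algebra_simps)+

end

text \<open>Only inverses of units are meaningful; \<open>crv_u\<close>, \<open>crv_v\<close> and all \<open>'a\<close>-linear forms are units.\<close>

instantiation crv :: ("{finite,field}", field) inverse
begin

definition inverse_crv :: "('a, 'b) crv \<Rightarrow> ('a, 'b) crv" where
  "inverse_crv f = (if f dvd 1 then (THE g. f * g = 1) else 0)"
definition divide_crv :: "('a, 'b) crv \<Rightarrow> ('a, 'b) crv \<Rightarrow> ('a, 'b) crv" where
  "divide_crv f g = f * inverse g"

instance ..

end

lift_definition cst :: "'e::field \<Rightarrow> ('a::{finite,field}, 'e) crv" is cst2 .
lift_definition crv_u :: "('a::{finite,field}, 'e::field) crv" is varX .
lift_definition crv_v :: "('a::{finite,field}, 'e::field) crv" is varY .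

text \<open>
  The ring homomorphism with \<open>crv_u \<mapsto> x\<close>, \<open>crv_v \<mapsto> y\<close> which is \<open>h\<close> on constants. It is only used when
  \<open>x y\<^sup>q - x\<^sup>q y = 1\<close>, so that it does not depend on the representative.
\<close>

definition crv_subst ::
    "('e::field \<Rightarrow> 'f::field) \<Rightarrow> ('a::{finite,field}, 'f) crv \<Rightarrow> ('a, 'f) crv \<Rightarrow>
     ('a, 'e) crv \<Rightarrow> ('a, 'f) crv" where
  "crv_subst h x y f = subst2 (\<lambda>c. cst (h c)) x y (rep_crv f)"

inductive_set subalg :: "('a::{finite,field}, 'e::field) crv set \<Rightarrow> ('a, 'e) crv set"
  for S where
  "cst c \<in> subalg S"
| "s \<in> S \<Longrightarrow> s \<in> subalg S"
| "f \<in> subalg S \<Longrightarrow> g \<in> subalg S \<Longrightarrow> f + g \<in> subalg S"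
| "f \<in> subalg S \<Longrightarrow> g \<in> subalg S \<Longrightarrow> f * g \<in> subalg S"

text \<open>
  \<open>reg L\<close> is the ring of regular functions on the intersection of the \<open>U\<^sub>l \<inter> C\<close>, \<open>l \<in> L\<close>, which is
  generated by the functions \<open>X/l, Y/l, Z/l\<close>. A linear form \<open>l\<close> is represented by the function
  \<open>l/Z\<close>; so \<open>X, Y, Z\<close> are \<open>crv_u, crv_v, 1\<close>, and \<open>U\<^sub>0\<close>, \<open>U\<^sub>1\<close> belong to \<open>crv_u\<close>, \<open>crv_v\<close>.
\<close>

definition reg :: "('a::{finite,field}, 'e::field) crv set \<Rightarrow> ('a, 'e) crv set" where
  "reg L = subalg (\<Union>l\<in>L. {crv_u / l, crv_v / l, 1 / l})"

definition t1 :: "('a::{finite,field}, 'e::field) crv" where "t1 = crv_v / crv_u"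
definition t2 :: "('a::{finite,field}, 'e::field) crv" where "t2 = 1 / crv_u"


section \<open>Kaehler differentials\<close>

lifting_forget crv.lifting

text \<open>
  \<open>\<Omega>\<^sup>1\<close> of the ring \<open>('a, 'e) crv\<close> over \<open>'e\<close>: the free module on symbols \<open>d f\<close> (the element
  \<open>Poly_Mapping.single f a\<close> stands for \<open>a d f\<close>) modulo the relations of a derivation over \<open>'e\<close>.
\<close>

inductive_set kaehler_rel ::
    "(('a::{finite,field}, 'e::field) crv \<Rightarrow>\<^sub>0 ('a, 'e) crv) set" where
  kaehler_rel_zero: "0 \<in> kaehler_rel"
| kaehler_rel_plus: "w \<in> kaehler_rel \<Longrightarrow> w' \<in> kaehler_rel \<Longrightarrow> w + w' \<in> kaehler_rel"
| kaehler_rel_scale: "w \<in> kaehler_rel \<Longrightarrow> Poly_Mapping.map ((*) a) w \<in> kaehler_rel"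
| kaehler_rel_const: "Poly_Mapping.single (cst c) 1 \<in> kaehler_rel"
| kaehler_rel_add: "Poly_Mapping.single (f + g) 1 - Poly_Mapping.single f 1
    - Poly_Mapping.single g 1 \<in> kaehler_rel"
| kaehler_rel_mult: "Poly_Mapping.single (f * g) 1 - Poly_Mapping.single g f
    - Poly_Mapping.single f g \<in> kaehler_rel"

lemma pm_map_eq_lookup:
  "Poly_Mapping.lookup (Poly_Mapping.map ((*) a) w) x = (a :: 'r::comm_ring_1) * Poly_Mapping.lookup w x"
  by (simp add: Poly_Mapping.map.rep_eq when_def)

lemma pm_map_diff: "Poly_Mapping.map ((*) (a :: 'r::comm_ring_1)) (w - w') =
    Poly_Mapping.map ((*) a) w - Poly_Mapping.map ((*) a) w'"
  by (rule poly_mapping_eqI) (simp add: pm_map_eq_lookup lookup_minus algebra_simps)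

lemma kaehler_rel_uminus: "w \<in> kaehler_rel \<Longrightarrow> - w \<in> kaehler_rel"
proof -
  assume "w \<in> kaehler_rel"
  hence "Poly_Mapping.map ((*) (-1)) w \<in> kaehler_rel" by (rule kaehler_rel_scale)
  moreover have "Poly_Mapping.map ((*) (-1)) w = - w"
    by (rule poly_mapping_eqI) (simp add: pm_map_eq_lookup)
  ultimately show ?thesis by simp
qed

quotient_type (overloaded) ('a, 'e) kaehler =
  "('a::{finite,field}, 'e::field) crv \<Rightarrow>\<^sub>0 ('a, 'e) crv" / "\<lambda>w w'. w - w' \<in> kaehler_rel"
proof (rule equivpI)
  show "reflp (\<lambda>w w' :: ('a, 'e) crv \<Rightarrow>\<^sub>0 ('a, 'e) crv. w - w' \<in> kaehler_rel)"
    by (rule reflpI) (simp add: kaehler_rel_zero)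
  show "symp (\<lambda>w w' :: ('a, 'e) crv \<Rightarrow>\<^sub>0 ('a, 'e) crv. w - w' \<in> kaehler_rel)"
    by (rule sympI) (metis kaehler_rel_uminus minus_diff_eq)
  show "transp (\<lambda>w w' :: ('a, 'e) crv \<Rightarrow>\<^sub>0 ('a, 'e) crv. w - w' \<in> kaehler_rel)"
  proof (rule transpI)
    fix w w' w'' :: "('a, 'e) crv \<Rightarrow>\<^sub>0 ('a, 'e) crv"
    assume "w - w' \<in> kaehler_rel" "w' - w'' \<in> kaehler_rel"
    from kaehler_rel_plus[OF this] show "w - w'' \<in> kaehler_rel" by simp
  qed
qed

instantiation kaehler :: ("{finite,field}", field) ab_group_add
begin

lift_definition zero_kaehler :: "('a, 'b) kaehler" is 0 .
lift_definition plus_kaehler :: "('a, 'b) kaehler \<Rightarrow> ('a, 'b) kaehler \<Rightarrow> ('a, 'b) kaehler" is "(+)"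
proof -
  fix f f' g g' :: "('a, 'b) crv \<Rightarrow>\<^sub>0 ('a, 'b) crv"
  assume "f - f' \<in> kaehler_rel" "g - g' \<in> kaehler_rel"
  from kaehler_rel_plus[OF this] show "f + g - (f' + g') \<in> kaehler_rel"
    by (simp add: algebra_simps)
qed
lift_definition uminus_kaehler :: "('a, 'b) kaehler \<Rightarrow> ('a, 'b) kaehler" is uminus
  by (metis kaehler_rel_uminus minus_diff_eq minus_diff_minus)
definition minus_kaehler :: "('a, 'b) kaehler \<Rightarrow> ('a, 'b) kaehler \<Rightarrow> ('a, 'b) kaehler" where
  "minus_kaehler w w' = w + - w'"

instance
proof
  fix x y z :: "('a, 'b) kaehler"
  show "x + y + z = x + (y + z)" by transfer (simp add: kaehler_rel_zero algebra_simps)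
  show "x + y = y + x" by transfer (simp add: kaehler_rel_zero algebra_simps)
  show "0 + x = x" by transfer (simp add: kaehler_rel_zero)
  show "- x + x = 0" by transfer (simp add: kaehler_rel_zero)
  show "x - y = x + - y" by (simp add: minus_kaehler_def)
qed

end

lift_definition scaleK :: "('a::{finite,field}, 'e::field) crv \<Rightarrow> ('a, 'e) kaehler \<Rightarrow> ('a, 'e) kaehler"
    (infixr \<open>\<bullet>\<^sub>K\<close> 75)
  is "\<lambda>a. Poly_Mapping.map ((*) a)"
  by (simp add: pm_map_diff[symmetric] kaehler_rel_scale)

lift_definition dK :: "('a::{finite,field}, 'e::field) crv \<Rightarrow> ('a, 'e) kaehler"
  is "\<lambda>f. Poly_Mapping.single f 1" .

text \<open>The map \<open>\<Sum> a\<^sub>i d f\<^sub>i \<mapsto> \<Sum> h(a\<^sub>i) d h(f\<^sub>i)\<close> induced by a ring homomorphism \<open>h\<close>.\<close>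

definition mapK ::
    "(('a::{finite,field}, 'e::field) crv \<Rightarrow> ('a, 'f::field) crv) \<Rightarrow> ('a, 'e) kaehler \<Rightarrow> ('a, 'f) kaehler"
  where "mapK h w = (\<Sum>f\<in>Poly_Mapping.keys (rep_kaehler w).
     h (Poly_Mapping.lookup (rep_kaehler w) f) \<bullet>\<^sub>K dK (h f))"

text \<open>The sections of \<open>\<Omega>\<^sup>1\<^sub>C\<close> over the intersection of the \<open>U\<^sub>l \<inter> C\<close>, \<open>l \<in> L\<close>.\<close>

inductive_set Omega :: "('a::{finite,field}, 'e::field) crv set \<Rightarrow> ('a, 'e) kaehler set"
  for L where
  "0 \<in> Omega L"
| "f \<in> reg L \<Longrightarrow> g \<in> reg L \<Longrightarrow> f \<bullet>\<^sub>K dK g \<in> Omega L"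
| "w \<in> Omega L \<Longrightarrow> w' \<in> Omega L \<Longrightarrow> w + w' \<in> Omega L"


section \<open>Cohomology of the curve\<close>

type_synonym ('a, 'e) dR_cochain = "('a, 'e) kaehler \<times> ('a, 'e) kaehler \<times> ('a, 'e) crv"

definition H0 :: "('e::field, ('a::{finite,field}, 'e) kaehler) module" where
  "H0 = type_module (\<lambda>c w. cst c \<bullet>\<^sub>K w) (Omega {crv_u} \<inter> Omega {crv_v})"

definition Z_dR :: "('e::field, ('a::{finite,field}, 'e) dR_cochain) module" where
  "Z_dR = type_module (\<lambda>c (w0, w1, f). (cst c \<bullet>\<^sub>K w0, cst c \<bullet>\<^sub>K w1, cst c * f))
     {(w0, w1, f). w0 \<in> Omega {crv_u} \<and> w1 \<in> Omega {crv_v} \<and> f \<in> reg {crv_u, crv_v} \<and>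
        dK f = w0 - w1}"

definition B_dR :: "('a::{finite,field}, 'e::field) dR_cochain set" where
  "B_dR = {(dK f0, dK f1, f0 - f1) | f0 f1. f0 \<in> reg {crv_u} \<and> f1 \<in> reg {crv_v}}"

definition H_dR :: "('e::field, ('a::{finite,field}, 'e) dR_cochain set) module" where
  "H_dR = quot_module Z_dR B_dR"

definition Z_O :: "('e::field, ('a::{finite,field}, 'e) crv) module" where
  "Z_O = type_module (\<lambda>c f. cst c * f) (reg {crv_u, crv_v})"

definition B_O :: "('a::{finite,field}, 'e::field) crv set" where
  "B_O = {f0 - f1 | f0 f1. f0 \<in> reg {crv_u} \<and> f1 \<in> reg {crv_v}}"

definition H1_O :: "('e::field, ('a::{finite,field}, 'e) crv set) module" where
  "H1_O = quot_module Z_O B_O"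

definition iota :: "('a::{finite,field}, 'e::field) kaehler \<Rightarrow> ('a, 'e) dR_cochain set" where
  "iota w = B_dR +>\<^bsub>Z_dR\<^esub> (w, w, 0)"

text \<open>The third components of the members of a de Rham class form a class in \<open>H\<^sup>1(C, \<O>\<^sub>C)\<close>.\<close>

definition pi_dR :: "('a::{finite,field}, 'e::field) dR_cochain set \<Rightarrow> ('a, 'e) crv set" where
  "pi_dR \<xi> = (\<lambda>(w0, w1, f). f) ` \<xi>"


subsection \<open>The action of the roots of unity\<close>

text \<open>
  The \<open>(q+1)\<close>-st roots of unity need not lie in \<open>'a\<close>, so their eigenspaces are formed after base
  change \<open>bc\<close> to the algebraic closure of \<open>'a\<close>: \<open>weight_part n M M' \<mu> b\<close> consists of those
  \<open>x\<close> in the \<open>'a\<close>-space \<open>M\<close> whose image \<open>b x\<close> in \<open>M'\<close> is multiplied by \<open>\<zeta>\<^sup>n\<close> under the action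
  \<open>\<mu> \<zeta>\<close> of \<open>\<zeta>\<close>. Since \<open>Z \<mapsto> \<zeta> Z\<close>, the functions \<open>crv_u = X/Z\<close>, \<open>crv_v = Y/Z\<close> are multiplied
  by the inverse of \<open>\<zeta>\<close>.
\<close>

definition bc :: "('a::{finite,field}, 'a) crv \<Rightarrow> ('a, 'a alg_closure) crv" where
  "bc = crv_subst to_ac crv_u crv_v"

definition mu :: "'e::field \<Rightarrow> ('a::{finite,field}, 'e) crv \<Rightarrow> ('a, 'e) crv" where
  "mu \<zeta> = crv_subst id (cst (inverse \<zeta>) * crv_u) (cst (inverse \<zeta>) * crv_v)"

definition map_dR ::
    "(('a::{finite,field}, 'e::field) crv \<Rightarrow> ('a, 'f::field) crv) \<Rightarrow> ('a, 'e) dR_cochain \<Rightarrow> ('a, 'f) dR_cochain"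
  where "map_dR h = (\<lambda>(w0, w1, f). (mapK h w0, mapK h w1, h f))"

definition bc_dR :: "('a::{finite,field}, 'a) dR_cochain set \<Rightarrow> ('a, 'a alg_closure) dR_cochain set" where
  "bc_dR \<xi> = B_dR <+>\<^bsub>Z_dR\<^esub> (map_dR bc ` \<xi>)"

definition bc_O :: "('a::{finite,field}, 'a) crv set \<Rightarrow> ('a, 'a alg_closure) crv set" where
  "bc_O \<xi> = B_O <+>\<^bsub>Z_O\<^esub> (bc ` \<xi>)"

definition weight_part ::
    "int \<Rightarrow> ('a::{finite,field}, 'm) module \<Rightarrow> ('a alg_closure, 'n) module \<Rightarrow>
     ('a alg_closure \<Rightarrow> 'n \<Rightarrow> 'n) \<Rightarrow> ('m \<Rightarrow> 'n) \<Rightarrow> ('a, 'm) module" where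
  "weight_part n M M' \<mu> b = M\<lparr>carrier := {x \<in> carrier M.
     \<forall>\<zeta>. \<zeta> ^ (CARD('a) + 1) = 1 \<longrightarrow> \<mu> \<zeta> (b x) = (\<zeta> powi n) \<odot>\<^bsub>M'\<^esub> b x}\<rparr>"

definition H0_weight :: "int \<Rightarrow> ('a::{finite,field}, ('a, 'a) kaehler) module" where
  "H0_weight n = weight_part n H0 H0 (\<lambda>\<zeta>. mapK (mu \<zeta>)) (mapK bc)"

definition H_dR_weight :: "int \<Rightarrow> ('a::{finite,field}, ('a, 'a) dR_cochain set) module" where
  "H_dR_weight n = weight_part n H_dR H_dR (\<lambda>\<zeta> \<xi>. map_dR (mu \<zeta>) ` \<xi>) bc_dR"

definition H1_O_weight :: "int \<Rightarrow> ('a::{finite,field}, ('a, 'a) crv set) module" where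
  "H1_O_weight n = weight_part n H1_O H1_O (\<lambda>\<zeta> \<xi>. mu \<zeta> ` \<xi>) bc_O"


subsection \<open>The action of \<open>SL\<^sub>2\<close>\<close>

definition sl2_crv :: "'a::{finite,field} ^ 2 ^ 2 \<Rightarrow> ('a, 'a) crv \<Rightarrow> ('a, 'a) crv" where
  "sl2_crv g = (let h = transpose (matrix_inv g) in
     crv_subst id (cst (h$1$1) * crv_u + cst (h$2$1) * crv_v)
                  (cst (h$1$2) * crv_u + cst (h$2$2) * crv_v))"

text \<open>
  \<open>SL\<^sub>2\<close> does not preserve the cover by \<open>U\<^sub>0\<close>, \<open>U\<^sub>1\<close>. Its action on Cech classes for this cover is
  obtained from the cover by all \<open>U\<^sub>l \<inter> C\<close>, which it permutes: a class is lifted to a cocycle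
  \<open>(\<omega>\<^sub>l)\<^sub>l, (f\<^sub>l\<^sub>m)\<^sub>l\<^sub>,\<^sub>m\<close> for the large cover, to which \<open>g\<close> is applied, and
  the result is restricted to \<open>U\<^sub>0\<close>, \<open>U\<^sub>1\<close>. All cocycles arising in this way form one class.
\<close>

definition lin_forms :: "('a::{finite,field}, 'a) crv set" where
  "lin_forms = {cst a * crv_u + cst b * crv_v | a b. (a, b) \<noteq> (0, 0)}"

definition full_Z_O :: "(('a::{finite,field}, 'a) crv \<Rightarrow> ('a, 'a) crv \<Rightarrow> ('a, 'a) crv) set" where
  "full_Z_O = {f. (\<forall>l\<in>lin_forms. \<forall>m\<in>lin_forms. f l m \<in> reg {l, m}) \<and>
     (\<forall>l\<in>lin_forms. \<forall>m\<in>lin_forms. \<forall>n\<in>lin_forms. f l m + f m n = f l n)}"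

definition full_Z_dR ::
    "((('a::{finite,field}, 'a) crv \<Rightarrow> ('a, 'a) kaehler) \<times>
      (('a, 'a) crv \<Rightarrow> ('a, 'a) crv \<Rightarrow> ('a, 'a) crv)) set" where
  "full_Z_dR = {(w, f). (\<forall>l\<in>lin_forms. w l \<in> Omega {l}) \<and> f \<in> full_Z_O \<and>
     (\<forall>l\<in>lin_forms. \<forall>m\<in>lin_forms. dK (f l m) = w l - w m)}"

definition sl2_full_O ::
    "'a::{finite,field} ^ 2 ^ 2 \<Rightarrow> (('a, 'a) crv \<Rightarrow> ('a, 'a) crv \<Rightarrow> ('a, 'a) crv) \<Rightarrow>
     ('a, 'a) crv \<Rightarrow> ('a, 'a) crv \<Rightarrow> ('a, 'a) crv" where
  "sl2_full_O g f = (\<lambda>l m. sl2_crv g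
     (f (sl2_crv (matrix_inv g) l) (sl2_crv (matrix_inv g) m)))"

definition sl2_full_Omega ::
    "'a::{finite,field} ^ 2 ^ 2 \<Rightarrow> (('a, 'a) crv \<Rightarrow> ('a, 'a) kaehler) \<Rightarrow> ('a, 'a) crv \<Rightarrow> ('a, 'a) kaehler"
  where "sl2_full_Omega g w = (\<lambda>l. mapK (sl2_crv g) (w (sl2_crv (matrix_inv g) l)))"

definition sl2_dR ::
    "'a::{finite,field} ^ 2 ^ 2 \<Rightarrow> ('a, 'a) dR_cochain set \<Rightarrow> ('a, 'a) dR_cochain set" where
  "sl2_dR g \<xi> =
     {(sl2_full_Omega g w crv_u, sl2_full_Omega g w crv_v, sl2_full_O g f crv_u crv_v) | w f.
        (w, f) \<in> full_Z_dR \<and> (w crv_u, w crv_v, f crv_u crv_v) \<in> \<xi>}"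

definition sl2_O :: "'a::{finite,field} ^ 2 ^ 2 \<Rightarrow> ('a, 'a) crv set \<Rightarrow> ('a, 'a) crv set" where
  "sl2_O g \<xi> = {sl2_full_O g f crv_u crv_v | f. f \<in> full_Z_O \<and> f crv_u crv_v \<in> \<xi>}"


subsection \<open>The action of \<open>GL\<^sub>2\<close>\<close>

text \<open>
  An \<open>\<bbbF>[G]\<close>-module structure on \<open>M\<close> which extends a given action of \<open>SL\<^sub>2\<close> and for which the
  diagonal matrices act on the basis \<open>e a\<close>, \<open>a \<in> A\<close>, of \<open>M\<close> as prescribed. As \<open>GL\<^sub>2\<close> is generated
  by \<open>SL\<^sub>2\<close> and the diagonal matrices, there is at most one such structure.
\<close>

definition extends_sl2 ::
    "nat \<Rightarrow> ('a::field, 'm) module \<Rightarrow> ('a ^ 2 ^ 2 \<Rightarrow> 'm \<Rightarrow> 'm) \<Rightarrow> int set \<Rightarrow> (int \<Rightarrow> 'm) \<Rightarrow>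
     ('a ^ 2 ^ 2 \<Rightarrow> 'm \<Rightarrow> 'm) \<Rightarrow> bool" where
  "extends_sl2 k M \<sigma> A e \<rho> \<longleftrightarrow>
     is_gl2_module (with_action M \<rho>) \<and>
     (\<forall>g\<in>SL2. \<forall>m\<in>carrier M. \<rho> g m = \<sigma> g m) \<and>
     (\<forall>x1 x2. \<forall>a\<in>A. x1 \<noteq> 0 \<longrightarrow> x2 \<noteq> 0 \<longrightarrow>
        \<rho> (diag2 x1 x2) (e a) = (x1 powi (a + 1) * x2 powi (int k - a - 1)) \<odot>\<^bsub>M\<^esub> e a)"

definition extend_to_gl2 ::
    "nat \<Rightarrow> ('a::field, 'm) module \<Rightarrow> ('a ^ 2 ^ 2 \<Rightarrow> 'm \<Rightarrow> 'm) \<Rightarrow> int set \<Rightarrow> (int \<Rightarrow> 'm) \<Rightarrow>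
     ('a, 'm) gl2_module" where
  "extend_to_gl2 k M \<sigma> A e = with_action M (SOME \<rho>. extends_sl2 k M \<sigma> A e \<rho>)"

definition sub_range :: "nat \<Rightarrow> int set" where "sub_range k = {0..int k - 2}"

definition quot_range :: "nat \<Rightarrow> nat \<Rightarrow> int set" where
  "quot_range q k = {a. 1 \<le> - a \<and> - a \<le> int q - int k}"

definition basis_H0 :: "nat \<Rightarrow> int \<Rightarrow> ('a::{finite,field}, 'a) kaehler" where
  "basis_H0 k a = (t1 powi a * t2 ^ (CARD('a) - k)) \<bullet>\<^sub>K dK t2"

definition basis_H_dR :: "nat \<Rightarrow> int \<Rightarrow> ('a::{finite,field}, 'a) dR_cochain set" where
  "basis_H_dR k a = B_dR +>\<^bsub>Z_dR\<^esub>
     (if a \<in> sub_range k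
      then ((t1 powi a * t2 ^ (CARD('a) - k)) \<bullet>\<^sub>K dK t2,
            (t1 powi a * t2 ^ (CARD('a) - k)) \<bullet>\<^sub>K dK t2, 0)
      else ((- of_int a * t1 powi (int CARD('a) - 1 + a) * t2 ^ (CARD('a) - k)) \<bullet>\<^sub>K dK t2,
            (- of_int (a + 1 - int k) * t1 powi a * t2 ^ (CARD('a) - k)) \<bullet>\<^sub>K dK t2,
            t1 powi a * t2 ^ (CARD('a) + 1 - k)))"

definition basis_H1_O :: "nat \<Rightarrow> int \<Rightarrow> ('a::{finite,field}, 'a) crv set" where
  "basis_H1_O k a = B_O +>\<^bsub>Z_O\<^esub> (t1 powi a * t2 ^ (CARD('a) + 1 - k))"

definition H0_k :: "nat \<Rightarrow> ('a::{finite,field}, ('a, 'a) kaehler) gl2_module" where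
  "H0_k k = extend_to_gl2 k (H0_weight (- int k)) (\<lambda>g. mapK (sl2_crv g)) (sub_range k) (basis_H0 k)"

definition H_dR_k :: "nat \<Rightarrow> ('a::{finite,field}, ('a, 'a) dR_cochain set) gl2_module" where
  "H_dR_k k = extend_to_gl2 k (H_dR_weight (- int k)) sl2_dR
     (sub_range k \<union> quot_range CARD('a) k) (basis_H_dR k)"

definition H1_O_k :: "nat \<Rightarrow> ('a::{finite,field}, ('a, 'a) crv set) gl2_module" where
  "H1_O_k k = extend_to_gl2 k (H1_O_weight (- int k)) sl2_O (quot_range CARD('a) k) (basis_H1_O k)"

end

theory Submission
  imports Defs "HOL-Number_Theory.Residues"
begin

text \<open>
  Let \<open>A\<close> be the coordinate ring of \<open>C - {Z = 0}\<close>, in which \<open>u v\<^sup>q - u\<^sup>q v = 1\<close>. It carries a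
  derivation \<open>D\<close> with \<open>D u = u\<^sup>q\<close>, \<open>D v = v\<^sup>q\<close>, and its differentials are free on
  \<open>\<eta> = u dv - v du\<close>, with \<open>d f = (D f) \<eta>\<close> (\<open>dK_eq_form\<close>). The substitution \<open>X \<mapsto> -v\<close>, \<open>Y \<mapsto> u\<close>
  defines a homomorphism \<open>eps\<close> from \<open>\<bbbF>[X, Y]\<close> to \<open>A\<close> which is equivariant under \<open>SL\<^sub>2\<close>
  (\<open>sl2_eps\<close>), carries the operator \<open>D\<close> on polynomials to the derivation \<open>D\<close> (\<open>eps_Dq\<close>) and the
  polynomial \<open>\<theta>\<^sub>q\<close> to the constant \<open>-1\<close> (\<open>eps_theta\<close>).

  From a homogeneous \<open>G\<close> of degree \<open>k + q - 1\<close> in \<open>A\<close> one obtains a de Rham cocycle as follows. For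
  a linear form \<open>l\<close> over \<open>\<bbbF>\<close> put \<open>\<phi>\<^sub>l = G / (k l\<^sup>q\<^sup>-\<^sup>1)\<close>. Divided by \<open>l\<^sup>q\<^sup>-\<^sup>1\<close>, the derivation \<open>D\<close> is the
  Euler operator modulo \<open>l\<^sup>-\<^sup>q\<close> (\<open>crv_der_euler\<close>), and it follows that \<open>(G - D \<phi>\<^sub>l) \<eta>\<close> is regular
  where \<open>l \<noteq> 0\<close>. These forms and the functions \<open>\<phi>\<^sub>m - \<phi>\<^sub>l\<close> are a cocycle for the cover by all
  \<open>U\<^sub>l\<close> (\<open>full_cyc\<close>). As all linear forms are treated alike, \<open>SL\<^sub>2\<close> acts on its class as it acts on
  \<open>G\<close> (\<open>sl2_dR_cyc\<close>); this also needs that a class for the cover by \<open>U\<^sub>0\<close>, \<open>U\<^sub>1\<close> has only one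
  extension to the large cover up to coboundaries (\<open>full_Z_O_unique\<close>).

  Now map \<open>F \<in> V\<^sub>k\<^sub>+\<^sub>q\<^sub>-\<^sub>1\<close> to the class of the cocycle of \<open>eps F\<close>. For \<open>F = D W\<close> the functions
  \<open>eps W - \<phi>\<^sub>l\<close> are regular on \<open>U\<^sub>l\<close>, so that the class vanishes (\<open>cyc_crv_der\<close>). For
  \<open>F = \<theta>\<^sub>q R\<close> the function \<open>eps F = - eps R\<close> has the low degree \<open>k - 2\<close>, the \<open>\<phi>\<^sub>l\<close> themselves are
  regular, and the class is the one of the global form \<open>- eps R \<eta>\<close> (\<open>cyc_low_degree\<close>). This yields
  the vertical maps and the commutativity of the diagram (\<open>iota_form\<close>, \<open>gamma_proj\<close>). That the maps
  are bijective is a comparison of coefficients: Laurent monomials \<open>u\<^sup>i v\<^sup>j\<close> from \<open>q + 1\<close> consecutive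
  degrees are independent (\<open>mm_independent\<close>); functions and forms on \<open>U\<^sub>0\<close>, \<open>U\<^sub>1\<close> have bases of such
  monomials (\<open>reg_u\<close>, \<open>Omega_uv_iff\<close>); and the roots of unity fix the degree modulo \<open>q + 1\<close>
  (\<open>degree_of_weight\<close>). The images and kernels are found in \<open>carrier_H0_weight\<close>,
  \<open>carrier_H1_O_weight\<close>, \<open>carrier_H_dR_weight\<close>, \<open>cyc_f_exact_iff\<close> and \<open>cyc_exact_iff\<close>.

  The polynomials \<open>\<theta>\<^sub>q X\<^sup>a Y\<^sup>k\<^sup>-\<^sup>2\<^sup>-\<^sup>a\<close> and \<open>X\<^sup>q\<^sup>+\<^sup>a Y\<^sup>k\<^sup>-\<^sup>1\<^sup>-\<^sup>a\<close> are eigenvectors of the diagonal matrices with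
  the prescribed eigenvalues, and up to constants they are mapped to the given bases
  (\<open>beta_eigvec\<close>). Since \<open>SL\<^sub>2\<close> and the diagonal matrices generate \<open>GL\<^sub>2\<close>, the vertical maps are
  isomorphisms of \<open>GL\<^sub>2\<close>-modules, and the action of \<open>GL\<^sub>2\<close> on cohomology exists
  (\<open>gl2_iso_extend_to_gl2\<close>).

  For \<open>q = p\<close> the map \<open>\<delta>(Q) = \<Sum>\<^sub>x\<^sub>,\<^sub>y Q(x, y) (x Y - y X)\<^sup>q\<^sup>-\<^sup>1\<^sup>-\<^sup>k\<close> from \<open>V\<^sub>k\<^sub>+\<^sub>q\<^sub>-\<^sub>1\<close> to \<open>V\<^sub>q\<^sub>-\<^sub>1\<^sub>-\<^sub>k\<close> is
  equivariant up to the \<open>k\<close>-th power of the determinant (\<open>delta_act2\<close>). Evaluation of power sums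
  shows that it is onto with kernel \<open>D(V\<^sub>k) + \<theta>\<^sub>q V\<^sub>k\<^sub>-\<^sub>2\<close> (\<open>delta_onto\<close>, \<open>delta_eq_zero_iff\<close>).
\<close>

section \<open>Linear maps, quotients and transport of structure\<close>

abbreviation vec_space :: "('a::field, 'm, 'z) module_scheme \<Rightarrow> bool" where
  "vec_space \<equiv> Module.module ring_of_type_algebra"

lemma vec_space_iff:
  "vec_space (M :: ('a::field, 'm, 'z) module_scheme) \<longleftrightarrow> abelian_group M \<and>
     (\<forall>c. \<forall>x\<in>carrier M. c \<odot>\<^bsub>M\<^esub> x \<in> carrier M) \<and>
     (\<forall>c d. \<forall>x\<in>carrier M. (c + d) \<odot>\<^bsub>M\<^esub> x = c \<odot>\<^bsub>M\<^esub> x \<oplus>\<^bsub>M\<^esub> d \<odot>\<^bsub>M\<^esub> x) \<and>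
     (\<forall>c. \<forall>x\<in>carrier M. \<forall>y\<in>carrier M. c \<odot>\<^bsub>M\<^esub> (x \<oplus>\<^bsub>M\<^esub> y) = c \<odot>\<^bsub>M\<^esub> x \<oplus>\<^bsub>M\<^esub> c \<odot>\<^bsub>M\<^esub> y) \<and>
     (\<forall>c d. \<forall>x\<in>carrier M. (c * d) \<odot>\<^bsub>M\<^esub> x = c \<odot>\<^bsub>M\<^esub> (d \<odot>\<^bsub>M\<^esub> x)) \<and>
     (\<forall>x\<in>carrier M. 1 \<odot>\<^bsub>M\<^esub> x = x)"
  by (auto simp: Module.module_def module_axioms_def cring_from_type_algebra)
     (auto simp: ring_of_type_algebra_def)

lemmas vec_spaceD = vec_space_iff[THEN iffD1]

lemma vec_space_smult_zero:
  assumes "vec_space (M :: ('a::field, 'm, 'z) module_scheme)"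
  shows "x \<in> carrier M \<Longrightarrow> 0 \<odot>\<^bsub>M\<^esub> x = \<zero>\<^bsub>M\<^esub>" and "c \<odot>\<^bsub>M\<^esub> \<zero>\<^bsub>M\<^esub> = \<zero>\<^bsub>M\<^esub>"
  using module.smult_l_null[OF assms, of x] module.smult_r_null[OF assms, of c]
  by (auto simp: ring_of_type_algebra_def)

definition lin_map ::
    "('a, 'm, 'y) module_scheme \<Rightarrow> ('a, 'n, 'z) module_scheme \<Rightarrow> ('m \<Rightarrow> 'n) \<Rightarrow> bool" where
  "lin_map M N f \<longleftrightarrow> f ` carrier M \<subseteq> carrier N \<and> f \<zero>\<^bsub>M\<^esub> = \<zero>\<^bsub>N\<^esub> \<and>
     (\<forall>x\<in>carrier M. \<forall>y\<in>carrier M. f (x \<oplus>\<^bsub>M\<^esub> y) = f x \<oplus>\<^bsub>N\<^esub> f y) \<and>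
     (\<forall>c. \<forall>x\<in>carrier M. f (c \<odot>\<^bsub>M\<^esub> x) = c \<odot>\<^bsub>N\<^esub> f x)"

lemma lin_mapD:
  assumes "lin_map M N f"
  shows "x \<in> carrier M \<Longrightarrow> f x \<in> carrier N" "f \<zero>\<^bsub>M\<^esub> = \<zero>\<^bsub>N\<^esub>"
    "x \<in> carrier M \<Longrightarrow> y \<in> carrier M \<Longrightarrow> f (x \<oplus>\<^bsub>M\<^esub> y) = f x \<oplus>\<^bsub>N\<^esub> f y"
    "x \<in> carrier M \<Longrightarrow> f (c \<odot>\<^bsub>M\<^esub> x) = c \<odot>\<^bsub>N\<^esub> f x"
  using assms by (auto simp: lin_map_def)

text \<open>Every identity of vector spaces, and so every axiom, passes to a linear image. This serves
  for quotients as well as for bijections.\<close>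

lemma lin_map_onto_vec_space:
  assumes M: "vec_space (M :: ('a::field, 'm, 'y) module_scheme)"
    and f: "lin_map M N f" and onto: "f ` carrier M = carrier N"
  shows "vec_space N"
proof -
  interpret M: Module.module ring_of_type_algebra M by (rule M)
  note f' = lin_mapD[OF f]
  have ex: "\<exists>x\<in>carrier M. y = f x" if "y \<in> carrier N" for y
    using that onto by auto
  have grp: "abelian_group N"
  proof (rule abelian_groupI)
    fix x y assume "x \<in> carrier N" "y \<in> carrier N"
    then obtain a b where "a \<in> carrier M" "b \<in> carrier M" "x = f a" "y = f b" using ex by metis
    then show "x \<oplus>\<^bsub>N\<^esub> y \<in> carrier N" "x \<oplus>\<^bsub>N\<^esub> y = y \<oplus>\<^bsub>N\<^esub> x"
      using f'(1,3) M.a_comm by (metis M.add.m_closed)+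
  next
    show "\<zero>\<^bsub>N\<^esub> \<in> carrier N" using f'(1,2) by (metis M.zero_closed)
  next
    fix x y z assume "x \<in> carrier N" "y \<in> carrier N" "z \<in> carrier N"
    then obtain a b c where "a \<in> carrier M" "b \<in> carrier M" "c \<in> carrier M"
      "x = f a" "y = f b" "z = f c" using ex by metis
    then show "x \<oplus>\<^bsub>N\<^esub> y \<oplus>\<^bsub>N\<^esub> z = x \<oplus>\<^bsub>N\<^esub> (y \<oplus>\<^bsub>N\<^esub> z)"
      using f'(3) M.a_assoc by (metis M.add.m_closed)
  next
    fix x assume "x \<in> carrier N"
    then obtain a where a: "a \<in> carrier M" "x = f a" using ex by metis
    then show "\<zero>\<^bsub>N\<^esub> \<oplus>\<^bsub>N\<^esub> x = x" using f'(2,3) by (metis M.l_zero M.zero_closed)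
    show "\<exists>y\<in>carrier N. y \<oplus>\<^bsub>N\<^esub> x = \<zero>\<^bsub>N\<^esub>"
      using a f' M.l_neg by (metis M.a_inv_closed)
  qed
  note V = vec_spaceD[OF M]
  have 1: "c \<odot>\<^bsub>N\<^esub> y \<in> carrier N" "1 \<odot>\<^bsub>N\<^esub> y = y"
    "(c + d) \<odot>\<^bsub>N\<^esub> y = c \<odot>\<^bsub>N\<^esub> y \<oplus>\<^bsub>N\<^esub> d \<odot>\<^bsub>N\<^esub> y"
    "(c * d) \<odot>\<^bsub>N\<^esub> y = c \<odot>\<^bsub>N\<^esub> (d \<odot>\<^bsub>N\<^esub> y)"
    if hyp: "y \<in> carrier N" for c d y
  proof -
    obtain x where x: "x \<in> carrier M" "y = f x" using ex[OF hyp] by blast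
    have s: "c \<odot>\<^bsub>M\<^esub> x \<in> carrier M" for c using V x by blast
    show "c \<odot>\<^bsub>N\<^esub> y \<in> carrier N" using f'(4)[OF x(1)] f'(1)[OF s] x by simp
    show "1 \<odot>\<^bsub>N\<^esub> y = y" using f'(4)[OF x(1), of 1] V x by simp
    show "(c + d) \<odot>\<^bsub>N\<^esub> y = c \<odot>\<^bsub>N\<^esub> y \<oplus>\<^bsub>N\<^esub> d \<odot>\<^bsub>N\<^esub> y"
      using f'(4)[OF x(1)] f'(3)[OF s s] V x by metis
    show "(c * d) \<odot>\<^bsub>N\<^esub> y = c \<odot>\<^bsub>N\<^esub> (d \<odot>\<^bsub>N\<^esub> y)"
      using f'(4)[OF x(1)] f'(4)[OF s] V x by metis
  qed
  have 2: "c \<odot>\<^bsub>N\<^esub> (y \<oplus>\<^bsub>N\<^esub> z) = c \<odot>\<^bsub>N\<^esub> y \<oplus>\<^bsub>N\<^esub> c \<odot>\<^bsub>N\<^esub> z"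
    if hyp: "y \<in> carrier N" "z \<in> carrier N" for c y z
  proof -
    obtain x where x: "x \<in> carrier M" "y = f x" using ex[OF hyp(1)] by blast
    obtain w where w: "w \<in> carrier M" "z = f w" using ex[OF hyp(2)] by blast
    have s: "c \<odot>\<^bsub>M\<^esub> x \<in> carrier M" "c \<odot>\<^bsub>M\<^esub> w \<in> carrier M" using V x w by blast+
    show ?thesis
      using f'(3)[OF x(1) w(1)] f'(4)[OF M.add.m_closed[OF x(1) w(1)], of c] f'(3)[OF s]
        f'(4)[OF x(1), of c] f'(4)[OF w(1), of c] V x w by simp
  qed
  show ?thesis
    unfolding vec_space_iff using grp 1 2 by blast
qed

lemma with_action_simps [simp]:
  "carrier (with_action M \<rho>) = carrier M" "zero (with_action M \<rho>) = zero M"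
  "add (with_action M \<rho>) = add M" "smult (with_action M \<rho>) = smult M" "act (with_action M \<rho>) = \<rho>"
  by (simp_all add: with_action_def module.defs gl2_module.defs)

lemma vec_space_cong:
  assumes "carrier N = carrier M" "zero N = zero M" "add N = add M" "smult N = smult M"
    and "vec_space (M :: ('a::field, 'm, 'y) module_scheme)"
  shows "vec_space N"
  by (rule lin_map_onto_vec_space[of M N "\<lambda>x. x"]) (use assms in \<open>auto simp: lin_map_def\<close>)

lemma twist_simps [simp]:
  "carrier (twist n M) = carrier M" "zero (twist n M) = zero M"
  "add (twist n M) = add M" "smult (twist n M) = smult M"
  "act (twist n M) g m = (det g ^ n) \<odot>\<^bsub>M\<^esub> act M g m"
  by (simp_all add: twist_def)

lemma GL2_mult: "g \<in> GL2 \<Longrightarrow> h \<in> GL2 \<Longrightarrow> g ** h \<in> GL2"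
  by (simp add: GL2_def invertible_mult)

lemma GL2_one: "mat 1 \<in> GL2"
  by (auto simp: GL2_def invertible_def intro: exI[of _ "mat 1"])

lemma GL2_inverse:
  assumes "g \<in> GL2"
  shows "matrix_inv g \<in> GL2" "g ** matrix_inv g = mat 1" "matrix_inv g ** g = mat 1"
  using assms by (auto simp: GL2_def invertible_def matrix_inv_def intro: someI2_ex)

lemma SL2_GL2: "g \<in> SL2 \<Longrightarrow> g \<in> GL2"
  by (simp add: SL2_def GL2_def invertible_det_nz)

lemma is_gl2_moduleD:
  assumes "is_gl2_module M"
  shows "vec_space M" "g \<in> GL2 \<Longrightarrow> m \<in> carrier M \<Longrightarrow> act M g m \<in> carrier M"
    "g \<in> GL2 \<Longrightarrow> m \<in> carrier M \<Longrightarrow> n \<in> carrier M \<Longrightarrow> act M g (m \<oplus>\<^bsub>M\<^esub> n) = act M g m \<oplus>\<^bsub>M\<^esub> act M g n"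
    "g \<in> GL2 \<Longrightarrow> m \<in> carrier M \<Longrightarrow> act M g (c \<odot>\<^bsub>M\<^esub> m) = c \<odot>\<^bsub>M\<^esub> act M g m"
    "m \<in> carrier M \<Longrightarrow> act M (mat 1) m = m"
    "g \<in> GL2 \<Longrightarrow> h \<in> GL2 \<Longrightarrow> m \<in> carrier M \<Longrightarrow> act M (g ** h) m = act M g (act M h m)"
  using assms by (auto simp: is_gl2_module_def)

lemma lin_map_onto_gl2_module:
  assumes M: "is_gl2_module M" and f: "lin_map M N f" and onto: "f ` carrier M = carrier N"
    and eq: "\<And>g m. g \<in> GL2 \<Longrightarrow> m \<in> carrier M \<Longrightarrow> f (act M g m) = act N g (f m)"
  shows "is_gl2_module N"
proof -
  interpret M: Module.module ring_of_type_algebra M by (rule is_gl2_moduleD(1)[OF M])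
  note f' = lin_mapD[OF f] and M' = is_gl2_moduleD[OF M] and V = vec_spaceD[OF is_gl2_moduleD(1)[OF M]]
  have ex: "\<exists>x\<in>carrier M. y = f x" if "y \<in> carrier N" for y
    using that onto by auto
  have "act N g y \<in> carrier N" "act N g (c \<odot>\<^bsub>N\<^esub> y) = c \<odot>\<^bsub>N\<^esub> act N g y"
    if hyp: "g \<in> GL2" "y \<in> carrier N" for g y c
  proof -
    obtain x where x: "x \<in> carrier M" "y = f x" using ex[OF hyp(2)] by blast
    have gx: "act M g x \<in> carrier M" "c \<odot>\<^bsub>M\<^esub> x \<in> carrier M" using M'(2)[OF hyp(1) x(1)] V x by blast+
    show "act N g y \<in> carrier N" using eq[OF hyp(1) x(1)] f'(1)[OF gx(1)] x by simp
    show "act N g (c \<odot>\<^bsub>N\<^esub> y) = c \<odot>\<^bsub>N\<^esub> act N g y"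
      using eq[OF hyp(1) x(1)] eq[OF hyp(1) gx(2)] f'(4)[OF gx(1), of c] f'(4)[OF x(1), of c]
        M'(4)[OF hyp(1) x(1), of c] x by simp
  qed
  moreover have "act N g (y \<oplus>\<^bsub>N\<^esub> z) = act N g y \<oplus>\<^bsub>N\<^esub> act N g z"
    if hyp: "g \<in> GL2" "y \<in> carrier N" "z \<in> carrier N" for g y z
  proof -
    obtain x where x: "x \<in> carrier M" "y = f x" using ex[OF hyp(2)] by blast
    obtain w where w: "w \<in> carrier M" "z = f w" using ex[OF hyp(3)] by blast
    show ?thesis
      using f'(3)[OF x(1) w(1)] M'(3)[OF hyp(1) x(1) w(1)] eq[OF hyp(1) M.add.m_closed[OF x(1) w(1)]]
        f'(3)[OF M'(2)[OF hyp(1) x(1)] M'(2)[OF hyp(1) w(1)]] eq[OF hyp(1) x(1)] eq[OF hyp(1) w(1)] x w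
      by simp
  qed
  moreover have "act N (mat 1) y = y" if hyp: "y \<in> carrier N" for y
  proof -
    obtain x where x: "x \<in> carrier M" "y = f x" using ex[OF hyp] by blast
    show ?thesis using eq[OF GL2_one x(1)] M'(5)[OF x(1)] x by simp
  qed
  moreover have "act N (g ** h) y = act N g (act N h y)"
    if hyp: "g \<in> GL2" "h \<in> GL2" "y \<in> carrier N" for g h y
  proof -
    obtain x where x: "x \<in> carrier M" "y = f x" using ex[OF hyp(3)] by blast
    show ?thesis
      using eq[OF GL2_mult[OF hyp(1,2)] x(1)] M'(6)[OF hyp(1,2) x(1)] eq[OF hyp(2) x(1)]
        eq[OF hyp(1) M'(2)[OF hyp(2) x(1)]] x by simp
  qed
  ultimately show ?thesis
    unfolding is_gl2_module_def using lin_map_onto_vec_space[OF M'(1) f onto] by blast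
qed

lemma is_gl2_module_twist:
  assumes "is_gl2_module M"
  shows "is_gl2_module (twist n M)"
proof -
  note M' = is_gl2_moduleD[OF assms] and V = vec_spaceD[OF is_gl2_moduleD(1)[OF assms]]
  have "vec_space (twist n M)"
    by (rule vec_space_cong[OF _ _ _ _ M'(1)]) simp_all
  moreover have "det g ^ n \<odot>\<^bsub>M\<^esub> act M g (c \<odot>\<^bsub>M\<^esub> m) = c \<odot>\<^bsub>M\<^esub> (det g ^ n \<odot>\<^bsub>M\<^esub> act M g m)"
    if "g \<in> GL2" "m \<in> carrier M" for g c m
    using M'(4)[OF that, of c] V M'(2)[OF that] mult.commute[of c] by metis
  moreover have "det (g ** h) ^ n \<odot>\<^bsub>M\<^esub> act M (g ** h) m =
      det g ^ n \<odot>\<^bsub>M\<^esub> act M g (det h ^ n \<odot>\<^bsub>M\<^esub> act M h m)"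
    if "g \<in> GL2" "h \<in> GL2" "m \<in> carrier M" for g h m
  proof -
    have hm: "act M h m \<in> carrier M" using M'(2) that by blast
    show ?thesis
      using M'(6)[OF that] M'(4)[OF that(1) hm, of "det h ^ n"] V M'(2)[OF that(1) hm]
      by (simp add: det_mul power_mult_distrib)
  qed
  moreover have "det g ^ n \<odot>\<^bsub>M\<^esub> act M g m \<in> carrier M"
    "det g ^ n \<odot>\<^bsub>M\<^esub> act M g (m \<oplus>\<^bsub>M\<^esub> m') = det g ^ n \<odot>\<^bsub>M\<^esub> act M g m \<oplus>\<^bsub>M\<^esub> det g ^ n \<odot>\<^bsub>M\<^esub> act M g m'"
    if "g \<in> GL2" "m \<in> carrier M" "m' \<in> carrier M" for g m m'
    using that M'(2,3) V by simp_all
  ultimately show ?thesis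
    unfolding is_gl2_module_def twist_simps using M'(5) V by auto
qed

definition sub_space :: "('a, 'm, 'z) module_scheme \<Rightarrow> 'm set \<Rightarrow> bool" where
  "sub_space M W \<longleftrightarrow> W \<subseteq> carrier M \<and> \<zero>\<^bsub>M\<^esub> \<in> W \<and> (\<forall>x\<in>W. \<forall>y\<in>W. x \<oplus>\<^bsub>M\<^esub> y \<in> W) \<and>
     (\<forall>c. \<forall>x\<in>W. c \<odot>\<^bsub>M\<^esub> x \<in> W)"

lemma vec_space_minus:
  assumes M: "vec_space (M :: ('a::field, 'm, 'z) module_scheme)" and x: "x \<in> carrier M"
  shows "\<ominus>\<^bsub>M\<^esub> x = (- 1) \<odot>\<^bsub>M\<^esub> x"
proof -
  interpret M: Module.module ring_of_type_algebra M by (rule M)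
  have "(- 1) \<odot>\<^bsub>M\<^esub> x \<oplus>\<^bsub>M\<^esub> x = (- 1 + 1) \<odot>\<^bsub>M\<^esub> x"
    using vec_spaceD[OF M] x by metis
  also have "\<dots> = \<zero>\<^bsub>M\<^esub>" using vec_space_smult_zero(1)[OF M x] by simp
  finally show ?thesis using x vec_spaceD[OF M] M.minus_equality by metis
qed

lemma sub_space_abelian_subgroup:
  assumes M: "vec_space (M :: ('a::field, 'm, 'z) module_scheme)" and W: "sub_space M W"
  shows "abelian_subgroup W M"
proof -
  interpret M: Module.module ring_of_type_algebra M by (rule M)
  have "subgroup W (add_monoid M)"
  proof (rule group.subgroupI)
    show "Group.group (add_monoid M)" by (rule M.a_group)
    fix a assume a: "a \<in> W"
    then have "\<ominus>\<^bsub>M\<^esub> a \<in> W"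
      using W vec_space_minus[OF M, of a] unfolding sub_space_def by auto
    then show "inv\<^bsub>add_monoid M\<^esub> a \<in> W" by (simp add: a_inv_def)
  qed (use W in \<open>auto simp: sub_space_def\<close>)
  then show ?thesis
    by (intro abelian_subgroupI3 additive_subgroupI M.abelian_group_axioms)
qed

lemma quot_module_simps [simp]:
  "carrier (quot_module M W) = a_rcosets\<^bsub>M\<^esub> W" "zero (quot_module M W) = W"
  "add (quot_module M W) = set_add M"
  "smult (quot_module M W) = (\<lambda>c U. W <+>\<^bsub>M\<^esub> ((\<lambda>m. c \<odot>\<^bsub>M\<^esub> m) ` U))"
  by (simp_all add: quot_module_def)

lemma a_r_coset_eq_image: "W +>\<^bsub>M\<^esub> x = (\<lambda>w. w \<oplus>\<^bsub>M\<^esub> x) ` W"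
  by (auto simp: a_r_coset_def')

lemma
  assumes M: "vec_space (M :: ('a::field, 'm, 'z) module_scheme)" and W: "sub_space M W"
  shows lin_map_coset: "lin_map M (quot_module M W) (\<lambda>x. W +>\<^bsub>M\<^esub> x)"
    and coset_onto: "(\<lambda>x. W +>\<^bsub>M\<^esub> x) ` carrier M = a_rcosets\<^bsub>M\<^esub> W"
    and coset_eq_iff: "x \<in> carrier M \<Longrightarrow> y \<in> carrier M \<Longrightarrow>
      W +>\<^bsub>M\<^esub> x = W +>\<^bsub>M\<^esub> y \<longleftrightarrow> x \<ominus>\<^bsub>M\<^esub> y \<in> W"
    and coset_self: "x \<in> carrier M \<Longrightarrow> x \<in> W +>\<^bsub>M\<^esub> x"
    and set_add_coset: "x \<in> carrier M \<Longrightarrow> W <+>\<^bsub>M\<^esub> (W +>\<^bsub>M\<^esub> x) = W +>\<^bsub>M\<^esub> x"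
proof -
  interpret M: Module.module ring_of_type_algebra M by (rule M)
  interpret W: abelian_subgroup W M by (rule sub_space_abelian_subgroup[OF M W])
  have WM: "W \<subseteq> carrier M" using W by (simp add: sub_space_def)
  show onto: "(\<lambda>x. W +>\<^bsub>M\<^esub> x) ` carrier M = a_rcosets\<^bsub>M\<^esub> W"
    by (auto simp: A_RCOSETS_def' a_r_coset_def')
  show eq: "W +>\<^bsub>M\<^esub> x = W +>\<^bsub>M\<^esub> y \<longleftrightarrow> x \<ominus>\<^bsub>M\<^esub> y \<in> W"
    if "x \<in> carrier M" "y \<in> carrier M" for x y
  proof -
    have "x \<in> W +>\<^bsub>M\<^esub> y \<longleftrightarrow> x \<ominus>\<^bsub>M\<^esub> y \<in> W"
      using W.a_rcos_module[OF that(2,1)] by (simp add: a_minus_def)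
    then show ?thesis
      using W.a_repr_independence'[of x y] W.a_rcos_self[of x] that by auto
  qed
  show self: "x \<in> W +>\<^bsub>M\<^esub> x" if "x \<in> carrier M" for x
    using W.a_rcos_self that by simp
  show ab: "W <+>\<^bsub>M\<^esub> (W +>\<^bsub>M\<^esub> x) = W +>\<^bsub>M\<^esub> x" if "x \<in> carrier M" for x
    using W.a_rcos_sum[of "\<zero>\<^bsub>M\<^esub>" x] that M.a_coset_add_zero[OF WM] by simp
  have sm: "W +>\<^bsub>M\<^esub> (c \<odot>\<^bsub>M\<^esub> x) = W <+>\<^bsub>M\<^esub> ((\<lambda>m. c \<odot>\<^bsub>M\<^esub> m) ` (W +>\<^bsub>M\<^esub> x))"
    if "x \<in> carrier M" for c x
  proof
    have cx: "c \<odot>\<^bsub>M\<^esub> x \<in> carrier M" using that vec_spaceD[OF M] by blast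
    show "W +>\<^bsub>M\<^esub> (c \<odot>\<^bsub>M\<^esub> x) \<subseteq> W <+>\<^bsub>M\<^esub> ((\<lambda>m. c \<odot>\<^bsub>M\<^esub> m) ` (W +>\<^bsub>M\<^esub> x))"
    proof
      fix z assume "z \<in> W +>\<^bsub>M\<^esub> (c \<odot>\<^bsub>M\<^esub> x)"
      then obtain w where "w \<in> W" "z = w \<oplus>\<^bsub>M\<^esub> c \<odot>\<^bsub>M\<^esub> x" by (auto simp: a_r_coset_eq_image)
      then show "z \<in> W <+>\<^bsub>M\<^esub> ((\<lambda>m. c \<odot>\<^bsub>M\<^esub> m) ` (W +>\<^bsub>M\<^esub> x))"
        using self[OF that] unfolding set_add_def' by blast
    qed
    have "(\<lambda>m. c \<odot>\<^bsub>M\<^esub> m) ` (W +>\<^bsub>M\<^esub> x) \<subseteq> W +>\<^bsub>M\<^esub> (c \<odot>\<^bsub>M\<^esub> x)"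
    proof
      fix z assume "z \<in> (\<lambda>m. c \<odot>\<^bsub>M\<^esub> m) ` (W +>\<^bsub>M\<^esub> x)"
      then obtain w where w: "w \<in> W" "z = c \<odot>\<^bsub>M\<^esub> (w \<oplus>\<^bsub>M\<^esub> x)" by (auto simp: a_r_coset_eq_image)
      then have "z = c \<odot>\<^bsub>M\<^esub> w \<oplus>\<^bsub>M\<^esub> c \<odot>\<^bsub>M\<^esub> x" using vec_spaceD[OF M] that WM by auto
      moreover have "c \<odot>\<^bsub>M\<^esub> w \<in> W" using w W by (auto simp: sub_space_def)
      ultimately show "z \<in> W +>\<^bsub>M\<^esub> (c \<odot>\<^bsub>M\<^esub> x)" by (auto simp: a_r_coset_eq_image)
    qed
    then have "W <+>\<^bsub>M\<^esub> ((\<lambda>m. c \<odot>\<^bsub>M\<^esub> m) ` (W +>\<^bsub>M\<^esub> x)) \<subseteq> W <+>\<^bsub>M\<^esub> (W +>\<^bsub>M\<^esub> (c \<odot>\<^bsub>M\<^esub> x))"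
      unfolding set_add_def' by blast
    then show "W <+>\<^bsub>M\<^esub> ((\<lambda>m. c \<odot>\<^bsub>M\<^esub> m) ` (W +>\<^bsub>M\<^esub> x)) \<subseteq> W +>\<^bsub>M\<^esub> (c \<odot>\<^bsub>M\<^esub> x)"
      using ab[OF cx] by simp
  qed
  show "lin_map M (quot_module M W) (\<lambda>x. W +>\<^bsub>M\<^esub> x)"
    unfolding lin_map_def quot_module_simps using onto sm W.a_rcos_sum WM
    by (auto simp: M.a_coset_add_zero)
qed

lemma vec_space_quot_module:
  assumes "vec_space (M :: ('a::field, 'm, 'z) module_scheme)" "sub_space M W"
  shows "vec_space (quot_module M W)"
  using lin_map_onto_vec_space[OF assms(1) lin_map_coset[OF assms]] coset_onto[OF assms] by simp

definition sub_rep :: "('a::field, 'm) gl2_module \<Rightarrow> 'm set \<Rightarrow> bool" where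
  "sub_rep M W \<longleftrightarrow> sub_space M W \<and> (\<forall>g\<in>GL2. act M g ` W \<subseteq> W)"

lemma
  assumes M: "is_gl2_module M" and W: "sub_rep M W"
  shows quot_act_coset: "g \<in> GL2 \<Longrightarrow> x \<in> carrier M \<Longrightarrow> act M g ` (W +>\<^bsub>M\<^esub> x) = W +>\<^bsub>M\<^esub> act M g x"
    and is_gl2_module_quot: "is_gl2_module (quot_gl2_module M W)"
proof -
  note M' = is_gl2_moduleD[OF M]
  have Ws: "sub_space M W" and Wg: "act M g ` W \<subseteq> W" if "g \<in> GL2" for g
    using W that by (auto simp: sub_rep_def)
  have W0: "sub_space M W" using W by (simp add: sub_rep_def)
  then have WM: "w \<in> carrier M" if "w \<in> W" for w using that by (auto simp: sub_space_def)
  show a: "act M g ` (W +>\<^bsub>M\<^esub> x) = W +>\<^bsub>M\<^esub> act M g x" if g: "g \<in> GL2" and x: "x \<in> carrier M" for g x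
  proof -
    have "W \<subseteq> act M g ` W"
    proof
      fix w assume w: "w \<in> W"
      have "w = act M g (act M (matrix_inv g) w)"
        using M'(6)[OF g GL2_inverse(1)[OF g] WM[OF w]] GL2_inverse[OF g] M'(5)[OF WM[OF w]] by simp
      then show "w \<in> act M g ` W" using Wg[OF GL2_inverse(1)[OF g]] w by auto
    qed
    then have "act M g ` W = W" using Wg[OF g] by auto
    moreover have "act M g ` (W +>\<^bsub>M\<^esub> x) = (\<lambda>w. w \<oplus>\<^bsub>M\<^esub> act M g x) ` (act M g ` W)"
      unfolding a_r_coset_eq_image image_image using M'(3)[OF g WM x] by auto
    ultimately show ?thesis by (simp add: a_r_coset_eq_image)
  qed
  show "is_gl2_module (quot_gl2_module M W)"
  proof (rule lin_map_onto_gl2_module[OF M])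
    show "lin_map M (quot_gl2_module M W) (\<lambda>x. W +>\<^bsub>M\<^esub> x)"
      using lin_map_coset[OF M'(1) W0] by (simp add: lin_map_def quot_gl2_module_def)
    show "(\<lambda>x. W +>\<^bsub>M\<^esub> x) ` carrier M = carrier (quot_gl2_module M W)"
      using coset_onto[OF M'(1) W0] by (simp add: quot_gl2_module_def)
  qed (simp add: quot_gl2_module_def a)
qed

definition lin_ker :: "('a, 'm, 'y) module_scheme \<Rightarrow> ('a, 'n, 'z) module_scheme \<Rightarrow> ('m \<Rightarrow> 'n) \<Rightarrow> 'm set"
  where "lin_ker M N f = {x \<in> carrier M. f x = \<zero>\<^bsub>N\<^esub>}"

definition quot_lift :: "('m \<Rightarrow> 'n) \<Rightarrow> 'm set \<Rightarrow> 'n" where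
  "quot_lift f U = f (SOME x. x \<in> U)"

lemma lin_map_eq_iff:
  assumes M: "vec_space (M :: ('a::field, 'm, 'y) module_scheme)" and N: "vec_space (N :: ('a, 'n, 'z) module_scheme)"
    and f: "lin_map M N f" and x: "x \<in> carrier M" and y: "y \<in> carrier M"
  shows "f x = f y \<longleftrightarrow> x \<ominus>\<^bsub>M\<^esub> y \<in> lin_ker M N f"
proof -
  interpret M: Module.module ring_of_type_algebra M by (rule M)
  interpret N: Module.module ring_of_type_algebra N by (rule N)
  note f' = lin_mapD[OF f]
  have "f (x \<ominus>\<^bsub>M\<^esub> y) = f x \<ominus>\<^bsub>N\<^esub> f y"
    unfolding a_minus_def using f' x y vec_space_minus[OF M y] vec_space_minus[OF N f'(1)[OF y]]
    by (metis M.a_inv_closed)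
  moreover have "f x = f y" if "f x \<ominus>\<^bsub>N\<^esub> f y = \<zero>\<^bsub>N\<^esub>"
    using that f'(1)[OF x] f'(1)[OF y] N.minus_equality[of "f x" "\<ominus>\<^bsub>N\<^esub> f y"]
    by (simp add: a_minus_def)
  ultimately show ?thesis
    unfolding lin_ker_def using x y f'(1)[OF y] N.r_neg[of "f y"] by (auto simp: a_minus_def)
qed

text \<open>
  The homomorphism theorem: all representatives of a coset have the same value under \<open>f\<close> as soon as
  \<open>W\<close> is contained in the kernel, and if it is the kernel, different cosets have different values.
\<close>

lemma
  assumes M: "vec_space (M :: ('a::field, 'm, 'y) module_scheme)" and N: "vec_space (N :: ('a, 'n, 'z) module_scheme)"
    and f: "lin_map M N f" and ker: "W \<subseteq> lin_ker M N f" and W: "sub_space M W"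
  shows quot_lift_coset: "x \<in> carrier M \<Longrightarrow> quot_lift f (W +>\<^bsub>M\<^esub> x) = f x"
    and lin_map_quot_lift: "lin_map (quot_module M W) N (quot_lift f)"
    and bij_betw_quot_lift: "f ` carrier M = carrier N \<Longrightarrow> lin_ker M N f \<subseteq> W \<Longrightarrow>
      bij_betw (quot_lift f) (a_rcosets\<^bsub>M\<^esub> W) (carrier N)"
proof -
  interpret M: Module.module ring_of_type_algebra M by (rule M)
  interpret Q: Module.module ring_of_type_algebra "quot_module M W" by (rule vec_space_quot_module[OF M W])
  interpret W: abelian_subgroup W M by (rule sub_space_abelian_subgroup[OF M W])
  note f' = lin_mapD[OF f] and c = lin_mapD[OF lin_map_coset[OF M W]]
  show 1: "quot_lift f (W +>\<^bsub>M\<^esub> x) = f x" if x: "x \<in> carrier M" for x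
  proof -
    define y where "y = (SOME y. y \<in> W +>\<^bsub>M\<^esub> x)"
    have y: "y \<in> W +>\<^bsub>M\<^esub> x" unfolding y_def by (rule someI[of _ x]) (rule coset_self[OF M W x])
    then have yM: "y \<in> carrier M" using W.a_elemrcos_carrier x by blast
    have "W +>\<^bsub>M\<^esub> y = W +>\<^bsub>M\<^esub> x" using W.a_repr_independence'[OF y x] by simp
    then have "f y = f x"
      using coset_eq_iff[OF M W yM x] lin_map_eq_iff[OF M N f yM x] ker by auto
    then show ?thesis by (simp add: quot_lift_def y_def)
  qed
  have ex: "\<exists>x\<in>carrier M. U = W +>\<^bsub>M\<^esub> x" if "U \<in> a_rcosets\<^bsub>M\<^esub> W" for U
    using that coset_onto[OF M W] by auto
  have add: "quot_lift f (U <+>\<^bsub>M\<^esub> V) = quot_lift f U \<oplus>\<^bsub>N\<^esub> quot_lift f V"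
    if UV: "U \<in> a_rcosets\<^bsub>M\<^esub> W" "V \<in> a_rcosets\<^bsub>M\<^esub> W" for U V
  proof -
    obtain x y where xy: "x \<in> carrier M" "U = W +>\<^bsub>M\<^esub> x" "y \<in> carrier M" "V = W +>\<^bsub>M\<^esub> y"
      using ex[OF UV(1)] ex[OF UV(2)] by auto
    then show ?thesis using c(3)[of x y] 1[of x] 1[of y] 1[OF M.add.m_closed[OF xy(1,3)]] f'(3)[of x y] by simp
  qed
  have sm: "quot_lift f (a \<odot>\<^bsub>quot_module M W\<^esub> U) = a \<odot>\<^bsub>N\<^esub> quot_lift f U"
    if U: "U \<in> a_rcosets\<^bsub>M\<^esub> W" for a U
  proof -
    obtain x where x: "x \<in> carrier M" "U = W +>\<^bsub>M\<^esub> x" using ex[OF U] by auto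
    then have "a \<odot>\<^bsub>M\<^esub> x \<in> carrier M" using vec_spaceD[OF M] by blast
    then show ?thesis using c(4)[of x a] 1 f'(4)[of x a] x by metis
  qed
  have z: "quot_lift f W = \<zero>\<^bsub>N\<^esub>"
    using 1[of "\<zero>\<^bsub>M\<^esub>"] f'(2) c(2) by simp
  show "lin_map (quot_module M W) N (quot_lift f)"
    unfolding lin_map_def using add sm z 1 f'(1) ex by (auto dest!: ex)
  assume onto: "f ` carrier M = carrier N" and ker': "lin_ker M N f \<subseteq> W"
  show "bij_betw (quot_lift f) (a_rcosets\<^bsub>M\<^esub> W) (carrier N)"
    unfolding bij_betw_def
  proof
    show "inj_on (quot_lift f) (a_rcosets\<^bsub>M\<^esub> W)"
    proof (rule inj_onI)
      fix U V assume UV: "U \<in> a_rcosets\<^bsub>M\<^esub> W" "V \<in> a_rcosets\<^bsub>M\<^esub> W" "quot_lift f U = quot_lift f V"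
      obtain x y where xy: "x \<in> carrier M" "U = W +>\<^bsub>M\<^esub> x" "y \<in> carrier M" "V = W +>\<^bsub>M\<^esub> y"
        using ex[OF UV(1)] ex[OF UV(2)] by auto
      then show "U = V" using UV(3) 1 coset_eq_iff[OF M W] lin_map_eq_iff[OF M N f] ker' by auto
    qed
    show "quot_lift f ` (a_rcosets\<^bsub>M\<^esub> W) = carrier N"
      unfolding coset_onto[OF M W, symmetric] image_image using 1 onto by auto
  qed
qed

lemma GL2_decomp:
  assumes "g \<in> GL2"
  obtains s where "s \<in> SL2" "g = diag2 (det g) 1 ** s" "det g \<noteq> 0"
proof -
  have d: "det g \<noteq> 0" using assms by (simp add: GL2_def invertible_det_nz)
  define s where "s = diag2 (1 / det g) 1 ** g"
  have m: "diag2 x 1 ** diag2 y 1 = (diag2 (x * y) 1 :: 'a ^ 2 ^ 2)" for x y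
    by (simp add: diag2_def matrix_matrix_mult_def vec_eq_iff forall_2 sum_2)
  have one: "diag2 1 1 = (mat 1 :: 'a ^ 2 ^ 2)"
    by (simp add: diag2_def mat_def vec_eq_iff forall_2)
  have "det s = 1" unfolding s_def det_mul using d by (simp add: det_2 diag2_def)
  moreover have "g = diag2 (det g) 1 ** s"
    unfolding s_def using d by (simp add: matrix_mul_assoc m one)
  ultimately show ?thesis using that d by (auto simp: SL2_def)
qed

lemma diag2_GL2: "x \<noteq> 0 \<Longrightarrow> y \<noteq> 0 \<Longrightarrow> diag2 x y \<in> GL2"
  by (simp add: GL2_def invertible_det_nz det_2 diag2_def)

text \<open>
  An \<open>SL\<^sub>2\<close>-equivariant linear bijection \<open>f\<close> from a \<open>GL\<^sub>2\<close>-module, under which the prescribed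
  eigenvectors of the diagonal matrices correspond to each other, carries the \<open>GL\<^sub>2\<close>-action over.
  Hence the required extension exists, and as it is determined on generators of the group, \<open>f\<close> is
  equivariant for whichever extension is selected.
\<close>

lemma
  fixes N :: "('a::field, 'n) gl2_module" and M :: "('a, 'm) module"
  assumes N: "is_gl2_module N" and f: "lin_map N M f" and bij: "bij_betw f (carrier N) (carrier M)"
    and sl2: "\<And>g m. g \<in> SL2 \<Longrightarrow> m \<in> carrier N \<Longrightarrow> f (act N g m) = \<sigma> g (f m)"
    and b: "\<And>a. a \<in> A \<Longrightarrow> b a \<in> carrier N \<and> f (b a) = e a"
    and diag: "\<And>a x1 x2. a \<in> A \<Longrightarrow> x1 \<noteq> 0 \<Longrightarrow> x2 \<noteq> 0 \<Longrightarrow>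
      act N (diag2 x1 x2) (b a) = (x1 powi (a + 1) * x2 powi (int k - a - 1)) \<odot>\<^bsub>N\<^esub> b a"
    and span: "\<And>S. sub_space N S \<Longrightarrow> b ` A \<subseteq> S \<Longrightarrow> carrier N \<subseteq> S"
  shows is_gl2_module_extend_to_gl2: "is_gl2_module (extend_to_gl2 k M \<sigma> A e)"
    and gl2_iso_extend_to_gl2: "f \<in> gl2_iso N (extend_to_gl2 k M \<sigma> A e)"
proof -
  note N' = is_gl2_moduleD[OF N] and f' = lin_mapD[OF f] and V = vec_spaceD[OF is_gl2_moduleD(1)[OF N]]
  interpret N: Module.module ring_of_type_algebra N by (rule N'(1))
  have onto: "f ` carrier N = carrier M" using bij by (simp add: bij_betw_def)
  have inv: "inv_into (carrier N) f (f m) = m" if "m \<in> carrier N" for m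
    using bij that by (simp add: bij_betw_def)
  define \<rho>0 where "\<rho>0 g m = f (act N g (inv_into (carrier N) f m))" for g m
  have \<rho>0: "\<rho>0 g (f m) = f (act N g m)" if "m \<in> carrier N" for g m
    using inv[OF that] by (simp add: \<rho>0_def)
  have "extends_sl2 k M \<sigma> A e \<rho>0"
    unfolding extends_sl2_def
  proof (intro conjI ballI allI impI)
    show "is_gl2_module (with_action M \<rho>0)"
      by (rule lin_map_onto_gl2_module[OF N, of _ f])
         (use f onto \<rho>0 in \<open>auto simp: lin_map_def\<close>)
    show "\<rho>0 g m = \<sigma> g m" if "g \<in> SL2" "m \<in> carrier M" for g m
      using \<rho>0 sl2[OF that(1)] that(2) onto by (metis imageE)
    show "\<rho>0 (diag2 x1 x2) (e a) = (x1 powi (a + 1) * x2 powi (int k - a - 1)) \<odot>\<^bsub>M\<^esub> e a"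
      if "a \<in> A" "x1 \<noteq> 0" "x2 \<noteq> 0" for x1 x2 a
      using \<rho>0[of "b a"] b[OF that(1)] diag[OF that] f'(4)[of "b a"] by simp
  qed
  then have ex0: "extends_sl2 k M \<sigma> A e (SOME \<rho>. extends_sl2 k M \<sigma> A e \<rho>)"
    by (rule someI[where P = "extends_sl2 k M \<sigma> A e"])
  define \<rho> where "\<rho> = (SOME \<rho>. extends_sl2 k M \<sigma> A e \<rho>)"
  have ex: "extends_sl2 k M \<sigma> A e \<rho>" using ex0 by (simp only: \<rho>_def)
  define E where "E = with_action M \<rho>"
  have E_eq: "extend_to_gl2 k M \<sigma> A e = E" by (simp add: extend_to_gl2_def E_def \<rho>_def)
  have gl: "is_gl2_module E"
    and sl2': "\<And>g m. g \<in> SL2 \<Longrightarrow> m \<in> carrier M \<Longrightarrow> \<rho> g m = \<sigma> g m"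
    and diag': "\<And>a x1 x2. a \<in> A \<Longrightarrow> x1 \<noteq> 0 \<Longrightarrow> x2 \<noteq> 0 \<Longrightarrow>
       \<rho> (diag2 x1 x2) (e a) = (x1 powi (a + 1) * x2 powi (int k - a - 1)) \<odot>\<^bsub>M\<^esub> e a"
    using ex unfolding extends_sl2_def E_def by blast+
  show "is_gl2_module (extend_to_gl2 k M \<sigma> A e)" using gl E_eq by simp
  note E' = is_gl2_moduleD[OF gl]
  have fE: "lin_map N E f" using f by (simp add: lin_map_def E_def)
  note fE' = lin_mapD[OF fE]
  have dg: "f (act N (diag2 x1 x2) m) = act E (diag2 x1 x2) (f m)"
    if x: "x1 \<noteq> 0" "x2 \<noteq> 0" and m: "m \<in> carrier N" for x1 x2 m
  proof -
    define d where "d = diag2 x1 x2"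
    have d: "d \<in> GL2" using x by (simp add: d_def diag2_GL2)
    define S where "S = {m \<in> carrier N. f (act N d m) = act E d (f m)}"
    have Z: "act N d \<zero>\<^bsub>N\<^esub> = \<zero>\<^bsub>N\<^esub>" "act E d \<zero>\<^bsub>E\<^esub> = \<zero>\<^bsub>E\<^esub>"
    proof -
      show "act N d \<zero>\<^bsub>N\<^esub> = \<zero>\<^bsub>N\<^esub>"
        using N'(4)[OF d N.zero_closed, of 0] vec_space_smult_zero[OF N'(1)] N'(2)[OF d N.zero_closed] by metis
      show "act E d \<zero>\<^bsub>E\<^esub> = \<zero>\<^bsub>E\<^esub>"
        using E'(4)[OF d, of "\<zero>\<^bsub>E\<^esub>" 0] vec_space_smult_zero[OF E'(1)] E'(2)[OF d]
        by (metis fE'(1,2) N.zero_closed)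
    qed
    have "sub_space N S"
      unfolding sub_space_def
    proof (intro conjI ballI allI)
      show "\<zero>\<^bsub>N\<^esub> \<in> S" using Z fE'(2) by (simp add: S_def)
      show "x \<oplus>\<^bsub>N\<^esub> y \<in> S" if "x \<in> S" "y \<in> S" for x y
        using that N'(2,3)[OF d] E'(3)[OF d] fE'(1,3) by (simp add: S_def)
      show "c \<odot>\<^bsub>N\<^esub> x \<in> S" if "x \<in> S" for x c
        using that N'(2,4)[OF d] E'(4)[OF d] fE'(1,4) V by (simp add: S_def)
    qed (simp add: S_def)
    moreover have "b ` A \<subseteq> S"
    proof
      fix y assume "y \<in> b ` A"
      then obtain a where a: "a \<in> A" "y = b a" by auto
      then show "y \<in> S"
        unfolding S_def using b[OF a(1)] diag[OF a(1) x] diag'[OF a(1) x] f'(4)[of "b a"]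
        by (simp add: d_def E_def)
    qed
    ultimately have "m \<in> S" using span m by blast
    then show ?thesis by (simp add: S_def d_def)
  qed
  have "f (act N g m) = act E g (f m)" if g: "g \<in> GL2" and m: "m \<in> carrier N" for g m
  proof -
    obtain s where s: "s \<in> SL2" "g = diag2 (det g) 1 ** s" "det g \<noteq> 0"
      using GL2_decomp[OF g] by metis
    have d: "diag2 (det g) 1 \<in> GL2" using s by (simp add: diag2_GL2)
    have "f (act N g m) = f (act N (diag2 (det g) 1) (act N s m))"
      using N'(6)[OF d SL2_GL2[OF s(1)] m] s(2) by simp
    also have "\<dots> = act E (diag2 (det g) 1) (f (act N s m))"
      using dg[of "det g" 1] s(3) N'(2)[OF SL2_GL2[OF s(1)] m] by simp
    also have "f (act N s m) = act E s (f m)"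
      using sl2[OF s(1) m] sl2'[OF s(1) f'(1)[OF m]] by (simp add: E_def)
    also have "act E (diag2 (det g) 1) (act E s (f m)) = act E g (f m)"
      using E'(6)[OF d SL2_GL2[OF s(1)] fE'(1)[OF m]] s(2) by simp
    finally show ?thesis .
  qed
  then show "f \<in> gl2_iso N (extend_to_gl2 k M \<sigma> A e)"
    unfolding E_eq gl2_iso_def gl2_hom_def using fE bij by (auto simp: lin_map_def E_def)
qed

lemma gl2_iso_inv_into:
  assumes N: "is_gl2_module N" and f: "f \<in> gl2_iso N M"
  shows "inv_into (carrier N) f \<in> gl2_iso M N"
proof -
  let ?g = "inv_into (carrier N) f"
  interpret N: Module.module ring_of_type_algebra N by (rule is_gl2_moduleD(1)[OF N])
  note N' = is_gl2_moduleD[OF N] and V = vec_spaceD[OF is_gl2_moduleD(1)[OF N]]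
  have bij: "bij_betw f (carrier N) (carrier M)" and
    h: "\<And>m n. m \<in> carrier N \<Longrightarrow> n \<in> carrier N \<Longrightarrow> f (m \<oplus>\<^bsub>N\<^esub> n) = f m \<oplus>\<^bsub>M\<^esub> f n"
       "\<And>c m. m \<in> carrier N \<Longrightarrow> f (c \<odot>\<^bsub>N\<^esub> m) = c \<odot>\<^bsub>M\<^esub> f m"
       "\<And>g m. g \<in> GL2 \<Longrightarrow> m \<in> carrier N \<Longrightarrow> f (act N g m) = act M g (f m)"
    using f by (auto simp: gl2_iso_def gl2_hom_def)
  have inv: "?g (f m) = m" if "m \<in> carrier N" for m
    using bij that by (simp add: bij_betw_def)
  have ex: "\<exists>m\<in>carrier N. y = f m" if "y \<in> carrier M" for y
    using bij that by (auto simp: bij_betw_def)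
  have 1: "?g (x \<oplus>\<^bsub>M\<^esub> y) = ?g x \<oplus>\<^bsub>N\<^esub> ?g y" if xy: "x \<in> carrier M" "y \<in> carrier M" for x y
  proof -
    obtain m where m: "m \<in> carrier N" "x = f m" using ex[OF xy(1)] by blast
    obtain m' where m': "m' \<in> carrier N" "y = f m'" using ex[OF xy(2)] by blast
    show ?thesis using inv[OF N.add.m_closed[OF m(1) m'(1)]] h(1)[OF m(1) m'(1)] inv m m' by simp
  qed
  have 2: "?g (c \<odot>\<^bsub>M\<^esub> x) = c \<odot>\<^bsub>N\<^esub> ?g x" if x: "x \<in> carrier M" for x c
  proof -
    obtain m where m: "m \<in> carrier N" "x = f m" using ex[OF x] by blast
    then have "c \<odot>\<^bsub>N\<^esub> m \<in> carrier N" using V by blast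
    then show ?thesis using inv h(2)[OF m(1), of c] m by metis
  qed
  have 3: "?g (act M g x) = act N g (?g x)" if x: "x \<in> carrier M" and g: "g \<in> GL2" for x g
  proof -
    obtain m where m: "m \<in> carrier N" "x = f m" using ex[OF x] by blast
    show ?thesis using inv[OF N'(2)[OF g m(1)]] h(3)[OF g m(1)] inv m by simp
  qed
  show ?thesis
    unfolding gl2_iso_def gl2_hom_def using 1 2 3 bij_betw_inv_into[OF bij]
    by (auto simp: bij_betw_def)
qed

section \<open>Ring homomorphisms and derivations on \<open>\<bbbF>[X, Y]\<close>\<close>

definition is_ring_hom :: "('r::comm_ring_1 \<Rightarrow> 's::comm_ring_1) \<Rightarrow> bool" where
  "is_ring_hom h \<longleftrightarrow> h 1 = 1 \<and> (\<forall>x y. h (x + y) = h x + h y) \<and> (\<forall>x y. h (x * y) = h x * h y)"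

lemma is_ring_homI:
  "h 1 = 1 \<Longrightarrow> (\<And>x y. h (x + y) = h x + h y) \<Longrightarrow> (\<And>x y. h (x * y) = h x * h y) \<Longrightarrow> is_ring_hom h"
  by (simp add: is_ring_hom_def)

lemma is_ring_homD:
  assumes "is_ring_hom h"
  shows "h 1 = 1" "h (x + y) = h x + h y" "h (x * y) = h x * h y" "h 0 = 0" "h (- x) = - h x"
    "h (x - y) = h x - h y" "h (x ^ n) = h x ^ n" "h (of_nat n) = of_nat n"
    "h (sum f A) = (\<Sum>a\<in>A. h (f a))"
proof -
  show a: "h 1 = 1" "\<And>x y. h (x + y) = h x + h y" "\<And>x y. h (x * y) = h x * h y"
    using assms by (auto simp: is_ring_hom_def)
  show z: "h 0 = 0" using a(2)[of 0 0] by simp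
  show m: "h (- x) = - h x" for x using a(2)[of x "- x"] z by (simp add: eq_neg_iff_add_eq_0 add.commute)
  show "h (x - y) = h x - h y" using a(2)[of x "- y"] m by simp
  show "h (x ^ n) = h x ^ n" by (induction n) (simp_all add: a)
  show "h (of_nat n) = of_nat n" by (induction n) (simp_all add: a z)
  show "h (sum f A) = (\<Sum>a\<in>A. h (f a))"
    by (induction A rule: infinite_finite_induct) (simp_all add: a z)
qed

lemma is_ring_hom_comp: "is_ring_hom h \<Longrightarrow> is_ring_hom h' \<Longrightarrow> is_ring_hom (\<lambda>x. h (h' x))"
  by (simp add: is_ring_hom_def)

lemma is_ring_hom_map_poly:
  assumes h: "is_ring_hom h"
  shows "is_ring_hom (map_poly h)"
proof (rule is_ring_homI)
  note h' = is_ring_homD[OF h]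
  show "map_poly h 1 = 1" by (simp add: h')
  show "map_poly h (x + y) = map_poly h x + map_poly h y" for x y
    by (rule poly_eqI) (simp add: coeff_map_poly h')
  show "map_poly h (x * y) = map_poly h x * map_poly h y" for x y
    by (rule poly_eqI) (simp add: coeff_map_poly h' coeff_mult)
qed

lemma is_ring_hom_subst2: "is_ring_hom h \<Longrightarrow> is_ring_hom (subst2 h x y)"
proof -
  assume h: "is_ring_hom h"
  have p: "is_ring_hom (\<lambda>f. poly f z)" for z :: 'b by (simp add: is_ring_hom_def)
  have "is_ring_hom (\<lambda>f. poly (map_poly h f) x)"
    by (rule is_ring_hom_comp[OF p is_ring_hom_map_poly[OF h]])
  from is_ring_hom_comp[OF p is_ring_hom_map_poly[OF this]]
  show ?thesis unfolding subst2_def .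
qed

lemma subst2_generators:
  assumes "is_ring_hom h"
  shows "subst2 h x y (cst2 c) = h c" "subst2 h x y varX = x" "subst2 h x y varY = y"
  by (simp_all add: subst2_def cst2_def varX_def varY_def map_poly_pCons is_ring_homD[OF assms])

lemma is_ring_hom_cst2: "is_ring_hom cst2"
  by (rule is_ring_homI) (simp_all add: cst2_def one_pCons)

lemmas cst2_simps = is_ring_homD(1-8)[OF is_ring_hom_cst2]
lemmas cst2_sum = is_ring_homD(9)[OF is_ring_hom_cst2]

abbreviation mon :: "nat \<Rightarrow> nat \<Rightarrow> 'e::comm_ring_1 poly poly" where
  "mon i j \<equiv> varX ^ i * varY ^ j"

abbreviation coeff2 :: "'e::comm_ring_1 poly poly \<Rightarrow> nat \<Rightarrow> nat \<Rightarrow> 'e" where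
  "coeff2 f i j \<equiv> Polynomial.coeff (Polynomial.coeff f j) i"

lemma varX_power: "varX ^ i = [:Polynomial.monom 1 i:]"
  by (simp add: varX_def poly_const_pow monom_altdef)

lemma varY_power: "varY ^ j = Polynomial.monom 1 j"
  by (simp add: varY_def monom_altdef)

lemma cst2_mon: "cst2 c * mon i j = Polynomial.monom (Polynomial.monom c i) j"
  by (simp add: cst2_def varX_power varY_power smult_monom)

lemma coeff2_cst2_mult: "coeff2 (cst2 c * f) i j = c * coeff2 f i j"
  by (simp add: cst2_def)

lemma coeff2_mon: "coeff2 (cst2 c * mon i j) i' j' = (if i = i' \<and> j = j' then c else 0)"
  unfolding cst2_mon by (simp add: coeff_monom)

lemma poly2_eqI: "(\<And>i j. coeff2 f i j = coeff2 g i j) \<Longrightarrow> f = g"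
  by (intro poly_eqI)

lemma coeff2_sum: "coeff2 (sum f A) i j = (\<Sum>a\<in>A. coeff2 (f a) i j)"
  by (simp add: coeff_sum)

lemma poly2_finite_support: "\<exists>N. \<forall>i j. coeff2 f i j \<noteq> 0 \<longrightarrow> i \<le> N \<and> j \<le> N"
proof -
  define N where "N = Polynomial.degree f + (\<Sum>j\<le>Polynomial.degree f. Polynomial.degree (Polynomial.coeff f j))"
  have "i \<le> N \<and> j \<le> N" if "coeff2 f i j \<noteq> 0" for i j
  proof -
    have j: "j \<le> Polynomial.degree f" using that by (metis coeff_0 le_degree)
    have "i \<le> Polynomial.degree (Polynomial.coeff f j)" using that by (rule le_degree)
    also have "\<dots> \<le> (\<Sum>j\<le>Polynomial.degree f. Polynomial.degree (Polynomial.coeff f j))"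
      using j by (intro member_le_sum) auto
    finally show ?thesis using j by (simp add: N_def)
  qed
  then show ?thesis by blast
qed

lemma poly2_as_sum:
  assumes "\<And>i j. coeff2 f i j \<noteq> 0 \<Longrightarrow> (i, j) \<in> T" "finite T"
  shows "f = (\<Sum>(i, j)\<in>T. cst2 (coeff2 f i j) * mon i j)"
proof (rule poly2_eqI)
  fix i j
  have "coeff2 (\<Sum>(i, j)\<in>T. cst2 (coeff2 f i j) * mon i j) i j =
        (\<Sum>t\<in>T. if t = (i, j) then coeff2 f i j else 0)"
    unfolding coeff2_sum by (rule sum.cong) (auto simp: coeff2_mon split: if_splits)
  also have "\<dots> = coeff2 f i j" using assms by auto
  finally show "coeff2 f i j = coeff2 (\<Sum>(i, j)\<in>T. cst2 (coeff2 f i j) * mon i j) i j" ..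
qed

lemma poly2_induct [case_names zero add mon]:
  fixes f :: "'e::comm_ring_1 poly poly"
  assumes "P 0" "\<And>f g. P f \<Longrightarrow> P g \<Longrightarrow> P (f + g)"
    "\<And>c i j. coeff2 f i j \<noteq> 0 \<Longrightarrow> P (cst2 c * mon i j)"
  shows "P f"
proof -
  obtain N where N: "\<And>i j. coeff2 f i j \<noteq> 0 \<Longrightarrow> i \<le> N \<and> j \<le> N"
    using poly2_finite_support[of f] by blast
  define T where "T = {(i, j). coeff2 f i j \<noteq> 0}"
  have T: "finite T"
    by (rule finite_subset[of _ "{..N} \<times> {..N}"]) (use N in \<open>auto simp: T_def\<close>)
  have "P (\<Sum>(i, j)\<in>S. cst2 (coeff2 f i j) * mon i j)" if "S \<subseteq> T" for S
    using finite_subset[OF that T] that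
    by (induction S rule: finite_induct) (auto simp: assms T_def)
  from this[OF subset_refl] show ?thesis
    using poly2_as_sum[of f T] T by (simp add: T_def)
qed

lemma poly2_ring_induct:
  fixes f :: "'e::comm_ring_1 poly poly"
  assumes c: "\<And>c. P (cst2 c)" and X: "P varX" and Y: "P varY"
    and add: "\<And>f g. P f \<Longrightarrow> P g \<Longrightarrow> P (f + g)" and mult: "\<And>f g. P f \<Longrightarrow> P g \<Longrightarrow> P (f * g)"
  shows "P f"
proof (induction f rule: poly2_induct)
  case zero
  then show ?case using c[of 0] by (simp add: cst2_simps)
next
  case (mon c i j)
  have one: "P 1" using \<open>\<And>c. P (cst2 c)\<close>[of 1] by (simp add: cst2_simps)
  have pw: "P g \<Longrightarrow> P (g ^ n)" for g n by (induction n) (auto intro: mult one)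
  show ?case by (intro mult pw X Y \<open>\<And>c. P (cst2 c)\<close>)
qed (rule add)

lemma ring_hom_poly2_eqI:
  assumes f: "is_ring_hom f" and g: "is_ring_hom g" and c: "\<And>c. f (cst2 c) = g (cst2 c)"
    and "f varX = g varX" "f varY = g varY"
  shows "f x = g x"
  by (induction x rule: poly2_ring_induct)
     (simp_all add: assms is_ring_homD(2,3)[OF f] is_ring_homD(2,3)[OF g])

text \<open>Derivations into a module on which the ring acts through \<open>h\<close>.\<close>

definition is_derivation :: "('r::comm_ring_1 \<Rightarrow> 's::comm_ring_1) \<Rightarrow> ('r \<Rightarrow> 's) \<Rightarrow> bool" where
  "is_derivation h d \<longleftrightarrow> (\<forall>x y. d (x + y) = d x + d y) \<and> (\<forall>x y. d (x * y) = h x * d y + h y * d x)"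

lemma is_derivationD:
  assumes "is_derivation h d"
  shows "d (x + y) = d x + d y" "d (x * y) = h x * d y + h y * d x" "d 0 = 0" "d (- x) = - d x"
    "d (x - y) = d x - d y"
proof -
  show a: "\<And>x y. d (x + y) = d x + d y" "d (x * y) = h x * d y + h y * d x"
    using assms by (auto simp: is_derivation_def)
  show z: "d 0 = 0" using a(1)[of 0 0] by simp
  show m: "d (- x) = - d x" for x using a(1)[of x "- x"] z by (simp add: eq_neg_iff_add_eq_0 add.commute)
  show "d (x - y) = d x - d y" using a(1)[of x "- y"] m by simp
qed

lemma derivation_power:
  assumes h: "is_ring_hom h" and d: "is_derivation h d"
  shows "d (x ^ n) = of_nat n * h x ^ (n - 1) * d x"
proof (induction n)
  case 0
  have "d (1 * 1) = d 1 + d 1" using is_derivationD(2)[OF d, of 1 1] is_ring_homD(1)[OF h] by simp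
  then show ?case by simp
next
  case (Suc n)
  then show ?case
    by (cases n) (simp_all add: is_derivationD[OF d] is_ring_homD[OF h] algebra_simps)
qed

lemma derivation_poly2_eqI:
  assumes "is_derivation h d" "is_derivation h d'" "\<And>c. d (cst2 c) = d' (cst2 c)"
    and "d varX = d' varX" "d varY = d' varY"
  shows "d x = d' x"
  by (induction x rule: poly2_ring_induct)
     (simp_all add: assms is_derivationD(1,2)[OF assms(1)] is_derivationD(1,2)[OF assms(2)])

lemma is_derivation_hom_left:
  assumes "is_derivation h d" "is_ring_hom g"
  shows "is_derivation (\<lambda>x. g (h x)) (\<lambda>x. g (d x))"
  using assms by (simp add: is_derivation_def is_ring_hom_def)

lemma is_derivation_hom_right:
  assumes "is_derivation h d" "is_ring_hom g"
  shows "is_derivation (\<lambda>x. h (g x)) (\<lambda>x. d (g x))"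
  using assms by (simp add: is_derivation_def is_ring_hom_def)

definition poly2_der :: "nat \<Rightarrow> 'e::idom poly poly \<Rightarrow> 'e poly poly" where
  "poly2_der q f = varX ^ q * map_poly pderiv f + varY ^ q * pderiv f"

lemma Dq_eq_poly2_der: "(Dq :: 'a::{finite,field} poly poly \<Rightarrow> _) = poly2_der CARD('a)"
  by (rule ext) (simp add: Dq_def poly2_der_def)

lemma is_derivation_map_pderiv: "is_derivation (\<lambda>f. f) (map_poly pderiv :: 'e::idom poly poly \<Rightarrow> _)"
proof -
  have add: "map_poly pderiv (f + g) = map_poly pderiv f + map_poly pderiv g" for f g :: "'e poly poly"
    by (rule poly_eqI) (simp add: coeff_map_poly pderiv_add)
  have sm: "map_poly pderiv (Polynomial.smult a g) = Polynomial.smult (pderiv a) g + Polynomial.smult a (map_poly pderiv g)"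
    for a and g :: "'e poly poly"
    by (rule poly_eqI) (simp add: coeff_map_poly pderiv_mult algebra_simps)
  have "map_poly pderiv (f * g) = f * map_poly pderiv g + g * map_poly pderiv f" for f g :: "'e poly poly"
  proof (induction f)
    case (pCons a f)
    show ?case
      by (simp add: add sm pCons map_poly_pCons algebra_simps)
  qed simp
  then show ?thesis by (simp add: is_derivation_def add)
qed

lemma is_derivation_poly2_der: "is_derivation (\<lambda>f. f) (poly2_der q :: 'e::idom poly poly \<Rightarrow> _)"
  using is_derivation_map_pderiv[where 'e = 'e]
  by (simp add: is_derivation_def poly2_der_def pderiv_add pderiv_mult algebra_simps)

lemma poly2_der_generators [simp]:
  "poly2_der q (cst2 c) = 0" "poly2_der q varX = varX ^ q" "poly2_der q varY = varY ^ q"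
  by (simp_all add: poly2_der_def cst2_def varX_def varY_def map_poly_pCons pderiv_pCons
      one_pCons[symmetric] map_poly_1)

lemma poly2_der_cst2_mult: "poly2_der q (cst2 c * f) = cst2 c * poly2_der q f"
  by (simp add: is_derivationD(2)[OF is_derivation_poly2_der])

lemma poly2_der_mon:
  "poly2_der q (mon i j) = of_nat i * mon (i - 1 + q) j + of_nat j * mon i (j - 1 + q)"
  by (simp add: is_derivationD(2)[OF is_derivation_poly2_der]
      derivation_power[OF _ is_derivation_poly2_der] is_ring_hom_def power_add algebra_simps)

section \<open>Homogeneous polynomials\<close>

lemma homog_subspace:
  "0 \<in> homog n" "f \<in> homog n \<Longrightarrow> g \<in> homog n \<Longrightarrow> f + g \<in> homog n"
  "f \<in> homog n \<Longrightarrow> g \<in> homog n \<Longrightarrow> f - g \<in> homog n"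
  "f \<in> homog n \<Longrightarrow> - f \<in> homog n"
  "f \<in> homog n \<Longrightarrow> cst2 c * f \<in> homog n"
proof -
  show "0 \<in> homog n" by (simp add: homog_def)
  show "f + g \<in> homog n" if "f \<in> homog n" "g \<in> homog n"
  proof -
    have "coeff2 (f + g) i j \<noteq> 0 \<Longrightarrow> coeff2 f i j \<noteq> 0 \<or> coeff2 g i j \<noteq> 0" for i j by auto
    then show ?thesis using that unfolding homog_def by blast
  qed
  show "f - g \<in> homog n" if "f \<in> homog n" "g \<in> homog n"
  proof -
    have "coeff2 (f - g) i j \<noteq> 0 \<Longrightarrow> coeff2 f i j \<noteq> 0 \<or> coeff2 g i j \<noteq> 0" for i j by auto
    then show ?thesis using that unfolding homog_def by blast
  qed
  show "- f \<in> homog n" if "f \<in> homog n" using that by (simp add: homog_def)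
  show "cst2 c * f \<in> homog n" if "f \<in> homog n"
  proof -
    have "coeff2 (cst2 c * f) i j \<noteq> 0 \<Longrightarrow> coeff2 f i j \<noteq> 0" for i j
      unfolding coeff2_cst2_mult by auto
    then show ?thesis using that unfolding homog_def by blast
  qed
qed

lemma mon_homog: "i + j = n \<Longrightarrow> (mon i j :: 'e::comm_ring_1 poly poly) \<in> homog n"
  using coeff2_mon[where c = "1 :: 'e"] unfolding homog_def by (auto simp: cst2_simps split: if_splits)

lemma homog_induct [consumes 1, case_names zero add mon]:
  assumes "f \<in> homog n" "P 0" "\<And>f g. P f \<Longrightarrow> P g \<Longrightarrow> P (f + g)"
    "\<And>c i j. i + j = n \<Longrightarrow> P (cst2 c * mon i j)"
  shows "P f"
  using assms by (intro poly2_induct[of P f]) (auto simp: homog_def)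

lemma homog_as_sum:
  assumes "f \<in> homog n"
  shows "f = (\<Sum>i\<le>n. cst2 (coeff2 f i (n - i)) * mon i (n - i))"
proof -
  have "f = (\<Sum>(i, j)\<in>(\<lambda>i. (i, n - i)) ` {..n}. cst2 (coeff2 f i j) * mon i j)"
    by (rule poly2_as_sum) (use assms in \<open>auto simp: homog_def\<close>, force)
  then show ?thesis by (subst (asm) sum.reindex) (auto simp: inj_on_def)
qed

lemma homog_mult:
  assumes "f \<in> homog m" "g \<in> homog n"
  shows "f * g \<in> homog (m + n)"
  using assms(1)
proof (induction f rule: homog_induct)
  case (mon c i j)
  show ?case using assms(2)
  proof (induction g rule: homog_induct)
    case (mon c' i' j')
    have "cst2 c * mon i j * (cst2 c' * mon i' j') = cst2 (c * c') * mon (i + i') (j + j')"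
      by (simp add: cst2_simps power_add algebra_simps)
    then show ?case
      using \<open>i + j = m\<close> mon by (simp add: homog_subspace(5) mon_homog)
  qed (auto simp: algebra_simps intro: homog_subspace)
qed (auto simp: algebra_simps intro: homog_subspace)

lemma homog_power: "f \<in> homog m \<Longrightarrow> f ^ n \<in> homog (n * m)"
proof (induction n)
  case 0
  show ?case using mon_homog[of 0 0 0] by simp
next
  case (Suc n)
  then show ?case using homog_mult[of f m "f ^ n" "n * m"] by simp
qed

lemma type_module_simps [simp]:
  "carrier (type_module sc S) = S" "zero (type_module sc S) = 0" "add (type_module sc S) = (+)"
  "smult (type_module sc S) = sc"
  by (simp_all add: type_module_def)

lemma vec_space_type_module:
  fixes S :: "'m::ab_group_add set" and sc :: "'e::field \<Rightarrow> 'm \<Rightarrow> 'm"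
  assumes S: "0 \<in> S" "\<And>x y. x \<in> S \<Longrightarrow> y \<in> S \<Longrightarrow> x + y \<in> S" "\<And>c x. x \<in> S \<Longrightarrow> sc c x \<in> S"
    and sc: "\<And>c x y. sc c (x + y) = sc c x + sc c y" "\<And>c d x. sc (c + d) x = sc c x + sc d x"
      "\<And>c d x. sc (c * d) x = sc c (sc d x)" "\<And>x. sc 1 x = x"
  shows "vec_space (type_module sc S)"
proof -
  have "sc 0 x = 0" for x using sc(2)[of 0 0 x] by simp
  then have "sc (- 1) x + x = 0" for x using sc(2)[of "- 1" 1 x] sc(4) by simp
  then have "\<exists>y\<in>S. y + x = 0" if "x \<in> S" for x using S(3)[OF that] by blast
  then have "abelian_group (type_module sc S)"
    using S by (intro abelian_groupI) (auto simp: algebra_simps)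
  then show ?thesis unfolding vec_space_iff using S sc by simp
qed

lemma sub_space_type_module:
  "sub_space (type_module sc S) W \<longleftrightarrow> W \<subseteq> S \<and> 0 \<in> W \<and> (\<forall>x\<in>W. \<forall>y\<in>W. x + y \<in> W) \<and> (\<forall>c. \<forall>x\<in>W. sc c x \<in> W)"
  by (simp add: sub_space_def)

lemma a_minus_type_module:
  fixes S :: "'m::ab_group_add set" and sc :: "'e::field \<Rightarrow> 'm \<Rightarrow> 'm"
  assumes V: "vec_space (type_module sc S)" and x: "x \<in> S" and y: "y \<in> S"
  shows "x \<ominus>\<^bsub>type_module sc S\<^esub> y = x - y"
proof -
  interpret Module.module ring_of_type_algebra "type_module sc S" by (rule V)
  have "\<ominus>\<^bsub>type_module sc S\<^esub> y + y = 0" using l_neg[of y] y by simp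
  then have "\<ominus>\<^bsub>type_module sc S\<^esub> y = - y" by (simp only: eq_neg_iff_add_eq_0)
  then show ?thesis by (simp add: a_minus_def)
qed

abbreviation act2 :: "'a::field ^ 2 ^ 2 \<Rightarrow> 'a poly poly \<Rightarrow> 'a poly poly" where
  "act2 g \<equiv> subst2 cst2 (cst2 (g$1$1) * varX + cst2 (g$2$1) * varY)
                        (cst2 (g$1$2) * varX + cst2 (g$2$2) * varY)"

lemmas is_ring_hom_act2 = is_ring_hom_subst2[OF is_ring_hom_cst2]
lemmas act2_generators = subst2_generators[OF is_ring_hom_cst2]
lemmas act2_hom = is_ring_homD[OF is_ring_hom_act2]

lemma Sym_simps [simp]:
  "carrier (Sym n) = homog n" "zero (Sym n) = 0" "add (Sym n) = (+)"
  "smult (Sym n) = (\<lambda>c f. cst2 c * f)" "act (Sym n) = act2"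
  by (simp_all add: Sym_def)

lemma vec_space_Sym: "vec_space (Sym n :: ('a::field, _) gl2_module)"
proof (rule vec_space_cong)
  show "vec_space (type_module (\<lambda>c f :: 'a poly poly. cst2 c * f) (homog n))"
    by (rule vec_space_type_module) (simp_all add: homog_subspace cst2_simps distrib_left distrib_right mult.assoc)
qed simp_all

lemma act2_homog: "f \<in> homog n \<Longrightarrow> act2 g f \<in> homog n"
proof (induction f rule: homog_induct)
  case (mon c i j)
  have "cst2 a * varX + cst2 b * varY \<in> homog 1" for a b :: 'a
    using mon_homog[of 1 0 1] mon_homog[of 0 1 1] by (auto intro!: homog_subspace)
  from homog_mult[OF homog_power[OF this] homog_power[OF this]] show ?case
    using mon by (auto simp: act2_hom act2_generators intro!: homog_subspace(5))
qed (auto simp: act2_hom homog_subspace)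

lemma act2_mult: "act2 (g ** h) f = act2 g (act2 h f)"
  by (rule ring_hom_poly2_eqI[OF is_ring_hom_act2 is_ring_hom_comp[OF is_ring_hom_act2 is_ring_hom_act2]])
     (simp_all add: act2_hom act2_generators matrix_matrix_mult_def sum_2 cst2_simps algebra_simps)

lemma act2_one: "act2 (mat 1) f = f"
  by (rule ring_hom_poly2_eqI[OF is_ring_hom_act2])
     (simp_all add: is_ring_hom_def act2_generators mat_def cst2_simps)

lemma is_gl2_module_Sym: "is_gl2_module (Sym n :: ('a::field, _) gl2_module)"
  unfolding is_gl2_module_def
  by (simp add: vec_space_Sym act2_homog act2_one act2_mult act2_hom act2_generators)

lemma Sym_sub_space_eqI:
  assumes "sub_space (Sym n) S" "\<And>i j. i + j = n \<Longrightarrow> mon i j \<in> S"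
  shows "homog n \<subseteq> (S :: 'a::field poly poly set)"
proof
  fix f :: "'a poly poly" assume "f \<in> homog n"
  then show "f \<in> S"
    by (induction f rule: homog_induct) (use assms in \<open>auto simp: sub_space_def\<close>)
qed

section \<open>The coordinate ring of the affine curve\<close>

lemma abs_crv_eq_iff:
  "(abs_crv f :: ('a::{finite,field}, 'e::field) crv) = abs_crv g \<longleftrightarrow> crv_poly TYPE('a) dvd f - g"
  by (rule crv.abs_eq_iff)

lemma abs_rep_crv [simp]: "abs_crv (rep_crv x) = x"
  by (rule Quotient3_abs_rep[OF Quotient3_crv])

lemma is_ring_hom_abs_crv: "is_ring_hom abs_crv"
  by (rule is_ring_homI) (simp_all add: one_crv_def plus_crv.abs_eq times_crv.abs_eq)

lemma abs_crv_generators: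
  "abs_crv (cst2 c) = cst c" "abs_crv varX = crv_u" "abs_crv varY = crv_v"
  by (simp_all add: cst.abs_eq crv_u_def crv_v_def)

lemmas abs_crv_hom = is_ring_homD[OF is_ring_hom_abs_crv]

lemma crv_induct [case_names cst u v add mult]:
  fixes x :: "('a::{finite,field}, 'e::field) crv"
  assumes "\<And>c. P (cst c)" "P crv_u" "P crv_v"
    "\<And>f g. P f \<Longrightarrow> P g \<Longrightarrow> P (f + g)" "\<And>f g. P f \<Longrightarrow> P g \<Longrightarrow> P (f * g)"
  shows "P x"
proof -
  have "P (abs_crv f)" for f
    by (induction f rule: poly2_ring_induct)
       (simp_all add: assms abs_crv_hom(2,3) abs_crv_generators)
  from this[of "rep_crv x"] show ?thesis by simp
qed

lemma is_ring_hom_cst: "is_ring_hom (cst :: 'e::field \<Rightarrow> ('a::{finite,field}, 'e) crv)"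
proof -
  have "is_ring_hom (\<lambda>c :: 'e. abs_crv (cst2 c) :: ('a, 'e) crv)"
    by (rule is_ring_hom_comp[OF is_ring_hom_abs_crv is_ring_hom_cst2])
  then show ?thesis by (simp add: abs_crv_generators)
qed

lemmas cst_simps = is_ring_homD(1-8)[OF is_ring_hom_cst]

lemma crv_relation:
  "crv_u * crv_v ^ CARD('a) - crv_u ^ CARD('a) * crv_v = (1 :: ('a::{finite,field}, 'e::field) crv)"
proof -
  have "abs_crv (varX * varY ^ CARD('a) - varX ^ CARD('a) * varY) = (abs_crv 1 :: ('a, 'e) crv)"
    unfolding abs_crv_eq_iff by (simp add: crv_poly_def)
  then show ?thesis by (simp add: abs_crv_hom abs_crv_generators)
qed

lemma crv_hom_eqI:
  fixes f :: "('a::{finite,field}, 'e::field) crv \<Rightarrow> 'r::comm_ring_1"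
  assumes f: "is_ring_hom f" and g: "is_ring_hom g" and "\<And>c. f (cst c) = g (cst c)"
    and "f crv_u = g crv_u" "f crv_v = g crv_v"
  shows "f x = g x"
  by (induction x rule: crv_induct) (simp_all add: assms is_ring_homD(2,3)[OF f] is_ring_homD(2,3)[OF g])

lemma crv_derivation_eqI:
  fixes d :: "('a::{finite,field}, 'e::field) crv \<Rightarrow> 'r::comm_ring_1"
  assumes "is_derivation h d" "is_derivation h d'" "\<And>c. d (cst c) = d' (cst c)"
    and "d crv_u = d' crv_u" "d crv_v = d' crv_v"
  shows "d x = d' x"
  by (induction x rule: crv_induct)
     (simp_all add: assms is_derivationD(1,2)[OF assms(1)] is_derivationD(1,2)[OF assms(2)])

lemma is_ring_hom_cst_comp: "is_ring_hom h \<Longrightarrow> is_ring_hom (\<lambda>c. cst (h c))"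
  by (rule is_ring_hom_comp[OF is_ring_hom_cst])

text \<open>A solution \<open>(x, y)\<close> of the equation of the curve is a homomorphism out of the coordinate ring.\<close>

lemma
  fixes x y :: "('a::{finite,field}, 'f::field) crv" and h :: "'e::field \<Rightarrow> 'f"
  assumes h: "is_ring_hom h" and xy: "x * y ^ CARD('a) - x ^ CARD('a) * y = 1"
  shows crv_subst_abs: "crv_subst h x y (abs_crv f) = subst2 (\<lambda>c. cst (h c)) x y f"
    and is_ring_hom_crv_subst: "is_ring_hom (crv_subst h x y)"
    and crv_subst_generators: "crv_subst h x y (cst c) = cst (h c)" "crv_subst h x y crv_u = x"
      "crv_subst h x y crv_v = y"
proof -
  let ?s = "subst2 (\<lambda>c. cst (h c)) x y"
  have s: "is_ring_hom ?s"
    by (rule is_ring_hom_subst2[OF is_ring_hom_cst_comp[OF h]])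
  note s' = is_ring_homD[OF s] subst2_generators[OF is_ring_hom_cst_comp[OF h]]
  have 1: "crv_subst h x y (abs_crv f) = ?s f" for f
  proof -
    have "abs_crv (rep_crv (abs_crv f :: ('a, 'e) crv)) = (abs_crv f :: ('a, 'e) crv)" by simp
    then obtain g where "rep_crv (abs_crv f :: ('a, 'e) crv) - f = crv_poly TYPE('a) * g"
      unfolding abs_crv_eq_iff by (auto elim: dvdE)
    then have "?s (rep_crv (abs_crv f :: ('a, 'e) crv)) - ?s f = ?s (crv_poly TYPE('a)) * ?s g"
      by (metis s'(6,3))
    also have "?s (crv_poly TYPE('a)) = 0"
      unfolding crv_poly_def using xy by (simp add: s')
    finally show ?thesis by (simp add: crv_subst_def)
  qed
  then show "crv_subst h x y (abs_crv f) = ?s f" .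
  show "is_ring_hom (crv_subst h x y)"
  proof (rule is_ring_homI)
    show "crv_subst h x y 1 = 1" using 1[of 1] by (simp add: abs_crv_hom s')
    show "crv_subst h x y (a + b) = crv_subst h x y a + crv_subst h x y b" for a b
      using 1[of "rep_crv a + rep_crv b"] 1[of "rep_crv a"] 1[of "rep_crv b"] by (simp add: abs_crv_hom s')
    show "crv_subst h x y (a * b) = crv_subst h x y a * crv_subst h x y b" for a b
      using 1[of "rep_crv a * rep_crv b"] 1[of "rep_crv a"] 1[of "rep_crv b"] by (simp add: abs_crv_hom s')
  qed
  show "crv_subst h x y (cst c) = cst (h c)" "crv_subst h x y crv_u = x" "crv_subst h x y crv_v = y"
    using 1[of "cst2 c"] 1[of varX] 1[of varY] by (simp_all add: abs_crv_generators s')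
qed

subsection \<open>Units\<close>

lemma inverse_crv_eqI:
  fixes x :: "('a::{finite,field}, 'e::field) crv"
  assumes "x * y = 1"
  shows "inverse x = y"
proof -
  have "x dvd 1" using assms by (metis dvd_triv_left)
  moreover have "(THE g. x * g = 1) = y"
  proof (rule the_equality)
    show "g = y" if "x * g = 1" for g
    proof -
      have "g = (x * y) * g" using assms by simp
      also have "\<dots> = y * (x * g)" by (simp only: mult.commute mult.left_commute)
      finally show ?thesis using that by simp
    qed
  qed (rule assms)
  ultimately show ?thesis by (simp add: inverse_crv_def)
qed

definition crv_unit :: "('a::{finite,field}, 'e::field) crv \<Rightarrow> bool" where
  "crv_unit x \<longleftrightarrow> x * inverse x = 1"

lemma crv_unitI: "x * y = 1 \<Longrightarrow> crv_unit x"
  using inverse_crv_eqI[of x y] by (simp add: crv_unit_def)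

lemma crv_unitD: "crv_unit x \<Longrightarrow> x * inverse x = 1" "crv_unit x \<Longrightarrow> inverse x * x = 1"
  by (simp_all add: crv_unit_def mult.commute)

lemma crv_unit_cancel:
  assumes *: "crv_unit x"
  shows "x * f = x * g \<longleftrightarrow> f = g"
proof
  assume "x * f = x * g"
  then have "inverse x * (x * f) = inverse x * (x * g)" by simp
  then show "f = g" using crv_unitD(2)[OF *] by (simp flip: mult.assoc)
qed simp

lemma crv_unit_mult_aux: "crv_unit x \<Longrightarrow> crv_unit y \<Longrightarrow> x * y * (inverse x * inverse y) = 1"
proof -
  assume *: "crv_unit x" "crv_unit y"
  have "x * y * (inverse x * inverse y) = (x * inverse x) * (y * inverse y)" by (simp only: mult_ac)
  then show ?thesis using * by (simp add: crv_unitD)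
qed

lemmas crv_unit_mult = crv_unitI[OF crv_unit_mult_aux]

lemma crv_unit_inverse: "crv_unit x \<Longrightarrow> crv_unit (inverse x)"
  by (rule crv_unitI[of _ x]) (simp add: crv_unitD)

lemma inverse_inverse_crv: "crv_unit x \<Longrightarrow> inverse (inverse x) = x"
  by (rule inverse_crv_eqI) (simp add: crv_unitD)

lemma inverse_mult_crv:
  "crv_unit x \<Longrightarrow> crv_unit y \<Longrightarrow> inverse (x * y) = inverse x * inverse y"
  by (rule inverse_crv_eqI) (rule crv_unit_mult_aux)

lemma crv_unit_one: "crv_unit 1"
  by (rule crv_unitI[of _ 1]) simp

lemma inverse_one_crv [simp]: "inverse 1 = (1 :: ('a::{finite,field}, 'e::field) crv)"
  by (rule inverse_crv_eqI) simp

lemma crv_unit_power: "crv_unit x \<Longrightarrow> crv_unit (x ^ n)"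
  by (induction n) (simp_all add: crv_unit_one crv_unit_mult)

lemma inverse_power_crv: "crv_unit x \<Longrightarrow> inverse (x ^ n) = inverse x ^ n"
  by (induction n) (simp_all add: inverse_mult_crv crv_unit_power)

lemma crv_unit_cst: "c \<noteq> 0 \<Longrightarrow> crv_unit (cst c)"
  by (rule crv_unitI[of _ "cst (inverse c)"]) (simp add: cst_simps flip: cst_simps(3))

lemma inverse_cst: "c \<noteq> 0 \<Longrightarrow> inverse (cst c) = cst (inverse c)"
  by (rule inverse_crv_eqI) (simp add: cst_simps flip: cst_simps(3))

lemma hom_inverse:
  assumes h: "is_ring_hom h" and x: "crv_unit x"
  shows "crv_unit (h x)" "h (inverse x) = inverse (h x)"
proof -
  have 1: "h x * h (inverse x) = 1"
    using crv_unitD(1)[OF x] is_ring_homD(1,3)[OF h] by metis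
  then show "crv_unit (h x)" by (rule crv_unitI)
  show "h (inverse x) = inverse (h x)" using inverse_crv_eqI[OF 1] by simp
qed

lemma powi_Suc_crv:
  assumes "crv_unit x"
  shows "x powi (a + 1) = x powi a * x"
proof (cases "a \<ge> 0")
  case True
  then show ?thesis by (simp add: power_int_def nat_add_distrib)
next
  case False
  then obtain n where a: "a = - int (Suc n)" by (metis int_cases not_le zero_le_imp_eq_int nat_int negative_eq_positive of_nat_0_le_iff)
  have "inverse x ^ Suc n * x = inverse x ^ n * (inverse x * x)" by (simp add: algebra_simps)
  moreover have "x powi (a + 1) = inverse x ^ n" by (cases "n = 0") (simp_all add: a power_int_def)
  moreover have "x powi a = inverse x ^ Suc n" by (simp add: a power_int_def nat_add_distrib)
  ultimately show ?thesis using crv_unitD[OF assms] by simp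
qed

lemma powi_add_crv:
  assumes x: "crv_unit x"
  shows "x powi (a + b) = x powi a * x powi b"
proof (induction b rule: int_induct[of _ 0])
  case (step1 b)
  then show ?case using powi_Suc_crv[OF x, of "a + b"] powi_Suc_crv[OF x, of b] by (simp add: algebra_simps)
next
  case (step2 b)
  have "x * x powi (a + (b - 1)) = x * (x powi a * x powi (b - 1))"
    using step2 powi_Suc_crv[OF x, of "a + (b - 1)"] powi_Suc_crv[OF x, of "b - 1"]
    by (simp add: algebra_simps)
  then show ?case using crv_unit_cancel[OF x] by blast
qed simp

lemma powi_of_nat_crv [simp]: "(x :: ('a::{finite,field}, 'e::field) crv) powi (int n) = x ^ n"
  by (simp add: power_int_def)

lemma powi_minus_crv:
  assumes x: "crv_unit x"
  shows "x powi (- a) = inverse (x powi a)" "inverse x powi a = x powi (- a)"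
proof -
  show 1: "x powi (- a) = inverse (x powi a)" for a
    using powi_add_crv[OF x, of a "- a"] by (intro inverse_crv_eqI[symmetric]) simp
  show "inverse x powi a = x powi (- a)"
    using x by (cases "a \<ge> 0")
      (simp_all add: power_int_def inverse_inverse_crv inverse_power_crv crv_unit_power crv_unit_inverse)
qed

lemma powi_mult_crv:
  assumes x: "crv_unit x" and y: "crv_unit y"
  shows "(x * y) powi a = x powi a * y powi a"
  by (simp add: power_int_def inverse_mult_crv[OF x y] power_mult_distrib)

lemma hom_powi:
  fixes h :: "('a::{finite,field}, 'e::field) crv \<Rightarrow> ('b::{finite,field}, 'f::field) crv"
  assumes h: "is_ring_hom h" and x: "crv_unit x"
  shows "h (x powi a) = h x powi a"
  using hom_inverse[OF assms] is_ring_homD(7)[OF h] by (simp add: power_int_def)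

lemma cst_powi:
  assumes "c \<noteq> 0"
  shows "cst c powi a = cst (c powi a)"
  using assms by (simp add: power_int_def inverse_cst cst_simps)

lemma crv_unit_u: "crv_unit (crv_u :: ('a::{finite,field}, 'e::field) crv)"
  and crv_unit_v: "crv_unit (crv_v :: ('a, 'e) crv)"
proof -
  let ?q = "CARD('a)"
  have q: "x ^ ?q = x * x ^ (?q - 1)" for x :: "('a, 'e) crv"
    using power_Suc[of x "?q - 1"] by simp
  show "crv_unit (crv_u :: ('a, 'e) crv)"
    using crv_relation[where 'a = 'a and 'e = 'e] q[of crv_u]
    by (intro crv_unitI[of _ "crv_v ^ ?q - crv_u ^ (?q - 1) * crv_v"]) (simp add: algebra_simps)
  show "crv_unit (crv_v :: ('a, 'e) crv)"
    using crv_relation[where 'a = 'a and 'e = 'e] q[of crv_v]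
    by (intro crv_unitI[of _ "crv_u * crv_v ^ (?q - 1) - crv_u ^ ?q"]) (simp add: algebra_simps)
qed

subsection \<open>Laurent monomials\<close>

definition mm :: "int \<Rightarrow> int \<Rightarrow> ('a::{finite,field}, 'e::field) crv" where
  "mm i j = crv_u powi i * crv_v powi j"

lemma mm_mult: "mm i j * mm i' j' = mm (i + i') (j + j')"
  by (simp add: mm_def powi_add_crv crv_unit_u crv_unit_v algebra_simps)

lemma mm_nat: "mm (int i) (int j) = crv_u ^ i * crv_v ^ j"
  by (simp add: mm_def)

lemma mm_0 [simp]: "mm 0 0 = 1"
  using mm_nat[of 0 0] by simp

lemma mm_power: "mm i j ^ n = mm (int n * i) (int n * j)"
  by (induction n) (simp_all add: mm_mult algebra_simps)

lemma mm_eqs: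
  "crv_u = mm 1 0" "crv_v = mm 0 1" "inverse crv_u = mm (- 1) 0" "inverse crv_v = mm 0 (- 1)"
  by (simp_all add: mm_def power_int_def)

lemma mm_inverse: "inverse (mm i j) = mm (- i) (- j)"
  by (rule inverse_crv_eqI) (simp add: mm_mult)

lemma t1_eq: "t1 = mm (- 1) 1" and t2_eq: "t2 = mm (- 1) 0"
  by (simp_all add: t1_def t2_def divide_crv_def mm_eqs mm_mult mm_inverse)

lemma mm_powi: "mm i j powi a = mm (a * i) (a * j)"
proof (cases "a \<ge> 0")
  case True
  then show ?thesis by (simp add: power_int_def mm_power)
next
  case False
  then show ?thesis by (simp add: power_int_def mm_power mm_inverse)
qed

lemma mm_relation:
  "mm i j = mm (i + 1) (j + int CARD('a)) - (mm (i + int CARD('a)) (j + 1) :: ('a::{finite,field}, 'e::field) crv)"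
proof -
  have "mm (i + 1) (j + int CARD('a)) - mm (i + int CARD('a)) (j + 1) =
      mm i j * (crv_u * crv_v ^ CARD('a) - crv_u ^ CARD('a) * crv_v :: ('a, 'e) crv)"
    by (simp add: mm_eqs mm_power mm_mult algebra_simps)
  then show ?thesis
    by (simp add: crv_relation)
qed

text \<open>
  The equation of the curve has terms of degree \<open>0\<close> and \<open>q + 1\<close> only. A nonzero multiple of it
  therefore has nonzero homogeneous components whose degrees differ by at least \<open>q + 1\<close>.
\<close>

lemma multiple_of_crv_poly_spread:
  fixes F :: "'e::field poly poly"
  assumes dvd: "crv_poly TYPE('a::{finite,field}) dvd F"
    and deg: "\<And>i j. coeff2 F i j \<noteq> 0 \<Longrightarrow> c \<le> i + j \<and> i + j \<le> c + CARD('a)"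
  shows "F = 0"
proof -
  define q where "q = CARD('a)"
  define h :: "'e \<Rightarrow> 'e poly poly poly" where "h c = [:cst2 c:]" for c
  have h: "is_ring_hom h"
    by (rule is_ring_homI) (simp_all add: h_def cst2_simps one_pCons)
  \<comment> \<open>The substitution of \<open>s X\<close>, \<open>s Y\<close> for \<open>X\<close>, \<open>Y\<close>, with values in polynomials in \<open>s\<close>; its coefficient
    at \<open>s\<^sup>n\<close> is the homogeneous component of degree \<open>n\<close>.\<close>
  define \<sigma> where "\<sigma> = subst2 h [:0, varX:] [:0, varY:]"
  have \<sigma>: "is_ring_hom \<sigma>" unfolding \<sigma>_def by (rule is_ring_hom_subst2[OF h])
  note s = is_ring_homD[OF \<sigma>]
  have gen: "\<sigma> (cst2 c) = [:cst2 c:]" "\<sigma> varX = Polynomial.monom varX 1" "\<sigma> varY = Polynomial.monom varY 1" for c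
    unfolding \<sigma>_def by (simp_all add: subst2_generators[OF h]) (simp_all add: h_def monom_Suc monom_0)
  have pow: "Polynomial.monom x 1 ^ n = Polynomial.monom (x ^ n) n" for x :: "'e poly poly" and n
    by (induction n) (simp_all add: mult_monom one_pCons monom_0)
  define H :: "'e poly poly" where "H = varX * varY ^ q - varX ^ q * varY"
  have \<sigma>crv: "\<sigma> (crv_poly TYPE('a)) = Polynomial.monom H (q + 1) - 1"
    unfolding crv_poly_def H_def q_def[symmetric]
    by (simp add: s gen pow mult_monom diff_monom add.commute del: One_nat_def)
  have mon: "\<sigma> (cst2 c * mon i j) = Polynomial.monom (cst2 c * mon i j) (i + j)" for c i j
    using pow[of varX i] pow[of varY j] by (simp add: s gen mult_monom smult_monom del: One_nat_def)
  have co: "Polynomial.coeff (\<sigma> F) n = 0" if "\<not> (c \<le> n \<and> n \<le> c + q)" for n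
  proof -
    define N where "N = {f. Polynomial.coeff (\<sigma> f) n = 0}"
    have "F \<in> N"
      by (induction F rule: poly2_induct)
         (use that in \<open>auto simp: N_def s(2,4) mon q_def coeff_monom dest!: deg\<close>)
    then show ?thesis by (simp add: N_def)
  qed
  obtain R where R: "F = crv_poly TYPE('a) * R" using dvd by (elim dvdE)
  have cR: "Polynomial.coeff (\<sigma> F) n =
      (if q + 1 \<le> n then H * Polynomial.coeff (\<sigma> R) (n - (q + 1)) else 0) - Polynomial.coeff (\<sigma> R) n" for n
    unfolding R s(3) \<sigma>crv by (simp add: left_diff_distrib coeff_monom_mult)
  have "\<sigma> R = 0"
  proof (rule ccontr)
    assume nz: "\<sigma> R \<noteq> 0"
    define r where "r = (LEAST n. Polynomial.coeff (\<sigma> R) n \<noteq> 0)"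
    have r: "Polynomial.coeff (\<sigma> R) r \<noteq> 0"
      unfolding r_def by (rule LeastI[of _ "Polynomial.degree (\<sigma> R)"]) (use nz in simp)
    have least: "Polynomial.coeff (\<sigma> R) n = 0" if "n < r" for n
      using that not_less_Least[of n "\<lambda>n. Polynomial.coeff (\<sigma> R) n \<noteq> 0"] by (auto simp: r_def)
    have "Polynomial.coeff (\<sigma> F) r \<noteq> 0"
      unfolding cR using r least[of "r - (q + 1)"] by auto
    then have "c \<le> r" using co by blast
    define d where "d = Polynomial.degree (\<sigma> R)"
    have "r \<le> d" unfolding d_def using r by (rule le_degree)
    have "H \<noteq> 0"
    proof
      have q1: "q \<noteq> 1" using card_mono[of UNIV "{0, 1 :: 'a}"] by (simp add: q_def)
      assume "H = 0"
      then have "coeff2 H 1 q = 0" by simp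
      moreover have "H = cst2 1 * mon 1 q - cst2 1 * mon q 1" by (simp add: H_def cst2_simps)
      ultimately show False using q1 by (simp only: coeff_diff coeff2_mon) simp
    qed
    moreover have "Polynomial.coeff (\<sigma> R) d \<noteq> 0" using nz by (simp add: d_def)
    moreover have "Polynomial.coeff (\<sigma> R) (d + (q + 1)) = 0" by (simp add: d_def coeff_eq_0)
    ultimately have "Polynomial.coeff (\<sigma> F) (d + (q + 1)) \<noteq> 0" unfolding cR by simp
    then have "d + (q + 1) \<le> c + q" using co by blast
    then show False using \<open>c \<le> r\<close> \<open>r \<le> d\<close> by simp
  qed
  then have "\<sigma> F = 0" unfolding R s(3) by simp
  moreover have "poly (\<sigma> F) 1 = F"
    by (rule ring_hom_poly2_eqI[of "\<lambda>F. poly (\<sigma> F) 1" "\<lambda>F. F"])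
       (simp_all add: is_ring_hom_def s gen poly_monom)
  ultimately show ?thesis by simp
qed

text \<open>
  The equation relates monomials of degrees \<open>d\<close> and \<open>d + q + 1\<close>, so that no longer range of degrees
  is free of relations.
\<close>

definition window :: "'a::finite itself \<Rightarrow> int \<Rightarrow> (int \<times> int) set" where
  "window _ c = {(i, j). c \<le> i + j \<and> i + j \<le> c + int CARD('a)}"

text \<open>
  Multiplication by a power of \<open>u v\<close> turns a linear relation into a multiple of the equation whose
  terms lie in \<open>q + 1\<close> consecutive degrees, and such a multiple vanishes.
\<close>

lemma mm_independent:
  fixes a :: "int \<times> int \<Rightarrow> 'e::field"
  assumes T: "finite T" "T \<subseteq> window TYPE('a::{finite,field}) c"
    and sum: "(\<Sum>(i, j)\<in>T. cst (a (i, j)) * mm i j) = (0 :: ('a, 'e) crv)"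
    and t: "t \<in> T"
  shows "a t = 0"
proof -
  obtain N :: nat where N: "\<And>i j. (i, j) \<in> T \<Longrightarrow> 0 \<le> i + int N \<and> 0 \<le> j + int N" and Nc: "0 \<le> c + 2 * int N"
  proof -
    have fin: "finite ((\<lambda>(i, j). nat \<bar>i\<bar> + nat \<bar>j\<bar>) ` T)" using T by simp
    define M where "M = Max ((\<lambda>(i, j). nat \<bar>i\<bar> + nat \<bar>j\<bar>) ` T)"
    define N where "N = M + nat \<bar>c\<bar>"
    have "0 \<le> i + int N \<and> 0 \<le> j + int N" if "(i, j) \<in> T" for i j
    proof -
      have "nat \<bar>i\<bar> + nat \<bar>j\<bar> \<le> M"
        unfolding M_def using that by (intro Max_ge fin) force
      then have "\<bar>i\<bar> + \<bar>j\<bar> \<le> int M" by linarith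
      then show ?thesis unfolding N_def by linarith
    qed
    then show ?thesis using that[of N] by (simp add: N_def)
  qed
  define e where "e = (\<lambda>(i, j). (nat (i + int N), nat (j + int N)))"
  have e_inj: "inj_on e T"
  proof (rule inj_onI)
    fix s s' assume "s \<in> T" "s' \<in> T" "e s = e s'"
    then show "s = s'" using N[of "fst s" "snd s"] N[of "fst s'" "snd s'"]
      by (cases s; cases s') (auto simp: e_def)
  qed
  define F :: "'e poly poly" where "F = (\<Sum>s\<in>T. cst2 (a s) * mon (fst (e s)) (snd (e s)))"
  have coF: "coeff2 F i j = (\<Sum>s\<in>T. if e s = (i, j) then a s else 0)" for i j
    unfolding F_def coeff2_sum coeff2_mon by (rule sum.cong) (auto simp: prod_eq_iff)
  have "(abs_crv F :: ('a, 'e) crv) = (\<Sum>(i, j)\<in>T. cst (a (i, j)) * mm i j) * mm (int N) (int N)"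
    unfolding F_def abs_crv_hom(9) sum_distrib_right
  proof (rule sum.cong[OF refl])
    fix s assume s: "s \<in> T"
    obtain i j where ij: "s = (i, j)" by (cases s)
    have "mm i j * (mm (int N) (int N) :: ('a, 'e) crv) = mm (int (nat (i + int N))) (int (nat (j + int N)))"
      using N[of i j] s ij by (simp add: mm_mult)
    also have "\<dots> = crv_u ^ nat (i + int N) * crv_v ^ nat (j + int N)" by (rule mm_nat)
    finally show "abs_crv (cst2 (a s) * mon (fst (e s)) (snd (e s))) =
        (case s of (i, j) \<Rightarrow> cst (a (i, j)) * mm i j) * (mm (int N) (int N) :: ('a, 'e) crv)"
      by (simp add: ij e_def abs_crv_hom(3,7) abs_crv_generators mult.assoc)
  qed
  also have "\<dots> = abs_crv 0" using sum by (simp add: abs_crv_hom)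
  finally have "crv_poly TYPE('a) dvd F" unfolding abs_crv_eq_iff by simp
  moreover have "nat (c + 2 * int N) \<le> i + j \<and> i + j \<le> nat (c + 2 * int N) + CARD('a)" if "coeff2 F i j \<noteq> 0" for i j
  proof -
    have "\<exists>s\<in>T. e s = (i, j)"
    proof (rule ccontr)
      assume "\<not> ?thesis"
      then have "coeff2 F i j = 0" unfolding coF by (intro sum.neutral) auto
      then show False using that by simp
    qed
    then obtain s where s: "s \<in> T" "e s = (i, j)" by blast
    obtain i' j' where s': "s = (i', j')" by (cases s)
    have "c \<le> i' + j'" "i' + j' \<le> c + int CARD('a)" using T(2) s(1) s' by (auto simp: window_def)
    moreover have "int i = i' + int N" "int j = j' + int N"
      using s N[of i' j'] by (auto simp: e_def s')
    ultimately show ?thesis using Nc by linarith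
  qed
  ultimately have "F = 0" by (rule multiple_of_crv_poly_spread)
  have "a t = (\<Sum>s\<in>T. if s = t then a s else 0)" using t T by simp
  also have "\<dots> = (\<Sum>s\<in>T. if e s = (fst (e t), snd (e t)) then a s else 0)"
    by (rule sum.cong) (use t in \<open>simp_all add: inj_on_eq_iff[OF e_inj]\<close>)
  also have "\<dots> = coeff2 F (fst (e t)) (snd (e t))" by (rule coF[symmetric])
  finally show ?thesis using \<open>F = 0\<close> by simp
qed

subsection \<open>Coefficients with respect to Laurent monomials\<close>

interpretation cv: vector_space "\<lambda>(c :: 'e::field) (f :: ('a::{finite,field}, 'e) crv). cst c * f"
  by standard (simp_all add: cst_simps algebra_simps)

declare cv.scale_scale [simp del]

definition lspan :: "(int \<times> int) set \<Rightarrow> ('a::{finite,field}, 'e::field) crv set" where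
  "lspan S = cv.span ((\<lambda>(i, j). mm i j) ` S)"

lemma lspan_subspace:
  "0 \<in> lspan S" "f \<in> lspan S \<Longrightarrow> g \<in> lspan S \<Longrightarrow> f + g \<in> lspan S"
  "f \<in> lspan S \<Longrightarrow> g \<in> lspan S \<Longrightarrow> f - g \<in> lspan S" "f \<in> lspan S \<Longrightarrow> cst c * f \<in> lspan S"
  "f \<in> lspan S \<Longrightarrow> - f \<in> lspan S"
  unfolding lspan_def by (auto intro: cv.span_zero cv.span_add cv.span_diff cv.span_scale cv.span_neg)

lemma lspan_sum: "(\<And>a. a \<in> A \<Longrightarrow> f a \<in> lspan S) \<Longrightarrow> sum f A \<in> lspan S"
  unfolding lspan_def by (rule cv.span_sum)

lemma mm_lspan: "(i, j) \<in> S \<Longrightarrow> mm i j \<in> lspan S"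
  unfolding lspan_def by (rule cv.span_base) force

lemma lspan_mono: "S \<subseteq> S' \<Longrightarrow> lspan S \<subseteq> lspan S'"
  unfolding lspan_def by (rule cv.span_mono) auto

lemma lspan_induct [consumes 1, case_names zero add mm]:
  assumes "f \<in> lspan S" "P 0" "\<And>f g. P f \<Longrightarrow> P g \<Longrightarrow> P (f + g)"
    "\<And>c i j. (i, j) \<in> S \<Longrightarrow> P (cst c * mm i j)"
  shows "P f"
  using assms(1) unfolding lspan_def
  by (induction rule: cv.span_induct_alt) (auto simp: assms)

lemma lspan_finite_sum:
  assumes "f \<in> lspan S"
  shows "\<exists>T a. finite T \<and> T \<subseteq> S \<and> f = (\<Sum>(i, j)\<in>T. cst (a (i, j)) * mm i j)"
  using assms
proof (induction f rule: lspan_induct)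
  case (add f g)
  then obtain T a T' a' where 1: "finite T" "T \<subseteq> S" "f = (\<Sum>(i, j)\<in>T. cst (a (i, j)) * mm i j)"
    "finite T'" "T' \<subseteq> S" "g = (\<Sum>(i, j)\<in>T'. cst (a' (i, j)) * mm i j)" by auto
  define b where "b t = (if t \<in> T then a t else 0)" for t
  define b' where "b' t = (if t \<in> T' then a' t else 0)" for t
  have "f = (\<Sum>(i, j)\<in>T \<union> T'. cst (b (i, j)) * mm i j)" "g = (\<Sum>(i, j)\<in>T \<union> T'. cst (b' (i, j)) * mm i j)"
    unfolding 1(3,6) using 1
    by (auto intro!: sum.mono_neutral_cong_left simp: b_def b'_def cst_simps)
  then have "f + g = (\<Sum>(i, j)\<in>T \<union> T'. cst (b (i, j) + b' (i, j)) * mm i j)"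
    by (simp add: sum.distrib[symmetric] cst_simps algebra_simps case_prod_unfold)
  then show ?case
    using 1 by (intro exI[of _ "T \<union> T'"] exI[of _ "\<lambda>t. b t + b' t"]) simp
next
  case (mm c i j)
  then show ?case by (intro exI[of _ "{(i, j)}"] exI[of _ "\<lambda>_. c"]) simp
qed (intro exI[of _ "{}"], simp)

text \<open>
  By independence the coefficients of an element of \<open>lspan (window c)\<close> are determined; outside of
  this space the value is meaningless.
\<close>

definition lcoeff :: "int \<Rightarrow> ('a::{finite,field}, 'e::field) crv \<Rightarrow> int \<times> int \<Rightarrow> 'e" where
  "lcoeff c f = (SOME a. finite {t. a t \<noteq> 0} \<and> {t. a t \<noteq> 0} \<subseteq> window TYPE('a) c \<and>
     f = (\<Sum>(i, j)\<in>{t. a t \<noteq> 0}. cst (a (i, j)) * mm i j))"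

lemma lcoeff_unique:
  fixes f :: "('a::{finite,field}, 'e::field) crv"
  assumes "finite {t. a t \<noteq> 0}" "{t. a t \<noteq> 0} \<subseteq> window TYPE('a) c"
    and "f = (\<Sum>(i, j)\<in>{t. a t \<noteq> 0}. cst (a (i, j)) * mm i j)"
    and "finite {t. b t \<noteq> 0}" "{t. b t \<noteq> 0} \<subseteq> window TYPE('a) c"
    and "f = (\<Sum>(i, j)\<in>{t. b t \<noteq> 0}. cst (b (i, j)) * mm i j)"
  shows "a = b"
proof -
  define T where "T = {t. a t \<noteq> 0} \<union> {t. b t \<noteq> 0}"
  have "f = (\<Sum>(i, j)\<in>T. cst (a (i, j)) * mm i j)" "f = (\<Sum>(i, j)\<in>T. cst (b (i, j)) * mm i j)"
    by (subst assms(3), rule sum.mono_neutral_cong_left; use assms in \<open>auto simp: T_def cst_simps\<close>)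
       (subst assms(6), rule sum.mono_neutral_cong_left; use assms in \<open>auto simp: T_def cst_simps\<close>)
  then have "(\<Sum>(i, j)\<in>T. cst (a (i, j) - b (i, j)) * mm i j) = f - f"
    by (simp add: cst_simps left_diff_distrib sum_subtractf case_prod_unfold)
  then have "(\<Sum>(i, j)\<in>T. cst ((\<lambda>t. a t - b t) (i, j)) * mm i j) = (0 :: ('a, 'e) crv)" by simp
  moreover have "finite T" "T \<subseteq> window TYPE('a) c" using assms by (auto simp: T_def)
  ultimately have "a t - b t = 0" if "t \<in> T" for t
    using mm_independent[of T c "\<lambda>t. a t - b t" t] that by blast
  then show ?thesis by (intro ext) (force simp: T_def)
qed

lemma lcoeff_eqI:
  fixes f :: "('a::{finite,field}, 'e::field) crv"
  assumes "finite T" "{t. a t \<noteq> 0} \<subseteq> T" "T \<subseteq> window TYPE('a) c"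
    and "f = (\<Sum>(i, j)\<in>T. cst (a (i, j)) * mm i j)"
  shows "lcoeff c f = a"
proof -
  define S where "S = {t. a t \<noteq> 0}"
  define P where "P b \<longleftrightarrow> finite {t. b t \<noteq> 0} \<and> {t. b t \<noteq> 0} \<subseteq> window TYPE('a) c \<and>
     f = (\<Sum>(i, j)\<in>{t. b t \<noteq> 0}. cst (b (i, j)) * mm i j)" for b
  have "f = (\<Sum>(i, j)\<in>S. cst (a (i, j)) * mm i j)"
    unfolding assms(4) by (rule sum.mono_neutral_right) (use assms in \<open>auto simp: S_def cst_simps\<close>)
  then have "P a" using assms unfolding P_def S_def by (auto intro: finite_subset)
  moreover have "lcoeff c f = (SOME a. P a)" by (simp add: lcoeff_def P_def)
  moreover from \<open>P a\<close> have "P (SOME a. P a)" by (rule someI[where P = P])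
  ultimately have "P a" "P (lcoeff c f)" by simp_all
  then show ?thesis unfolding P_def using lcoeff_unique[of "lcoeff c f" c f a] by blast
qed

lemma lcoeff_sum:
  fixes f :: "('a::{finite,field}, 'e::field) crv"
  assumes "f \<in> lspan S" "S \<subseteq> window TYPE('a) c"
  shows "finite {t. lcoeff c f t \<noteq> 0}" "{t. lcoeff c f t \<noteq> 0} \<subseteq> S"
    "f = (\<Sum>(i, j)\<in>{t. lcoeff c f t \<noteq> 0}. cst (lcoeff c f (i, j)) * mm i j)"
proof -
  obtain T a where T: "finite T" "T \<subseteq> S" "f = (\<Sum>(i, j)\<in>T. cst (a (i, j)) * mm i j)"
    using lspan_finite_sum[OF assms(1)] by blast
  define b where "b t = (if t \<in> T then a t else 0)" for t
  have fb: "f = (\<Sum>(i, j)\<in>T. cst (b (i, j)) * mm i j)"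
    unfolding T(3) by (rule sum.cong) (auto simp: b_def)
  have "lcoeff c f = b"
    by (rule lcoeff_eqI[OF T(1) _ _ fb]) (use T assms(2) in \<open>auto simp: b_def split: if_splits\<close>)
  moreover have "{t. b t \<noteq> 0} \<subseteq> T" by (auto simp: b_def split: if_splits)
  moreover have "f = (\<Sum>(i, j)\<in>{t. b t \<noteq> 0}. cst (b (i, j)) * mm i j)"
    by (subst fb, rule sum.mono_neutral_right) (use T \<open>{t. b t \<noteq> 0} \<subseteq> T\<close> in \<open>auto simp: cst_simps\<close>)
  ultimately show "finite {t. lcoeff c f t \<noteq> 0}" "{t. lcoeff c f t \<noteq> 0} \<subseteq> S"
    "f = (\<Sum>(i, j)\<in>{t. lcoeff c f t \<noteq> 0}. cst (lcoeff c f (i, j)) * mm i j)"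
    using T by (auto intro: finite_subset)
qed

lemma lcoeff_add:
  fixes f :: "('a::{finite,field}, 'e::field) crv"
  assumes "f \<in> lspan (window TYPE('a) c)" "g \<in> lspan (window TYPE('a) c)"
  shows "lcoeff c (f + g) t = lcoeff c f t + lcoeff c g t"
proof -
  note F = lcoeff_sum[OF assms(1) subset_refl] and G = lcoeff_sum[OF assms(2) subset_refl]
  define T where "T = {t. lcoeff c f t \<noteq> 0} \<union> {t. lcoeff c g t \<noteq> 0}"
  have "f = (\<Sum>(i, j)\<in>T. cst (lcoeff c f (i, j)) * mm i j)"
    by (subst F(3), rule sum.mono_neutral_left) (use F(1,2) G(1,2) in \<open>auto simp: T_def cst_simps\<close>)
  moreover have "g = (\<Sum>(i, j)\<in>T. cst (lcoeff c g (i, j)) * mm i j)"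
    by (subst G(3), rule sum.mono_neutral_left) (use F(1,2) G(1,2) in \<open>auto simp: T_def cst_simps\<close>)
  ultimately have eq: "f + g = (\<Sum>(i, j)\<in>T. cst (lcoeff c f (i, j) + lcoeff c g (i, j)) * mm i j)"
    by (simp only: cst_simps distrib_right sum.distrib case_prod_unfold)
  have "lcoeff c (f + g) = (\<lambda>t. lcoeff c f t + lcoeff c g t)"
    by (rule lcoeff_eqI[OF _ _ _ eq]) (use F(1,2) G(1,2) in \<open>auto simp: T_def\<close>)
  then show ?thesis by simp
qed

lemma lcoeff_mm:
  fixes d :: "'e::field"
  assumes "(i, j) \<in> window TYPE('a::{finite,field}) c"
  shows "lcoeff c (cst d * mm i j :: ('a, 'e) crv) t = (if t = (i, j) then d else 0)"
proof -
  have "lcoeff c (cst d * mm i j :: ('a, 'e) crv) = (\<lambda>t. if t = (i, j) then d else 0)"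
    by (rule lcoeff_eqI[of "{(i, j)}"]) (use assms in auto)
  then show ?thesis by simp
qed

lemma lcoeff_scale:
  fixes f :: "('a::{finite,field}, 'e::field) crv"
  assumes "f \<in> lspan (window TYPE('a) c)"
  shows "lcoeff c (cst d * f) t = d * lcoeff c f t"
proof -
  note F = lcoeff_sum[OF assms subset_refl]
  have eq: "cst d * f = (\<Sum>(i, j)\<in>{t. lcoeff c f t \<noteq> 0}. cst (d * lcoeff c f (i, j)) * mm i j)"
    by (rule trans[OF arg_cong[OF F(3), of "\<lambda>f. cst d * f"]])
       (simp add: sum_distrib_left cst_simps case_prod_unfold mult.assoc)
  have "lcoeff c (cst d * f) = (\<lambda>t. d * lcoeff c f t)"
    by (rule lcoeff_eqI[OF F(1) _ F(2) eq]) auto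
  then show ?thesis by simp
qed

lemma lcoeff_diff:
  fixes f :: "('a::{finite,field}, 'e::field) crv"
  assumes "f \<in> lspan (window TYPE('a) c)" "g \<in> lspan (window TYPE('a) c)"
  shows "lcoeff c (f - g) t = lcoeff c f t - lcoeff c g t"
  using lcoeff_add[OF assms(1) lspan_subspace(4)[OF assms(2), of "- 1"], of t] lcoeff_scale[OF assms(2), of "- 1" t]
  by (simp add: cst_simps)

lemma lspan_iff_lcoeff:
  fixes f :: "('a::{finite,field}, 'e::field) crv"
  assumes "S \<subseteq> window TYPE('a) c"
  shows "f \<in> lspan S \<longleftrightarrow> f \<in> lspan (window TYPE('a) c) \<and> (\<forall>t. t \<notin> S \<longrightarrow> lcoeff c f t = 0)"
proof
  assume f: "f \<in> lspan S"
  then show "f \<in> lspan (window TYPE('a) c) \<and> (\<forall>t. t \<notin> S \<longrightarrow> lcoeff c f t = 0)"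
    using lcoeff_sum(2)[OF f assms] lspan_mono[OF assms] by auto
next
  assume f: "f \<in> lspan (window TYPE('a) c) \<and> (\<forall>t. t \<notin> S \<longrightarrow> lcoeff c f t = 0)"
  have "(\<Sum>(i, j)\<in>{t. lcoeff c f t \<noteq> 0}. cst (lcoeff c f (i, j)) * mm i j) \<in> (lspan S :: ('a, 'e) crv set)"
  proof (rule lspan_sum)
    fix t assume "t \<in> {t. lcoeff c f t \<noteq> 0}"
    then have "lcoeff c f t \<noteq> 0" by simp
    then have "t \<in> S" using f by blast
    then show "(case t of (i, j) \<Rightarrow> cst (lcoeff c f (i, j)) * mm i j) \<in> (lspan S :: ('a, 'e) crv set)"
      by (cases t) (simp add: lspan_subspace(4) mm_lspan)
  qed
  then show "f \<in> lspan S"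
    by (subst lcoeff_sum(3)[OF conjunct1[OF f] subset_refl])
qed

lemma lspan_Int:
  assumes "S \<subseteq> window TYPE('a::{finite,field}) c" "S' \<subseteq> window TYPE('a) c"
  shows "lspan S \<inter> lspan S' = (lspan (S \<inter> S') :: ('a, 'e::field) crv set)"
proof (rule Set.set_eqI)
  fix f :: "('a, 'e) crv"
  have "S \<inter> S' \<subseteq> window TYPE('a) c" using assms by auto
  then show "f \<in> lspan S \<inter> lspan S' \<longleftrightarrow> f \<in> lspan (S \<inter> S')"
    unfolding Int_iff lspan_iff_lcoeff[OF assms(1)] lspan_iff_lcoeff[OF assms(2)]
    by (subst lspan_iff_lcoeff) auto
qed

lemma lspan_shift:
  "f \<in> lspan S \<Longrightarrow> mm a b * f \<in> lspan ((\<lambda>(i, j). (i + a, j + b)) ` S)"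
proof (induction f rule: lspan_induct)
  case (mm c i j)
  have "mm a b * (cst c * mm i j) = cst c * mm (i + a) (j + b)"
    by (simp add: mult.left_commute mm_mult algebra_simps)
  also have "\<dots> \<in> lspan ((\<lambda>(i, j). (i + a, j + b)) ` S)"
    using mm by (intro lspan_subspace mm_lspan) force
  finally show ?case .
qed (auto simp: algebra_simps intro: lspan_subspace)

lemma lspan_mult:
  assumes "f \<in> lspan S" "g \<in> lspan S'"
  shows "f * g \<in> lspan {(i + i', j + j') | i j i' j'. (i, j) \<in> S \<and> (i', j') \<in> S'}"
  using assms(1)
proof (induction f rule: lspan_induct)
  case (mm c i j)
  have "mm i j * g \<in> lspan {(i + i', j + j') | i j i' j'. (i, j) \<in> S \<and> (i', j') \<in> S'}"
    by (rule subsetD[OF lspan_mono lspan_shift[OF assms(2)]]) (use mm in \<open>auto, metis add.commute\<close>)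
  then show ?case by (simp add: mult.assoc lspan_subspace)
qed (auto simp: algebra_simps intro: lspan_subspace)

text \<open>The relation raises degrees by \<open>q + 1\<close> without lowering an exponent, so that monomials of
  negative degree can be moved into the window.\<close>

lemma mm_reduce:
  assumes "i + j \<le> 0"
  shows "(mm i j :: ('a::{finite,field}, 'e::field) crv) \<in>
    lspan {(i', j'). - int CARD('a) \<le> i' + j' \<and> i' + j' \<le> 0 \<and> i \<le> i' \<and> j \<le> j'}"
  using assms
proof (induction "nat (- (i + j))" arbitrary: i j rule: less_induct)
  case less
  let ?S = "\<lambda>i j. {(i', j'). - int CARD('a) \<le> i' + j' \<and> i' + j' \<le> 0 \<and> i \<le> i' \<and> j \<le> j'}"
  show ?case
  proof (cases "- int CARD('a) \<le> i + j")
    case True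
    then show ?thesis using less by (intro mm_lspan) auto
  next
    case False
    have q: "CARD('a) > 0" by simp
    have "(mm (i + 1) (j + int CARD('a)) :: ('a, 'e) crv) \<in> lspan (?S (i + 1) (j + int CARD('a)))"
      "(mm (i + int CARD('a)) (j + 1) :: ('a, 'e) crv) \<in> lspan (?S (i + int CARD('a)) (j + 1))"
      by (rule less(1); use False q in linarith)+
    moreover have "?S (i + 1) (j + int CARD('a)) \<subseteq> ?S i j" "?S (i + int CARD('a)) (j + 1) \<subseteq> ?S i j" by auto
    ultimately show ?thesis
      using mm_relation[of i j, where 'a = 'a and 'e = 'e] lspan_mono by (metis (no_types, lifting) lspan_subspace(3) subsetD)
  qed
qed

subsection \<open>Regular functions\<close>

definition idx_u :: "'a::finite itself \<Rightarrow> (int \<times> int) set" where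
  "idx_u _ = {(i, j). - int CARD('a) \<le> i + j \<and> i + j \<le> 0 \<and> 0 \<le> j}"

definition idx_v :: "'a::finite itself \<Rightarrow> (int \<times> int) set" where
  "idx_v _ = {(i, j). - int CARD('a) \<le> i + j \<and> i + j \<le> 0 \<and> 0 \<le> i}"

abbreviation idx_uv :: "'a::finite itself \<Rightarrow> (int \<times> int) set" where
  "idx_uv T \<equiv> window T (- int CARD('a))"

lemma idx_subset: "idx_u TYPE('a::finite) \<subseteq> idx_uv TYPE('a)" "idx_v TYPE('a) \<subseteq> idx_uv TYPE('a)"
  by (auto simp: idx_u_def idx_v_def window_def)

lemma subalg_subset:
  assumes "\<And>c. cst c \<in> R" "S \<subseteq> R" "\<And>f g. f \<in> R \<Longrightarrow> g \<in> R \<Longrightarrow> f + g \<in> R"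
    "\<And>f g. f \<in> R \<Longrightarrow> g \<in> R \<Longrightarrow> f * g \<in> R"
  shows "subalg S \<subseteq> R"
proof
  fix f assume "f \<in> subalg S"
  then show "f \<in> R" by induction (use assms in auto)
qed

lemma subalg_power: "f \<in> subalg S \<Longrightarrow> f ^ n \<in> subalg S"
proof (induction n)
  case 0
  then show ?case using subalg.intros(1)[of 1] by (simp add: cst_simps)
qed (simp add: subalg.intros)

lemma reg_closed:
  "cst c \<in> reg L" "f \<in> reg L \<Longrightarrow> g \<in> reg L \<Longrightarrow> f + g \<in> reg L" "f \<in> reg L \<Longrightarrow> g \<in> reg L \<Longrightarrow> f * g \<in> reg L"
  "f \<in> reg L \<Longrightarrow> f ^ n \<in> reg L" "0 \<in> reg L" "1 \<in> reg L" "f \<in> reg L \<Longrightarrow> - f \<in> reg L"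
  "f \<in> reg L \<Longrightarrow> g \<in> reg L \<Longrightarrow> f - g \<in> reg L"
proof -
  show c: "cst c \<in> reg L" for c unfolding reg_def by (rule subalg.intros)
  show a: "f \<in> reg L \<Longrightarrow> g \<in> reg L \<Longrightarrow> f + g \<in> reg L" for f g unfolding reg_def by (rule subalg.intros)
  show m: "f \<in> reg L \<Longrightarrow> g \<in> reg L \<Longrightarrow> f * g \<in> reg L" for f g unfolding reg_def by (rule subalg.intros)
  show "f \<in> reg L \<Longrightarrow> f ^ n \<in> reg L" unfolding reg_def by (rule subalg_power)
  show "0 \<in> reg L" "1 \<in> reg L" using c[of 0] c[of 1] by (simp_all add: cst_simps)
  show n: "f \<in> reg L \<Longrightarrow> - f \<in> reg L" for f using m[OF c[of "- 1"], of f] by (simp add: cst_simps)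
  show "f \<in> reg L \<Longrightarrow> g \<in> reg L \<Longrightarrow> f - g \<in> reg L" using a[of f "- g"] n[of g] by simp
qed

lemma reg_generators: "l \<in> L \<Longrightarrow> crv_u * inverse l \<in> reg L" "l \<in> L \<Longrightarrow> crv_v * inverse l \<in> reg L"
  "l \<in> L \<Longrightarrow> inverse l \<in> reg L"
  by (auto simp: reg_def divide_crv_def intro!: subalg.intros(2))

lemma reg_subset:
  assumes "\<And>c. cst c \<in> R" "\<And>f g. f \<in> R \<Longrightarrow> g \<in> R \<Longrightarrow> f + g \<in> R"
    "\<And>f g. f \<in> R \<Longrightarrow> g \<in> R \<Longrightarrow> f * g \<in> R"
    "\<And>l. l \<in> L \<Longrightarrow> crv_u * inverse l \<in> R \<and> crv_v * inverse l \<in> R \<and> inverse l \<in> R"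
  shows "reg L \<subseteq> R"
  unfolding reg_def by (rule subalg_subset) (use assms in \<open>auto simp: divide_crv_def\<close>)

lemma reg_mono: "L \<subseteq> L' \<Longrightarrow> reg L \<subseteq> reg L'"
  by (rule reg_subset) (auto intro: reg_closed reg_generators)

lemma lspan_idx_mult:
  fixes f g :: "('a::{finite,field}, 'e::field) crv"
  shows "f \<in> lspan (idx_u TYPE('a)) \<Longrightarrow> g \<in> lspan (idx_u TYPE('a)) \<Longrightarrow> f * g \<in> lspan (idx_u TYPE('a))"
    and "f \<in> lspan (idx_v TYPE('a)) \<Longrightarrow> g \<in> lspan (idx_v TYPE('a)) \<Longrightarrow> f * g \<in> lspan (idx_v TYPE('a))"
    and "f \<in> lspan (idx_uv TYPE('a)) \<Longrightarrow> g \<in> lspan (idx_uv TYPE('a)) \<Longrightarrow> f * g \<in> lspan (idx_uv TYPE('a))"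
proof -
  have red: "f \<in> lspan S"
    if f: "f \<in> lspan S'" and S': "\<And>i j. (i, j) \<in> S' \<Longrightarrow> i + j \<le> 0"
      and S: "\<And>i j i' j'. (i, j) \<in> S' \<Longrightarrow> - int CARD('a) \<le> i' + j' \<Longrightarrow> i' + j' \<le> 0 \<Longrightarrow> i \<le> i' \<Longrightarrow> j \<le> j'
         \<Longrightarrow> (i', j') \<in> S" for S S' and f :: "('a, 'e) crv"
    using f
  proof (induction f rule: lspan_induct)
    case (mm c i j)
    have "mm i j \<in> (lspan S :: ('a, 'e) crv set)"
      by (rule subsetD[OF lspan_mono mm_reduce]) (use S S' mm in auto)
    then show ?case by (rule lspan_subspace)
  qed (auto intro: lspan_subspace)
  show "f * g \<in> lspan (idx_u TYPE('a))" if "f \<in> lspan (idx_u TYPE('a))" "g \<in> lspan (idx_u TYPE('a))"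
    by (rule red[OF lspan_mult[OF that]]) (auto simp: idx_u_def)
  show "f * g \<in> lspan (idx_v TYPE('a))" if "f \<in> lspan (idx_v TYPE('a))" "g \<in> lspan (idx_v TYPE('a))"
    by (rule red[OF lspan_mult[OF that]]) (auto simp: idx_v_def)
  show "f * g \<in> lspan (idx_uv TYPE('a))" if "f \<in> lspan (idx_uv TYPE('a))" "g \<in> lspan (idx_uv TYPE('a))"
    by (rule red[OF lspan_mult[OF that]]) (auto simp: window_def)
qed

text \<open>
  A monomial in \<open>idx_u\<close> is a product of powers of \<open>v/u\<close> and \<open>1/u\<close>. Conversely, a product of two such
  monomials may leave the window, and \<open>mm_reduce\<close> brings it back without creating a negative
  exponent of \<open>v\<close>.
\<close>

lemma
  shows reg_u: "reg {crv_u} = (lspan (idx_u TYPE('a)) :: ('a::{finite,field}, 'e::field) crv set)"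
    and reg_v: "reg {crv_v} = (lspan (idx_v TYPE('a)) :: ('a, 'e) crv set)"
    and reg_uv: "reg {crv_u, crv_v} = (lspan (idx_uv TYPE('a)) :: ('a, 'e) crv set)"
proof -
  have q: "CARD('a) > 0" by simp
  then have q1: "int CARD('a) \<ge> 1" by linarith
  have cst: "cst c \<in> lspan S" if "(0, 0) \<in> S" for c :: 'e and S
    using lspan_subspace(4)[OF mm_lspan[OF that], of c] by simp
  have le: "lspan S \<subseteq> reg L" if "\<And>i j. (i, j) \<in> S \<Longrightarrow> (mm i j :: ('a, 'e) crv) \<in> reg L" for S L
  proof
    fix f :: "('a, 'e) crv" assume "f \<in> lspan S"
    then show "f \<in> reg L" by (induction f rule: lspan_induct) (auto intro: reg_closed that)
  qed
  have u: "(mm i j :: ('a, 'e) crv) \<in> reg {crv_u}" if "i + j \<le> 0" "0 \<le> j" for i j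
  proof -
    have "(crv_v * inverse crv_u) ^ nat j * inverse crv_u ^ nat (- (i + j)) \<in> (reg {crv_u} :: ('a, 'e) crv set)"
      by (intro reg_closed reg_generators) auto
    also have "(crv_v * inverse crv_u) ^ nat j * inverse crv_u ^ nat (- (i + j)) = (mm i j :: ('a, 'e) crv)"
      using that by (simp add: mm_eqs mm_mult mm_power mm_inverse)
    finally show ?thesis .
  qed
  have v: "(mm i j :: ('a, 'e) crv) \<in> reg {crv_v}" if "i + j \<le> 0" "0 \<le> i" for i j
  proof -
    have "(crv_u * inverse crv_v) ^ nat i * inverse crv_v ^ nat (- (i + j)) \<in> (reg {crv_v} :: ('a, 'e) crv set)"
      by (intro reg_closed reg_generators) auto
    also have "(crv_u * inverse crv_v) ^ nat i * inverse crv_v ^ nat (- (i + j)) = (mm i j :: ('a, 'e) crv)"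
      using that by (simp add: mm_eqs mm_mult mm_power mm_inverse)
    finally show ?thesis .
  qed
  have uv: "(mm i j :: ('a, 'e) crv) \<in> reg {crv_u, crv_v}" if "i + j \<le> 0" for i j
  proof -
    consider "0 \<le> j" | "0 \<le> i" | "i < 0" "j < 0" by linarith
    then show ?thesis
    proof cases
      case 1 then show ?thesis using u[OF that] reg_mono[of "{crv_u}" "{crv_u, crv_v}"] by auto
    next
      case 2 then show ?thesis using v[OF that] reg_mono[of "{crv_v}" "{crv_u, crv_v}"] by auto
    next
      case 3
      have "inverse crv_u ^ nat (- i) * inverse crv_v ^ nat (- j) \<in> (reg {crv_u, crv_v} :: ('a, 'e) crv set)"
        by (intro reg_closed reg_generators) auto
      also have "inverse crv_u ^ nat (- i) * inverse crv_v ^ nat (- j) = (mm i j :: ('a, 'e) crv)"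
        using 3 by (simp add: mm_eqs mm_mult mm_power mm_inverse)
      finally show ?thesis .
    qed
  qed
  have "reg {crv_u} \<subseteq> (lspan (idx_u TYPE('a)) :: ('a, 'e) crv set)"
    by (rule reg_subset)
       (use q1 in \<open>auto simp: mm_eqs mm_mult mm_inverse lspan_idx_mult lspan_subspace(2) simp del: mm_0 intro!: cst mm_lspan, auto simp: idx_u_def\<close>)
  then show "reg {crv_u} = (lspan (idx_u TYPE('a)) :: ('a, 'e) crv set)"
    using le[of "idx_u TYPE('a)" "{crv_u}"] u by (auto simp: idx_u_def)
  have "reg {crv_v} \<subseteq> (lspan (idx_v TYPE('a)) :: ('a, 'e) crv set)"
    by (rule reg_subset)
       (use q1 in \<open>auto simp: mm_eqs mm_mult mm_inverse lspan_idx_mult lspan_subspace(2) simp del: mm_0 intro!: cst mm_lspan, auto simp: idx_v_def\<close>)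
  then show "reg {crv_v} = (lspan (idx_v TYPE('a)) :: ('a, 'e) crv set)"
    using le[of "idx_v TYPE('a)" "{crv_v}"] v by (auto simp: idx_v_def)
  have "reg {crv_u, crv_v} \<subseteq> (lspan (idx_uv TYPE('a)) :: ('a, 'e) crv set)"
    by (rule reg_subset)
       (use q1 in \<open>auto simp: mm_eqs mm_mult mm_inverse lspan_idx_mult lspan_subspace(2) simp del: mm_0 intro!: cst mm_lspan, auto simp: window_def\<close>)
  then show "reg {crv_u, crv_v} = (lspan (idx_uv TYPE('a)) :: ('a, 'e) crv set)"
    using le[of "idx_uv TYPE('a)" "{crv_u, crv_v}"] uv by (auto simp: window_def)
qed

section \<open>Differentials on the affine curve\<close>

definition crv_der :: "('a::{finite,field}, 'e::field) crv \<Rightarrow> ('a, 'e) crv" where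
  "crv_der f = abs_crv (poly2_der CARD('a) (rep_crv f))"

context
  fixes TA :: "'a::{finite,field} itself" and TE :: "'e::field itself"
  assumes q0: "of_nat CARD('a) = (0 :: 'e)"
begin

text \<open>
  The derivation of the polynomial ring annihilates the equation, as \<open>X\<^sup>q Y\<^sup>q - X\<^sup>q Y\<^sup>q = 0\<close>, and
  thus passes to the coordinate ring.
\<close>

lemma crv_der_abs: "crv_der (abs_crv f :: ('a, 'e) crv) = abs_crv (poly2_der CARD('a) f)"
proof -
  note D = is_derivationD[OF is_derivation_poly2_der]
  have q0': "of_nat CARD('a) = (0 :: 'e poly poly)"
    using q0 cst2_simps(8)[of "CARD('a)", where ?'a = 'e] by (simp add: cst2_simps)
  have pw: "poly2_der CARD('a) (x ^ CARD('a)) = 0" for x :: "'e poly poly"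
    using derivation_power[OF _ is_derivation_poly2_der, of "CARD('a)" x "CARD('a)"] q0'
    by (simp add: is_ring_hom_def)
  have "poly2_der CARD('a) (1 :: 'e poly poly) = 0"
    using poly2_der_generators(1)[of "CARD('a)" "1 :: 'e"] by (simp add: cst2_simps)
  then have c: "poly2_der CARD('a) (crv_poly TYPE('a) :: 'e poly poly) = 0"
    unfolding crv_poly_def by (simp add: D pw algebra_simps)
  have "abs_crv (rep_crv (abs_crv f :: ('a, 'e) crv)) = (abs_crv f :: ('a, 'e) crv)" by simp
  then obtain g where g: "rep_crv (abs_crv f :: ('a, 'e) crv) - f = crv_poly TYPE('a) * g"
    unfolding abs_crv_eq_iff by (auto elim: dvdE)
  have "poly2_der CARD('a) (rep_crv (abs_crv f :: ('a, 'e) crv)) - poly2_der CARD('a) f =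
      crv_poly TYPE('a) * poly2_der CARD('a) g"
    unfolding D(5)[symmetric] g D(2) c by simp
  then show ?thesis unfolding crv_der_def abs_crv_eq_iff by simp
qed

lemma is_derivation_crv_der: "is_derivation (\<lambda>f. f) (crv_der :: ('a, 'e) crv \<Rightarrow> _)"
proof -
  note D = is_derivationD[OF is_derivation_poly2_der]
  have "crv_der (x + y) = crv_der x + crv_der y" "crv_der (x * y) = x * crv_der y + y * crv_der x"
    for x y :: "('a, 'e) crv"
    using crv_der_abs[of "rep_crv x + rep_crv y"] crv_der_abs[of "rep_crv x * rep_crv y"]
      crv_der_abs[of "rep_crv x"] crv_der_abs[of "rep_crv y"]
    by (simp_all add: D abs_crv_hom)
  then show ?thesis by (simp add: is_derivation_def)
qed

lemmas crv_der_rules = is_derivationD[OF is_derivation_crv_der]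

lemma crv_der_generators:
  "crv_der (cst c :: ('a, 'e) crv) = 0" "crv_der (crv_u :: ('a, 'e) crv) = crv_u ^ CARD('a)"
  "crv_der (crv_v :: ('a, 'e) crv) = crv_v ^ CARD('a)"
  using crv_der_abs[of "cst2 c"] crv_der_abs[of varX] crv_der_abs[of varY]
  by (simp_all add: abs_crv_generators abs_crv_hom)

lemma crv_der_power: "crv_der (x ^ n :: ('a, 'e) crv) = of_nat n * x ^ (n - 1) * crv_der x"
  by (rule derivation_power[OF _ is_derivation_crv_der]) (simp add: is_ring_hom_def)

lemma crv_der_one: "crv_der (1 :: ('a, 'e) crv) = 0"
  using crv_der_generators(1)[of 1] by (simp add: cst_simps)

lemma crv_der_cst_mult: "crv_der (cst c * x :: ('a, 'e) crv) = cst c * crv_der x"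
  by (simp add: crv_der_rules crv_der_generators)

lemma crv_der_inverse:
  assumes x: "crv_unit (x :: ('a, 'e) crv)"
  shows "crv_der (inverse x) = - (inverse x ^ 2 * crv_der x)"
proof -
  have "x * crv_der (inverse x) + inverse x * crv_der x = crv_der (x * inverse x)"
    by (simp add: crv_der_rules)
  also have "\<dots> = 0" using crv_der_one crv_unitD(1)[OF x] by simp
  finally have "x * crv_der (inverse x) = - (inverse x * crv_der x)" by (simp add: eq_neg_iff_add_eq_0)
  also have "\<dots> = x * (- (inverse x ^ 2 * crv_der x))"
    using crv_unitD(1)[OF x] by (simp add: power2_eq_square flip: mult.assoc)
  finally show ?thesis using crv_unit_cancel[OF x] by blast
qed

lemma crv_der_powi:
  assumes x: "crv_unit (x :: ('a, 'e) crv)"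
  shows "crv_der (x powi a) = of_int a * x powi (a - 1) * crv_der x"
proof (cases "a \<ge> 0")
  case True
  then obtain n where a: "a = int n" by (metis nonneg_int_cases)
  show ?thesis
  proof (cases n)
    case (Suc m)
    then have "x powi (a - 1) = x ^ (n - 1)" using a powi_of_nat_crv[of x m] by simp
    then show ?thesis using a powi_of_nat_crv[of x n] crv_der_power[of x n] by simp
  qed (simp add: a crv_der_one)
next
  case False
  then obtain n where a: "a = - int n" by (metis le_cases nonneg_int_cases minus_minus neg_0_le_iff_le)
  have pi: "x powi (- int m) = inverse x ^ m" for m
    using powi_minus_crv[OF x, of "int m"] powi_of_nat_crv[of "inverse x" m] by simp
  have "crv_der (x powi a) = of_nat n * inverse x ^ (n - 1) * (- (inverse x ^ 2 * crv_der x))"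
    unfolding a pi crv_der_power crv_der_inverse[OF x] ..
  also have "\<dots> = - of_nat n * inverse x ^ (n + 1) * crv_der x"
    using False a by (cases n) (simp_all add: power2_eq_square algebra_simps)
  also have "inverse x ^ (n + 1) = x powi (a - 1)"
  proof -
    have "a - 1 = - int (n + 1)" by (simp add: a)
    then show ?thesis by (simp only: pi)
  qed
  finally show ?thesis by (simp add: a)
qed

lemma crv_der_mm:
  "crv_der (mm i j :: ('a, 'e) crv) =
     of_int i * mm (i - 1 + int CARD('a)) j + of_int j * mm i (j - 1 + int CARD('a))"
proof -
  have "mm (i - 1 + int CARD('a)) j = crv_u powi (i - 1) * crv_u ^ CARD('a) * (crv_v powi j :: ('a, 'e) crv)"
    "mm i (j - 1 + int CARD('a)) = crv_u powi i * (crv_v powi (j - 1) * (crv_v ^ CARD('a) :: ('a, 'e) crv))"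
    unfolding mm_def powi_add_crv[OF crv_unit_u] powi_add_crv[OF crv_unit_v] powi_of_nat_crv by simp_all
  then show ?thesis
    unfolding mm_def[of i j] crv_der_rules crv_der_powi[OF crv_unit_u] crv_der_powi[OF crv_unit_v] crv_der_generators
    by (simp add: algebra_simps)
qed

end

subsection \<open>Kaehler differentials are free on one generator\<close>

lemma abs_kaehler_eq_iff: "abs_kaehler w = abs_kaehler w' \<longleftrightarrow> w - w' \<in> kaehler_rel"
  by (rule kaehler.abs_eq_iff)

lemma abs_rep_kaehler [simp]: "abs_kaehler (rep_kaehler w) = w"
  by (rule Quotient3_abs_rep[OF Quotient3_kaehler])

lemma kaehler_relations:
  "dK (cst c) = 0" "dK (f + g) = dK f + dK g" "dK (f * g) = f \<bullet>\<^sub>K dK g + g \<bullet>\<^sub>K dK f"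
proof -
  show "dK (cst c) = 0"
    unfolding dK.abs_eq zero_kaehler_def abs_kaehler_eq_iff using kaehler_rel_const by simp
  show "dK (f + g) = dK f + dK g"
    unfolding dK.abs_eq plus_kaehler.abs_eq abs_kaehler_eq_iff using kaehler_rel_add[of f g]
    by (simp add: algebra_simps)
  have "Poly_Mapping.map ((*) a) (Poly_Mapping.single x 1) = Poly_Mapping.single x a" for a x :: "('a, 'b) crv"
    by (rule poly_mapping_eqI) (simp add: pm_map_eq_lookup lookup_single when_def)
  then show "dK (f * g) = f \<bullet>\<^sub>K dK g + g \<bullet>\<^sub>K dK f"
    unfolding dK.abs_eq plus_kaehler.abs_eq scaleK.abs_eq abs_kaehler_eq_iff using kaehler_rel_mult[of f g]
    by (simp add: algebra_simps)
qed

lemma scaleK_rules: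
  "a \<bullet>\<^sub>K (w + w') = a \<bullet>\<^sub>K w + a \<bullet>\<^sub>K w'" "(a + b) \<bullet>\<^sub>K w = a \<bullet>\<^sub>K w + b \<bullet>\<^sub>K w"
  "(a * b) \<bullet>\<^sub>K w = a \<bullet>\<^sub>K (b \<bullet>\<^sub>K w)" "1 \<bullet>\<^sub>K w = w"
  "0 \<bullet>\<^sub>K w = 0" "a \<bullet>\<^sub>K 0 = 0" "a \<bullet>\<^sub>K (- w) = - (a \<bullet>\<^sub>K w)" "(- a) \<bullet>\<^sub>K w = - (a \<bullet>\<^sub>K w)"
  "a \<bullet>\<^sub>K (w - w') = a \<bullet>\<^sub>K w - a \<bullet>\<^sub>K w'" "(a - b) \<bullet>\<^sub>K w = a \<bullet>\<^sub>K w - b \<bullet>\<^sub>K w"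
  for w w' :: "('a::{finite,field}, 'e::field) kaehler"
proof -
  have 1: "a \<bullet>\<^sub>K (w + w') = a \<bullet>\<^sub>K w + a \<bullet>\<^sub>K w'" for a and w w' :: "('a, 'e) kaehler"
  proof -
    have "Poly_Mapping.map ((*) a) (x + y) = Poly_Mapping.map ((*) a) x + Poly_Mapping.map ((*) a) y"
      for x y :: "('a, 'e) crv \<Rightarrow>\<^sub>0 ('a, 'e) crv"
      by (rule poly_mapping_eqI) (simp add: pm_map_eq_lookup lookup_add algebra_simps)
    then have "a \<bullet>\<^sub>K (abs_kaehler x + abs_kaehler y) = a \<bullet>\<^sub>K abs_kaehler x + a \<bullet>\<^sub>K abs_kaehler y"
      for x y :: "('a, 'e) crv \<Rightarrow>\<^sub>0 ('a, 'e) crv"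
      by (simp only: plus_kaehler.abs_eq scaleK.abs_eq)
    from this[of "rep_kaehler w" "rep_kaehler w'"] show ?thesis by simp
  qed
  have 2: "(a + b) \<bullet>\<^sub>K w = a \<bullet>\<^sub>K w + b \<bullet>\<^sub>K w" for a b and w :: "('a, 'e) kaehler"
  proof -
    have "Poly_Mapping.map ((*) (a + b)) x = Poly_Mapping.map ((*) a) x + Poly_Mapping.map ((*) b) x"
      for x :: "('a, 'e) crv \<Rightarrow>\<^sub>0 ('a, 'e) crv"
      by (rule poly_mapping_eqI) (simp add: pm_map_eq_lookup lookup_add algebra_simps)
    then have "(a + b) \<bullet>\<^sub>K abs_kaehler x = a \<bullet>\<^sub>K abs_kaehler x + b \<bullet>\<^sub>K abs_kaehler x"
      for x :: "('a, 'e) crv \<Rightarrow>\<^sub>0 ('a, 'e) crv"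
      by (simp only: plus_kaehler.abs_eq scaleK.abs_eq)
    from this[of "rep_kaehler w"] show ?thesis by simp
  qed
  have 3: "(a * b) \<bullet>\<^sub>K w = a \<bullet>\<^sub>K (b \<bullet>\<^sub>K w)" for a b and w :: "('a, 'e) kaehler"
  proof -
    have "Poly_Mapping.map ((*) (a * b)) x = Poly_Mapping.map ((*) a) (Poly_Mapping.map ((*) b) x)"
      for x :: "('a, 'e) crv \<Rightarrow>\<^sub>0 ('a, 'e) crv"
      by (rule poly_mapping_eqI) (simp add: pm_map_eq_lookup algebra_simps)
    then have "(a * b) \<bullet>\<^sub>K abs_kaehler x = a \<bullet>\<^sub>K (b \<bullet>\<^sub>K abs_kaehler x)"
      for x :: "('a, 'e) crv \<Rightarrow>\<^sub>0 ('a, 'e) crv"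
      by (simp only: scaleK.abs_eq)
    from this[of "rep_kaehler w"] show ?thesis by simp
  qed
  have 4: "1 \<bullet>\<^sub>K w = w" for w :: "('a, 'e) kaehler"
  proof -
    have "Poly_Mapping.map ((*) 1) x = x" for x :: "('a, 'e) crv \<Rightarrow>\<^sub>0 ('a, 'e) crv"
      by (rule poly_mapping_eqI) (simp add: pm_map_eq_lookup)
    then have "1 \<bullet>\<^sub>K abs_kaehler x = abs_kaehler x" for x :: "('a, 'e) crv \<Rightarrow>\<^sub>0 ('a, 'e) crv"
      by (simp only: scaleK.abs_eq)
    from this[of "rep_kaehler w"] show ?thesis by simp
  qed
  have 5: "0 \<bullet>\<^sub>K w = 0" for w :: "('a, 'e) kaehler" using 2[of 0 0 w] by simp
  have 6: "a \<bullet>\<^sub>K 0 = (0 :: ('a, 'e) kaehler)" for a using 1[of a 0 0] by simp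
  have 7: "a \<bullet>\<^sub>K (- w) = - (a \<bullet>\<^sub>K w)" for a and w :: "('a, 'e) kaehler"
    using 1[of a w "- w"] 6 by (simp add: eq_neg_iff_add_eq_0 add.commute)
  have 8: "(- a) \<bullet>\<^sub>K w = - (a \<bullet>\<^sub>K w)" for a and w :: "('a, 'e) kaehler"
    using 2[of a "- a" w] 5 by (simp add: eq_neg_iff_add_eq_0 add.commute)
  show "a \<bullet>\<^sub>K (w + w') = a \<bullet>\<^sub>K w + a \<bullet>\<^sub>K w'" "(a + b) \<bullet>\<^sub>K w = a \<bullet>\<^sub>K w + b \<bullet>\<^sub>K w"
    "(a * b) \<bullet>\<^sub>K w = a \<bullet>\<^sub>K (b \<bullet>\<^sub>K w)" "1 \<bullet>\<^sub>K w = w" "0 \<bullet>\<^sub>K w = 0" "a \<bullet>\<^sub>K 0 = 0"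
    "a \<bullet>\<^sub>K (- w) = - (a \<bullet>\<^sub>K w)" "(- a) \<bullet>\<^sub>K w = - (a \<bullet>\<^sub>K w)"
    "a \<bullet>\<^sub>K (w - w') = a \<bullet>\<^sub>K w - a \<bullet>\<^sub>K w'" "(a - b) \<bullet>\<^sub>K w = a \<bullet>\<^sub>K w - b \<bullet>\<^sub>K w"
    using 1[of a w "- w'"] 2[of a "- b" w] by (simp_all add: 1 2 3 4 5 6 7 8)
qed

lemma dK_power: "dK (x ^ n) = (of_nat n * x ^ (n - 1)) \<bullet>\<^sub>K dK x"
proof (induction n)
  case 0
  then show ?case using kaehler_relations(1)[of 1] by (simp add: cst_simps scaleK_rules)
next
  case (Suc n)
  then show ?case
    by (cases n) (simp_all add: kaehler_relations scaleK_rules(2)[symmetric] scaleK_rules(3)[symmetric] algebra_simps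
        scaleK_rules(4,5))
qed

lemma kaehler_induct [case_names zero add d]:
  fixes w :: "('a::{finite,field}, 'e::field) kaehler"
  assumes "P 0" "\<And>w w'. P w \<Longrightarrow> P w' \<Longrightarrow> P (w + w')" "\<And>f g. P (f \<bullet>\<^sub>K dK g)"
  shows "P w"
proof -
  have single: "abs_kaehler (Poly_Mapping.single g f) = f \<bullet>\<^sub>K dK g" for f g :: "('a, 'e) crv"
  proof -
    have "Poly_Mapping.map ((*) f) (Poly_Mapping.single g 1) = Poly_Mapping.single g f"
      by (rule poly_mapping_eqI) (simp add: pm_map_eq_lookup lookup_single when_def)
    then show ?thesis by (simp add: dK.abs_eq scaleK.abs_eq)
  qed
  have sums: "P (abs_kaehler (\<Sum>g\<in>S. Poly_Mapping.single g (c g)))" for S and c :: "('a, 'e) crv \<Rightarrow> ('a, 'e) crv"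
    by (induction S rule: infinite_finite_induct)
       (simp_all add: assms single zero_kaehler_def[symmetric] plus_kaehler.abs_eq[symmetric])
  have "P (abs_kaehler x)" for x
  proof -
    have "x = (\<Sum>g\<in>Poly_Mapping.keys x. Poly_Mapping.single g (Poly_Mapping.lookup x g))"
      by (rule poly_mapping_eqI) (simp add: lookup_sum lookup_single when_def in_keys_iff)
    then show ?thesis using sums[of "Poly_Mapping.lookup x" "Poly_Mapping.keys x"] by simp
  qed
  from this[of "rep_kaehler w"] show ?thesis by simp
qed

text \<open>
  The linear map on differentials that corresponds to the derivation \<open>crv_der\<close>.
\<close>

definition diff_coeff :: "('a::{finite,field}, 'e::field) kaehler \<Rightarrow> ('a, 'e) crv" where
  "diff_coeff w = (\<Sum>f\<in>Poly_Mapping.keys (rep_kaehler w). Poly_Mapping.lookup (rep_kaehler w) f * crv_der f)"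

definition form :: "('a::{finite,field}, 'e::field) crv \<Rightarrow> ('a, 'e) kaehler" where
  "form f = f \<bullet>\<^sub>K (crv_u \<bullet>\<^sub>K dK crv_v - crv_v \<bullet>\<^sub>K dK crv_u)"

lemma form_rules:
  "form 0 = 0" "form (f + g) = form f + form g" "form (f - g) = form f - form g" "form (- f) = - form f"
  "form (f * g) = f \<bullet>\<^sub>K form g"
  by (simp_all add: form_def scaleK_rules)

context
  fixes TA :: "'a::{finite,field} itself" and TE :: "'e::field itself"
  assumes q0: "of_nat CARD('a) = (0 :: 'e)"
begin

lemma diff_coeff_abs:
  fixes x :: "('a, 'e) crv \<Rightarrow>\<^sub>0 ('a, 'e) crv"
  assumes "finite S" "Poly_Mapping.keys x \<subseteq> S"
  shows "diff_coeff (abs_kaehler x) = (\<Sum>f\<in>S. Poly_Mapping.lookup x f * crv_der f)"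
proof -
  define D where "D x = (\<Sum>f\<in>Poly_Mapping.keys x. Poly_Mapping.lookup x f * crv_der f)" for x :: "('a, 'e) crv \<Rightarrow>\<^sub>0 ('a, 'e) crv"
  have D: "D x = (\<Sum>f\<in>S. Poly_Mapping.lookup x f * crv_der f)" if "finite S" "Poly_Mapping.keys x \<subseteq> S" for x S
    unfolding D_def by (rule sum.mono_neutral_left) (use that in \<open>auto simp: in_keys_iff\<close>)
  have add: "D (x + y) = D x + D y" and diff: "D (x - y) = D x - D y" for x y
  proof -
    let ?S = "Poly_Mapping.keys x \<union> Poly_Mapping.keys y"
    have "Poly_Mapping.keys (x + y) \<subseteq> ?S" "Poly_Mapping.keys (x - y) \<subseteq> ?S"
      by (auto simp: in_keys_iff lookup_add lookup_minus)
    then show "D (x + y) = D x + D y" "D (x - y) = D x - D y"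
      using D[of ?S x] D[of ?S y] D[of ?S "x + y"] D[of ?S "x - y"]
      by (simp_all add: lookup_add lookup_minus algebra_simps sum.distrib sum_subtractf)
  qed
  have single: "D (Poly_Mapping.single g f) = f * crv_der g" for f g
    using D[of "{g}" "Poly_Mapping.single g f"] by (simp add: lookup_single)
  have "D x = 0" if "x \<in> kaehler_rel" for x
    using that
  proof induction
    case (kaehler_rel_scale w a)
    have "D (Poly_Mapping.map ((*) a) w) = a * D w"
    proof -
      have "Poly_Mapping.keys (Poly_Mapping.map ((*) a) w) \<subseteq> Poly_Mapping.keys w"
        by (auto simp: in_keys_iff pm_map_eq_lookup)
      then show ?thesis
        using D[of "Poly_Mapping.keys w" "Poly_Mapping.map ((*) a) w"] D[of "Poly_Mapping.keys w" w]
        by (simp add: pm_map_eq_lookup sum_distrib_left mult.assoc)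
    qed
    then show ?case using kaehler_rel_scale by simp
  qed (simp_all add: add diff single crv_der_generators[OF q0] crv_der_rules[OF q0], simp add: D_def)
  moreover have "abs_kaehler (rep_kaehler (abs_kaehler x)) = abs_kaehler x" by simp
  ultimately have "D (rep_kaehler (abs_kaehler x)) - D x = 0"
    unfolding abs_kaehler_eq_iff diff[symmetric] by blast
  then show ?thesis using D[OF assms] by (simp add: D_def diff_coeff_def)
qed

lemma diff_coeff_rules:
  "diff_coeff (0 :: ('a, 'e) kaehler) = 0" "diff_coeff (w + w' :: ('a, 'e) kaehler) = diff_coeff w + diff_coeff w'"
  "diff_coeff (f \<bullet>\<^sub>K w :: ('a, 'e) kaehler) = f * diff_coeff w" "diff_coeff (dK f :: ('a, 'e) kaehler) = crv_der f"
  "diff_coeff (- w :: ('a, 'e) kaehler) = - diff_coeff w"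
  "diff_coeff (w - w' :: ('a, 'e) kaehler) = diff_coeff w - diff_coeff w'"
proof -
  have add: "diff_coeff (w + w') = diff_coeff w + diff_coeff w'" for w w' :: "('a, 'e) kaehler"
  proof -
    let ?x = "rep_kaehler w" and ?y = "rep_kaehler w'"
    let ?S = "Poly_Mapping.keys ?x \<union> Poly_Mapping.keys ?y"
    have "Poly_Mapping.keys (?x + ?y) \<subseteq> ?S" by (auto simp: in_keys_iff lookup_add)
    then have "diff_coeff (abs_kaehler (?x + ?y)) = diff_coeff (abs_kaehler ?x) + diff_coeff (abs_kaehler ?y)"
      using diff_coeff_abs[of ?S ?x] diff_coeff_abs[of ?S ?y] diff_coeff_abs[of ?S "?x + ?y"]
      by (simp add: lookup_add algebra_simps sum.distrib)
    then show ?thesis unfolding plus_kaehler.abs_eq[symmetric] by simp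
  qed
  have sc: "diff_coeff (f \<bullet>\<^sub>K w) = f * diff_coeff w" for f and w :: "('a, 'e) kaehler"
  proof -
    let ?x = "rep_kaehler w"
    have "Poly_Mapping.keys (Poly_Mapping.map ((*) f) ?x) \<subseteq> Poly_Mapping.keys ?x"
      by (auto simp: in_keys_iff pm_map_eq_lookup)
    then have "diff_coeff (abs_kaehler (Poly_Mapping.map ((*) f) ?x)) = f * diff_coeff (abs_kaehler ?x)"
      using diff_coeff_abs[of "Poly_Mapping.keys ?x" ?x] diff_coeff_abs[of "Poly_Mapping.keys ?x" "Poly_Mapping.map ((*) f) ?x"]
      by (simp add: pm_map_eq_lookup sum_distrib_left mult.assoc)
    then show ?thesis unfolding scaleK.abs_eq[symmetric] by simp
  qed
  show d: "diff_coeff (dK f) = crv_der f" for f :: "('a, 'e) crv"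
    unfolding dK.abs_eq using diff_coeff_abs[of "{f}" "Poly_Mapping.single f 1"] by (simp add: lookup_single)
  show z: "diff_coeff (0 :: ('a, 'e) kaehler) = 0" using add[of 0 0] by simp
  show m: "diff_coeff (- w) = - diff_coeff w" for w :: "('a, 'e) kaehler"
    using add[of w "- w"] z by (simp add: eq_neg_iff_add_eq_0 add.commute)
  show "diff_coeff (w - w') = diff_coeff w - diff_coeff w'"
    using add[of w "- w'"] m[of w'] by simp
  show "diff_coeff (w + w') = diff_coeff w + diff_coeff w'" "diff_coeff (f \<bullet>\<^sub>K w) = f * diff_coeff w"
    by (rule add, rule sc)
qed

text \<open>Differentiating the equation of the curve gives \<open>v\<^sup>q du = u\<^sup>q dv\<close>, and with the equation itself
  one finds \<open>du = u\<^sup>q \<eta>\<close>, \<open>dv = v\<^sup>q \<eta>\<close> for \<open>\<eta> = u dv - v du\<close>.\<close>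

lemma dK_eq_form: "dK f = form (crv_der f :: ('a, 'e) crv)"
proof -
  let ?q = "CARD('a)"
  let ?u = "crv_u :: ('a, 'e) crv" and ?v = "crv_v :: ('a, 'e) crv"
  have q0': "of_nat ?q = (0 :: ('a, 'e) crv)"
  proof -
    have "cst (of_nat ?q :: 'e) = (of_nat ?q :: ('a, 'e) crv)" by (rule cst_simps(8))
    then show ?thesis using q0 by (simp add: cst_simps)
  qed
  have pw: "dK (x ^ ?q) = 0" for x :: "('a, 'e) crv"
    unfolding dK_power q0' by (simp add: scaleK_rules)
  have "dK (?u * ?v ^ ?q) = dK (?u ^ ?q * ?v + 1)"
    using crv_relation[where 'a = 'a and 'e = 'e] by (simp add: algebra_simps)
  moreover have "dK (1 :: ('a, 'e) crv) = 0" using kaehler_relations(1)[of 1] by (simp add: cst_simps)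
  ultimately have r: "?v ^ ?q \<bullet>\<^sub>K dK ?u = ?u ^ ?q \<bullet>\<^sub>K dK ?v"
    unfolding kaehler_relations by (simp add: pw scaleK_rules)
  have rel: "?u * ?v ^ ?q - ?u ^ ?q * ?v = 1" by (rule crv_relation)
  have "form (?u ^ ?q) = ?u \<bullet>\<^sub>K (?u ^ ?q \<bullet>\<^sub>K dK ?v) - (?u ^ ?q * ?v) \<bullet>\<^sub>K dK ?u"
    by (simp add: form_def scaleK_rules(9) mult.commute flip: scaleK_rules(3))
  also have "\<dots> = (?u * ?v ^ ?q - ?u ^ ?q * ?v) \<bullet>\<^sub>K dK ?u"
    unfolding r[symmetric] by (simp add: scaleK_rules)
  finally have u: "form (?u ^ ?q) = dK ?u" by (simp add: rel scaleK_rules)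
  have "form (?v ^ ?q) = (?u * ?v ^ ?q) \<bullet>\<^sub>K dK ?v - ?v \<bullet>\<^sub>K (?v ^ ?q \<bullet>\<^sub>K dK ?u)"
    by (simp add: form_def scaleK_rules(9) mult.commute flip: scaleK_rules(3))
  also have "\<dots> = (?u * ?v ^ ?q - ?u ^ ?q * ?v) \<bullet>\<^sub>K dK ?v"
    unfolding r by (simp add: scaleK_rules(10) mult.commute flip: scaleK_rules(3))
  finally have v: "form (?v ^ ?q) = dK ?v" by (simp add: rel scaleK_rules)
  show ?thesis
  proof (induction f rule: crv_induct)
    case (mult f g)
    then show ?case
      by (simp add: kaehler_relations crv_der_rules[OF q0] form_def scaleK_rules(2,3))
  qed (simp_all add: kaehler_relations crv_der_generators[OF q0] crv_der_rules[OF q0] u v,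
       simp_all add: form_def scaleK_rules)
qed

lemma form_diff_coeff: "form (diff_coeff w) = (w :: ('a, 'e) kaehler)"
  by (induction w rule: kaehler_induct)
     (simp_all add: diff_coeff_rules form_rules flip: dK_eq_form)

lemma diff_coeff_form: "diff_coeff (form f) = (f :: ('a, 'e) crv)"
proof -
  have "diff_coeff (form f) = f * (crv_u * crv_v ^ CARD('a) - crv_u ^ CARD('a) * crv_v)"
    by (simp add: form_def diff_coeff_rules crv_der_generators[OF q0] mult.commute)
  then show ?thesis by (simp add: crv_relation)
qed

lemma kaehler_eq_iff: "w = w' \<longleftrightarrow> diff_coeff w = diff_coeff (w' :: ('a, 'e) kaehler)"
  by (metis form_diff_coeff)

end

lemma diff_coeff_mapK:
  fixes h :: "('a::{finite,field}, 'e::field) crv \<Rightarrow> ('a, 'f::field) crv"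
  assumes q0f: "of_nat CARD('a) = (0 :: 'f)"
    and h: "is_ring_hom h" and d: "\<And>f. crv_der (h f) = lam * h (crv_der f)"
  shows "diff_coeff (mapK h w) = lam * h (diff_coeff w)"
proof -
  have s: "diff_coeff (sum F A) = (\<Sum>a\<in>A. diff_coeff (F a))" for F :: "('a, 'e) crv \<Rightarrow> ('a, 'f) kaehler" and A
    by (induction A rule: infinite_finite_induct) (simp_all add: diff_coeff_rules[OF q0f])
  show ?thesis
    unfolding mapK_def s diff_coeff_def[of w] is_ring_homD(9)[OF h] sum_distrib_left
    by (rule sum.cong) (simp_all add: diff_coeff_rules[OF q0f] d is_ring_homD(3)[OF h] mult.left_commute)
qed

subsection \<open>Forms regular where a linear form does not vanish\<close>

text \<open>What is used of a linear form \<open>l\<close> over the field with \<open>q\<close> elements: its Wronskian-like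
  expressions with the coordinates are constant.\<close>

definition linear_form :: "('a::{finite,field}, 'e::field) crv \<Rightarrow> bool" where
  "linear_form l \<longleftrightarrow> crv_unit l \<and> crv_der l = l ^ CARD('a) \<and>
     (\<exists>b. crv_u ^ CARD('a) * l - crv_u * l ^ CARD('a) = cst b) \<and>
     (\<exists>a. crv_v ^ CARD('a) * l - crv_v * l ^ CARD('a) = cst a)"

lemma card_field_ge_2: "CARD('a::{finite,field}) \<ge> 2"
  using card_mono[of UNIV "{0, 1 :: 'a}"] by simp

context
  fixes TA :: "'a::{finite,field} itself" and TE :: "'e::field itself"
  assumes q0: "of_nat CARD('a) = (0 :: 'e)"
begin

lemma linear_form_uv: "linear_form (crv_u :: ('a, 'e) crv)" "linear_form (crv_v :: ('a, 'e) crv)"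
proof -
  have r: "crv_v ^ CARD('a) * crv_u - crv_v * crv_u ^ CARD('a) = (cst 1 :: ('a, 'e) crv)"
    using crv_relation[where 'a = 'a and 'e = 'e] by (simp add: cst_simps mult.commute)
  then have r': "crv_u ^ CARD('a) * crv_v - crv_u * crv_v ^ CARD('a) = (cst (- 1) :: ('a, 'e) crv)"
    by (simp add: cst_simps) (metis minus_diff_eq mult.commute)
  have z: "x ^ CARD('a) * x - x * x ^ CARD('a) = cst 0" for x :: "('a, 'e) crv"
    by (simp add: cst_simps mult.commute)
  show "linear_form (crv_u :: ('a, 'e) crv)" "linear_form (crv_v :: ('a, 'e) crv)"
    unfolding linear_form_def using r r' z crv_unit_u crv_unit_v crv_der_generators[OF q0] by blast+
qed

text \<open>
  The derivatives of \<open>u/l\<close>, \<open>v/l\<close>, \<open>1/l\<close> are multiples of \<open>l\<^sup>q\<^sup>-\<^sup>2\<close>, the first two because \<open>u\<^sup>q l - u l\<^sup>q\<close>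
  and \<open>v\<^sup>q l - v l\<^sup>q\<close> are constant.
\<close>

lemma reg_der:
  assumes l: "linear_form (l :: ('a, 'e) crv)" and g: "g \<in> reg {l}"
  shows "\<exists>f\<in>reg {l}. crv_der g = l ^ (CARD('a) - 2) * f"
proof -
  let ?q = "CARD('a)"
  let ?R = "{g \<in> reg {l}. \<exists>f\<in>reg {l}. crv_der g = l ^ (?q - 2) * f}"
  note D = crv_der_rules[OF q0] crv_der_generators[OF q0]
  have lu: "crv_unit l" and dl: "crv_der l = l ^ ?q" using l by (auto simp: linear_form_def)
  obtain a b where b: "crv_u ^ ?q * l - crv_u * l ^ ?q = cst b" and a: "crv_v ^ ?q * l - crv_v * l ^ ?q = cst a"
    using l by (auto simp: linear_form_def)
  have lq: "l ^ ?q = l ^ (?q - 2) * l ^ 2"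
    using card_field_ge_2[where 'a = 'a] by (metis le_add_diff_inverse2 power_add)
  have il: "l * inverse l = 1" "l * (inverse l * x) = x" for x
    using crv_unitD(1)[OF lu] by (simp_all flip: mult.assoc)
  have il': "inverse l ^ ?q * l ^ (?q - 2) = inverse l ^ 2"
  proof -
    have "l ^ (?q - 2) * inverse l ^ (?q - 2) = 1" using il(1) by (simp flip: power_mult_distrib)
    moreover have "inverse l ^ ?q = inverse l ^ (?q - 2) * inverse l ^ 2"
      using card_field_ge_2[where 'a = 'a] by (metis le_add_diff_inverse2 power_add)
    ultimately have "inverse l ^ ?q * l ^ (?q - 2) = (l ^ (?q - 2) * inverse l ^ (?q - 2)) * inverse l ^ 2"
      by (simp only: mult_ac)
    then show ?thesis using \<open>l ^ (?q - 2) * inverse l ^ (?q - 2) = 1\<close> by simp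
  qed
  have gen: "crv_der (x * inverse l) = l ^ (?q - 2) * (cst c * inverse l ^ ?q)"
    if c: "crv_der x * l - x * l ^ ?q = cst c" for x c
  proof -
    have "crv_der (x * inverse l) = inverse l ^ 2 * (crv_der x * l - x * l ^ ?q)"
      by (simp add: D crv_der_inverse[OF q0 lu] dl power2_eq_square algebra_simps il)
    then show ?thesis unfolding c il'[symmetric] by (simp add: mult_ac)
  qed
  have il2: "crv_der (inverse l) = l ^ (?q - 2) * (- 1)"
  proof -
    have "inverse l ^ 2 * l ^ ?q = (inverse l * l) ^ 2 * l ^ (?q - 2)"
      unfolding lq power_mult_distrib by (simp only: mult_ac)
    then show ?thesis
      unfolding crv_der_inverse[OF q0 lu] dl using crv_unitD(2)[OF lu] by simp
  qed
  have "reg {l} \<subseteq> ?R"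
  proof (rule reg_subset)
    fix c show "cst c \<in> ?R" by (auto simp: D reg_closed intro!: bexI[of _ 0])
  next
    fix f g assume "f \<in> ?R" "g \<in> ?R"
    then obtain f' g' where *: "f \<in> reg {l}" "g \<in> reg {l}" "f' \<in> reg {l}" "g' \<in> reg {l}"
      "crv_der f = l ^ (?q - 2) * f'" "crv_der g = l ^ (?q - 2) * g'" by auto
    then show "f + g \<in> ?R" by (auto simp: D reg_closed algebra_simps intro!: bexI[of _ "f' + g'"])
    have "crv_der (f * g) = l ^ (?q - 2) * (f * g' + g * f')"
      by (simp add: D * algebra_simps)
    then show "f * g \<in> ?R" using * by (blast intro: reg_closed)
  next
    fix l' assume "l' \<in> {l}"
    then have [simp]: "l' = l" by simp
    have "cst c * inverse l ^ ?q \<in> reg {l}" for c by (intro reg_closed reg_generators) simp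
    moreover have "- 1 \<in> reg {l}" by (intro reg_closed)
    moreover have "crv_der (crv_u * inverse l) = l ^ (?q - 2) * (cst b * inverse l ^ ?q)"
      "crv_der (crv_v * inverse l) = l ^ (?q - 2) * (cst a * inverse l ^ ?q)"
      by (rule gen, simp add: D a b)+
    moreover have "crv_u * inverse l \<in> reg {l}" "crv_v * inverse l \<in> reg {l}" "inverse l \<in> reg {l}"
      by (auto intro: reg_generators)
    ultimately show "crv_u * inverse l' \<in> ?R \<and> crv_v * inverse l' \<in> ?R \<and> inverse l' \<in> ?R"
      unfolding \<open>l' = l\<close> mem_Collect_eq using il2 by blast
  qed
  then show ?thesis using g by auto
qed

text \<open>
  On \<open>U\<^sub>l\<close> the differential of \<open>1/l\<close>, which is \<open>- l\<^sup>q\<^sup>-\<^sup>2 \<eta>\<close>, generates all forms.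
\<close>

lemma Omega_iff:
  assumes l: "linear_form (l :: ('a, 'e) crv)"
  shows "w \<in> Omega {l} \<longleftrightarrow> (\<exists>f\<in>reg {l}. diff_coeff w = l ^ (CARD('a) - 2) * f)"
proof
  assume "w \<in> Omega {l}"
  then show "\<exists>f\<in>reg {l}. diff_coeff w = l ^ (CARD('a) - 2) * f"
  proof induction
    case 1
    then show ?case by (auto simp: diff_coeff_rules[OF q0] reg_closed intro!: bexI[of _ 0])
  next
    case (2 f g)
    then obtain g' where "g' \<in> reg {l}" "crv_der g = l ^ (CARD('a) - 2) * g'" using reg_der[OF l] by blast
    with 2 show ?case
      by (intro bexI[of _ "f * g'"]) (auto simp: diff_coeff_rules[OF q0] reg_closed mult.left_commute)
  next
    case (3 w w')
    then show ?case by (auto simp: diff_coeff_rules[OF q0] distrib_left[symmetric] intro: reg_closed)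
  qed
next
  assume "\<exists>f\<in>reg {l}. diff_coeff w = l ^ (CARD('a) - 2) * f"
  then obtain f where f: "f \<in> reg {l}" "diff_coeff w = l ^ (CARD('a) - 2) * f" by blast
  have lu: "crv_unit l" and dl: "crv_der l = l ^ CARD('a)" using l by (auto simp: linear_form_def)
  have lq: "l ^ CARD('a) = l ^ (CARD('a) - 2) * l ^ 2"
    using card_field_ge_2[where 'a = 'a] by (metis le_add_diff_inverse2 power_add)
  have "inverse l ^ 2 * l ^ CARD('a) = (inverse l * l) ^ 2 * l ^ (CARD('a) - 2)"
    unfolding lq power_mult_distrib by (simp only: mult_ac)
  then have "diff_coeff ((- f) \<bullet>\<^sub>K dK (inverse l)) = l ^ (CARD('a) - 2) * f"
    unfolding diff_coeff_rules[OF q0] crv_der_inverse[OF q0 lu] dl using crv_unitD(2)[OF lu] by simp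
  then have "w = (- f) \<bullet>\<^sub>K dK (inverse l)" using kaehler_eq_iff[OF q0] f(2) by metis
  then show "w \<in> Omega {l}" using f(1) by (auto intro!: Omega.intros reg_closed reg_generators)
qed

end

section \<open>Linear forms over the finite field\<close>

text \<open>
  The parameter \<open>TA\<close> fixes the field with \<open>q\<close> elements, which is a type.
\<close>

locale curve_setup =
  fixes p n k :: nat and TA :: "'a::{finite,field} itself"
  assumes prime_p: "prime p" and card: "CARD('a) = p ^ n" and card_gt_2: "CARD('a) > 2"
    and k_ge_2: "2 \<le> k" and k_le: "k \<le> p - 1"
begin

lemma CHAR_eq: "CHAR('a) = p"
proof -
  have dvd: "CHAR('a) dvd p ^ n" using CHAR_dvd_CARD[where 'a = 'a] card by simp
  have "CHAR('a) > 0" by (rule finite_imp_CHAR_pos) simp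
  then have "prime CHAR('a)" by (rule prime_CHAR_semidom)
  then show ?thesis using dvd prime_p by (metis prime_dvd_power primes_dvd_imp_eq)
qed

lemma p_zero: "of_nat p = (0 :: 'a)"
  using of_nat_CHAR[where 'a = 'a] by (simp add: CHAR_eq)

lemma of_nat_nonzero: "0 < j \<Longrightarrow> j < p \<Longrightarrow> of_nat j \<noteq> (0 :: 'a)"
  using of_nat_eq_0_iff_char_dvd[of j, where 'a = 'a] by (auto simp: CHAR_eq dest: dvd_imp_le)

lemma n_pos: "n > 0"
  using card card_gt_2 by (cases n) auto

lemma q_zero: "of_nat CARD('a) = (0 :: 'a)"
  using n_pos by (simp add: card p_zero zero_power)

lemma q_zero_ac: "of_nat CARD('a) = (0 :: 'a alg_closure)"
  using q_zero by (metis to_ac_0 to_ac_of_nat)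

lemma k_less_p: "k < p" and p_le_q: "p \<le> CARD('a)" and k_less_q: "k < CARD('a)" and k_nonzero: "of_nat k \<noteq> (0 :: 'a)"
proof -
  show 1: "k < p" using k_ge_2 k_le by simp
  show 2: "p \<le> CARD('a)" unfolding card using n_pos prime_gt_0_nat[OF prime_p] by (cases n) simp_all
  show "k < CARD('a)" using 1 2 by simp
  show "of_nat k \<noteq> (0 :: 'a)" by (rule of_nat_nonzero) (use 1 k_ge_2 in auto)
qed

lemma odd_q: "odd CARD('a)"
proof -
  have "p \<noteq> 2" using k_less_p k_ge_2 by simp
  then have "odd p" using prime_p prime_odd_nat[of p] prime_ge_2_nat[of p] by auto
  then show ?thesis by (simp add: card)
qed

lemma frobenius_add:
  fixes x y :: "'r::comm_ring_1"
  assumes "of_nat p = (0 :: 'r)"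
  shows "(x + y) ^ CARD('a) = x ^ CARD('a) + y ^ CARD('a)"
proof -
  have "CHAR('r) dvd p" using assms by (simp add: of_nat_eq_0_iff_char_dvd)
  moreover have "CHAR('r) \<noteq> 1" using of_nat_CHAR[where 'a = 'r] by (metis of_nat_1 zero_neq_one)
  ultimately have "CHAR('r) = p" using prime_p by (auto simp: prime_nat_iff)
  then show ?thesis using freshmans_dream'[where 'a = 'r, of "CARD('a)" n x y] prime_p card by simp
qed

lemma power_q [simp]: "x ^ CARD('a) = (x :: 'a)"
proof (cases "x = 0")
  case False
  have "(\<Prod>y\<in>UNIV - {0 :: 'a}. y) = (\<Prod>y\<in>UNIV - {0}. x * y)"
    by (rule prod.reindex_bij_witness[of _ "\<lambda>y. x * y" "\<lambda>y. y / x"]) (use False in auto)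
  also have "\<dots> = x ^ (CARD('a) - 1) * (\<Prod>y\<in>UNIV - {0}. y)"
    by (simp add: prod.distrib card_Diff_singleton)
  finally have "x ^ (CARD('a) - 1) = 1" by simp
  then have "x * x ^ (CARD('a) - 1) = x" by simp
  then show ?thesis by (simp flip: power_Suc)
qed (use card_gt_2 in simp)

lemma p_zero_crv: "of_nat p = (0 :: ('a, 'a) crv)"
proof -
  have "cst (of_nat p :: 'a) = (of_nat p :: ('a, 'a) crv)" by (rule cst_simps(8))
  then show ?thesis by (simp add: p_zero cst_simps)
qed

lemma k_inverse_crv: "cst (inverse (of_nat k)) * of_nat k = (1 :: ('a, 'a) crv)"
proof -
  have "cst (of_nat k :: 'a) = (of_nat k :: ('a, 'a) crv)" by (rule cst_simps(8))
  then have "cst (inverse (of_nat k)) * of_nat k = (cst (inverse (of_nat k) * of_nat k) :: ('a, 'a) crv)"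
    by (simp add: cst_simps)
  also have "inverse (of_nat k) * of_nat k = (1 :: 'a)" using k_nonzero by simp
  finally show ?thesis by (simp add: cst_simps)
qed

lemma q_zero_crv: "of_nat CARD('a) = (0 :: ('a, 'a) crv)"
  using p_zero_crv n_pos by (simp add: card zero_power)

abbreviation lin :: "'a \<Rightarrow> 'a \<Rightarrow> ('a, 'a) crv" where
  "lin a b \<equiv> cst a * crv_u + cst b * crv_v"

lemma lin_power_q: "lin a b ^ CARD('a) = cst a * crv_u ^ CARD('a) + cst b * crv_v ^ CARD('a)"
  by (simp add: frobenius_add[OF p_zero_crv] power_mult_distrib flip: cst_simps(7))

lemma lin_wronskian: "lin a b * lin c d ^ CARD('a) - lin a b ^ CARD('a) * lin c d = cst (a * d - b * c)"
proof -
  have "lin a b * lin c d ^ CARD('a) - lin a b ^ CARD('a) * lin c d =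
      (cst a * cst d - cst b * cst c) * (crv_u * crv_v ^ CARD('a) - crv_u ^ CARD('a) * crv_v)"
    unfolding lin_power_q by (simp add: algebra_simps)
  then show ?thesis by (simp only: crv_relation) (simp add: cst_simps)
qed

lemma linear_form_lin:
  assumes "(a, b) \<noteq> (0, 0)"
  shows "linear_form (lin a b)"
proof -
  have 1: "crv_u ^ CARD('a) * lin a b - crv_u * lin a b ^ CARD('a) = cst (- b)"
    "crv_v ^ CARD('a) * lin a b - crv_v * lin a b ^ CARD('a) = cst a"
    using lin_wronskian[of 1 0 a b] lin_wronskian[of 0 1 a b]
    by (simp_all add: cst_simps minus_diff_commute) (metis minus_diff_eq add.inverse_inverse)+
  have lq: "lin a b ^ CARD('a) = lin a b * lin a b ^ (CARD('a) - 1)" by (simp flip: power_Suc)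
  have unit: "crv_unit (lin a b)" if "x * lin a b - y * lin a b ^ CARD('a) = cst c" "c \<noteq> 0" for x y c
  proof (rule crv_unitI)
    have "lin a b * (cst (inverse c) * (x - y * lin a b ^ (CARD('a) - 1))) =
        cst (inverse c) * (x * lin a b - y * lin a b ^ CARD('a))"
      unfolding lq by (simp add: algebra_simps)
    then show "lin a b * (cst (inverse c) * (x - y * lin a b ^ (CARD('a) - 1))) = 1"
      unfolding that(1) using that(2) by (simp add: cst_simps flip: cst_simps(3))
  qed
  have "crv_unit (lin a b)"
  proof (cases "b = 0")
    case True
    then show ?thesis using unit[OF 1(2)] assms by simp
  next
    case False
    then show ?thesis using unit[OF 1(1)] by simp
  qed
  moreover have "crv_der (lin a b) = lin a b ^ CARD('a)"
    by (simp add: lin_power_q crv_der_rules[OF q_zero] crv_der_generators[OF q_zero])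
  ultimately show ?thesis unfolding linear_form_def using 1 by blast
qed

lemma crv_der_lin: "crv_der (lin a b) = lin a b ^ CARD('a)"
  by (simp add: lin_power_q crv_der_rules[OF q_zero] crv_der_generators[OF q_zero])

lemma lin_forms_linear_form: "l \<in> lin_forms \<Longrightarrow> linear_form (l :: ('a, 'a) crv)"
  unfolding lin_forms_def using linear_form_lin by blast

lemma lin_forms_unit: "l \<in> lin_forms \<Longrightarrow> crv_unit (l :: ('a, 'a) crv)"
  using lin_forms_linear_form by (auto simp: linear_form_def)

lemma uv_lin_forms: "(crv_u :: ('a, 'a) crv) \<in> lin_forms" "(crv_v :: ('a, 'a) crv) \<in> lin_forms"
proof -
  have "(crv_u :: ('a, 'a) crv) = lin 1 0 \<and> (1, 0) \<noteq> (0 :: 'a, 0 :: 'a)"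
    "(crv_v :: ('a, 'a) crv) = lin 0 1 \<and> (0, 1) \<noteq> (0 :: 'a, 0 :: 'a)"
    by (simp_all add: cst_simps)
  then show "(crv_u :: ('a, 'a) crv) \<in> lin_forms" "(crv_v :: ('a, 'a) crv) \<in> lin_forms"
    unfolding lin_forms_def by blast+
qed

subsection \<open>Homogeneous functions and denominators\<close>

definition hom_crv :: "nat \<Rightarrow> ('a, 'a) crv set" where
  "hom_crv d = lspan {(int i, int j) | i j. i + j = d}"

lemma hom_crv_induct [consumes 1, case_names zero add mon]:
  assumes "f \<in> hom_crv d" "P 0" "\<And>f g. P f \<Longrightarrow> P g \<Longrightarrow> P (f + g)"
    "\<And>c i j. i + j = d \<Longrightarrow> P (cst c * (crv_u ^ i * crv_v ^ j))"
  shows "P f"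
  using assms(1) unfolding hom_crv_def
  by (induction f rule: lspan_induct) (auto simp: assms mm_nat)

lemma mon_hom_crv: "i + j = d \<Longrightarrow> crv_u ^ i * crv_v ^ j \<in> hom_crv d"
  unfolding hom_crv_def mm_nat[symmetric] by (rule mm_lspan) auto

lemma hom_crv_subspace:
  "0 \<in> hom_crv d" "f \<in> hom_crv d \<Longrightarrow> g \<in> hom_crv d \<Longrightarrow> f + g \<in> hom_crv d"
  "f \<in> hom_crv d \<Longrightarrow> cst c * f \<in> hom_crv d"
  unfolding hom_crv_def by (auto intro: lspan_subspace)

lemma mon_over_power_reg:
  assumes "crv_unit l" "i + j \<le> s"
  shows "crv_u ^ i * crv_v ^ j * inverse l ^ s \<in> reg {l :: ('a, 'a) crv}"
proof -
  have "inverse l ^ s = inverse l ^ i * inverse l ^ j * inverse l ^ (s - (i + j))"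
    using assms(2) by (simp flip: power_add)
  then have "crv_u ^ i * crv_v ^ j * inverse l ^ s =
      (crv_u * inverse l) ^ i * (crv_v * inverse l) ^ j * inverse l ^ (s - (i + j))"
    by (simp add: power_mult_distrib mult_ac)
  then show ?thesis by (simp add: reg_closed reg_generators)
qed

lemma hom_over_power_reg:
  assumes "crv_unit l" "d \<le> s" "f \<in> hom_crv d"
  shows "f * inverse l ^ s \<in> reg {l :: ('a, 'a) crv}"
  using assms(3)
proof (induction f rule: hom_crv_induct)
  case (mon c i j)
  then show ?case
    using reg_closed(3)[OF reg_closed(1) mon_over_power_reg[OF assms(1), of i j s], of c] assms(2)
    by (simp add: mult.assoc)
qed (simp_all add: reg_closed distrib_right)

lemma hom_over_two_powers_reg:
  assumes l: "crv_unit l" and m: "crv_unit m" and d: "d \<le> s + t" and f: "f \<in> hom_crv d"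
  shows "f * (inverse l ^ s * inverse m ^ t) \<in> reg {l, m :: ('a, 'a) crv}"
  using f
proof (induction f rule: hom_crv_induct)
  case (mon c i j)
  define i1 where "i1 = min i s"
  define j1 where "j1 = min j (s - i1)"
  have 1: "i1 + j1 \<le> s" "(i - i1) + (j - j1) \<le> t" "i = i1 + (i - i1)" "j = j1 + (j - j1)"
    using mon d by (auto simp: i1_def j1_def)
  have "crv_u ^ i1 * crv_v ^ j1 * inverse l ^ s \<in> reg {l, m}"
    "crv_u ^ (i - i1) * crv_v ^ (j - j1) * inverse m ^ t \<in> reg {l, m}"
    using mon_over_power_reg[OF l 1(1)] mon_over_power_reg[OF m 1(2)]
      reg_mono[of "{l}" "{l, m}"] reg_mono[of "{m}" "{l, m}"] by auto
  then have "cst c * ((crv_u ^ i1 * crv_v ^ j1 * inverse l ^ s) * (crv_u ^ (i - i1) * crv_v ^ (j - j1) * inverse m ^ t)) \<in> reg {l, m}"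
    by (rule reg_closed(3)[OF reg_closed(1) reg_closed(3)])
  also have "cst c * ((crv_u ^ i1 * crv_v ^ j1 * inverse l ^ s) * (crv_u ^ (i - i1) * crv_v ^ (j - j1) * inverse m ^ t)) =
      cst c * ((crv_u ^ (i1 + (i - i1)) * crv_v ^ (j1 + (j - j1))) * (inverse l ^ s * inverse m ^ t))"
    by (simp only: power_add mult_ac)
  finally show ?case using 1 by (simp add: mult.assoc)
qed (simp_all add: reg_closed distrib_right)

text \<open>
  Since \<open>u\<^sup>q l - u l\<^sup>q\<close> is constant, \<open>D u = u\<^sup>q\<close> differs from \<open>u l\<^sup>q\<^sup>-\<^sup>1\<close> by a multiple of \<open>1/l\<close>, and
  likewise for \<open>v\<close>. After division by \<open>l\<^sup>q\<^sup>-\<^sup>1\<close> the derivation thus is the Euler operator, which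
  multiplies \<open>F\<close> by its degree, up to terms with the denominator \<open>l\<^sup>q\<close>.
\<close>

lemma crv_der_euler:
  assumes l: "linear_form (l :: ('a, 'a) crv)" and F: "F \<in> hom_crv d"
  shows "\<exists>N\<in>hom_crv (d - 1). crv_der F * inverse l ^ (CARD('a) - 1) = of_nat d * F + inverse l ^ CARD('a) * N"
  using F
proof (induction F rule: hom_crv_induct)
  case zero
  show ?case by (rule bexI[of _ 0]) (simp_all add: crv_der_rules[OF q_zero] hom_crv_subspace)
next
  case (add F G)
  then obtain M N where "M \<in> hom_crv (d - 1)" "N \<in> hom_crv (d - 1)"
    "crv_der F * inverse l ^ (CARD('a) - 1) = of_nat d * F + inverse l ^ CARD('a) * M"
    "crv_der G * inverse l ^ (CARD('a) - 1) = of_nat d * G + inverse l ^ CARD('a) * N" by blast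
  then show ?case
    by (intro bexI[of _ "M + N"]) (simp_all add: crv_der_rules[OF q_zero] hom_crv_subspace algebra_simps)
next
  case (mon c i j)
  obtain a b where b: "crv_u ^ CARD('a) * l - crv_u * l ^ CARD('a) = cst b" and a: "crv_v ^ CARD('a) * l - crv_v * l ^ CARD('a) = cst a"
    and lu: "crv_unit l" using l by (auto simp: linear_form_def)
  have iq: "inverse l ^ (CARD('a) - 1) = inverse l ^ CARD('a) * l"
  proof -
    have "inverse l ^ CARD('a) = inverse l ^ (CARD('a) - 1) * inverse l" by (simp flip: power_Suc2)
    then show ?thesis using crv_unitD(2)[OF lu] by (simp add: mult.assoc)
  qed
  have one: "inverse l ^ CARD('a) * l ^ CARD('a) = 1" using crv_unitD(2)[OF lu] by (simp flip: power_mult_distrib)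
  have x: "x ^ CARD('a) * inverse l ^ (CARD('a) - 1) = inverse l ^ CARD('a) * cst c + x" if "x ^ CARD('a) * l - x * l ^ CARD('a) = cst c" for x c
  proof -
    have "x ^ CARD('a) * inverse l ^ (CARD('a) - 1) = inverse l ^ CARD('a) * (x ^ CARD('a) * l - x * l ^ CARD('a)) + x * (inverse l ^ CARD('a) * l ^ CARD('a))"
      unfolding iq by (simp add: algebra_simps)
    then show ?thesis by (simp add: that one)
  qed
  define Nu :: "('a, 'a) crv" where "Nu = (if i = 0 then 0 else cst (c * of_nat i * b) * (crv_u ^ (i - 1) * crv_v ^ j))"
  define Nv :: "('a, 'a) crv" where "Nv = (if j = 0 then 0 else cst (c * of_nat j * a) * (crv_u ^ i * crv_v ^ (j - 1)))"
  have U: "cst c * (of_nat i * crv_u ^ (i - 1) * crv_v ^ j) * (crv_u ^ CARD('a) * inverse l ^ (CARD('a) - 1)) =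
      of_nat i * (cst c * (crv_u ^ i * crv_v ^ j)) + inverse l ^ CARD('a) * Nu"
    unfolding x[OF b] Nu_def by (cases i) (simp_all add: cst_simps algebra_simps)
  have V: "cst c * (of_nat j * crv_v ^ (j - 1) * crv_u ^ i) * (crv_v ^ CARD('a) * inverse l ^ (CARD('a) - 1)) =
      of_nat j * (cst c * (crv_u ^ i * crv_v ^ j)) + inverse l ^ CARD('a) * Nv"
    unfolding x[OF a] Nv_def by (cases j) (simp_all add: cst_simps algebra_simps)
  have "crv_der (cst c * (crv_u ^ i * crv_v ^ j)) * inverse l ^ (CARD('a) - 1) =
     cst c * (of_nat i * crv_u ^ (i - 1) * crv_v ^ j) * (crv_u ^ CARD('a) * inverse l ^ (CARD('a) - 1)) +
     cst c * (of_nat j * crv_v ^ (j - 1) * crv_u ^ i) * (crv_v ^ CARD('a) * inverse l ^ (CARD('a) - 1))"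
    by (simp add: crv_der_rules[OF q_zero] crv_der_generators[OF q_zero] crv_der_power[OF q_zero] algebra_simps)
  also have "\<dots> = of_nat d * (cst c * (crv_u ^ i * crv_v ^ j)) + inverse l ^ CARD('a) * (Nu + Nv)"
    unfolding U V using mon by (simp add: algebra_simps flip: mon)
  finally have eq: "crv_der (cst c * (crv_u ^ i * crv_v ^ j)) * inverse l ^ (CARD('a) - 1) =
    of_nat d * (cst c * (crv_u ^ i * crv_v ^ j)) + inverse l ^ CARD('a) * (Nu + Nv)" .
  have "Nu \<in> hom_crv (d - 1)" "Nv \<in> hom_crv (d - 1)"
    unfolding Nu_def Nv_def using mon by (auto intro!: hom_crv_subspace mon_hom_crv)
  then have "Nu + Nv \<in> hom_crv (d - 1)" by (rule hom_crv_subspace)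
  then show ?case using eq by blast
qed

section \<open>The action of \<open>SL\<^sub>2\<close> on functions\<close>

text \<open>
  The matrix \<open>g\<close> acts on the coordinates through \<open>(g\<^sup>-\<^sup>1)\<^sup>t\<close>, which for determinant \<open>1\<close> is
  conjugate to \<open>g\<close> by the rotation \<open>X \<mapsto> -v\<close>, \<open>Y \<mapsto> u\<close>.
\<close>

definition eps :: "'a poly poly \<Rightarrow> ('a, 'a) crv" where
  "eps = subst2 cst (- crv_v) crv_u"

lemma is_ring_hom_eps: "is_ring_hom eps"
  unfolding eps_def by (rule is_ring_hom_subst2[OF is_ring_hom_cst])

lemmas eps_hom = is_ring_homD[OF is_ring_hom_eps]

lemma eps_generators: "eps (cst2 c) = cst c" "eps varX = - crv_v" "eps varY = crv_u"
  unfolding eps_def by (rule subst2_generators[OF is_ring_hom_cst])+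

lemma eps_mon: "eps (cst2 c * mon i j) = cst (c * (- 1) ^ i) * (crv_u ^ j * crv_v ^ i)"
proof -
  have "(- crv_v :: ('a, 'a) crv) ^ i = cst ((- 1) ^ i) * crv_v ^ i"
    by (subst power_minus) (simp add: cst_simps)
  then show ?thesis by (simp add: eps_hom eps_generators cst_simps mult_ac)
qed

lemma eps_homog: "f \<in> homog d \<Longrightarrow> eps f \<in> hom_crv d"
proof (induction f rule: homog_induct)
  case (mon c i j)
  then show ?case unfolding eps_mon by (intro hom_crv_subspace mon_hom_crv) simp
qed (simp_all add: eps_hom hom_crv_subspace)

lemma eps_homog_onto: "f \<in> hom_crv d \<Longrightarrow> \<exists>g\<in>homog d. f = eps g"
proof (induction f rule: hom_crv_induct)
  case zero
  show ?case by (rule bexI[of _ 0]) (simp_all add: eps_hom homog_subspace)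
next
  case (add f g)
  then obtain f' g' where "f' \<in> homog d" "g' \<in> homog d" "f = eps f'" "g = eps g'" by blast
  then show ?case by (intro bexI[of _ "f' + g'"]) (simp_all add: eps_hom homog_subspace)
next
  case (mon c i j)
  have "cst c * (crv_u ^ i * crv_v ^ j) = eps (cst2 (c * (- 1) ^ j) * mon j i)"
    unfolding eps_mon by (simp add: mult.assoc flip: power_add mult_2)
  then show ?case using mon by (intro bexI[of _ "cst2 (c * (- 1) ^ j) * mon j i"] homog_subspace mon_homog) simp_all
qed

lemma eps_onto: "\<exists>f. x = eps f"
proof (induction x rule: crv_induct)
  case (cst c)
  show ?case using eps_generators(1) by metis
next
  case u
  show ?case using eps_generators(3) by metis
next
  case v
  have "crv_v = eps (- varX)" by (simp add: eps_hom eps_generators)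
  then show ?case by blast
qed (metis eps_hom(2), metis eps_hom(3))

lemma eps_theta: "eps theta = - 1"
proof -
  have "eps theta = - (crv_u * crv_v ^ CARD('a) - crv_u ^ CARD('a) * crv_v)"
    using odd_q by (simp add: theta_def eps_hom eps_generators mult.commute)
  then show ?thesis by (simp add: crv_relation)
qed

lemma eps_Dq: "eps (Dq f) = crv_der (eps f)"
  unfolding Dq_eq_poly2_der
proof (rule derivation_poly2_eqI[of eps "\<lambda>f. eps (poly2_der CARD('a) f)" "\<lambda>f. crv_der (eps f)"])
  show "is_derivation eps (\<lambda>f. eps (poly2_der CARD('a) f))"
    by (rule is_derivation_hom_left[OF is_derivation_poly2_der is_ring_hom_eps])
  show "is_derivation eps (\<lambda>f. crv_der (eps f))"
    by (rule is_derivation_hom_right[OF is_derivation_crv_der[OF q_zero] is_ring_hom_eps])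
qed (use odd_q in \<open>simp_all add: eps_hom eps_generators crv_der_rules[OF q_zero] crv_der_generators[OF q_zero]\<close>)

lemma matrix_inv_SL2:
  fixes g :: "'a ^ 2 ^ 2"
  assumes g: "g \<in> SL2"
  shows "matrix_inv g $ 1 $ 1 = g $ 2 $ 2" "matrix_inv g $ 1 $ 2 = - g $ 1 $ 2"
    "matrix_inv g $ 2 $ 1 = - g $ 2 $ 1" "matrix_inv g $ 2 $ 2 = g $ 1 $ 1" "matrix_inv g \<in> SL2"
proof -
  define h :: "'a ^ 2 ^ 2" where "h = vector [vector [g$2$2, - g$1$2], vector [- g$2$1, g$1$1]]"
  have d: "g$1$1 * g$2$2 - g$1$2 * g$2$1 = 1" using g by (simp add: SL2_def det_2)
  have "h ** g = mat 1"
    using d by (simp add: h_def matrix_matrix_mult_def mat_def vec_eq_iff forall_2 sum_2 algebra_simps)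
  then have "matrix_inv g = h"
    using GL2_inverse[OF SL2_GL2[OF g]] by (metis matrix_mul_assoc matrix_mul_lid matrix_mul_rid)
  then show "matrix_inv g $ 1 $ 1 = g $ 2 $ 2" "matrix_inv g $ 1 $ 2 = - g $ 1 $ 2"
    "matrix_inv g $ 2 $ 1 = - g $ 2 $ 1" "matrix_inv g $ 2 $ 2 = g $ 1 $ 1" "matrix_inv g \<in> SL2"
    using d by (simp_all add: h_def SL2_def det_2 algebra_simps)
qed

lemma
  fixes g :: "'a ^ 2 ^ 2"
  assumes g: "g \<in> SL2"
  shows is_ring_hom_sl2: "is_ring_hom (sl2_crv g)"
    and sl2_generators: "sl2_crv g (cst c) = cst c" "sl2_crv g crv_u = lin (g$2$2) (- g$1$2)"
      "sl2_crv g crv_v = lin (- g$2$1) (g$1$1)"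
proof -
  have d: "g$2$2 * g$1$1 - (- g$1$2) * (- g$2$1) = 1" using g by (simp add: SL2_def det_2 algebra_simps)
  have s: "sl2_crv g = crv_subst id (lin (g$2$2) (- g$1$2)) (lin (- g$2$1) (g$1$1))"
    unfolding sl2_crv_def Let_def by (rule ext) (simp add: transpose_def matrix_inv_SL2[OF g])
  note r = lin_wronskian[of "g$2$2" "- g$1$2" "- g$2$1" "g$1$1", unfolded d cst_simps(1)]
  have id: "is_ring_hom (id :: 'a \<Rightarrow> 'a)" by (simp add: is_ring_hom_def)
  show "is_ring_hom (sl2_crv g)" unfolding s by (rule is_ring_hom_crv_subst[OF id r])
  show "sl2_crv g (cst c) = cst c" "sl2_crv g crv_u = lin (g$2$2) (- g$1$2)"
      "sl2_crv g crv_v = lin (- g$2$1) (g$1$1)"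
    unfolding s crv_subst_generators[OF id r] by simp_all
qed

lemmas sl2_hom = is_ring_homD[OF is_ring_hom_sl2]

lemma sl2_eps:
  fixes g :: "'a ^ 2 ^ 2"
  assumes g: "g \<in> SL2"
  shows "sl2_crv g (eps f) = eps (act2 g f)"
  by (rule ring_hom_poly2_eqI[OF is_ring_hom_comp[OF is_ring_hom_sl2[OF g] is_ring_hom_eps]
        is_ring_hom_comp[OF is_ring_hom_eps is_ring_hom_act2]])
     (simp_all add: eps_hom eps_generators sl2_generators[OF g] sl2_hom[OF g] act2_generators cst_simps)

lemma sl2_inverse:
  fixes g :: "'a ^ 2 ^ 2"
  assumes g: "g \<in> SL2"
  shows "sl2_crv g (sl2_crv (matrix_inv g) x) = x" "sl2_crv (matrix_inv g) (sl2_crv g x) = x"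
proof -
  note i = GL2_inverse[OF SL2_GL2[OF g]] and g' = matrix_inv_SL2(5)[OF g]
  obtain f where x: "x = eps f" using eps_onto by blast
  show "sl2_crv g (sl2_crv (matrix_inv g) x) = x" "sl2_crv (matrix_inv g) (sl2_crv g x) = x"
    unfolding x sl2_eps[OF g] sl2_eps[OF g'] by (simp_all add: i act2_one flip: act2_mult)
qed

lemma sl2_der:
  fixes g :: "'a ^ 2 ^ 2"
  assumes g: "g \<in> SL2"
  shows "crv_der (sl2_crv g x) = sl2_crv g (crv_der x)"
proof (rule crv_derivation_eqI[of "sl2_crv g" "\<lambda>x. crv_der (sl2_crv g x)" "\<lambda>x. sl2_crv g (crv_der x)"])
  show "is_derivation (sl2_crv g) (\<lambda>x. crv_der (sl2_crv g x))"
    by (rule is_derivation_hom_right[OF is_derivation_crv_der[OF q_zero] is_ring_hom_sl2[OF g]])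
  show "is_derivation (sl2_crv g) (\<lambda>x. sl2_crv g (crv_der x))"
    by (rule is_derivation_hom_left[OF is_derivation_crv_der[OF q_zero] is_ring_hom_sl2[OF g]])
qed (simp_all only: crv_der_generators[OF q_zero] sl2_generators[OF g] sl2_hom[OF g] crv_der_lin)

lemma sl2_mapK:
  fixes g :: "'a ^ 2 ^ 2"
  assumes g: "g \<in> SL2"
  shows "diff_coeff (mapK (sl2_crv g) w) = sl2_crv g (diff_coeff w)"
  using diff_coeff_mapK[OF q_zero is_ring_hom_sl2[OF g], of 1 w] sl2_der[OF g] by simp

lemma sl2_lin:
  fixes g :: "'a ^ 2 ^ 2"
  assumes g: "g \<in> SL2"
  shows "sl2_crv g (lin a b) = lin (a * g$2$2 - b * g$2$1) (b * g$1$1 - a * g$1$2)"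
  by (simp add: sl2_hom[OF g] sl2_generators[OF g] cst_simps algebra_simps)

lemma sl2_lin_forms:
  fixes g :: "'a ^ 2 ^ 2"
  assumes g: "g \<in> SL2" and l: "l \<in> lin_forms"
  shows "sl2_crv g l \<in> lin_forms"
proof -
  obtain a b where ab: "l = lin a b" "(a, b) \<noteq> (0, 0)" using l by (auto simp: lin_forms_def)
  have "l \<noteq> 0" using lin_forms_unit[OF l] by (auto simp: crv_unit_def)
  have "(a * g$2$2 - b * g$2$1, b * g$1$1 - a * g$1$2) \<noteq> (0, 0)"
  proof
    assume "(a * g$2$2 - b * g$2$1, b * g$1$1 - a * g$1$2) = (0, 0)"
    then have "sl2_crv g l = 0" unfolding ab(1) sl2_lin[OF g] by (simp add: cst_simps)
    then have "l = 0" using sl2_inverse(2)[OF g, of l] sl2_hom(4)[OF matrix_inv_SL2(5)[OF g]] by simp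
    then show False using \<open>l \<noteq> 0\<close> by simp
  qed
  then show ?thesis unfolding ab(1) sl2_lin[OF g] lin_forms_def by blast
qed

lemma sl2_reg:
  fixes g :: "'a ^ 2 ^ 2"
  assumes g: "g \<in> SL2" and L: "L \<subseteq> lin_forms" and x: "x \<in> reg L"
  shows "sl2_crv g x \<in> reg (sl2_crv g ` L)"
proof -
  have "reg L \<subseteq> {x. sl2_crv g x \<in> reg (sl2_crv g ` L)}"
  proof (rule reg_subset)
    fix l assume l: "l \<in> L"
    then have inv: "sl2_crv g (inverse l) = inverse (sl2_crv g l)"
      using hom_inverse(2)[OF is_ring_hom_sl2[OF g] lin_forms_unit] L by blast
    have gl: "sl2_crv g l \<in> sl2_crv g ` L" using l by simp
    have "lin a b * inverse (sl2_crv g l) \<in> reg (sl2_crv g ` L)" for a b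
      unfolding distrib_right mult.assoc by (intro reg_closed reg_generators gl)
    then show "crv_u * inverse l \<in> {x. sl2_crv g x \<in> reg (sl2_crv g ` L)} \<and>
        crv_v * inverse l \<in> {x. sl2_crv g x \<in> reg (sl2_crv g ` L)} \<and>
        inverse l \<in> {x. sl2_crv g x \<in> reg (sl2_crv g ` L)}"
      unfolding mem_Collect_eq sl2_hom(3)[OF g] inv sl2_generators[OF g] using reg_generators(3)[OF gl] by blast
  qed (simp_all add: sl2_hom[OF g] sl2_generators[OF g] reg_closed)
  then show ?thesis using x by blast
qed

subsection \<open>Functions regular on two overlaps\<close>

lemma reg_scale:
  assumes "c \<noteq> 0" "crv_unit l"
  shows "reg (insert (cst c * l) L) \<subseteq> reg (insert (l :: ('a, 'a) crv) L)"
proof (rule reg_subset)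
  fix l' assume "l' \<in> insert (cst c * l) L"
  moreover have "inverse (cst c * l) = cst (inverse c) * inverse l"
    unfolding inverse_mult_crv[OF crv_unit_cst[OF assms(1)] assms(2)] inverse_cst[OF assms(1)] ..
  moreover have "x * (cst (inverse c) * inverse l) \<in> reg (insert l L)" if "x * inverse l \<in> reg (insert l L)" for x
    unfolding mult.left_commute[of x] by (rule reg_closed(3)[OF reg_closed(1) that])
  moreover have "cst (inverse c) * inverse l \<in> reg (insert l L)"
    by (intro reg_closed(3)[OF reg_closed(1)] reg_generators) simp
  ultimately show "crv_u * inverse l' \<in> reg (insert l L) \<and> crv_v * inverse l' \<in> reg (insert l L) \<and>
      inverse l' \<in> reg (insert l L)"
    by (elim insertE) (simp_all add: reg_generators)
qed (auto intro: reg_closed)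

lemma lcoeff_shift:
  fixes f :: "('a, 'a) crv"
  assumes "f \<in> lspan (window TYPE('a) c)"
  shows "lcoeff (c + a + b) (mm a b * f) (i + a, j + b) = lcoeff c f (i, j)"
proof -
  have z: "lcoeff c (0 :: ('a, 'a) crv) t = 0" for c t
    using lcoeff_scale[OF lspan_subspace(1), of c 0 t] by (simp add: cst_simps)
  have "f \<in> lspan (window TYPE('a) c) \<and> lcoeff (c + a + b) (mm a b * f) (i + a, j + b) = lcoeff c f (i, j)"
    using assms
  proof (induction f rule: lspan_induct)
    case (add f g)
    have "mm a b * h \<in> lspan (window TYPE('a) (c + a + b))" if "h \<in> lspan (window TYPE('a) c)" for h :: "('a, 'a) crv"
      by (rule subsetD[OF lspan_mono lspan_shift[OF that]]) (auto simp: window_def)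
    then show ?case using add by (simp add: lcoeff_add distrib_left lspan_subspace)
  next
    case (mm d i' j')
    have "mm a b * (cst d * mm i' j') = cst d * (mm (i' + a) (j' + b) :: ('a, 'a) crv)"
      by (simp add: mult.left_commute mm_mult add.commute)
    moreover have "(i' + a, j' + b) \<in> window TYPE('a) (c + a + b)" using mm by (auto simp: window_def)
    ultimately show ?case using mm by (auto simp: lcoeff_mm lspan_subspace mm_lspan)
  qed (simp add: z lspan_subspace)
  then show ?thesis ..
qed

text \<open>
  In terms of coefficients, division by \<open>a + b t\<^sub>1\<close> with \<open>a \<noteq> 0\<close> is a recursion which would continue
  a polar part at \<open>t\<^sub>1 = 0\<close> indefinitely.
\<close>

lemma reg_u_cancel:
  assumes f: "f \<in> reg {crv_u, crv_v}" and m: "lin a b * inverse crv_u * f \<in> reg {crv_u}" and a: "a \<noteq> 0"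
  shows "f \<in> reg {crv_u :: ('a, 'a) crv}"
proof -
  let ?c = "- int CARD('a)"
  have f': "f \<in> lspan (idx_uv TYPE('a))" using f by (simp add: reg_uv)
  have "mm (- 1) 1 * f \<in> lspan (idx_uv TYPE('a))"
    by (rule subsetD[OF lspan_mono lspan_shift[OF f']]) (auto simp: window_def)
  moreover have "lin a b * inverse crv_u * f = cst a * f + cst b * (mm (- 1) 1 * f)"
    by (simp add: mm_eqs mm_inverse algebra_simps) (simp add: mm_mult flip: mult.assoc)
  ultimately have co: "lcoeff ?c (lin a b * inverse crv_u * f) (i, j) =
      a * lcoeff ?c f (i, j) + b * lcoeff ?c f (i + 1, j - 1)" for i j
    using f' lcoeff_shift[OF f', of "- 1" 1 "i + 1" "j - 1"] by (simp add: lcoeff_add lcoeff_scale lspan_subspace)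
  have "a * lcoeff ?c f (i, j) = - (b * lcoeff ?c f (i + 1, j - 1))" if "j < 0" for i j
  proof -
    have "lcoeff ?c (lin a b * inverse crv_u * f) (i, j) = 0"
      using m that unfolding reg_u lspan_iff_lcoeff[OF idx_subset(1)] by (auto simp: idx_u_def)
    then show ?thesis unfolding co by (simp add: eq_neg_iff_add_eq_0)
  qed
  then have rec: "lcoeff ?c f (i + 1, j - 1) \<noteq> 0" if "j < 0" "lcoeff ?c f (i, j) \<noteq> 0" for i j
    using that a by (metis mult_eq_0_iff mult_zero_right neg_equal_0_iff_equal)
  have "lcoeff ?c f (i, j) = 0" if "j < 0" for i j
  proof (rule ccontr)
    assume nz: "lcoeff ?c f (i, j) \<noteq> 0"
    have "lcoeff ?c f (i + int s, j - int s) \<noteq> 0" for s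
    proof (induction s)
      case (Suc s)
      then show ?case using rec[of "j - int s" "i + int s"] that by (simp add: algebra_simps)
    qed (use nz in simp)
    then have "range (\<lambda>s. (i + int s, j - int s)) \<subseteq> {t. lcoeff ?c f t \<noteq> 0}" by auto
    moreover have "infinite (range (\<lambda>s. (i + int s, j - int s)))"
      by (rule range_inj_infinite) (auto simp: inj_def)
    ultimately show False using lcoeff_sum(1)[OF f' subset_refl] finite_subset by blast
  qed
  moreover have "lcoeff ?c f t = 0" if "t \<notin> idx_uv TYPE('a)" for t
    using f' that lspan_iff_lcoeff[OF subset_refl] by blast
  ultimately have "lcoeff ?c f (i, j) = 0" if "(i, j) \<notin> idx_u TYPE('a)" for i j
    using that by (cases "(i, j) \<in> idx_uv TYPE('a)") (auto simp: idx_u_def window_def)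
  then show ?thesis
    unfolding reg_u lspan_iff_lcoeff[OF idx_subset(1)] using f' by auto
qed

text \<open>
  An element of \<open>SL\<^sub>2\<close> moves \<open>l\<close> to \<open>u\<close>. A function on the intersection of \<open>U\<^sub>0\<close> with the set where
  another form \<open>m\<close> does not vanish becomes regular on \<open>U\<^sub>0\<close> when multiplied by a power of \<open>m/u\<close>, and
  these factors are cancelled one by one.
\<close>

lemma reg_overlap:
  assumes l: "l \<in> lin_forms" and f: "f \<in> reg {l, crv_u}" "f \<in> reg {l, crv_v}"
  shows "f \<in> reg {l :: ('a, 'a) crv}"
proof -
  obtain \<alpha> \<beta> where ab: "l = lin \<alpha> \<beta>" "(\<alpha>, \<beta>) \<noteq> (0, 0)" using l by (auto simp: lin_forms_def)
  consider "\<alpha> = 0" | "\<beta> = 0" | "\<alpha> \<noteq> 0" "\<beta> \<noteq> 0" by blast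
  then show ?thesis
  proof cases
    case 1
    then have "l = cst \<beta> * crv_v" "\<beta> \<noteq> 0" using ab by (simp_all add: cst_simps)
    moreover from this have "crv_v = cst (inverse \<beta>) * l" by (simp add: cst_simps flip: mult.assoc cst_simps(3))
    ultimately have "reg {l, crv_v} \<subseteq> reg {l}"
      using reg_scale[of "inverse \<beta>" l "{l}"] lin_forms_unit[OF l] by (simp add: insert_commute)
    then show ?thesis using f by auto
  next
    case 2
    then have "l = cst \<alpha> * crv_u" "\<alpha> \<noteq> 0" using ab by (simp_all add: cst_simps)
    moreover from this have "crv_u = cst (inverse \<alpha>) * l" by (simp add: cst_simps flip: mult.assoc cst_simps(3))
    ultimately have "reg {l, crv_u} \<subseteq> reg {l}"
      using reg_scale[of "inverse \<alpha>" l "{l}"] lin_forms_unit[OF l] by (simp add: insert_commute)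
    then show ?thesis using f by auto
  next
    case 3
    define g :: "'a ^ 2 ^ 2" where "g = vector [vector [inverse \<alpha>, - \<beta>], vector [0, \<alpha>]]"
    have g: "g \<in> SL2" using 3 by (simp add: g_def SL2_def det_2)
    let ?h = "matrix_inv g"
    have h: "?h \<in> SL2" by (rule matrix_inv_SL2(5)[OF g])
    have hc: "?h$1$1 = \<alpha>" "?h$1$2 = \<beta>" "?h$2$1 = 0" "?h$2$2 = inverse \<alpha>"
      unfolding matrix_inv_SL2(1-4)[OF g] by (simp_all add: g_def)
    have gu: "sl2_crv g crv_u = l" unfolding sl2_generators[OF g] ab(1) by (simp add: g_def)
    then have hl: "sl2_crv ?h l = crv_u" using sl2_inverse(2)[OF g, of crv_u] by simp
    have hv: "sl2_crv ?h crv_v = cst \<alpha> * crv_v" unfolding sl2_generators[OF h] hc by (simp add: cst_simps)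
    have hu: "sl2_crv ?h crv_u = lin (inverse \<alpha>) (- \<beta>)" unfolding sl2_generators[OF h] hc by simp
    define m where "m = lin (inverse \<alpha>) (- \<beta>)"
    have mu: "crv_unit m" using linear_form_lin[of "inverse \<alpha>" "- \<beta>"] 3 by (auto simp: m_def linear_form_def)
    define x where "x = sl2_crv ?h f"
    have "x \<in> reg {crv_u, cst \<alpha> * crv_v}"
      using sl2_reg[OF h _ f(2)] l uv_lin_forms by (simp add: x_def hl hv)
    then have x1: "x \<in> reg {crv_u, crv_v}"
      using reg_scale[OF 3(1) crv_unit_v, of "{crv_u}"] by (auto simp: insert_commute)
    have x2: "x \<in> reg {crv_u, m}"
      using sl2_reg[OF h _ f(1)] l uv_lin_forms by (simp add: x_def hl hu m_def)
    let ?r = "m * inverse crv_u"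
    have r: "?r \<in> reg {crv_u}"
      unfolding m_def distrib_right mult.assoc by (intro reg_closed reg_generators) simp_all
    let ?R = "{y. \<exists>M. ?r ^ M * y \<in> reg {crv_u}}"
    have rm: "?r * inverse m = inverse crv_u"
      using crv_unitD(1)[OF mu] by (metis mult.assoc mult.commute mult_1)
    have "reg {crv_u, m} \<subseteq> ?R"
    proof (rule reg_subset)
      fix c :: 'a
      have "?r ^ 0 * cst c \<in> reg {crv_u}" by (simp add: reg_closed)
      then show "cst c \<in> ?R" by blast
    next
      fix y z assume "y \<in> ?R" "z \<in> ?R"
      then obtain M N where MN: "?r ^ M * y \<in> reg {crv_u}" "?r ^ N * z \<in> reg {crv_u}" by blast
      have "?r ^ N * (?r ^ M * y) + ?r ^ M * (?r ^ N * z) \<in> reg {crv_u}" "(?r ^ M * y) * (?r ^ N * z) \<in> reg {crv_u}"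
        by (intro reg_closed(2,3) reg_closed(3)[OF reg_closed(4)[OF r]] MN)+
      moreover have "?r ^ N * (?r ^ M * y) + ?r ^ M * (?r ^ N * z) = ?r ^ (M + N) * (y + z)"
        "(?r ^ M * y) * (?r ^ N * z) = ?r ^ (M + N) * (y * z)"
        by (simp_all add: power_add algebra_simps)
      ultimately have "?r ^ (M + N) * (y + z) \<in> reg {crv_u}" "?r ^ (M + N) * (y * z) \<in> reg {crv_u}"
        by simp_all
      then show "y + z \<in> ?R" "y * z \<in> ?R" by blast+
    next
      fix l' assume "l' \<in> {crv_u, m}"
      then show "crv_u * inverse l' \<in> ?R \<and> crv_v * inverse l' \<in> ?R \<and> inverse l' \<in> ?R"
      proof
        assume "l' = crv_u"
        then have "?r ^ 0 * (crv_u * inverse l') \<in> reg {crv_u}" "?r ^ 0 * (crv_v * inverse l') \<in> reg {crv_u}"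
          "?r ^ 0 * inverse l' \<in> reg {crv_u}" by (auto intro: reg_generators)
        then show ?thesis by blast
      next
        assume "l' \<in> {m}"
        then have l': "?r * inverse l' = inverse crv_u" using rm by simp
        have "?r ^ 1 * (crv_u * inverse l') = crv_u * (?r * inverse l')" "?r ^ 1 * (crv_v * inverse l') = crv_v * (?r * inverse l')"
          "?r ^ 1 * inverse l' = ?r * inverse l'" by (simp_all add: mult_ac)
        then have "?r ^ 1 * (crv_u * inverse l') \<in> reg {crv_u}" "?r ^ 1 * (crv_v * inverse l') \<in> reg {crv_u}"
          "?r ^ 1 * inverse l' \<in> reg {crv_u}" unfolding l' by (auto intro: reg_generators)
        then show ?thesis by blast
      qed
    qed
    then obtain M where "?r ^ M * x \<in> reg {crv_u}" using x2 by blast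
    then have "x \<in> reg {crv_u}"
    proof (induction M)
      case (Suc M)
      have "?r ^ M * x \<in> reg {crv_u, crv_v}"
        by (rule reg_closed(3)[OF reg_closed(4) x1]) (use r reg_mono[of "{crv_u}" "{crv_u, crv_v}"] in auto)
      moreover have "?r * (?r ^ M * x) \<in> reg {crv_u}" using Suc(2) by (simp add: mult.assoc)
      ultimately have "?r ^ M * x \<in> reg {crv_u}"
        unfolding m_def by (rule reg_u_cancel) (use 3 in simp)
      then show ?case by (rule Suc(1))
    qed simp
    then have "sl2_crv g x \<in> reg {l}" using sl2_reg[OF g, of "{crv_u}" x] uv_lin_forms gu by simp
    then show ?thesis using sl2_inverse(1)[OF g, of f] by (simp add: x_def)
  qed
qed

section \<open>The cocycle of a homogeneous polynomial\<close>

text \<open>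
  For \<open>G\<close> of degree \<open>k + q - 1\<close> the form \<open>G \<eta>\<close> has poles along \<open>Z = 0\<close>. Where \<open>l \<noteq> 0\<close>, they are
  removed by subtracting the differential of \<open>G / (k l\<^sup>q\<^sup>-\<^sup>1)\<close>. The differences of these functions
  make up a cocycle for the cover by all complements of rational lines. The construction treats all
  linear forms alike, and this is why it is equivariant.
\<close>

definition cyc_phi :: "('a, 'a) crv \<Rightarrow> ('a, 'a) crv \<Rightarrow> ('a, 'a) crv" where
  "cyc_phi l G = cst (inverse (of_nat k)) * (G * inverse l ^ (CARD('a) - 1))"

definition cyc_w :: "('a, 'a) crv \<Rightarrow> ('a, 'a) crv \<Rightarrow> ('a, 'a) kaehler" where
  "cyc_w G l = form (G - crv_der (cyc_phi l G))"

definition cyc_f :: "('a, 'a) crv \<Rightarrow> ('a, 'a) crv \<Rightarrow> ('a, 'a) crv \<Rightarrow> ('a, 'a) crv" where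
  "cyc_f G l m = cyc_phi m G - cyc_phi l G"

definition cyc :: "('a, 'a) crv \<Rightarrow> ('a, 'a) dR_cochain" where
  "cyc G = (cyc_w G crv_u, cyc_w G crv_v, cyc_f G crv_u crv_v)"

lemma crv_der_inverse_power:
  assumes l: "linear_form (l :: ('a, 'a) crv)"
  shows "crv_der (inverse l ^ (CARD('a) - 1)) = 1"
proof -
  have lu: "crv_unit l" and dl: "crv_der l = l ^ CARD('a)" using l by (auto simp: linear_form_def)
  have "of_nat (CARD('a) - 1) = (- 1 :: ('a, 'a) crv)"
    using q_zero_crv of_nat_diff[of 1 "CARD('a)", where ?'a = "('a, 'a) crv"] card_gt_2 by simp
  moreover have "inverse l ^ (CARD('a) - 1 - 1) * inverse l ^ 2 = inverse l ^ CARD('a)"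
  proof -
    have "CARD('a) - 1 - 1 + 2 = CARD('a)" using card_gt_2 by simp
    then show ?thesis by (simp only: power_add[symmetric])
  qed
  moreover have "inverse l ^ CARD('a) * l ^ CARD('a) = 1"
    using crv_unitD(2)[OF lu] by (simp flip: power_mult_distrib)
  ultimately show ?thesis
    by (simp add: crv_der_power[OF q_zero] crv_der_inverse[OF q_zero lu] dl flip: mult.assoc)
qed

lemma k_inverse: "cst (inverse (of_nat k)) * (of_nat k * x) = (x :: ('a, 'a) crv)"
  using k_inverse_crv by (simp flip: mult.assoc)

lemma of_nat_k_q: "of_nat (k + CARD('a) - 1) + 1 = (of_nat k :: ('a, 'a) crv)"
proof -
  have "of_nat (k + CARD('a) - 1) + 1 = (of_nat (k + CARD('a) - 1 + 1) :: ('a, 'a) crv)"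
    by (simp only: of_nat_add of_nat_1)
  also have "k + CARD('a) - 1 + 1 = k + CARD('a)" using card_gt_2 by simp
  finally show ?thesis by (simp only: of_nat_add q_zero_crv add_0_right)
qed

text \<open>
  The degree of \<open>G\<close> is \<open>k - 1\<close> in \<open>\<bbbF>\<close>, and \<open>D (l\<^sup>1\<^sup>-\<^sup>q) = 1\<close> contributes one more multiple of \<open>G\<close>. This
  determines the factor \<open>1/k\<close> in the definition of \<open>cyc_phi\<close>.
\<close>

lemma crv_der_cyc_phi:
  assumes l: "linear_form (l :: ('a, 'a) crv)" and G: "G \<in> hom_crv (k + CARD('a) - 1)"
  shows "\<exists>N\<in>hom_crv (k + CARD('a) - 2). crv_der (cyc_phi l G) = G + inverse l ^ CARD('a) * N"
proof -
  obtain N where N: "N \<in> hom_crv (k + CARD('a) - 1 - 1)"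
    "crv_der G * inverse l ^ (CARD('a) - 1) = of_nat (k + CARD('a) - 1) * G + inverse l ^ CARD('a) * N"
    using crv_der_euler[OF l G] by blast
  have "crv_der (cyc_phi l G) = cst (inverse (of_nat k)) * (G * 1 + crv_der G * inverse l ^ (CARD('a) - 1))"
    by (simp add: cyc_phi_def crv_der_rules[OF q_zero] crv_der_generators[OF q_zero]
        crv_der_inverse_power[OF l] mult.commute del: One_nat_def)
  also have "\<dots> = cst (inverse (of_nat k)) * ((of_nat (k + CARD('a) - 1) + 1) * G + inverse l ^ CARD('a) * N)"
    unfolding N(2) by (simp add: algebra_simps)
  also have "\<dots> = cst (inverse (of_nat k)) * (of_nat k * G) + inverse l ^ CARD('a) * (cst (inverse (of_nat k)) * N)"
    unfolding of_nat_k_q by (simp add: algebra_simps)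
  finally show ?thesis
    unfolding k_inverse
    by (rule bexI[OF _ hom_crv_subspace(3)]) (use N(1) in \<open>simp add: numeral_2_eq_2\<close>)
qed

lemma cyc_w_Omega:
  assumes l: "linear_form (l :: ('a, 'a) crv)" and G: "G \<in> hom_crv (k + CARD('a) - 1)"
  shows "cyc_w G l \<in> Omega {l}"
proof -
  have lu: "crv_unit l" using l by (simp add: linear_form_def)
  obtain N where N: "N \<in> hom_crv (k + CARD('a) - 2)" "crv_der (cyc_phi l G) = G + inverse l ^ CARD('a) * N"
    using crv_der_cyc_phi[OF l G] by blast
  define s where "s = CARD('a) + (CARD('a) - 2)"
  have "N * inverse l ^ s \<in> reg {l}"
    by (rule hom_over_power_reg[OF lu _ N(1)]) (use k_less_q card_gt_2 in \<open>simp add: s_def\<close>)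
  moreover have "l ^ (CARD('a) - 2) * (- (N * inverse l ^ s)) = - (inverse l ^ CARD('a) * N) * (inverse l * l) ^ (CARD('a) - 2)"
    unfolding s_def power_add power_mult_distrib by (simp add: mult_ac)
  ultimately show ?thesis
    unfolding Omega_iff[OF q_zero l] cyc_w_def diff_coeff_form[OF q_zero] N(2)
    using crv_unitD(2)[OF lu] by (intro bexI[of _ "- (N * inverse l ^ s)"] reg_closed(7)) simp_all
qed

text \<open>
  Over the common denominator \<open>l\<^sup>q m\<^sup>q\<close> the difference of \<open>l\<^sup>1\<^sup>-\<^sup>q\<close> and \<open>m\<^sup>1\<^sup>-\<^sup>q\<close> has the constant numerator
  \<open>l m\<^sup>q - l\<^sup>q m\<close> up to sign, so that the pole along \<open>Z = 0\<close> disappears.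
\<close>

lemma cyc_f_lin:
  assumes ab: "(a, b) \<noteq> (0, 0)" and cd: "(c, d) \<noteq> (0, 0)"
  shows "cyc_f G (lin a b) (lin c d) = cst (inverse (of_nat k)) * (cst (b * c - a * d) *
     (G * (inverse (lin a b) ^ CARD('a) * inverse (lin c d) ^ CARD('a))))"
proof -
  define l where "l = lin a b"
  define m where "m = lin c d"
  have lu: "crv_unit l" and mu: "crv_unit m"
    using linear_form_lin[OF ab] linear_form_lin[OF cd] by (auto simp: l_def m_def linear_form_def)
  have iq: "inverse x ^ CARD('a) * x = inverse x ^ (CARD('a) - 1)" "inverse x ^ CARD('a) * x ^ CARD('a) = 1"
    if "crv_unit x" for x :: "('a, 'a) crv"
  proof -
    have "inverse x ^ CARD('a) = inverse x ^ (CARD('a) - 1) * inverse x" by (simp flip: power_Suc2)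
    then show "inverse x ^ CARD('a) * x = inverse x ^ (CARD('a) - 1)" using crv_unitD(2)[OF that] by (simp add: mult.assoc)
    show "inverse x ^ CARD('a) * x ^ CARD('a) = 1" using crv_unitD(2)[OF that] by (simp flip: power_mult_distrib)
  qed
  have "inverse m ^ (CARD('a) - 1) - inverse l ^ (CARD('a) - 1) =
      (inverse m ^ CARD('a) * m) * (inverse l ^ CARD('a) * l ^ CARD('a)) - (inverse l ^ CARD('a) * l) * (inverse m ^ CARD('a) * m ^ CARD('a))"
    by (simp add: iq[OF lu] iq[OF mu])
  also have "\<dots> = - (l * m ^ CARD('a) - l ^ CARD('a) * m) * (inverse l ^ CARD('a) * inverse m ^ CARD('a))"
    by (simp add: algebra_simps)
  also have "- (l * m ^ CARD('a) - l ^ CARD('a) * m) = cst (b * c - a * d)"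
    unfolding l_def m_def lin_wronskian by (simp add: cst_simps)
  finally have "G * inverse m ^ (CARD('a) - 1) - G * inverse l ^ (CARD('a) - 1) =
      cst (b * c - a * d) * (G * (inverse l ^ CARD('a) * inverse m ^ CARD('a)))"
    unfolding right_diff_distrib[symmetric] by (simp add: mult.left_commute)
  then show ?thesis
    unfolding cyc_f_def cyc_phi_def l_def[symmetric] m_def[symmetric] right_diff_distrib[symmetric] by simp
qed

lemma cyc_f_reg:
  assumes "l \<in> lin_forms" "m \<in> lin_forms" "G \<in> hom_crv (k + CARD('a) - 1)"
  shows "cyc_f G l m \<in> reg {l, m}"
proof -
  obtain a b c d where *: "l = lin a b" "(a, b) \<noteq> (0, 0)" "m = lin c d" "(c, d) \<noteq> (0, 0)"
    using assms(1,2) unfolding lin_forms_def by blast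
  have "G * (inverse l ^ CARD('a) * inverse m ^ CARD('a)) \<in> reg {l, m}"
    by (rule hom_over_two_powers_reg[OF lin_forms_unit[OF assms(1)] lin_forms_unit[OF assms(2)] _ assms(3)])
       (use k_less_q in simp)
  then show ?thesis
    unfolding *(1,3) cyc_f_lin[OF *(2,4)] by (intro reg_closed(3)[OF reg_closed(1)])
qed

lemma full_cyc:
  assumes G: "G \<in> hom_crv (k + CARD('a) - 1)"
  shows "cyc_f G \<in> full_Z_O" "(cyc_w G, cyc_f G) \<in> full_Z_dR"
proof -
  show 1: "cyc_f G \<in> full_Z_O"
    unfolding full_Z_O_def using cyc_f_reg[OF _ _ G] by (auto simp: cyc_f_def)
  have "dK (cyc_f G l m) = cyc_w G l - cyc_w G m" for l m
    by (simp add: dK_eq_form[OF q_zero] cyc_f_def cyc_w_def crv_der_rules[OF q_zero] form_rules)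
  then show "(cyc_w G, cyc_f G) \<in> full_Z_dR"
    unfolding full_Z_dR_def using 1 cyc_w_Omega[OF lin_forms_linear_form G] by blast
qed

lemma cyc_linear:
  "cyc_phi l (G + G') = cyc_phi l G + cyc_phi l G'" "cyc_phi l (cst c * G) = cst c * cyc_phi l G"
  "cyc (G + G') = cyc G + cyc G'"
  "cyc (cst c * G) = (cst c \<bullet>\<^sub>K cyc_w G crv_u, cst c \<bullet>\<^sub>K cyc_w G crv_v, cst c * cyc_f G crv_u crv_v)"
proof -
  show 1: "cyc_phi l (G + G') = cyc_phi l G + cyc_phi l G'" "cyc_phi l (cst c * G) = cst c * cyc_phi l G" for l G G' c
    by (simp_all add: cyc_phi_def algebra_simps)
  have "cyc_w (G + G') l = cyc_w G l + cyc_w G' l" for l G G'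
    by (simp add: cyc_w_def 1 crv_der_rules[OF q_zero] form_rules)
  then show "cyc (G + G') = cyc G + cyc G'"
    by (simp add: cyc_def cyc_f_def 1 plus_prod_def)
  have "cyc_w (cst c * G) l = cst c \<bullet>\<^sub>K cyc_w G l" for l G c
    unfolding cyc_w_def 1 crv_der_cst_mult[OF q_zero] right_diff_distrib[symmetric] form_rules(5) ..
  then show "cyc (cst c * G) = (cst c \<bullet>\<^sub>K cyc_w G crv_u, cst c \<bullet>\<^sub>K cyc_w G crv_v, cst c * cyc_f G crv_u crv_v)"
    by (simp add: cyc_def cyc_f_def 1 right_diff_distrib)
qed

subsection \<open>Exact polynomials and multiples of the equation\<close>

lemma B_dR_I: "f0 \<in> reg {crv_u} \<Longrightarrow> f1 \<in> reg {crv_v} \<Longrightarrow> (dK f0, dK f1, f0 - f1) \<in> B_dR"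
  by (auto simp: B_dR_def)

text \<open>
  By \<open>crv_der_euler\<close>, now in degree \<open>k\<close>, the function \<open>F\<close> agrees with \<open>\<phi>\<^sub>l\<close> up to a function which is
  regular on \<open>U\<^sub>l\<close>. Hence the cocycle is the coboundary of the functions \<open>F - \<phi>\<^sub>l\<close>. Here \<open>\<phi>\<^sub>l\<close> belongs to \<open>G = D F\<close>.
\<close>

lemma cyc_crv_der:
  assumes F: "F \<in> hom_crv k"
  shows "cyc (crv_der F) \<in> B_dR"
proof -
  have reg: "F - cyc_phi l (crv_der F) \<in> reg {l}" if l: "linear_form l" for l
  proof -
    have lu: "crv_unit l" using l by (simp add: linear_form_def)
    obtain N where N: "N \<in> hom_crv (k - 1)"
      "crv_der F * inverse l ^ (CARD('a) - 1) = of_nat k * F + inverse l ^ CARD('a) * N"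
      using crv_der_euler[OF l F] by blast
    have "N * inverse l ^ CARD('a) \<in> reg {l}"
      by (rule hom_over_power_reg[OF lu _ N(1)]) (use k_less_q in simp)
    moreover have "F - cyc_phi l (crv_der F) = - (cst (inverse (of_nat k)) * (N * inverse l ^ CARD('a)))"
      unfolding cyc_phi_def N(2) distrib_left k_inverse by (simp add: mult.commute)
    ultimately show ?thesis by (simp add: reg_closed)
  qed
  have "cyc (crv_der F) = (dK (F - cyc_phi crv_u (crv_der F)), dK (F - cyc_phi crv_v (crv_der F)),
      (F - cyc_phi crv_u (crv_der F)) - (F - cyc_phi crv_v (crv_der F)))"
    by (simp add: cyc_def cyc_f_def cyc_w_def dK_eq_form[OF q_zero] crv_der_rules[OF q_zero])
  then show ?thesis
    using B_dR_I[OF reg[OF linear_form_uv(1)[OF q_zero]] reg[OF linear_form_uv(2)[OF q_zero]]] by simp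
qed

text \<open>
  In degree \<open>k - 2 < q\<close> the functions \<open>\<phi>\<^sub>l\<close> are regular on \<open>U\<^sub>l\<close>, and they are a coboundary between
  the cocycle and the global form. These degrees belong to multiples of \<open>\<theta>\<^sub>q\<close>, on which \<open>eps\<close> is of
  degree \<open>k - 2\<close>.
\<close>

lemma cyc_low_degree:
  assumes G: "G \<in> hom_crv (k - 2)"
  shows "(form G, form G, 0) - cyc G \<in> B_dR"
proof -
  have reg: "cyc_phi l G \<in> reg {l}" if l: "crv_unit l" for l
    unfolding cyc_phi_def
    by (intro reg_closed(3)[OF reg_closed(1)] hom_over_power_reg[OF l _ G]) (use k_less_q in simp)
  have "(form G, form G, 0) - cyc G = (dK (cyc_phi crv_u G), dK (cyc_phi crv_v G), cyc_phi crv_u G - cyc_phi crv_v G)"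
    by (simp add: cyc_def cyc_f_def cyc_w_def dK_eq_form[OF q_zero] form_rules minus_prod_def)
  then show ?thesis using B_dR_I[OF reg[OF crv_unit_u] reg[OF crv_unit_v]] by simp
qed

section \<open>Action of \<open>SL\<^sub>2\<close> on cohomology classes\<close>

text \<open>
  Two cocycles for the large cover which are cohomologous on \<open>U\<^sub>0\<close>, \<open>U\<^sub>1\<close> are cohomologous: the
  function \<open>c l\<close> is regular on the intersections of \<open>U\<^sub>l\<close> with \<open>U\<^sub>0\<close> and with \<open>U\<^sub>1\<close>, thus on \<open>U\<^sub>l\<close>.
\<close>

lemma full_Z_O_unique:
  fixes f f' :: "('a, 'a) crv \<Rightarrow> ('a, 'a) crv \<Rightarrow> ('a, 'a) crv"
  assumes f: "f \<in> full_Z_O" and f': "f' \<in> full_Z_O"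
    and b: "b0 \<in> reg {crv_u}" "b1 \<in> reg {crv_v}" and eq: "f crv_u crv_v = f' crv_u crv_v + (b0 - b1)"
  defines "c \<equiv> \<lambda>l. f l crv_u - f' l crv_u + b0"
  shows "\<And>l. l \<in> lin_forms \<Longrightarrow> c l \<in> reg {l}"
    "\<And>l m. l \<in> lin_forms \<Longrightarrow> m \<in> lin_forms \<Longrightarrow> f l m = f' l m + (c l - c m)"
proof -
  have r: "g l m \<in> reg {l, m}" if "g \<in> full_Z_O" "l \<in> lin_forms" "m \<in> lin_forms"
    for g :: "('a, 'a) crv \<Rightarrow> ('a, 'a) crv \<Rightarrow> ('a, 'a) crv" and l m
    using that by (auto simp: full_Z_O_def)
  have co: "g l m + g m x = g l x" if "g \<in> full_Z_O" "l \<in> lin_forms" "m \<in> lin_forms" "x \<in> lin_forms"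
    for g :: "('a, 'a) crv \<Rightarrow> ('a, 'a) crv \<Rightarrow> ('a, 'a) crv" and l m x
    using that by (auto simp: full_Z_O_def)
  note u = uv_lin_forms(1) and v = uv_lin_forms(2)
  show "c l \<in> reg {l}" if l: "l \<in> lin_forms" for l
  proof (rule reg_overlap[OF l])
    show "c l \<in> reg {l, crv_u}"
      unfolding c_def using b(1) reg_mono[of "{crv_u}" "{l, crv_u}"]
      by (intro reg_closed(2) reg_closed(8) r[OF f l u] r[OF f' l u]) auto
    have "c l = f l crv_v - f' l crv_v + b1"
    proof -
      have "f l crv_u = f l crv_v - f crv_u crv_v" "f' l crv_u = f' l crv_v - f' crv_u crv_v"
        using co[OF f l u v] co[OF f' l u v] by (simp_all add: eq_diff_eq)
      then show ?thesis by (simp add: c_def eq)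
    qed
    then show "c l \<in> reg {l, crv_v}"
      using b(2) reg_mono[of "{crv_v}" "{l, crv_v}"] r[OF f l v] r[OF f' l v] by (auto intro!: reg_closed(2,8))
  qed
  show "f l m = f' l m + (c l - c m)" if l: "l \<in> lin_forms" and m: "m \<in> lin_forms" for l m
    unfolding c_def using co[OF f l m u] co[OF f' l m u] by (simp add: algebra_simps)
qed

lemma full_Z_dR_unique:
  fixes f f' :: "('a, 'a) crv \<Rightarrow> ('a, 'a) crv \<Rightarrow> ('a, 'a) crv" and w w' :: "('a, 'a) crv \<Rightarrow> ('a, 'a) kaehler"
  assumes f: "(w, f) \<in> full_Z_dR" and f': "(w', f') \<in> full_Z_dR"
    and b: "b0 \<in> reg {crv_u}" "b1 \<in> reg {crv_v}" and eq: "f crv_u crv_v = f' crv_u crv_v + (b0 - b1)"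
    and weq: "w crv_u = w' crv_u + dK b0" and l: "l \<in> lin_forms"
  shows "w l = w' l + dK (f l crv_u - f' l crv_u + b0)"
proof -
  have "dK (f l crv_u) = w l - w crv_u" "dK (f' l crv_u) = w' l - w' crv_u"
    using f f' l uv_lin_forms by (auto simp: full_Z_dR_def)
  moreover have "dK (f l crv_u - f' l crv_u + b0) = dK (f l crv_u) - dK (f' l crv_u) + dK b0"
    by (simp add: dK_eq_form[OF q_zero] crv_der_rules[OF q_zero] form_rules)
  ultimately show ?thesis using weq by simp
qed

lemma sl2_cyc_phi:
  fixes g :: "'a ^ 2 ^ 2"
  assumes g: "g \<in> SL2" and l: "l \<in> lin_forms"
  shows "sl2_crv g (cyc_phi l G) = cyc_phi (sl2_crv g l) (sl2_crv g G)"
  unfolding cyc_phi_def sl2_hom(3,7)[OF g] sl2_generators[OF g]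
    hom_inverse(2)[OF is_ring_hom_sl2[OF g] lin_forms_unit[OF l]] ..

lemma sl2_cyc_w:
  fixes g :: "'a ^ 2 ^ 2"
  assumes g: "g \<in> SL2" and l: "l \<in> lin_forms"
  shows "mapK (sl2_crv g) (cyc_w G l) = cyc_w (sl2_crv g G) (sl2_crv g l)"
  unfolding kaehler_eq_iff[OF q_zero] sl2_mapK[OF g] cyc_w_def diff_coeff_form[OF q_zero] sl2_hom(6)[OF g]
    sl2_der[OF g, symmetric] sl2_cyc_phi[OF g l] ..

lemma sl2_mapK_dK:
  fixes g :: "'a ^ 2 ^ 2"
  assumes g: "g \<in> SL2"
  shows "mapK (sl2_crv g) (dK f) = dK (sl2_crv g f)"
  unfolding kaehler_eq_iff[OF q_zero] sl2_mapK[OF g] diff_coeff_rules(4)[OF q_zero] sl2_der[OF g] ..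

lemma sl2_mapK_add:
  fixes g :: "'a ^ 2 ^ 2"
  assumes g: "g \<in> SL2"
  shows "mapK (sl2_crv g) (w + w') = mapK (sl2_crv g) w + mapK (sl2_crv g) w'"
  unfolding kaehler_eq_iff[OF q_zero] by (simp add: sl2_mapK[OF g] diff_coeff_rules[OF q_zero] sl2_hom[OF g])

lemma crv_u_neq_v: "(crv_u :: ('a, 'a) crv) \<noteq> crv_v"
proof
  assume "(crv_u :: ('a, 'a) crv) = crv_v"
  then show False using crv_relation[where 'a = 'a and 'e = 'a] by (simp add: mult.commute)
qed

text \<open>The coboundary that has prescribed values at the forms which \<open>g\<close> moves to \<open>u\<close> and \<open>v\<close>.\<close>

lemma sl2_cochain_exists:
  fixes g :: "'a ^ 2 ^ 2"
  assumes g: "g \<in> SL2" and h: "h0 \<in> reg {crv_u}" "h1 \<in> reg {crv_v}"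
  shows "\<exists>c. (\<forall>l\<in>lin_forms. c l \<in> reg {l}) \<and> sl2_crv g (c (sl2_crv (matrix_inv g) crv_u)) = h0 \<and>
     sl2_crv g (c (sl2_crv (matrix_inv g) crv_v)) = h1"
proof -
  let ?g' = "matrix_inv g"
  have g': "?g' \<in> SL2" by (rule matrix_inv_SL2(5)[OF g])
  have ne: "sl2_crv ?g' crv_u \<noteq> sl2_crv ?g' crv_v"
    using sl2_inverse(1)[OF g] crv_u_neq_v by metis
  have r: "sl2_crv ?g' h0 \<in> reg {sl2_crv ?g' crv_u}" "sl2_crv ?g' h1 \<in> reg {sl2_crv ?g' crv_v}"
    using sl2_reg[OF g' _ h(1)] sl2_reg[OF g' _ h(2)] uv_lin_forms by auto
  show ?thesis
    by (rule exI[of _ "\<lambda>l. if l = sl2_crv ?g' crv_u then sl2_crv ?g' h0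
        else if l = sl2_crv ?g' crv_v then sl2_crv ?g' h1 else 0"])
       (use r ne sl2_inverse(1)[OF g] in \<open>auto simp: reg_closed\<close>)
qed

lemma Z_O_coset: "B_O +>\<^bsub>Z_O\<^esub> f = {(f0 - f1) + f | f0 f1. f0 \<in> reg {crv_u} \<and> f1 \<in> reg {crv_v}}"
  unfolding a_r_coset_eq_image Z_O_def B_O_def by auto

lemma Z_dR_coset:
  "B_dR +>\<^bsub>Z_dR\<^esub> (w0, w1, f) =
    {(dK f0 + w0, dK f1 + w1, (f0 - f1) + f) | f0 f1. f0 \<in> reg {crv_u} \<and> f1 \<in> reg {crv_v}}"
proof -
  have "B_dR +>\<^bsub>Z_dR\<^esub> (w0, w1, f) = (\<lambda>z. z + (w0, w1, f)) ` B_dR"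
    by (simp add: a_r_coset_eq_image Z_dR_def)
  also have "\<dots> = {(dK f0 + w0, dK f1 + w1, (f0 - f1) + f) | f0 f1. f0 \<in> reg {crv_u} \<and> f1 \<in> reg {crv_v}}"
  proof (rule equalityI; rule subsetI)
    fix z assume "z \<in> (\<lambda>z. z + (w0, w1, f)) ` B_dR"
    then obtain f0 f1 where "f0 \<in> reg {crv_u}" "f1 \<in> reg {crv_v}" "z = (dK f0, dK f1, f0 - f1) + (w0, w1, f)"
      unfolding B_dR_def by blast
    then show "z \<in> {(dK f0 + w0, dK f1 + w1, (f0 - f1) + f) | f0 f1. f0 \<in> reg {crv_u} \<and> f1 \<in> reg {crv_v}}"
      unfolding add_Pair by blast
  next
    fix z assume "z \<in> {(dK f0 + w0, dK f1 + w1, (f0 - f1) + f) | f0 f1. f0 \<in> reg {crv_u} \<and> f1 \<in> reg {crv_v}}"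
    then obtain f0 f1 where 1: "f0 \<in> reg {crv_u}" "f1 \<in> reg {crv_v}" and z: "z = (dK f0 + w0, dK f1 + w1, (f0 - f1) + f)"
      by blast
    show "z \<in> (\<lambda>z. z + (w0, w1, f)) ` B_dR"
      by (rule image_eqI[OF _ B_dR_I[OF 1]]) (simp add: z)
  qed
  finally show ?thesis .
qed

text \<open>
  The action is defined by all extensions of a class to the large cover. They differ from the cocycle
  of \<open>G\<close> by coboundaries, which gives one inclusion; conversely, \<open>sl2_cochain_exists\<close> provides an
  extension for each member of the class on the right.
\<close>

lemma sl2_O_cyc:
  fixes g :: "'a ^ 2 ^ 2"
  assumes g: "g \<in> SL2" and G: "G \<in> hom_crv (k + CARD('a) - 1)"
  shows "sl2_O g (B_O +>\<^bsub>Z_O\<^esub> cyc_f G crv_u crv_v) = B_O +>\<^bsub>Z_O\<^esub> cyc_f (sl2_crv g G) crv_u crv_v"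
proof (rule equalityI; rule subsetI)
  let ?g' = "matrix_inv g"
  have g': "?g' \<in> SL2" by (rule matrix_inv_SL2(5)[OF g])
  define x where "x = sl2_crv ?g' crv_u"
  define y where "y = sl2_crv ?g' crv_v"
  have xy: "x \<in> lin_forms" "y \<in> lin_forms" "sl2_crv g x = crv_u" "sl2_crv g y = crv_v"
    using sl2_lin_forms[OF g'] uv_lin_forms sl2_inverse(1)[OF g] by (auto simp: x_def y_def)
  have cf: "sl2_crv g (cyc_f G x y) = cyc_f (sl2_crv g G) crv_u crv_v"
    by (simp add: cyc_f_def sl2_hom[OF g] sl2_cyc_phi[OF g] xy)
  {
    fix z assume "z \<in> sl2_O g (B_O +>\<^bsub>Z_O\<^esub> cyc_f G crv_u crv_v)"
    then obtain f b0 b1 where f: "f \<in> full_Z_O" and z: "z = sl2_crv g (f x y)" and b: "b0 \<in> reg {crv_u}" "b1 \<in> reg {crv_v}"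
      and eq: "f crv_u crv_v = (b0 - b1) + cyc_f G crv_u crv_v"
      unfolding sl2_O_def sl2_full_O_def Z_O_coset x_def y_def by blast
    define c where "c l = f l crv_u - cyc_f G l crv_u + b0" for l
    note un = full_Z_O_unique[OF f full_cyc(1)[OF G] b eq[unfolded add.commute[of "b0 - b1"]], folded c_def]
    have "sl2_crv g (c x) \<in> reg {crv_u}" "sl2_crv g (c y) \<in> reg {crv_v}"
      using sl2_reg[OF g _ un(1)[OF xy(1)]] sl2_reg[OF g _ un(1)[OF xy(2)]] xy by auto
    moreover have "z = (sl2_crv g (c x) - sl2_crv g (c y)) + cyc_f (sl2_crv g G) crv_u crv_v"
      unfolding z un(2)[OF xy(1,2)] by (simp add: sl2_hom[OF g] cf)
    ultimately show "z \<in> B_O +>\<^bsub>Z_O\<^esub> cyc_f (sl2_crv g G) crv_u crv_v"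
      unfolding Z_O_coset by blast
  }
  {
    fix z assume "z \<in> B_O +>\<^bsub>Z_O\<^esub> cyc_f (sl2_crv g G) crv_u crv_v"
    then obtain h0 h1 where h: "h0 \<in> reg {crv_u}" "h1 \<in> reg {crv_v}"
      and z: "z = (h0 - h1) + cyc_f (sl2_crv g G) crv_u crv_v" unfolding Z_O_coset by blast
    obtain c where c: "\<And>l. l \<in> lin_forms \<Longrightarrow> c l \<in> reg {l}" "sl2_crv g (c x) = h0" "sl2_crv g (c y) = h1"
      using sl2_cochain_exists[OF g h] unfolding x_def y_def by blast
    define f where "f l m = cyc_f G l m + (c l - c m)" for l m
    have cr: "c l \<in> reg {l, m}" "c m \<in> reg {l, m}" if "l \<in> lin_forms" "m \<in> lin_forms" for l m
      using c(1) that reg_mono[of "{l}" "{l, m}"] reg_mono[of "{m}" "{l, m}"] by auto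
    have "f \<in> full_Z_O"
      unfolding full_Z_O_def f_def using cr cyc_f_reg[OF _ _ G]
      by (auto intro!: reg_closed(2,8)) (simp add: cyc_f_def)
    moreover have "f crv_u crv_v \<in> B_O +>\<^bsub>Z_O\<^esub> cyc_f G crv_u crv_v"
      unfolding Z_O_coset f_def using c(1) uv_lin_forms by (auto simp: add.commute)
    moreover have "z = sl2_crv g (f x y)"
      unfolding z f_def by (simp add: sl2_hom[OF g] cf c)
    ultimately show "z \<in> sl2_O g (B_O +>\<^bsub>Z_O\<^esub> cyc_f G crv_u crv_v)"
      unfolding sl2_O_def sl2_full_O_def x_def y_def by blast
  }
qed

lemma sl2_dR_cyc:
  fixes g :: "'a ^ 2 ^ 2"
  assumes g: "g \<in> SL2" and G: "G \<in> hom_crv (k + CARD('a) - 1)"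
  shows "sl2_dR g (B_dR +>\<^bsub>Z_dR\<^esub> cyc G) = B_dR +>\<^bsub>Z_dR\<^esub> cyc (sl2_crv g G)"
proof (rule equalityI; rule subsetI)
  let ?g' = "matrix_inv g"
  have g': "?g' \<in> SL2" by (rule matrix_inv_SL2(5)[OF g])
  define x where "x = sl2_crv ?g' crv_u"
  define y where "y = sl2_crv ?g' crv_v"
  have xy: "x \<in> lin_forms" "y \<in> lin_forms" "sl2_crv g x = crv_u" "sl2_crv g y = crv_v"
    using sl2_lin_forms[OF g'] uv_lin_forms sl2_inverse(1)[OF g] by (auto simp: x_def y_def)
  have cf: "sl2_crv g (cyc_f G x y) = cyc_f (sl2_crv g G) crv_u crv_v"
    by (simp add: cyc_f_def sl2_hom[OF g] sl2_cyc_phi[OF g] xy)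
  have cw: "mapK (sl2_crv g) (cyc_w G x) = cyc_w (sl2_crv g G) crv_u"
    "mapK (sl2_crv g) (cyc_w G y) = cyc_w (sl2_crv g G) crv_v"
    by (simp_all add: sl2_cyc_w[OF g] xy)
  {
    fix z assume "z \<in> sl2_dR g (B_dR +>\<^bsub>Z_dR\<^esub> cyc G)"
    then obtain w f b0 b1 where f: "(w, f) \<in> full_Z_dR"
      and z: "z = (mapK (sl2_crv g) (w x), mapK (sl2_crv g) (w y), sl2_crv g (f x y))"
      and b: "b0 \<in> reg {crv_u}" "b1 \<in> reg {crv_v}"
      and eq: "f crv_u crv_v = cyc_f G crv_u crv_v + (b0 - b1)" "w crv_u = cyc_w G crv_u + dK b0"
      unfolding sl2_dR_def sl2_full_O_def sl2_full_Omega_def Z_dR_coset cyc_def x_def y_def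
      by (auto simp: add.commute)
    have f': "f \<in> full_Z_O" using f by (simp add: full_Z_dR_def)
    define c where "c l = f l crv_u - cyc_f G l crv_u + b0" for l
    note un = full_Z_O_unique[OF f' full_cyc(1)[OF G] b eq(1), folded c_def]
    note unw = full_Z_dR_unique[OF f full_cyc(2)[OF G] b eq, folded c_def]
    have "sl2_crv g (c x) \<in> reg {crv_u}" "sl2_crv g (c y) \<in> reg {crv_v}"
      using sl2_reg[OF g _ un(1)[OF xy(1)]] sl2_reg[OF g _ un(1)[OF xy(2)]] xy by auto
    moreover have "z = (dK (sl2_crv g (c x)) + cyc_w (sl2_crv g G) crv_u, dK (sl2_crv g (c y)) + cyc_w (sl2_crv g G) crv_v,
        (sl2_crv g (c x) - sl2_crv g (c y)) + cyc_f (sl2_crv g G) crv_u crv_v)"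
      unfolding z un(2)[OF xy(1,2)] unw[OF xy(1)] unw[OF xy(2)]
      by (simp add: sl2_hom[OF g] cf cw sl2_mapK_add[OF g] sl2_mapK_dK[OF g] add.commute)
    ultimately show "z \<in> B_dR +>\<^bsub>Z_dR\<^esub> cyc (sl2_crv g G)"
      unfolding Z_dR_coset cyc_def by blast
  }
  {
    fix z assume "z \<in> B_dR +>\<^bsub>Z_dR\<^esub> cyc (sl2_crv g G)"
    then obtain h0 h1 where h: "h0 \<in> reg {crv_u}" "h1 \<in> reg {crv_v}"
      and z: "z = (dK h0 + cyc_w (sl2_crv g G) crv_u, dK h1 + cyc_w (sl2_crv g G) crv_v,
        (h0 - h1) + cyc_f (sl2_crv g G) crv_u crv_v)" unfolding Z_dR_coset cyc_def by blast
    obtain c where c: "\<And>l. l \<in> lin_forms \<Longrightarrow> c l \<in> reg {l}" "sl2_crv g (c x) = h0" "sl2_crv g (c y) = h1"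
      using sl2_cochain_exists[OF g h] unfolding x_def y_def by blast
    define f where "f l m = cyc_f G l m + (c l - c m)" for l m
    define w where "w l = cyc_w G l + dK (c l)" for l
    have cr: "c l \<in> reg {l, m}" "c m \<in> reg {l, m}" if "l \<in> lin_forms" "m \<in> lin_forms" for l m
      using c(1) that reg_mono[of "{l}" "{l, m}"] reg_mono[of "{m}" "{l, m}"] by auto
    have "f \<in> full_Z_O"
      unfolding full_Z_O_def f_def using cr cyc_f_reg[OF _ _ G]
      by (auto intro!: reg_closed(2,8)) (simp add: cyc_f_def)
    moreover have "w l \<in> Omega {l}" if "l \<in> lin_forms" for l
    proof -
      have "1 \<bullet>\<^sub>K dK (c l) \<in> Omega {l}" by (rule Omega.intros(2)) (use c(1) that in \<open>auto simp: reg_closed\<close>)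
      then show ?thesis
        unfolding w_def using Omega.intros(3)[OF cyc_w_Omega[OF lin_forms_linear_form[OF that] G]]
        by (simp add: scaleK_rules)
    qed
    moreover have "dK (f l m) = w l - w m" for l m
      unfolding f_def w_def cyc_f_def cyc_w_def
      by (simp add: dK_eq_form[OF q_zero] crv_der_rules[OF q_zero] form_rules)
    ultimately have "(w, f) \<in> full_Z_dR" by (simp add: full_Z_dR_def)
    moreover have "(w crv_u, w crv_v, f crv_u crv_v) \<in> B_dR +>\<^bsub>Z_dR\<^esub> cyc G"
      unfolding Z_dR_coset cyc_def f_def w_def using c(1) uv_lin_forms by (auto simp: add.commute)
    moreover have "z = (mapK (sl2_crv g) (w x), mapK (sl2_crv g) (w y), sl2_crv g (f x y))"
      unfolding z f_def w_def by (simp add: sl2_hom[OF g] cf cw c sl2_mapK_add[OF g] sl2_mapK_dK[OF g] add.commute)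
    ultimately show "z \<in> sl2_dR g (B_dR +>\<^bsub>Z_dR\<^esub> cyc G)"
      unfolding sl2_dR_def sl2_full_O_def sl2_full_Omega_def x_def y_def by blast
  }
qed

end

section \<open>Cohomology spaces\<close>

lemma mapK_rules:
  fixes h :: "('a::{finite,field}, 'e::field) crv \<Rightarrow> ('a, 'f::field) crv"
  assumes q0e: "of_nat CARD('a) = (0 :: 'e)" and q0f: "of_nat CARD('a) = (0 :: 'f)"
    and h: "is_ring_hom h" and d: "\<And>f. crv_der (h f) = lam * h (crv_der f)"
  shows "mapK h (w + w') = mapK h w + mapK h w'" "mapK h (dK f) = dK (h f)"
    "mapK h (f \<bullet>\<^sub>K w) = h f \<bullet>\<^sub>K mapK h w" "mapK h 0 = 0"
proof -
  note D = diff_coeff_mapK[OF q0f h d]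
  show "mapK h (w + w') = mapK h w + mapK h w'" "mapK h (dK f) = dK (h f)"
    "mapK h (f \<bullet>\<^sub>K w) = h f \<bullet>\<^sub>K mapK h w" "mapK h 0 = 0"
    unfolding kaehler_eq_iff[OF q0f]
    by (simp_all add: D diff_coeff_rules[OF q0e] diff_coeff_rules[OF q0f] is_ring_homD[OF h] d algebra_simps)
qed

lemma lspan_Un: "f \<in> lspan (S \<union> S') \<longleftrightarrow> (\<exists>g h. f = g + h \<and> g \<in> lspan S \<and> h \<in> lspan S')"
  unfolding lspan_def image_Un cv.span_Un by auto

text \<open>
  The monomials which are regular on the intersection of \<open>U\<^sub>0\<close> and \<open>U\<^sub>1\<close>, but on neither of these sets.
  Their classes are a basis of \<open>H\<^sup>1(C, \<O>\<^sub>C)\<close>.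
\<close>

definition idx_pole :: "'a::finite itself \<Rightarrow> (int \<times> int) set" where
  "idx_pole _ = {(i, j). - int CARD('a) \<le> i + j \<and> i < 0 \<and> j < 0}"

lemma B_O_eq:
  "B_O = (lspan (idx_u TYPE('a) \<union> idx_v TYPE('a)) :: ('a::{finite,field}, 'e::field) crv set)"
proof (rule equalityI; rule subsetI)
  fix f :: "('a, 'e) crv" assume "f \<in> B_O"
  then obtain g h where "f = g - h" "g \<in> lspan (idx_u TYPE('a))" "h \<in> lspan (idx_v TYPE('a))"
    unfolding B_O_def reg_u reg_v by blast
  then have "f = g + (- h)" "g \<in> lspan (idx_u TYPE('a))" "- h \<in> lspan (idx_v TYPE('a))"
    by (simp_all add: lspan_subspace)
  then show "f \<in> lspan (idx_u TYPE('a) \<union> idx_v TYPE('a))" unfolding lspan_Un by blast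
next
  fix f :: "('a, 'e) crv" assume "f \<in> lspan (idx_u TYPE('a) \<union> idx_v TYPE('a))"
  then obtain g h where "f = g + h" "g \<in> lspan (idx_u TYPE('a))" "h \<in> lspan (idx_v TYPE('a))"
    unfolding lspan_Un by blast
  then have "f = g - (- h)" "g \<in> lspan (idx_u TYPE('a))" "- h \<in> lspan (idx_v TYPE('a))"
    by (simp_all add: lspan_subspace)
  then show "f \<in> B_O" unfolding B_O_def reg_u reg_v by blast
qed

lemma idx_split:
  "idx_u TYPE('a::finite) \<union> idx_v TYPE('a) \<subseteq> idx_uv TYPE('a)"
  "idx_uv TYPE('a) - (idx_u TYPE('a) \<union> idx_v TYPE('a)) = idx_pole TYPE('a)"
  "idx_uv TYPE('a) = (idx_u TYPE('a) \<union> idx_v TYPE('a)) \<union> idx_pole TYPE('a)"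
  by (auto simp: idx_u_def idx_v_def idx_pole_def window_def)

lemma vec_space_Z_O: "vec_space (Z_O :: ('e::field, ('a::{finite,field}, 'e) crv) module)"
  unfolding Z_O_def by (rule vec_space_type_module) (auto simp: reg_closed cst_simps algebra_simps)

lemma sub_space_B_O: "sub_space (Z_O :: ('e::field, ('a::{finite,field}, 'e) crv) module) B_O"
  unfolding Z_O_def sub_space_type_module B_O_eq reg_uv using lspan_mono[OF idx_split(1)]
  by (auto intro: lspan_subspace)

lemma Omega_add: "w \<in> Omega L \<Longrightarrow> w' \<in> Omega L \<Longrightarrow> w + w' \<in> Omega L"
  by (rule Omega.intros)

lemma Omega_scale: "w \<in> Omega L \<Longrightarrow> f \<in> reg L \<Longrightarrow> f \<bullet>\<^sub>K w \<in> Omega L"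
proof (induction w rule: Omega.induct)
  case (2 g h)
  then show ?case by (simp add: reg_closed Omega.intros flip: scaleK_rules(3))
qed (auto simp: scaleK_rules intro: Omega.intros)

lemma Omega_dK: "f \<in> reg L \<Longrightarrow> dK f \<in> Omega L"
  using Omega.intros(2)[OF reg_closed(6), of f L] by (simp add: scaleK_rules)

definition scale_dR :: "'e::field \<Rightarrow> ('a::{finite,field}, 'e) dR_cochain \<Rightarrow> ('a, 'e) dR_cochain" where
  "scale_dR = (\<lambda>c (w0, w1, f). (cst c \<bullet>\<^sub>K w0, cst c \<bullet>\<^sub>K w1, cst c * f))"

definition cocycles_dR :: "('a::{finite,field}, 'e::field) dR_cochain set" where
  "cocycles_dR = {(w0, w1, f). w0 \<in> Omega {crv_u} \<and> w1 \<in> Omega {crv_v} \<and> f \<in> reg {crv_u, crv_v} \<and> dK f = w0 - w1}"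

lemma Z_dR_eq: "Z_dR = type_module scale_dR cocycles_dR"
  by (simp add: Z_dR_def scale_dR_def cocycles_dR_def)

context
  fixes TA :: "'a::{finite,field} itself" and TE :: "'e::field itself"
  assumes q0: "of_nat CARD('a) = (0 :: 'e)"
begin

lemma dK_rules:
  "dK (0 :: ('a, 'e) crv) = 0" "dK (f - g :: ('a, 'e) crv) = dK f - dK g" "dK (- f :: ('a, 'e) crv) = - dK f"
  "dK (cst c * f :: ('a, 'e) crv) = cst c \<bullet>\<^sub>K dK f"
  by (simp_all add: dK_eq_form[OF q0] crv_der_rules[OF q0] crv_der_cst_mult[OF q0] crv_der_generators[OF q0]
      form_rules scaleK_rules)

lemma vec_space_Z_dR: "vec_space (Z_dR :: ('e, ('a, 'e) dR_cochain) module)"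
  unfolding Z_dR_eq
proof (rule vec_space_type_module)
  show "0 \<in> (cocycles_dR :: ('a, 'e) dR_cochain set)"
    by (simp add: cocycles_dR_def zero_prod_def Omega.intros reg_closed dK_rules)
  show "x + y \<in> cocycles_dR" if "x \<in> cocycles_dR" "y \<in> cocycles_dR" for x y :: "('a, 'e) dR_cochain"
    using that by (cases x; cases y) (simp add: cocycles_dR_def Omega_add reg_closed kaehler_relations)
  show "scale_dR c x \<in> cocycles_dR" if "x \<in> cocycles_dR" for c and x :: "('a, 'e) dR_cochain"
    using that by (cases x) (simp add: cocycles_dR_def scale_dR_def Omega_scale reg_closed dK_rules scaleK_rules)
qed (auto simp: scale_dR_def scaleK_rules cst_simps algebra_simps)

lemma sub_space_B_dR: "sub_space (Z_dR :: ('e, ('a, 'e) dR_cochain) module) B_dR"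
  unfolding Z_dR_eq sub_space_type_module
proof (intro conjI ballI allI subsetI)
  fix x :: "('a, 'e) dR_cochain" assume "x \<in> B_dR"
  then obtain f0 f1 where x: "x = (dK f0, dK f1, f0 - f1)" and f: "f0 \<in> reg {crv_u}" "f1 \<in> reg {crv_v}"
    unfolding B_dR_def by blast
  then have "f0 \<in> reg {crv_u, crv_v}" "f1 \<in> reg {crv_u, crv_v}"
    using reg_mono[of "{crv_u}" "{crv_u, crv_v}"] reg_mono[of "{crv_v}" "{crv_u, crv_v}"] by auto
  then show "x \<in> cocycles_dR" using f by (simp add: x cocycles_dR_def Omega_dK reg_closed dK_rules)
  show "scale_dR c x \<in> B_dR" for c
  proof -
    have "scale_dR c x = (dK (cst c * f0), dK (cst c * f1), cst c * f0 - cst c * f1)"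
      by (simp add: x scale_dR_def dK_rules right_diff_distrib)
    moreover have "cst c * f0 \<in> reg {crv_u}" "cst c * f1 \<in> reg {crv_v}" using f by (auto intro: reg_closed)
    ultimately show ?thesis unfolding B_dR_def by blast
  qed
  fix y :: "('a, 'e) dR_cochain" assume "y \<in> B_dR"
  then obtain g0 g1 where y: "y = (dK g0, dK g1, g0 - g1)" and g: "g0 \<in> reg {crv_u}" "g1 \<in> reg {crv_v}"
    unfolding B_dR_def by blast
  have "x + y = (dK (f0 + g0), dK (f1 + g1), (f0 + g0) - (f1 + g1))"
    by (simp add: x y kaehler_relations)
  moreover have "f0 + g0 \<in> reg {crv_u}" "f1 + g1 \<in> reg {crv_v}" using f g by (auto intro: reg_closed)
  ultimately show "x + y \<in> B_dR" unfolding B_dR_def by blast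
next
  show "0 \<in> (B_dR :: ('a, 'e) dR_cochain set)"
    unfolding B_dR_def zero_prod_def
    by (auto intro!: exI[of _ 0] simp: dK_rules reg_closed)
qed

lemma B_dR_coset_eq_iff:
  assumes "x \<in> carrier Z_dR" "y \<in> carrier Z_dR"
  shows "B_dR +>\<^bsub>Z_dR\<^esub> x = B_dR +>\<^bsub>Z_dR\<^esub> y \<longleftrightarrow> x - y \<in> (B_dR :: ('a, 'e) dR_cochain set)"
  unfolding coset_eq_iff[OF vec_space_Z_dR sub_space_B_dR assms]
  using a_minus_type_module[OF vec_space_Z_dR[unfolded Z_dR_eq]] assms by (simp add: Z_dR_eq)

lemma B_O_coset_eq_iff:
  assumes "x \<in> carrier Z_O" "y \<in> carrier Z_O"
  shows "B_O +>\<^bsub>Z_O\<^esub> x = B_O +>\<^bsub>Z_O\<^esub> y \<longleftrightarrow> x - y \<in> (B_O :: ('a, 'e) crv set)"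
  unfolding coset_eq_iff[OF vec_space_Z_O sub_space_B_O assms]
  using a_minus_type_module[OF vec_space_Z_O[where 'a = 'a and 'e = 'e, unfolded Z_O_def]] assms by (simp add: Z_O_def)

lemma Omega_uv_iff:
  "w \<in> Omega {crv_u} \<longleftrightarrow> diff_coeff (w :: ('a, 'e) kaehler) \<in> lspan {(i, j). - 2 \<le> i + j \<and> i + j \<le> int CARD('a) - 2 \<and> 0 \<le> j}"
  "w \<in> Omega {crv_v} \<longleftrightarrow> diff_coeff (w :: ('a, 'e) kaehler) \<in> lspan {(i, j). - 2 \<le> i + j \<and> i + j \<le> int CARD('a) - 2 \<and> 0 \<le> i}"
proof -
  have q: "int (CARD('a) - 2) = int CARD('a) - 2" using card_field_ge_2[where 'a = 'a] by simp
  have *: "(\<exists>f\<in>lspan S. x = mm a b * f) \<longleftrightarrow> x \<in> lspan S'"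
    if "S' = (\<lambda>(i, j). (i + a, j + b)) ` S" for S S' a b and x :: "('a, 'e) crv"
  proof
    show "\<exists>f\<in>lspan S. x = mm a b * f \<Longrightarrow> x \<in> lspan S'" unfolding that using lspan_shift by blast
    assume "x \<in> lspan S'"
    then have "mm (- a) (- b) * x \<in> lspan ((\<lambda>(i, j). (i + - a, j + - b)) ` S')" by (rule lspan_shift)
    also have "(\<lambda>(i, j). (i + - a, j + - b)) ` S' = S" unfolding that image_image by (auto simp: case_prod_unfold)
    finally show "\<exists>f\<in>lspan S. x = mm a b * f"
      by (intro bexI[of _ "mm (- a) (- b) * x"]) (simp_all add: mm_mult flip: mult.assoc)
  qed
  have u: "crv_u ^ (CARD('a) - 2) = (mm (int CARD('a) - 2) 0 :: ('a, 'e) crv)"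
    and v: "crv_v ^ (CARD('a) - 2) = (mm 0 (int CARD('a) - 2) :: ('a, 'e) crv)"
    unfolding mm_eqs mm_power q by simp_all
  show "w \<in> Omega {crv_u} \<longleftrightarrow> diff_coeff w \<in> lspan {(i, j). - 2 \<le> i + j \<and> i + j \<le> int CARD('a) - 2 \<and> 0 \<le> j}"
    unfolding Omega_iff[OF q0 linear_form_uv(1)[OF q0]] reg_u u
  proof (rule *, rule Set.set_eqI)
    fix t show "t \<in> {(i, j). - 2 \<le> i + j \<and> i + j \<le> int CARD('a) - 2 \<and> 0 \<le> j} \<longleftrightarrow>
       t \<in> (\<lambda>(i, j). (i + (int CARD('a) - 2), j + 0)) ` idx_u TYPE('a)"
    proof -
      obtain a b where t: "t = (a, b)" by (cases t)
      show ?thesis by (auto simp: t idx_u_def image_iff intro!: exI[of _ "a - (int CARD('a) - 2)"])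
    qed
  qed
  show "w \<in> Omega {crv_v} \<longleftrightarrow> diff_coeff w \<in> lspan {(i, j). - 2 \<le> i + j \<and> i + j \<le> int CARD('a) - 2 \<and> 0 \<le> i}"
    unfolding Omega_iff[OF q0 linear_form_uv(2)[OF q0]] reg_v v
  proof (rule *, rule Set.set_eqI)
    fix t show "t \<in> {(i, j). - 2 \<le> i + j \<and> i + j \<le> int CARD('a) - 2 \<and> 0 \<le> i} \<longleftrightarrow>
       t \<in> (\<lambda>(i, j). (i + 0, j + (int CARD('a) - 2))) ` idx_v TYPE('a)"
    proof -
      obtain a b where t: "t = (a, b)" by (cases t)
      show ?thesis by (auto simp: t idx_v_def image_iff intro!: exI[of _ "b - (int CARD('a) - 2)"])
    qed
  qed
qed

lemma regular_forms_iff: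
  "w \<in> Omega {crv_u} \<inter> Omega {crv_v} \<longleftrightarrow>
     diff_coeff (w :: ('a, 'e) kaehler) \<in> lspan {(i, j). 0 \<le> i \<and> 0 \<le> j \<and> i + j \<le> int CARD('a) - 2}"
proof -
  let ?U = "{(i, j). - 2 \<le> i + j \<and> i + j \<le> int CARD('a) - 2 \<and> 0 \<le> j}"
  let ?V = "{(i, j). - 2 \<le> i + j \<and> i + j \<le> int CARD('a) - 2 \<and> 0 \<le> i}"
  have "?U \<subseteq> window TYPE('a) (- 2)" "?V \<subseteq> window TYPE('a) (- 2)" by (auto simp: window_def)
  then have 1: "lspan ?U \<inter> lspan ?V = (lspan (?U \<inter> ?V) :: ('a, 'e) crv set)" by (rule lspan_Int)
  have 2: "?U \<inter> ?V = {(i, j). 0 \<le> i \<and> 0 \<le> j \<and> i + j \<le> int CARD('a) - 2}" by auto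
  show ?thesis unfolding Int_iff Omega_uv_iff 1[unfolded 2, symmetric] ..
qed

lemma regular_functions_constant:
  assumes "f \<in> reg {crv_u}" "f \<in> reg {crv_v :: ('a, 'e) crv}"
  shows "\<exists>c. f = cst c"
proof -
  have "lspan (idx_u TYPE('a)) \<inter> lspan (idx_v TYPE('a)) = (lspan (idx_u TYPE('a) \<inter> idx_v TYPE('a)) :: ('a, 'e) crv set)"
    by (rule lspan_Int[OF idx_subset])
  also have "idx_u TYPE('a) \<inter> idx_v TYPE('a) = {(0, 0)}" by (auto simp: idx_u_def idx_v_def)
  finally have "f \<in> lspan {(0, 0)}" using assms by (auto simp: reg_u reg_v)
  then show ?thesis
  proof (induction f rule: lspan_induct)
    case zero
    show ?case by (rule exI[of _ 0]) (simp add: cst_simps)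
  next
    case (add f g)
    then obtain c d where "f = cst c" "g = cst d" by blast
    then show ?case by (intro exI[of _ "c + d"]) (simp add: cst_simps)
  qed auto
qed

lemma form_exact_imp_zero:
  assumes "(w, w, 0) \<in> (B_dR :: ('a, 'e) dR_cochain set)"
  shows "w = 0"
proof -
  obtain f0 f1 where f: "w = dK f0" "0 = f0 - f1" "f0 \<in> reg {crv_u}" "f1 \<in> reg {crv_v}"
    using assms unfolding B_dR_def by auto
  then obtain c where "f0 = cst c" using regular_functions_constant[of f0] by auto
  then show ?thesis unfolding f(1) by (simp add: kaehler_relations)
qed

end

section \<open>Weights\<close>

text \<open>The eigenspaces are compared over the algebraic closure, where there are enough roots of unity.\<close>

text \<open>
  There are \<open>N\<close> different \<open>N\<close>-th roots of unity, because \<open>z\<^sup>N - 1\<close> has no multiple roots. Hence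
  \<open>z\<^sup>r - 1\<close> with \<open>0 < r < N\<close> does not vanish at all of them.
\<close>

lemma roots_of_unity_dvd:
  fixes m :: int and N :: nat
  assumes N: "of_nat N \<noteq> (0 :: 'e::alg_closed_field)" and all: "\<And>z :: 'e. z ^ N = 1 \<Longrightarrow> z powi m = 1"
  shows "int N dvd m"
proof (rule ccontr)
  assume ndvd: "\<not> int N dvd m"
  have N0: "N > 0" using N by (cases N) auto
  define r where "r = nat (m mod int N)"
  have r: "0 < r" "r < N"
  proof -
    have "0 \<le> m mod int N" "m mod int N < int N" "m mod int N \<noteq> 0"
      using ndvd N0 by (simp_all add: dvd_eq_mod_eq_0)
    then show "0 < r" "r < N" unfolding r_def by linarith+
  qed
  have zr: "z ^ r = 1" if z: "z ^ N = 1" for z :: 'e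
  proof -
    have z0: "z \<noteq> 0" using z N0 by (metis power_0_left gr_implies_not0 zero_neq_one)
    have "m = int N * (m div int N) + int r" by (simp add: r_def N0)
    then have "z powi m = (z powi int N) powi (m div int N) * z powi int r"
      using z0 by (metis power_int_add power_int_mult)
    then show ?thesis using all[OF z] z by simp
  qed
  have dg: "Polynomial.degree (Polynomial.monom 1 s - 1 :: 'e poly) = s" if "0 < s" for s
    unfolding diff_conv_add_uminus using that
    by (subst degree_add_eq_left) (simp_all add: degree_monom_eq)
  define P :: "'e poly" where "P = Polynomial.monom 1 N - 1"
  have P: "poly P z = z ^ N - 1" for z by (simp add: P_def poly_monom)
  have dP: "poly (pderiv P) z = of_nat N * z ^ (N - 1)" for z
    by (simp add: P_def pderiv_diff pderiv_monom poly_monom pderiv_1)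
  have deg: "Polynomial.degree P = N"
    unfolding P_def by (rule dg[OF N0])
  then have P0: "P \<noteq> 0" using N0 by auto
  obtain A where A: "size A = N" "P = Polynomial.smult (lead_coeff P) (\<Prod>x\<in>#A. [:- x, 1:])"
    using alg_closed_imp_factorization[OF P0] deg by metis
  have rt: "x ^ N = 1" if "x \<in># A" for x
  proof -
    have "poly P x = 0" using that by (subst A(2)) (auto simp: poly_prod_mset image_iff)
    then show ?thesis by (simp add: P)
  qed
  have simple: "count A x = 1" if x: "x \<in># A" for x
  proof (rule ccontr)
    assume "count A x \<noteq> 1"
    moreover have "count A x > 0" using x by simp
    ultimately have "count A x \<ge> 2" by linarith
    then obtain B where B: "A = {#x, x#} + B"
      by (metis count_le_replicate_mset_subset_eq mset_subset_eq_exists_conv numeral_2_eq_2 replicate_mset_Suc replicate_mset_0)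
    then have "P = [:- x, 1:] * ([:- x, 1:] * Polynomial.smult (lead_coeff P) (\<Prod>x\<in>#B. [:- x, 1:]))"
      using A(2) by (metis (no_types, lifting) image_mset_add_mset mult_smult_right prod_mset.add_mset add_mset_add_single union_mset_add_mset_left add_cancel_left_left)
    then obtain R where R: "P = [:- x, 1:] * ([:- x, 1:] * R)" by blast
    have d: "poly (pderiv (L * (L * R))) x = 0" if "poly L x = 0" for L :: "'e poly"
      by (simp add: pderiv_mult that)
    have "poly (pderiv P) x = 0" unfolding R by (rule d) simp
    moreover have "x \<noteq> 0" using rt[OF x] N0 by (metis power_0_left gr_implies_not0 zero_neq_one)
    ultimately show False unfolding dP using N by simp
  qed
  have "A = mset_set (set_mset A)"
    by (rule multiset_eqI) (use simple in \<open>auto simp: count_mset_set' not_in_iff\<close>)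
  then have cardA: "card (set_mset A) = N" using A(1) by (metis size_mset_set)
  define Q :: "'e poly" where "Q = Polynomial.monom 1 r - 1"
  have "Polynomial.degree Q = r"
    unfolding Q_def by (rule dg[OF r(1)])
  then have Q0: "Q \<noteq> 0" "Polynomial.degree Q = r" using r by auto
  have "set_mset A \<subseteq> {x. poly Q x = 0}" using rt zr by (auto simp: Q_def poly_monom)
  then have "card (set_mset A) \<le> card {x. poly Q x = 0}"
    by (rule card_mono[OF poly_roots_finite[OF Q0(1)]])
  also have "\<dots> \<le> r" using card_poly_roots_bound[OF Q0(1)] Q0(2) by simp
  finally show False using cardA r by simp
qed

context curve_setup
begin

lemma is_ring_hom_to_ac: "is_ring_hom (to_ac :: 'a \<Rightarrow> _)"
  by (simp add: is_ring_hom_def)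

lemma
  shows is_ring_hom_bc: "is_ring_hom (bc :: ('a, 'a) crv \<Rightarrow> _)"
    and bc_generators: "bc (cst c :: ('a, 'a) crv) = cst (to_ac c)" "bc (crv_u :: ('a, 'a) crv) = crv_u"
      "bc (crv_v :: ('a, 'a) crv) = crv_v"
  unfolding bc_def using is_ring_hom_crv_subst[OF is_ring_hom_to_ac crv_relation]
    crv_subst_generators[OF is_ring_hom_to_ac crv_relation] by blast+

lemmas bc_hom = is_ring_homD[OF is_ring_hom_bc]

definition root :: "'a alg_closure \<Rightarrow> bool" where
  "root z \<longleftrightarrow> z ^ (CARD('a) + 1) = 1"

lemma root_nonzero: "root z \<Longrightarrow> z \<noteq> 0"
  by (auto simp: root_def)

lemma root_powi_cong:
  assumes z: "root z" and d: "int (CARD('a) + 1) dvd a - b"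
  shows "z powi a = z powi b"
proof -
  obtain c where "a = b + int (CARD('a) + 1) * c" using d by (auto elim!: dvdE simp: algebra_simps)
  moreover have "z \<noteq> 0" by (rule root_nonzero[OF z])
  ultimately have "z powi a = z powi b * (z powi int (CARD('a) + 1)) powi c"
    by (simp only: power_int_add power_int_mult simp_thms)
  also have "z powi int (CARD('a) + 1) = 1" using z unfolding root_def by (simp only: power_int_of_nat)
  finally show ?thesis by simp
qed

lemma
  assumes z: "root z"
  shows is_ring_hom_mu: "is_ring_hom (mu z :: ('a, 'a alg_closure) crv \<Rightarrow> _)"
    and mu_generators: "mu z (cst c :: ('a, 'a alg_closure) crv) = cst c"
      "mu z (crv_u :: ('a, 'a alg_closure) crv) = cst (inverse z) * crv_u"
      "mu z (crv_v :: ('a, 'a alg_closure) crv) = cst (inverse z) * crv_v"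
proof -
  let ?u = "crv_u :: ('a, 'a alg_closure) crv" and ?v = "crv_v :: ('a, 'a alg_closure) crv"
  have id: "is_ring_hom (id :: 'a alg_closure \<Rightarrow> _)" by (simp add: is_ring_hom_def)
  have "inverse z ^ (CARD('a) + 1) = 1" using z unfolding root_def power_inverse by simp
  then have "cst (inverse z) * cst (inverse z) ^ CARD('a) = (1 :: ('a, 'a alg_closure) crv)"
    by (simp add: cst_simps(1) flip: cst_simps(7) cst_simps(3))
  then have r: "(cst (inverse z) * ?u) * (cst (inverse z) * ?v) ^ CARD('a) - (cst (inverse z) * ?u) ^ CARD('a) * (cst (inverse z) * ?v) = 1"
  proof -
    assume 1: "cst (inverse z) * cst (inverse z) ^ CARD('a) = (1 :: ('a, 'a alg_closure) crv)"
    have "(cst (inverse z) * ?u) * (cst (inverse z) * ?v) ^ CARD('a) - (cst (inverse z) * ?u) ^ CARD('a) * (cst (inverse z) * ?v) =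
      (cst (inverse z) * cst (inverse z) ^ CARD('a)) * (?u * ?v ^ CARD('a) - ?u ^ CARD('a) * ?v)"
      by (simp add: power_mult_distrib algebra_simps)
    then show ?thesis unfolding 1 crv_relation by simp
  qed
  show "is_ring_hom (mu z :: ('a, 'a alg_closure) crv \<Rightarrow> _)"
    unfolding mu_def by (rule is_ring_hom_crv_subst[OF id r])
  show "mu z (cst c :: ('a, 'a alg_closure) crv) = cst c" "mu z ?u = cst (inverse z) * ?u" "mu z ?v = cst (inverse z) * ?v"
    unfolding mu_def crv_subst_generators[OF id r] by simp_all
qed

lemmas mu_hom = is_ring_homD[OF is_ring_hom_mu]

lemma bc_mm: "bc (mm i j :: ('a, 'a) crv) = mm i j"
  unfolding mm_def bc_hom(3) hom_powi[OF is_ring_hom_bc crv_unit_u] hom_powi[OF is_ring_hom_bc crv_unit_v] bc_generators ..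

lemma mu_mm:
  assumes z: "root z"
  shows "mu z (mm i j :: ('a, 'a alg_closure) crv) = cst (z powi - (i + j)) * mm i j"
proof -
  have z': "inverse z \<noteq> 0" using root_nonzero[OF z] by simp
  have "inverse z powi i * inverse z powi j = z powi (- (i + j))"
    using root_nonzero[OF z] by (simp only: power_int_inverse power_int_minus power_int_add inverse_mult_distrib simp_thms)
  then show ?thesis
    unfolding mm_def mu_hom(3)[OF z] hom_powi[OF is_ring_hom_mu[OF z] crv_unit_u] hom_powi[OF is_ring_hom_mu[OF z] crv_unit_v]
      mu_generators[OF z] powi_mult_crv[OF crv_unit_cst[OF z'] crv_unit_u] powi_mult_crv[OF crv_unit_cst[OF z'] crv_unit_v]
      cst_powi[OF z']
    by (metis (no_types, opaque_lifting) cst_simps(3) mult.assoc mult.left_commute)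
qed

lemma bc_der: "crv_der (bc x :: ('a, 'a alg_closure) crv) = 1 * bc (crv_der x)"
proof -
  have "crv_der (bc x :: ('a, 'a alg_closure) crv) = bc (crv_der x)"
  proof (rule crv_derivation_eqI[of bc "\<lambda>x. crv_der (bc x)" "\<lambda>x. bc (crv_der x)"])
    show "is_derivation bc (\<lambda>x. crv_der (bc x :: ('a, 'a alg_closure) crv))"
      by (rule is_derivation_hom_right[OF is_derivation_crv_der[OF q_zero_ac] is_ring_hom_bc])
    show "is_derivation bc (\<lambda>x. bc (crv_der x :: ('a, 'a) crv))"
      by (rule is_derivation_hom_left[OF is_derivation_crv_der[OF q_zero] is_ring_hom_bc])
  qed (simp_all add: bc_generators bc_hom crv_der_generators[OF q_zero] crv_der_generators[OF q_zero_ac])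
  then show ?thesis by simp
qed

lemma mu_der:
  assumes z: "root z"
  shows "crv_der (mu z x :: ('a, 'a alg_closure) crv) = cst (z powi - 2) * mu z (crv_der x)"
proof (rule crv_derivation_eqI[of "mu z" "\<lambda>x. crv_der (mu z x)" "\<lambda>x. cst (z powi - 2) * mu z (crv_der x)"])
  show "is_derivation (mu z) (\<lambda>x. crv_der (mu z x :: ('a, 'a alg_closure) crv))"
    by (rule is_derivation_hom_right[OF is_derivation_crv_der[OF q_zero_ac] is_ring_hom_mu[OF z]])
  have "is_derivation (mu z) (\<lambda>x. mu z (crv_der x :: ('a, 'a alg_closure) crv))"
    by (rule is_derivation_hom_left[OF is_derivation_crv_der[OF q_zero_ac] is_ring_hom_mu[OF z]])
  then show "is_derivation (mu z) (\<lambda>x. cst (z powi - 2) * mu z (crv_der x :: ('a, 'a alg_closure) crv))"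
    by (simp add: is_derivation_def algebra_simps)
  have "z powi - 2 * inverse z ^ CARD('a) = z powi (- 2 - int CARD('a))"
    using root_nonzero[OF z] by (simp add: power_int_diff divide_inverse power_inverse)
  also have "\<dots> = z powi (- 1)"
  proof (rule root_powi_cong[OF z])
    have "- 2 - int CARD('a) - - 1 = int (CARD('a) + 1) * - 1" by simp
    then show "int (CARD('a) + 1) dvd - 2 - int CARD('a) - - 1" by (metis dvd_triv_left)
  qed
  finally have "cst (z powi - 2) * cst (inverse z) ^ CARD('a) = (cst (inverse z) :: ('a, 'a alg_closure) crv)"
    by (simp add: power_int_minus flip: cst_simps(3,7))
  then show "crv_der (mu z crv_u) = cst (z powi - 2) * mu z (crv_der (crv_u :: ('a, 'a alg_closure) crv))"
    "crv_der (mu z crv_v) = cst (z powi - 2) * mu z (crv_der (crv_v :: ('a, 'a alg_closure) crv))"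
    by (simp_all add: mu_generators[OF z] mu_hom(7)[OF z] crv_der_generators[OF q_zero_ac] crv_der_cst_mult[OF q_zero_ac]
        power_mult_distrib flip: mult.assoc)
qed (simp add: mu_generators[OF z] mu_hom[OF z] crv_der_generators[OF q_zero_ac])

lemmas mapK_bc = mapK_rules[OF q_zero q_zero_ac is_ring_hom_bc bc_der]
lemmas mapK_mu = mapK_rules[OF q_zero_ac q_zero_ac is_ring_hom_mu mu_der]
lemmas diff_coeff_bc = diff_coeff_mapK[OF q_zero_ac is_ring_hom_bc bc_der]
lemmas diff_coeff_mu = diff_coeff_mapK[OF q_zero_ac is_ring_hom_mu mu_der]

text \<open>\<open>has_weight m\<close> are the functions of degree \<open>m\<close> for the grading modulo \<open>q + 1\<close>.\<close>

definition has_weight :: "int \<Rightarrow> ('a, 'a) crv \<Rightarrow> bool" where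
  "has_weight m x \<longleftrightarrow> (\<forall>z. root z \<longrightarrow> mu z (bc x) = cst (z powi - m) * bc x)"

lemma has_weight_mm: "has_weight (i + j) (mm i j)"
  by (simp add: has_weight_def bc_mm mu_mm)

lemma has_weight_rules:
  "has_weight m 0" "has_weight m x \<Longrightarrow> has_weight m y \<Longrightarrow> has_weight m (x + y)"
  "has_weight m x \<Longrightarrow> has_weight m y \<Longrightarrow> has_weight m (x - y)" "has_weight m x \<Longrightarrow> has_weight m (cst c * x)"
  by (auto simp: has_weight_def bc_hom mu_hom bc_generators mu_generators algebra_simps)

lemma has_weight_mult:
  assumes "has_weight m x" "has_weight m' y"
  shows "has_weight (m + m') (x * y)"
  unfolding has_weight_def
proof (intro allI impI)
  fix z assume z: "root z"
  have "z powi - (m + m') = z powi - m * z powi - m'"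
    using root_nonzero[OF z] by (simp only: minus_add_distrib power_int_add simp_thms)
  then show "mu z (bc (x * y)) = cst (z powi - (m + m')) * bc (x * y)"
    using assms z by (simp add: has_weight_def bc_hom mu_hom[OF z] cst_simps mult_ac)
qed

lemma has_weight_der:
  assumes "has_weight m x"
  shows "has_weight (m - 2) (crv_der x)"
  unfolding has_weight_def
proof (intro allI impI)
  fix z assume z: "root z"
  have "z powi - (m - 2) = z powi 2 * z powi - m" "z powi 2 * z powi - 2 = 1"
    using root_nonzero[OF z] by (simp_all add: power_int_minus power_int_diff divide_inverse)
  moreover have "cst (z powi - 2) * mu z (crv_der (bc x)) = cst (z powi - m) * crv_der (bc x)"
    using assms z mu_der[OF z, of "bc x"] by (simp add: has_weight_def crv_der_cst_mult[OF q_zero_ac])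
  ultimately have "mu z (crv_der (bc x)) = cst (z powi - (m - 2)) * crv_der (bc x)"
    by (metis (no_types) cst_simps(1,3) mult.assoc mult_1)
  then show "mu z (bc (crv_der x)) = cst (z powi - (m - 2)) * bc (crv_der x)" by (simp add: bc_der)
qed

lemma has_weight_cong:
  assumes "has_weight m x" "int (CARD('a) + 1) dvd m - m'"
  shows "has_weight m' x"
  unfolding has_weight_def
proof (intro allI impI)
  fix z assume z: "root z"
  have "int (CARD('a) + 1) dvd - m' - - m" using assms(2) by simp
  from root_powi_cong[OF z this] show "mu z (bc x) = cst (z powi - m') * bc x"
    using assms(1) z by (simp add: has_weight_def)
qed

lemma lcoeff_bc_mu:
  fixes x :: "('a, 'a) crv"
  assumes z: "root z" and x: "x \<in> lspan (window TYPE('a) c)"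
  shows "bc x \<in> lspan (window TYPE('a) c)" "mu z (bc x) \<in> lspan (window TYPE('a) c)"
    "lcoeff c (bc x) (i, j) = to_ac (lcoeff c x (i, j))"
    "lcoeff c (mu z (bc x)) (i, j) = z powi - (i + j) * to_ac (lcoeff c x (i, j))"
proof -
  have z0: "lcoeff c (0 :: ('a, 'e::field) crv) t = 0" for t
    using lcoeff_scale[OF lspan_subspace(1), of c 0 t] by (simp add: cst_simps)
  have "x \<in> lspan (window TYPE('a) c) \<and> bc x \<in> lspan (window TYPE('a) c) \<and> mu z (bc x) \<in> lspan (window TYPE('a) c) \<and>
    lcoeff c (bc x) (i, j) = to_ac (lcoeff c x (i, j)) \<and>
    lcoeff c (mu z (bc x)) (i, j) = z powi - (i + j) * to_ac (lcoeff c x (i, j))"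
    using x
  proof (induction x rule: lspan_induct)
    case zero
    then show ?case by (simp add: bc_hom mu_hom[OF z] lspan_subspace z0)
  next
    case (add f g)
    then show ?case by (simp add: bc_hom mu_hom[OF z] lspan_subspace lcoeff_add algebra_simps)
  next
    case (mm d i' j')
    have 1: "bc (cst d * mm i' j') = cst (to_ac d) * (mm i' j' :: ('a, 'a alg_closure) crv)"
      by (simp add: bc_hom bc_generators bc_mm)
    have 2: "mu z (cst (to_ac d) * (mm i' j' :: ('a, 'a alg_closure) crv)) = cst (to_ac d * z powi - (i' + j')) * mm i' j'"
      by (simp only: mu_hom[OF z] mu_generators[OF z] mu_mm[OF z] cst_simps mult.assoc)
    show ?case unfolding 1 2 using mm by (simp add: lspan_subspace mm_lspan lcoeff_mm)
  qed
  then show "bc x \<in> lspan (window TYPE('a) c)" "mu z (bc x) \<in> lspan (window TYPE('a) c)"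
    "lcoeff c (bc x) (i, j) = to_ac (lcoeff c x (i, j))"
    "lcoeff c (mu z (bc x)) (i, j) = z powi - (i + j) * to_ac (lcoeff c x (i, j))" by blast+
qed

text \<open>
  A root of unity \<open>z\<close> multiplies \<open>u\<^sup>i v\<^sup>j\<close> by the power of \<open>z\<close> with exponent \<open>-(i + j)\<close>. The set \<open>S\<close>
  allows for an ambiguity by coboundaries, which do not involve the coefficient in question.
\<close>

lemma degree_of_weight:
  fixes x :: "('a, 'a) crv"
  assumes x: "x \<in> lspan (window TYPE('a) c)" and S: "S \<subseteq> window TYPE('a) c"
    and wt: "\<And>z. root z \<Longrightarrow> mu z (bc x) - cst (z powi m) * bc x \<in> lspan S"
    and t: "(i, j) \<notin> S" "lcoeff c x (i, j) \<noteq> 0"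
  shows "int (CARD('a) + 1) dvd m + (i + j)"
proof (rule roots_of_unity_dvd)
  show "of_nat (CARD('a) + 1) \<noteq> (0 :: 'a alg_closure)" by (simp add: q_zero_ac)
  fix z :: "'a alg_closure" assume "z ^ (CARD('a) + 1) = 1"
  then have z: "root z" by (simp add: root_def)
  note b = lcoeff_bc_mu[OF z x]
  have "lcoeff c (mu z (bc x) - cst (z powi m) * bc x) (i, j) = 0"
    using wt[OF z] t(1) lspan_iff_lcoeff[OF S] by blast
  then have "z powi - (i + j) * to_ac (lcoeff c x (i, j)) = z powi m * to_ac (lcoeff c x (i, j))"
    using b by (simp add: lcoeff_diff lcoeff_scale lspan_subspace)
  then have "z powi - (i + j) = z powi m" using t(2) by simp
  then have "z powi m * z powi (i + j) = z powi - (i + j) * z powi (i + j)" by simp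
  also have "\<dots> = 1" using root_nonzero[OF z] by (simp flip: power_int_add)
  finally show "z powi (m + (i + j)) = 1" using root_nonzero[OF z] by (simp add: power_int_add)
qed

lemma dvd_abs_less_imp_zero: "d dvd a \<Longrightarrow> - d < a \<Longrightarrow> a < d \<Longrightarrow> a = (0 :: int)"
  using dvd_imp_le_int[of a d] by linarith

lemma has_weight_hom: "G \<in> hom_crv d \<Longrightarrow> has_weight (int d) G"
proof (induction G rule: hom_crv_induct)
  case (mon c i j)
  then show ?case using has_weight_rules(4)[OF has_weight_mm[of "int i" "int j"], of c] by (simp add: mm_nat flip: of_nat_add)
qed (auto intro: has_weight_rules)

lemma has_weight_cyc_phi:
  assumes "G \<in> hom_crv (k + CARD('a) - 1)"
  shows "has_weight (int k) (cyc_phi crv_u G)" "has_weight (int k) (cyc_phi crv_v G)"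
proof -
  have d: "int (k + CARD('a) - 1) + - int (CARD('a) - 1) = int k" using card_gt_2 by simp
  have "has_weight (- int (CARD('a) - 1)) (inverse crv_u ^ (CARD('a) - 1))"
    "has_weight (- int (CARD('a) - 1)) (inverse crv_v ^ (CARD('a) - 1))"
    using has_weight_mm[of "- int (CARD('a) - 1)" 0] has_weight_mm[of 0 "- int (CARD('a) - 1)"]
    by (simp_all add: mm_eqs mm_inverse mm_power)
  from has_weight_mult[OF has_weight_hom[OF assms] this(1)] has_weight_mult[OF has_weight_hom[OF assms] this(2)]
  show "has_weight (int k) (cyc_phi crv_u G)" "has_weight (int k) (cyc_phi crv_v G)"
    unfolding d cyc_phi_def by (auto intro: has_weight_rules)
qed

lemma form_weight_iff:
  assumes z: "root z"
  shows "mapK (mu z) (mapK bc w) = cst (z powi - m) \<bullet>\<^sub>K mapK bc w \<longleftrightarrow>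
     mu z (bc (diff_coeff w)) = cst (z powi - (m - 2)) * bc (diff_coeff (w :: ('a, 'a) kaehler))"
proof -
  have e: "z powi - 2 * z powi - (m - 2) = z powi - m"
    using root_nonzero[OF z] by (simp flip: power_int_add)
  have n: "z powi - 2 \<noteq> 0" using root_nonzero[OF z] by (simp add: power_int_not_zero)
  have "mapK (mu z) (mapK bc w) = cst (z powi - m) \<bullet>\<^sub>K mapK bc w \<longleftrightarrow>
      cst (z powi - 2) * mu z (bc (diff_coeff w)) = cst (z powi - m) * bc (diff_coeff w)"
    unfolding kaehler_eq_iff[OF q_zero_ac] diff_coeff_mu[OF z z] diff_coeff_rules(3)[OF q_zero_ac] diff_coeff_bc
    by simp
  also have "\<dots> \<longleftrightarrow> cst (z powi - 2) * mu z (bc (diff_coeff w)) = cst (z powi - 2) * (cst (z powi - (m - 2)) * bc (diff_coeff w))"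
    unfolding mult.assoc[symmetric] cst_simps(3)[symmetric] e ..
  finally show ?thesis unfolding crv_unit_cancel[OF crv_unit_cst[OF n]] .
qed

lemma weight_part_simps:
  "carrier (weight_part m M M' \<mu> b) = {x \<in> carrier M. \<forall>\<zeta>. \<zeta> ^ (CARD('a) + 1) = 1 \<longrightarrow> \<mu> \<zeta> (b x) = (\<zeta> powi m) \<odot>\<^bsub>M'\<^esub> b x}"
  "zero (weight_part m M M' \<mu> b) = zero M" "add (weight_part m M M' \<mu> b) = add M"
  "smult (weight_part m M M' \<mu> b) = smult M" for M :: "('a, 'm) module"
  by (simp_all add: weight_part_def)

lemma H0_weight_iff:
  "w \<in> carrier (H0_weight (- int k)) \<longleftrightarrow> w \<in> Omega {crv_u} \<inter> Omega {crv_v} \<and> has_weight (int k - 2) (diff_coeff (w :: ('a, 'a) kaehler))"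
  unfolding H0_weight_def weight_part_simps has_weight_def root_def[symmetric] using form_weight_iff[of _ w "int k"]
  by (auto simp: H0_def)

text \<open>
  The coefficients of global forms have degrees between \<open>0\<close> and \<open>q - 2\<close>, among which only \<open>k - 2\<close> is
  congruent to \<open>k - 2\<close> modulo \<open>q + 1\<close>.
\<close>

lemma carrier_H0_weight: "carrier (H0_weight (- int k)) = form ` hom_crv (k - 2)"
proof (rule equalityI; rule subsetI)
  let ?R = "{(i, j). 0 \<le> i \<and> 0 \<le> j \<and> i + j \<le> int CARD('a) - 2}"
  have R: "?R \<subseteq> window TYPE('a) (- 2)" by (auto simp: window_def)
  fix w :: "('a, 'a) kaehler" assume "w \<in> carrier (H0_weight (- int k))"
  then have w: "diff_coeff w \<in> lspan ?R" "has_weight (int k - 2) (diff_coeff w)"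
    unfolding H0_weight_iff regular_forms_iff[OF q_zero] by auto
  then have wW: "diff_coeff w \<in> lspan (window TYPE('a) (- 2))" using lspan_mono[OF R] by blast
  have S: "{(int i, int j) | i j. i + j = k - 2} \<subseteq> window TYPE('a) (- 2)"
    using k_less_q k_ge_2 by (auto simp: window_def)
  have "lcoeff (- 2) (diff_coeff w) (i, j) = 0" if "(i, j) \<notin> {(int i, int j) | i j. i + j = k - 2}" for i j
  proof (rule ccontr)
    assume nz: "lcoeff (- 2) (diff_coeff w) (i, j) \<noteq> 0"
    then have ij: "(i, j) \<in> ?R" using w(1) lspan_iff_lcoeff[OF R] by blast
    have "int (CARD('a) + 1) dvd (2 - int k) + (i + j)"
    proof (rule degree_of_weight[OF wW _ _ _ nz])
      show "mu z (bc (diff_coeff w)) - cst (z powi (2 - int k)) * bc (diff_coeff w) \<in> lspan {}" if "root z" for z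
        using w(2) that by (simp add: has_weight_def lspan_subspace)
    qed auto
    moreover have b: "2 - int k + (i + j) < int (CARD('a) + 1)" "- int (CARD('a) + 1) < 2 - int k + (i + j)"
      using ij k_less_q by auto
    ultimately have "2 - int k + (i + j) = 0" by (intro dvd_abs_less_imp_zero[of "int (CARD('a) + 1)"])
    then have "i + j = int k - 2" by simp
    then have "(i, j) = (int (nat i), int (nat j)) \<and> nat i + nat j = k - 2" using ij k_ge_2 by auto
    then show False using that by blast
  qed
  then have "diff_coeff w \<in> hom_crv (k - 2)"
    unfolding hom_crv_def lspan_iff_lcoeff[OF S] using wW by auto
  then show "w \<in> form ` hom_crv (k - 2)" using form_diff_coeff[OF q_zero, of w] by (metis imageI)
next
  fix w :: "('a, 'a) kaehler" assume "w \<in> form ` hom_crv (k - 2)"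
  then obtain G where G: "w = form G" "G \<in> hom_crv (k - 2)" by blast
  have "hom_crv (k - 2) \<subseteq> lspan {(i, j). 0 \<le> i \<and> 0 \<le> j \<and> i + j \<le> int CARD('a) - 2}"
    unfolding hom_crv_def by (rule lspan_mono) (use k_less_q k_ge_2 in auto)
  moreover have "has_weight (int k - 2) G" using has_weight_hom[OF G(2)] k_ge_2 by (simp add: of_nat_diff)
  ultimately show "w \<in> carrier (H0_weight (- int k))"
    unfolding H0_weight_iff regular_forms_iff[OF q_zero] G(1) diff_coeff_form[OF q_zero] using G(2) by blast
qed

subsection \<open>Classes of functions\<close>

lemma mu_lspan:
  assumes z: "root z"
  shows "x \<in> lspan S \<Longrightarrow> mu z (x :: ('a, 'a alg_closure) crv) \<in> lspan S"
proof (induction x rule: lspan_induct)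
  case (mm c i j)
  then show ?case by (simp only: mu_hom[OF z] mu_generators[OF z] mu_mm[OF z]) (intro lspan_subspace mm_lspan)
qed (auto simp: mu_hom[OF z] intro: lspan_subspace)

lemma bc_lspan: "x \<in> lspan S \<Longrightarrow> bc (x :: ('a, 'a) crv) \<in> lspan S"
proof (induction x rule: lspan_induct)
  case (mm c i j)
  then show ?case by (simp only: bc_hom bc_generators bc_mm) (intro lspan_subspace mm_lspan)
qed (auto simp: bc_hom intro: lspan_subspace)

lemma root_inverse: "root z \<Longrightarrow> root (inverse z)"
  unfolding root_def power_inverse by simp

lemma mu_inverse:
  assumes z: "root z"
  shows "mu z (mu (inverse z) x) = (x :: ('a, 'a alg_closure) crv)"
  by (rule crv_hom_eqI[OF is_ring_hom_comp[OF is_ring_hom_mu[OF z] is_ring_hom_mu[OF root_inverse[OF z]]]])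
     (use root_nonzero[OF z] in \<open>simp_all add: is_ring_hom_def mu_generators[OF z] mu_generators[OF root_inverse[OF z]]
        mu_hom[OF z] cst_simps(1) flip: mult.assoc cst_simps(3)\<close>)

lemma set_add_image_coset:
  fixes W :: "'m::ab_group_add set" and W' :: "'n::ab_group_add set"
  assumes add: "add M = (+)" "add M' = (+)" and h: "\<And>x y. h (x + y) = h x + h y"
    and W: "h ` W \<subseteq> W'" "0 \<in> W" "\<And>x y. x \<in> W' \<Longrightarrow> y \<in> W' \<Longrightarrow> x + y \<in> W'"
  shows "W' <+>\<^bsub>M'\<^esub> (h ` (W +>\<^bsub>M\<^esub> x)) = W' +>\<^bsub>M'\<^esub> h x"
proof (rule equalityI; rule subsetI)
  fix y assume "y \<in> W' <+>\<^bsub>M'\<^esub> (h ` (W +>\<^bsub>M\<^esub> x))"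
  then obtain w' w where "w' \<in> W'" "w \<in> W" "y = w' + h (w + x)"
    unfolding set_add_def' a_r_coset_eq_image add by blast
  then have "w' + h w \<in> W'" "y = (w' + h w) + h x" using W by (auto simp: h add.assoc)
  then show "y \<in> W' +>\<^bsub>M'\<^esub> h x" unfolding a_r_coset_eq_image add by blast
next
  fix y assume "y \<in> W' +>\<^bsub>M'\<^esub> h x"
  then obtain w' where w': "w' \<in> W'" "y = w' + h (0 + x)"
    unfolding a_r_coset_eq_image add by auto
  then show "y \<in> W' <+>\<^bsub>M'\<^esub> (h ` (W +>\<^bsub>M\<^esub> x))"
    unfolding set_add_def' a_r_coset_eq_image add using W(2) by blast
qed

lemma image_coset:
  fixes W :: "'m::ab_group_add set"
  assumes add: "add M = (+)" and h: "\<And>x y. h (x + y) = h x + h y" and W: "h ` W = W"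
  shows "h ` (W +>\<^bsub>M\<^esub> x) = W +>\<^bsub>M\<^esub> h x"
proof -
  have "h ` (W +>\<^bsub>M\<^esub> x) = (\<lambda>w. w + h x) ` (h ` W)" unfolding a_r_coset_eq_image add image_image h ..
  then show ?thesis unfolding W a_r_coset_eq_image add .
qed

lemma image_eq_of_inverse: "h ` W \<subseteq> W \<Longrightarrow> h' ` W \<subseteq> W \<Longrightarrow> (\<And>x. h (h' x) = x) \<Longrightarrow> h ` W = W"
  by (metis image_subset_iff rev_image_eqI subsetI subset_antisym)

lemma H1_O_weight_iff:
  fixes f :: "('a, 'a) crv"
  assumes f: "f \<in> reg {crv_u, crv_v}"
  shows "B_O +>\<^bsub>Z_O\<^esub> f \<in> carrier (H1_O_weight m) \<longleftrightarrow>
     (\<forall>z. root z \<longrightarrow> mu z (bc f) - cst (z powi m) * bc f \<in> B_O)"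
proof -
  let ?Z = "Z_O :: ('a alg_closure, ('a, 'a alg_closure) crv) module"
  have aO: "add (Z_O :: ('e::field, ('a, 'e) crv) module) = (+)" by (simp add: Z_O_def)
  have bcf: "bc f \<in> carrier ?Z" using bc_lspan f by (simp add: Z_O_def reg_uv)
  have b: "bc_O (B_O +>\<^bsub>Z_O\<^esub> f) = B_O +>\<^bsub>?Z\<^esub> bc f"
    unfolding bc_O_def
    by (rule set_add_image_coset) (auto simp: aO bc_hom B_O_eq intro: bc_lspan lspan_subspace)
  have "B_O +>\<^bsub>Z_O\<^esub> f \<in> carrier H1_O"
    using coset_onto[OF vec_space_Z_O sub_space_B_O] f by (auto simp: H1_O_def Z_O_def)
  then have a: "B_O +>\<^bsub>Z_O\<^esub> f \<in> carrier H1_O" .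
  have b': "mu z ` bc_O (B_O +>\<^bsub>Z_O\<^esub> f) = (z powi m) \<odot>\<^bsub>H1_O\<^esub> bc_O (B_O +>\<^bsub>Z_O\<^esub> f) \<longleftrightarrow>
      mu z (bc f) - cst (z powi m) * bc f \<in> B_O" if z: "root z" for z
  proof -
    have "mu z ` B_O = (B_O :: ('a, 'a alg_closure) crv set)"
      by (rule image_eq_of_inverse[of _ _ "mu (inverse z)"])
         (auto simp: B_O_eq mu_lspan[OF z] mu_lspan[OF root_inverse[OF z]] mu_inverse[OF z])
    then have 1: "mu z ` (B_O +>\<^bsub>?Z\<^esub> bc f) = B_O +>\<^bsub>?Z\<^esub> mu z (bc f)"
      by (intro image_coset) (simp_all add: aO mu_hom[OF z])
    have 2: "(z powi m) \<odot>\<^bsub>H1_O\<^esub> (B_O +>\<^bsub>?Z\<^esub> bc f) = B_O +>\<^bsub>?Z\<^esub> (cst (z powi m) * bc f)"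
      using lin_mapD(4)[OF lin_map_coset[OF vec_space_Z_O sub_space_B_O] bcf, of "z powi m"]
      unfolding H1_O_def by (simp add: Z_O_def)
    have "mu z (bc f) \<in> carrier ?Z" "cst (z powi m) * bc f \<in> carrier ?Z"
      using bcf mu_lspan[OF z] by (auto simp: Z_O_def reg_uv intro: lspan_subspace)
    then show ?thesis unfolding b 1 2 by (rule B_O_coset_eq_iff[OF q_zero_ac])
  qed
  have "(\<forall>z. root z \<longrightarrow> mu z ` bc_O (B_O +>\<^bsub>Z_O\<^esub> f) = (z powi m) \<odot>\<^bsub>H1_O\<^esub> bc_O (B_O +>\<^bsub>Z_O\<^esub> f)) \<longleftrightarrow>
      (\<forall>z. root z \<longrightarrow> mu z (bc f) - cst (z powi m) * bc f \<in> B_O)"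
    by (intro iff_allI imp_cong refl b')
  then show ?thesis
    unfolding H1_O_weight_def weight_part_simps mem_Collect_eq root_def[symmetric] using a by simp
qed

lemma cyc_f_uv: "cyc_f G crv_u crv_v = cst (- inverse (of_nat k)) * (mm (- int CARD('a)) (- int CARD('a)) * G)"
proof -
  have "cyc_f G (lin 1 0) (lin 0 1) = cst (inverse (of_nat k)) * (cst (0 * 0 - 1 * 1) *
     (G * (inverse (lin 1 0) ^ CARD('a) * inverse (lin 0 1) ^ CARD('a))))"
    by (rule cyc_f_lin) simp_all
  then show ?thesis
    by (simp add: cst_simps mm_eqs mm_inverse mm_power mm_mult mult.commute)
qed

text \<open>
  Modulo coboundaries \<open>f\<close> is a combination of monomials with two negative exponents and with degrees
  between \<open>-q\<close> and \<open>-2\<close>. Only the degree \<open>k - q - 1\<close> is congruent to \<open>k\<close> modulo \<open>q + 1\<close>, and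
  multiplication by \<open>u\<^sup>q v\<^sup>q\<close> produces polynomials of degree \<open>k + q - 1\<close>.
\<close>

lemma cyc_f_weight_part:
  assumes f: "f \<in> reg {crv_u, crv_v :: ('a, 'a) crv}"
    and wt: "\<And>z. root z \<Longrightarrow> mu z (bc f) - cst (z powi - int k) * bc f \<in> B_O"
  shows "\<exists>G\<in>hom_crv (k + CARD('a) - 1). f - cyc_f G crv_u crv_v \<in> B_O"
proof -
  let ?q = "int CARD('a)"
  obtain g h where gh: "f = g + h" "g \<in> lspan (idx_u TYPE('a) \<union> idx_v TYPE('a))" "h \<in> lspan (idx_pole TYPE('a))"
    using f unfolding reg_uv idx_split(3) lspan_Un[of f "_ \<union> _"] by blast
  define S where "S = {(i, j) \<in> idx_pole TYPE('a). i + j = int k - ?q - 1}"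
  have S: "S \<subseteq> idx_uv TYPE('a)" and P: "idx_pole TYPE('a) \<subseteq> idx_uv TYPE('a)"
    by (auto simp: S_def idx_pole_def window_def)
  have W: "f \<in> lspan (idx_uv TYPE('a))" "g \<in> lspan (idx_uv TYPE('a))" "h \<in> lspan (idx_uv TYPE('a))"
    using f gh lspan_mono[OF idx_split(1)] lspan_mono[OF P] by (auto simp: reg_uv)
  have "lcoeff (- ?q) h (i, j) = 0" if ij: "(i, j) \<notin> S" for i j
  proof (rule ccontr)
    assume nz: "lcoeff (- ?q) h (i, j) \<noteq> 0"
    then have p: "(i, j) \<in> idx_pole TYPE('a)" using gh(3) lspan_iff_lcoeff[OF P] by blast
    then have np: "(i, j) \<notin> idx_u TYPE('a) \<union> idx_v TYPE('a)" using idx_split(2)[where 'a = 'a] by blast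
    then have "lcoeff (- ?q) g (i, j) = 0" using gh(2) lspan_iff_lcoeff[OF idx_split(1)] by blast
    then have "lcoeff (- ?q) f (i, j) \<noteq> 0" using nz unfolding gh(1) lcoeff_add[OF W(2,3)] by simp
    from degree_of_weight[OF W(1) idx_split(1) wt[unfolded B_O_eq] np this]
    have "int (CARD('a) + 1) dvd - int k + (i + j)" by simp
    then obtain t where t: "- int k + (i + j) = int (CARD('a) + 1) * t" by (elim dvdE)
    have b: "- int k + (i + j) < 0" "- 2 * int (CARD('a) + 1) < - int k + (i + j)"
      using p k_less_q by (auto simp: idx_pole_def)
    have d: "int (CARD('a) + 1) dvd - int k + (i + j) + int (CARD('a) + 1)" unfolding t by simp
    have "- int (CARD('a) + 1) < - int k + (i + j) + int (CARD('a) + 1)"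
      "- int k + (i + j) + int (CARD('a) + 1) < int (CARD('a) + 1)" using b by simp_all
    from dvd_abs_less_imp_zero[OF d this]
    have "i + j = int k - ?q - 1" by simp
    then show False using p ij by (simp add: S_def)
  qed
  then have hS: "h \<in> lspan S" unfolding lspan_iff_lcoeff[OF S] using W(3) by auto
  define G where "G = cst (- of_nat k) * (mm ?q ?q * h)"
  have "G \<in> lspan ((\<lambda>(i, j). (i + ?q, j + ?q)) ` S)"
    unfolding G_def by (intro lspan_subspace lspan_shift hS)
  moreover have "(\<lambda>(i, j). (i + ?q, j + ?q)) ` S \<subseteq> {(int i, int j) | i j. i + j = k + CARD('a) - 1}"
  proof
    fix t assume "t \<in> (\<lambda>(i, j). (i + ?q, j + ?q)) ` S"
    then obtain i j where ij: "(i, j) \<in> S" "t = (i + ?q, j + ?q)" by auto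
    then have "t = (int (nat (i + ?q)), int (nat (j + ?q))) \<and> nat (i + ?q) + nat (j + ?q) = k + CARD('a) - 1"
      using k_ge_2 by (auto simp: S_def idx_pole_def)
    then show "t \<in> {(int i, int j) | i j. i + j = k + CARD('a) - 1}" by blast
  qed
  ultimately have G: "G \<in> hom_crv (k + CARD('a) - 1)" unfolding hom_crv_def using lspan_mono by blast
  have "cyc_f G crv_u crv_v = cst (- inverse (of_nat k) * - of_nat k) * h"
  proof -
    have "mm (- ?q) (- ?q) * (cst c * (mm ?q ?q * h)) = cst c * ((mm (- ?q) (- ?q) * mm ?q ?q) * h)" for c
      by (simp only: mult_ac)
    then have "mm (- ?q) (- ?q) * (cst c * (mm ?q ?q * h)) = cst c * h" for c by (simp add: mm_mult)
    then show ?thesis unfolding cyc_f_uv G_def by (simp only: cst_simps(3) mult.assoc)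
  qed
  also have "\<dots> = h" using k_nonzero by (simp add: cst_simps)
  finally have "f - cyc_f G crv_u crv_v = g" using gh(1) by simp
  then show ?thesis using G gh(2) by (auto simp: B_O_eq)
qed

lemma cyc_f_uv_reg: "G \<in> hom_crv (k + CARD('a) - 1) \<Longrightarrow> cyc_f G crv_u crv_v \<in> reg {crv_u, crv_v}"
  by (rule cyc_f_reg[OF uv_lin_forms])

lemma zero_B: "0 \<in> (B_O :: ('a, 'e::field) crv set)"
  by (simp add: B_O_eq lspan_subspace)

lemma carrier_H1_O_weight:
  "carrier (H1_O_weight (- int k)) = (\<lambda>G. B_O +>\<^bsub>Z_O\<^esub> cyc_f G crv_u crv_v) ` hom_crv (k + CARD('a) - 1)"
proof (rule equalityI; rule subsetI)
  fix U :: "('a, 'a) crv set" assume U: "U \<in> carrier (H1_O_weight (- int k))"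
  then have "U \<in> a_rcosets\<^bsub>Z_O\<^esub> B_O" unfolding H1_O_weight_def weight_part_simps by (simp add: H1_O_def)
  then obtain f where f: "U = B_O +>\<^bsub>Z_O\<^esub> f" "f \<in> reg {crv_u, crv_v}"
    unfolding coset_onto[OF vec_space_Z_O sub_space_B_O, symmetric] by (auto simp: Z_O_def)
  then obtain G where G: "G \<in> hom_crv (k + CARD('a) - 1)" "f - cyc_f G crv_u crv_v \<in> B_O"
    using cyc_f_weight_part U unfolding f(1) H1_O_weight_iff[OF f(2)] by blast
  then have "U = B_O +>\<^bsub>Z_O\<^esub> cyc_f G crv_u crv_v"
    unfolding f(1) using B_O_coset_eq_iff[OF q_zero] f(2) cyc_f_uv_reg[OF G(1)] by (simp add: Z_O_def)
  then show "U \<in> (\<lambda>G. B_O +>\<^bsub>Z_O\<^esub> cyc_f G crv_u crv_v) ` hom_crv (k + CARD('a) - 1)" using G(1) by blast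
next
  fix U :: "('a, 'a) crv set" assume "U \<in> (\<lambda>G. B_O +>\<^bsub>Z_O\<^esub> cyc_f G crv_u crv_v) ` hom_crv (k + CARD('a) - 1)"
  then obtain G where G: "G \<in> hom_crv (k + CARD('a) - 1)" "U = B_O +>\<^bsub>Z_O\<^esub> cyc_f G crv_u crv_v" by blast
  have "has_weight (int k) (cyc_f G crv_u crv_v)"
    unfolding cyc_f_def by (intro has_weight_rules has_weight_cyc_phi G(1))
  then show "U \<in> carrier (H1_O_weight (- int k))"
    unfolding G(2) H1_O_weight_iff[OF cyc_f_uv_reg[OF G(1)]] by (simp add: has_weight_def zero_B)
qed

subsection \<open>De Rham classes\<close>

lemma map_dR_Pair: "map_dR h (w0, w1, f) = (mapK h w0, mapK h w1, h f)"
  by (simp add: map_dR_def)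

lemma map_dR_bc_add: "map_dR bc (x + y) = map_dR bc x + map_dR bc (y :: ('a, 'a) dR_cochain)"
  by (cases x; cases y) (simp add: map_dR_Pair mapK_bc bc_hom)

lemma map_dR_mu_add:
  assumes z: "root z"
  shows "map_dR (mu z) (x + y) = map_dR (mu z) x + map_dR (mu z) (y :: ('a, 'a alg_closure) dR_cochain)"
  by (cases x; cases y) (simp add: map_dR_Pair mapK_mu[OF z z] mu_hom[OF z])

lemma map_dR_bc_coboundary: "x \<in> B_dR \<Longrightarrow> map_dR bc (x :: ('a, 'a) dR_cochain) \<in> B_dR"
  unfolding B_dR_def reg_u reg_v by (auto simp: map_dR_Pair mapK_bc bc_hom) (blast intro: bc_lspan)

lemma map_dR_mu_coboundary:
  assumes z: "root z"
  shows "x \<in> B_dR \<Longrightarrow> map_dR (mu z) (x :: ('a, 'a alg_closure) dR_cochain) \<in> B_dR"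
  unfolding B_dR_def reg_u reg_v
  by (auto simp: map_dR_Pair mapK_mu[OF z z] mu_hom[OF z]) (blast intro: mu_lspan[OF z])

lemma map_dR_bc_cocycle: "x \<in> cocycles_dR \<Longrightarrow> map_dR bc (x :: ('a, 'a) dR_cochain) \<in> cocycles_dR"
proof -
  assume x: "x \<in> cocycles_dR"
  obtain w0 w1 f where [simp]: "x = (w0, w1, f)" by (cases x)
  have "w0 = w1 + dK f" using x by (simp add: cocycles_dR_def)
  then have "dK (bc f) = mapK bc w0 - mapK bc w1" by (simp add: mapK_bc)
  then show ?thesis
    using x unfolding cocycles_dR_def Omega_uv_iff[OF q_zero] Omega_uv_iff[OF q_zero_ac] reg_uv
    by (simp add: map_dR_Pair diff_coeff_bc bc_lspan)
qed

lemma map_dR_mu_cocycle: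
  assumes z: "root z"
  shows "x \<in> cocycles_dR \<Longrightarrow> map_dR (mu z) (x :: ('a, 'a alg_closure) dR_cochain) \<in> cocycles_dR"
proof -
  assume x: "x \<in> cocycles_dR"
  obtain w0 w1 f where [simp]: "x = (w0, w1, f)" by (cases x)
  have "w0 = w1 + dK f" using x by (simp add: cocycles_dR_def)
  then have "dK (mu z f) = mapK (mu z) w0 - mapK (mu z) w1" by (simp add: mapK_mu[OF z z])
  then show ?thesis
    using x unfolding cocycles_dR_def Omega_uv_iff[OF q_zero_ac] reg_uv
    by (simp add: map_dR_Pair diff_coeff_mu[OF z z] mu_lspan[OF z] lspan_subspace)
qed

lemma map_dR_mu_inverse:
  assumes z: "root z"
  shows "map_dR (mu z) (map_dR (mu (inverse z)) x) = (x :: ('a, 'a alg_closure) dR_cochain)"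
proof -
  note z' = root_inverse[OF z]
  have e: "z powi - 2 * inverse z powi - 2 = 1"
    unfolding power_int_mult_distrib[symmetric] using root_nonzero[OF z] by simp
  have "mapK (mu z) (mapK (mu (inverse z)) w) = w" for w :: "('a, 'a alg_closure) kaehler"
  proof -
    have "diff_coeff (mapK (mu z) (mapK (mu (inverse z)) w)) = (cst (z powi - 2) * cst (inverse z powi - 2)) * diff_coeff w"
      unfolding diff_coeff_mu[OF z z] diff_coeff_mu[OF z' z'] mu_hom(3)[OF z] mu_generators(1)[OF z] mu_inverse[OF z] mult.assoc ..
    also have "\<dots> = diff_coeff w" unfolding cst_simps(3)[symmetric] e by (simp add: cst_simps)
    finally show ?thesis using kaehler_eq_iff[OF q_zero_ac] by blast
  qed
  then show ?thesis by (cases x) (simp add: map_dR_Pair mu_inverse[OF z])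
qed

lemma add_Z_dR: "add (Z_dR :: ('e::field, ('a, 'e) dR_cochain) module) = (+)"
  and smult_Z_dR: "smult (Z_dR :: ('e::field, ('a, 'e) dR_cochain) module) = scale_dR"
  and carrier_Z_dR: "carrier (Z_dR :: ('e::field, ('a, 'e) dR_cochain) module) = cocycles_dR"
  by (simp_all add: Z_dR_eq)

lemma B_dR_closed:
  assumes q0: "of_nat CARD('a) = (0 :: 'e::field)"
  shows "0 \<in> (B_dR :: ('a, 'e) dR_cochain set)"
    "x \<in> B_dR \<Longrightarrow> y \<in> B_dR \<Longrightarrow> x + y \<in> (B_dR :: ('a, 'e) dR_cochain set)"
    "x \<in> B_dR \<Longrightarrow> scale_dR c x \<in> (B_dR :: ('a, 'e) dR_cochain set)"
    "x \<in> B_dR \<Longrightarrow> y \<in> B_dR \<Longrightarrow> x - y \<in> (B_dR :: ('a, 'e) dR_cochain set)"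
    "x \<in> B_dR \<Longrightarrow> x \<in> (cocycles_dR :: ('a, 'e) dR_cochain set)"
proof -
  note S = sub_space_B_dR[OF q0, unfolded Z_dR_eq sub_space_type_module]
  show "0 \<in> (B_dR :: ('a, 'e) dR_cochain set)" using S by blast
  show a: "x \<in> B_dR \<Longrightarrow> y \<in> B_dR \<Longrightarrow> x + y \<in> B_dR" for x y :: "('a, 'e) dR_cochain" using S by blast
  show s: "x \<in> B_dR \<Longrightarrow> scale_dR c x \<in> B_dR" for c and x :: "('a, 'e) dR_cochain" using S by blast
  have "scale_dR (- 1) y = - y" for y :: "('a, 'e) dR_cochain"
    by (cases y) (simp add: scale_dR_def cst_simps scaleK_rules)
  then show "x \<in> B_dR \<Longrightarrow> y \<in> B_dR \<Longrightarrow> x - y \<in> (B_dR :: ('a, 'e) dR_cochain set)"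
    using a[of x "- y"] s[of y "- 1"] by simp
  show "x \<in> B_dR \<Longrightarrow> x \<in> (cocycles_dR :: ('a, 'e) dR_cochain set)" using S by blast
qed

lemma cocycles_scale:
  assumes q0: "of_nat CARD('a) = (0 :: 'e::field)"
  shows "x \<in> cocycles_dR \<Longrightarrow> scale_dR c x \<in> (cocycles_dR :: ('a, 'e) dR_cochain set)"
  using vec_spaceD[OF vec_space_Z_dR[OF q0]] by (simp add: Z_dR_eq)

lemma cyc_cocycle: "G \<in> hom_crv (k + CARD('a) - 1) \<Longrightarrow> cyc G \<in> cocycles_dR"
  using full_cyc(2)[of G] cyc_f_uv_reg[of G] uv_lin_forms by (auto simp: cocycles_dR_def cyc_def full_Z_dR_def)

lemma H_dR_weight_iff:
  fixes x :: "('a, 'a) dR_cochain"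
  assumes x: "x \<in> cocycles_dR"
  shows "B_dR +>\<^bsub>Z_dR\<^esub> x \<in> carrier (H_dR_weight m) \<longleftrightarrow>
     (\<forall>z. root z \<longrightarrow> map_dR (mu z) (map_dR bc x) - scale_dR (z powi m) (map_dR bc x) \<in> B_dR)"
proof -
  let ?Z = "Z_dR :: ('a alg_closure, ('a, 'a alg_closure) dR_cochain) module"
  have bx: "map_dR bc x \<in> cocycles_dR" by (rule map_dR_bc_cocycle[OF x])
  have b: "bc_dR (B_dR +>\<^bsub>Z_dR\<^esub> x) = B_dR +>\<^bsub>?Z\<^esub> map_dR bc x"
    unfolding bc_dR_def
    by (rule set_add_image_coset)
       (auto simp: add_Z_dR map_dR_bc_add intro: map_dR_bc_coboundary B_dR_closed[OF q_zero] B_dR_closed[OF q_zero_ac])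
  have a: "B_dR +>\<^bsub>Z_dR\<^esub> x \<in> carrier H_dR"
    using coset_onto[OF vec_space_Z_dR[OF q_zero] sub_space_B_dR[OF q_zero]] x by (auto simp: H_dR_def carrier_Z_dR)
  have b': "map_dR (mu z) ` bc_dR (B_dR +>\<^bsub>Z_dR\<^esub> x) = (z powi m) \<odot>\<^bsub>H_dR\<^esub> bc_dR (B_dR +>\<^bsub>Z_dR\<^esub> x) \<longleftrightarrow>
      map_dR (mu z) (map_dR bc x) - scale_dR (z powi m) (map_dR bc x) \<in> B_dR" if z: "root z" for z
  proof -
    have "map_dR (mu z) ` B_dR = (B_dR :: ('a, 'a alg_closure) dR_cochain set)"
      by (rule image_eq_of_inverse[of _ _ "map_dR (mu (inverse z))"])
         (auto simp: map_dR_mu_coboundary[OF z] map_dR_mu_coboundary[OF root_inverse[OF z]] map_dR_mu_inverse[OF z])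
    then have 1: "map_dR (mu z) ` (B_dR +>\<^bsub>?Z\<^esub> map_dR bc x) = B_dR +>\<^bsub>?Z\<^esub> map_dR (mu z) (map_dR bc x)"
      by (intro image_coset) (simp_all add: add_Z_dR map_dR_mu_add[OF z])
    have 2: "(z powi m) \<odot>\<^bsub>H_dR\<^esub> (B_dR +>\<^bsub>?Z\<^esub> map_dR bc x) = B_dR +>\<^bsub>?Z\<^esub> (scale_dR (z powi m) (map_dR bc x))"
      using lin_mapD(4)[OF lin_map_coset[OF vec_space_Z_dR[OF q_zero_ac] sub_space_B_dR[OF q_zero_ac]], of "map_dR bc x" "z powi m"]
        bx unfolding H_dR_def by (simp add: smult_Z_dR carrier_Z_dR)
    show ?thesis
      unfolding b 1 2
      by (rule B_dR_coset_eq_iff[OF q_zero_ac]) (simp_all add: carrier_Z_dR map_dR_mu_cocycle[OF z] cocycles_scale[OF q_zero_ac] bx)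
  qed
  have "(\<forall>z. root z \<longrightarrow> map_dR (mu z) ` bc_dR (B_dR +>\<^bsub>Z_dR\<^esub> x) = (z powi m) \<odot>\<^bsub>H_dR\<^esub> bc_dR (B_dR +>\<^bsub>Z_dR\<^esub> x)) \<longleftrightarrow>
      (\<forall>z. root z \<longrightarrow> map_dR (mu z) (map_dR bc x) - scale_dR (z powi m) (map_dR bc x) \<in> B_dR)"
    by (intro iff_allI imp_cong refl b')
  then show ?thesis
    unfolding H_dR_weight_def weight_part_simps mem_Collect_eq root_def[symmetric] using a by simp
qed

lemma cyc_weight:
  assumes G: "G \<in> hom_crv (k + CARD('a) - 1)" and z: "root z"
  shows "map_dR (mu z) (map_dR bc (cyc G)) = scale_dR (z powi - int k) (map_dR bc (cyc G))"
proof -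
  have wG: "has_weight (int k - 2) G"
  proof (rule has_weight_cong[OF has_weight_hom[OF G]])
    have "int (k + CARD('a) - 1) - (int k - 2) = int (CARD('a) + 1)" using card_gt_2 by (simp add: of_nat_diff)
    then show "int (CARD('a) + 1) dvd int (k + CARD('a) - 1) - (int k - 2)" by (simp only: dvd_refl)
  qed
  have "has_weight (int k - 2) (G - crv_der (cyc_phi crv_u G))" "has_weight (int k - 2) (G - crv_der (cyc_phi crv_v G))"
    by (intro has_weight_rules(3)[OF wG] has_weight_der has_weight_cyc_phi G)+
  then have "mapK (mu z) (mapK bc (cyc_w G crv_u)) = cst (z powi - int k) \<bullet>\<^sub>K mapK bc (cyc_w G crv_u)"
    "mapK (mu z) (mapK bc (cyc_w G crv_v)) = cst (z powi - int k) \<bullet>\<^sub>K mapK bc (cyc_w G crv_v)"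
    unfolding form_weight_iff[OF z] cyc_w_def diff_coeff_form[OF q_zero] has_weight_def using z by blast+
  moreover have "has_weight (int k) (cyc_f G crv_u crv_v)"
    unfolding cyc_f_def by (intro has_weight_rules has_weight_cyc_phi G)
  ultimately show ?thesis
    using z by (simp add: cyc_def map_dR_Pair scale_dR_def has_weight_def)
qed

lemma theta_homog: "(theta :: 'a poly poly) \<in> homog (CARD('a) + 1)"
  unfolding theta_def using mon_homog[of "CARD('a)" 1 "CARD('a) + 1"] mon_homog[of 1 "CARD('a)" "CARD('a) + 1"]
  by (intro homog_subspace) simp_all

lemma theta_mult_homog: "R \<in> homog (k - 2) \<Longrightarrow> theta * (R :: 'a poly poly) \<in> homog (k + CARD('a) - 1)"
proof -
  assume "R \<in> homog (k - 2)"
  then have "theta * R \<in> homog ((CARD('a) + 1) + (k - 2))" by (rule homog_mult[OF theta_homog])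
  also have "(CARD('a) + 1) + (k - 2) = k + CARD('a) - 1" using k_ge_2 by simp
  finally show ?thesis .
qed

lemma hom_crv_low_subset: "hom_crv (k - 2) \<subseteq> hom_crv (k + CARD('a) - 1)"
proof
  fix G assume "G \<in> hom_crv (k - 2)"
  then obtain R where R: "R \<in> homog (k - 2)" "G = eps R" using eps_homog_onto by blast
  then have "G = eps (cst2 (- 1) * (theta * R))" by (simp add: eps_hom eps_generators eps_theta cst_simps)
  then show "G \<in> hom_crv (k + CARD('a) - 1)"
    using eps_homog[OF homog_subspace(5)[OF theta_mult_homog[OF R(1)]]] by simp
qed

text \<open>
  A class of the right weight is, up to the class of a cocycle \<open>cyc G\<close>, represented by a triple with
  trivial function, which is a global form.
\<close>

lemma carrier_H_dR_weight:
  "carrier (H_dR_weight (- int k)) = (\<lambda>G. B_dR +>\<^bsub>Z_dR\<^esub> cyc G) ` hom_crv (k + CARD('a) - 1)"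
proof (rule equalityI; rule subsetI)
  fix U :: "('a, 'a) dR_cochain set" assume "U \<in> (\<lambda>G. B_dR +>\<^bsub>Z_dR\<^esub> cyc G) ` hom_crv (k + CARD('a) - 1)"
  then obtain G where G: "G \<in> hom_crv (k + CARD('a) - 1)" "U = B_dR +>\<^bsub>Z_dR\<^esub> cyc G" by blast
  then show "U \<in> carrier (H_dR_weight (- int k))"
    unfolding G(2) H_dR_weight_iff[OF cyc_cocycle[OF G(1)]] by (simp add: cyc_weight B_dR_closed[OF q_zero_ac])
next
  fix U :: "('a, 'a) dR_cochain set" assume U: "U \<in> carrier (H_dR_weight (- int k))"
  then have "U \<in> a_rcosets\<^bsub>Z_dR\<^esub> B_dR" unfolding H_dR_weight_def weight_part_simps by (simp add: H_dR_def)
  then obtain x where x: "U = B_dR +>\<^bsub>Z_dR\<^esub> x" "x \<in> cocycles_dR"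
    unfolding coset_onto[OF vec_space_Z_dR[OF q_zero] sub_space_B_dR[OF q_zero], symmetric] by (auto simp: carrier_Z_dR)
  let ?m = "- int k"
  have wt: "map_dR (mu z) (map_dR bc x) - scale_dR (z powi ?m) (map_dR bc x) \<in> B_dR" if "root z" for z
    using U that unfolding x(1) H_dR_weight_iff[OF x(2)] by blast
  obtain w0 w1 f where xf: "x = (w0, w1, f)" by (cases x)
  have f: "f \<in> reg {crv_u, crv_v}" using x(2) by (simp add: xf cocycles_dR_def)
  have "mu z (bc f) - cst (z powi ?m) * bc f \<in> B_O" if "root z" for z
    using wt[OF that] by (auto simp: xf map_dR_Pair scale_dR_def B_dR_def B_O_def)
  from cyc_f_weight_part[OF f this] obtain G where G: "G \<in> hom_crv (k + CARD('a) - 1)" "f - cyc_f G crv_u crv_v \<in> B_O"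
    by blast
  obtain f0 f1 where fb: "f - cyc_f G crv_u crv_v = f0 - f1" "f0 \<in> reg {crv_u}" "f1 \<in> reg {crv_v}"
    using G(2) by (auto simp: B_O_def)
  define b where "b = (dK f0, dK f1, f0 - f1)"
  have b: "b \<in> B_dR" unfolding b_def by (rule B_dR_I[OF fb(2,3)])
  define w where "w = w0 - cyc_w G crv_u - dK f0"
  have "w0 - w1 = dK f" using x(2) by (simp add: xf cocycles_dR_def)
  moreover have "cyc_w G crv_u - cyc_w G crv_v = dK (cyc_f G crv_u crv_v)"
    using cyc_cocycle[OF G(1)] by (simp add: cocycles_dR_def cyc_def)
  moreover have "dK f - dK (cyc_f G crv_u crv_v) = dK f0 - dK f1"
    using fb(1) by (simp flip: dK_rules(2)[OF q_zero])
  ultimately have "(w0 - w1) - (cyc_w G crv_u - cyc_w G crv_v) = dK f0 - dK f1" by simp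
  moreover have "w - (w1 - cyc_w G crv_v - dK f1) = ((w0 - w1) - (cyc_w G crv_u - cyc_w G crv_v)) - (dK f0 - dK f1)"
    unfolding w_def by (simp add: algebra_simps)
  ultimately have "w1 - cyc_w G crv_v - dK f1 = w" by simp
  then have xw: "x - cyc G - b = (w, w, 0)"
    using fb(1) by (simp add: xf cyc_def b_def w_def minus_prod_def)
  have xw': "x = (w, w, 0) + cyc G + b" using xw by (simp only: diff_eq_eq ac_simps)
  have "(w, w, 0) \<in> cocycles_dR"
  proof -
    have V: "vec_space (type_module scale_dR (cocycles_dR :: ('a, 'a) dR_cochain set))"
      using vec_space_Z_dR[OF q_zero] unfolding Z_dR_eq .
    have "x - y \<in> cocycles_dR" if "x \<in> cocycles_dR" "y \<in> cocycles_dR" for x y :: "('a, 'a) dR_cochain"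
      using that a_minus_type_module[OF V that] abelian_group.minus_closed[OF conjunct1[OF vec_spaceD[OF V]], of x y] by simp
    then show ?thesis unfolding xw[symmetric] using x(2) cyc_cocycle[OF G(1)] B_dR_closed(5)[OF q_zero b] by blast
  qed
  then have wO: "w \<in> Omega {crv_u} \<inter> Omega {crv_v}" by (simp add: cocycles_dR_def)
  have "mapK (mu z) (mapK bc w) = cst (z powi ?m) \<bullet>\<^sub>K mapK bc w" if z: "root z" for z
  proof -
    let ?T = "\<lambda>y. map_dR (mu z) (map_dR bc y) - scale_dR (z powi ?m) (map_dR bc y)"
    have sadd: "scale_dR c (y + y') = scale_dR c y + scale_dR c y'" for c and y y' :: "('a, 'a alg_closure) dR_cochain"
      by (cases y; cases y') (simp add: scale_dR_def scaleK_rules distrib_left)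
    have "?T b \<in> B_dR"
      by (intro B_dR_closed[OF q_zero_ac] map_dR_mu_coboundary[OF z] map_dR_bc_coboundary b)
    moreover have "?T (cyc G) = 0" using cyc_weight[OF G(1) z] by simp
    moreover have "?T x = ?T (w, w, 0) + ?T (cyc G) + ?T b"
      unfolding xw' map_dR_bc_add map_dR_mu_add[OF z] sadd by (simp add: algebra_simps)
    ultimately have "?T (w, w, 0) = ?T x - ?T b" by simp
    then have "?T (w, w, 0) \<in> B_dR" using B_dR_closed(4)[OF q_zero_ac wt[OF z] \<open>?T b \<in> B_dR\<close>] by simp
    then have "mapK (mu z) (mapK bc w) - cst (z powi ?m) \<bullet>\<^sub>K mapK bc w = 0"
      by (intro form_exact_imp_zero[OF q_zero_ac]) (simp add: map_dR_Pair scale_dR_def bc_hom mu_hom[OF z])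
    then show ?thesis by simp
  qed
  then have "w \<in> carrier (H0_weight ?m)"
    unfolding H0_weight_def weight_part_simps root_def[symmetric] using wO by (simp add: H0_def)
  then obtain G0 where G0: "w = form G0" "G0 \<in> hom_crv (k - 2)" unfolding carrier_H0_weight by blast
  have G0': "G0 \<in> hom_crv (k + CARD('a) - 1)" using hom_crv_low_subset G0(2) by blast
  have GG: "G0 + G \<in> hom_crv (k + CARD('a) - 1)" by (rule hom_crv_subspace(2)[OF G0' G(1)])
  have "x - cyc (G0 + G) = ((form G0, form G0, 0) - cyc G0) + b"
    unfolding xw' cyc_linear G0(1) by (simp add: algebra_simps)
  then have "x - cyc (G0 + G) \<in> B_dR"
    using B_dR_closed(2)[OF q_zero cyc_low_degree[OF G0(2)] b] by simp
  then have "U = B_dR +>\<^bsub>Z_dR\<^esub> cyc (G0 + G)"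
    unfolding x(1) by (subst B_dR_coset_eq_iff[OF q_zero]) (simp_all add: carrier_Z_dR x(2) cyc_cocycle[OF GG])
  then show "U \<in> (\<lambda>G. B_dR +>\<^bsub>Z_dR\<^esub> cyc G) ` hom_crv (k + CARD('a) - 1)" using GG by blast
qed

section \<open>Kernels\<close>

lemma lcoeff_eps:
  assumes F: "F \<in> homog d" and d: "c \<le> int d" "int d \<le> c + int CARD('a)" and ij: "i + j = d"
  shows "lcoeff c (eps F) (int j, int i) = (- 1) ^ i * coeff2 F i j"
proof -
  have W: "{(int i, int j) | i j. i + j = d} \<subseteq> window TYPE('a) c"
    using d by (auto simp: window_def)
  have L: "eps F \<in> lspan (window TYPE('a) c)" if "F \<in> homog d" for F
    using eps_homog[OF that] lspan_mono[OF W] unfolding hom_crv_def by blast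
  have "F \<in> homog d \<and> lcoeff c (eps F) (int j, int i) = (- 1) ^ i * coeff2 F i j"
    using F
  proof (induction F rule: homog_induct)
    case zero
    have "lcoeff c (0 :: ('a, 'a) crv) t = 0" for t
      using lcoeff_scale[OF lspan_subspace(1), of c 0 t] by (simp add: cst_simps)
    then show ?case by (simp add: eps_hom homog_subspace)
  next
    case (add f g)
    then show ?case by (simp add: eps_hom homog_subspace lcoeff_add L algebra_simps)
  next
    case (mon e i' j')
    have "(int j', int i') \<in> window TYPE('a) c" using mon W by auto
    then show ?case
      unfolding eps_mon mm_nat[symmetric] coeff2_mon using mon ij
      by (auto simp: lcoeff_mm intro!: homog_subspace(5) mon_homog)
  qed
  then show ?thesis ..
qed

lemma eps_inj:
  assumes "F \<in> homog d" "eps F = 0"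
  shows "F = 0"
proof (rule poly2_eqI)
  fix i j
  have z: "lcoeff (int d) (0 :: ('a, 'a) crv) t = 0" for t
    using lcoeff_scale[OF lspan_subspace(1), of "int d" 0 t] by (simp add: cst_simps)
  show "coeff2 F i j = coeff2 0 i j"
  proof (cases "i + j = d")
    case True
    then show ?thesis using lcoeff_eps[OF assms(1), of "int d" i j] assms(2) by (simp add: z)
  next
    case False
    then show ?thesis using assms(1) by (auto simp: homog_def)
  qed
qed

definition exact_plus_theta :: "'a poly poly set" where
  "exact_plus_theta = {Dq W + theta * R | W R. W \<in> homog k \<and> R \<in> homog (k - 2)}"

lemma Dq_rules: "Dq (f + g) = Dq f + Dq (g :: 'a poly poly)" "Dq (cst2 c * f) = cst2 c * Dq (f :: 'a poly poly)"
  "Dq (0 :: 'a poly poly) = 0" "Dq (f - g) = Dq f - Dq (g :: 'a poly poly)"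
  "Dq (mon i j :: 'a poly poly) = cst2 (of_nat i) * mon (i - 1 + CARD('a)) j + cst2 (of_nat j) * mon i (j - 1 + CARD('a))"
  unfolding Dq_eq_poly2_der
  by (simp_all only: is_derivationD(1,3,5)[OF is_derivation_poly2_der] poly2_der_cst2_mult poly2_der_mon cst2_simps(8))

lemma exact_plus_theta_closed:
  "0 \<in> exact_plus_theta" "f \<in> exact_plus_theta \<Longrightarrow> g \<in> exact_plus_theta \<Longrightarrow> f + g \<in> exact_plus_theta"
  "f \<in> exact_plus_theta \<Longrightarrow> cst2 c * f \<in> exact_plus_theta"
proof -
  show "0 \<in> exact_plus_theta"
    unfolding exact_plus_theta_def by (auto intro!: exI[of _ 0] simp: Dq_rules homog_subspace)
  {
    assume "f \<in> exact_plus_theta" "g \<in> exact_plus_theta"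
    then obtain W R W' R' where *: "f = Dq W + theta * R" "W \<in> homog k" "R \<in> homog (k - 2)"
      "g = Dq W' + theta * R'" "W' \<in> homog k" "R' \<in> homog (k - 2)" unfolding exact_plus_theta_def by blast
    have "f + g = Dq (W + W') + theta * (R + R')" by (simp add: * Dq_rules algebra_simps)
    then show "f + g \<in> exact_plus_theta" unfolding exact_plus_theta_def using * homog_subspace(2) by blast
  }
  {
    assume "f \<in> exact_plus_theta"
    then obtain W R where *: "f = Dq W + theta * R" "W \<in> homog k" "R \<in> homog (k - 2)"
      unfolding exact_plus_theta_def by blast
    have "cst2 c * f = Dq (cst2 c * W) + theta * (cst2 c * R)"
      by (simp only: * Dq_rules) (simp add: algebra_simps)
    then show "cst2 c * f \<in> exact_plus_theta" unfolding exact_plus_theta_def using * homog_subspace(5) by blast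
  }
qed

lemma of_nat_k_sum: "i + j = k \<Longrightarrow> cst2 (of_nat i) + cst2 (of_nat j) = (cst2 (of_nat k) :: 'a poly poly)"
  by (simp add: cst2_simps(8) flip: cst2_simps(2) of_nat_add)

text \<open>
  The two monomials in \<open>D(X\<^sup>a Y\<^sup>b)\<close>, where \<open>a + b = k\<close>, are congruent modulo \<open>\<theta>\<^sub>q\<close>. Their coefficients
  \<open>a\<close> and \<open>b\<close> add up to \<open>k\<close>, which is invertible.
\<close>

lemma mon_exact_plus_theta:
  assumes ij: "i + j = k + CARD('a) - 1" and big: "CARD('a) \<le> i \<or> CARD('a) \<le> j"
  shows "mon i j \<in> exact_plus_theta"
proof -
  have "\<exists>W R :: 'a poly poly. W \<in> homog k \<and> R \<in> homog (k - 2) \<and> cst2 (of_nat k) * mon i j = Dq W + theta * R"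
  proof (cases "CARD('a) \<le> j")
    case True
    define b where "b = k - i"
    have b: "i + b = k" "j = b - 1 + CARD('a)" "b \<ge> 1" using True ij k_ge_2 by (auto simp: b_def)
    define R :: "'a poly poly" where "R = (if i = 0 then 0 else - (cst2 (of_nat i) * mon (i - 1) (b - 1)))"
    have "R \<in> homog (k - 2)"
      using b unfolding R_def by (auto intro!: homog_subspace mon_homog)
    moreover have "cst2 (of_nat k) * mon i j = Dq (mon i b) + theta * R"
    proof (cases i)
      case 0
      then show ?thesis using b unfolding Dq_rules R_def of_nat_k_sum[OF b(1), symmetric] by (simp add: cst2_simps)
    next
      case (Suc i')
      obtain b' where b': "b = Suc b'" using b(3) by (cases b) auto
      show ?thesis
        unfolding of_nat_k_sum[OF b(1), symmetric] Dq_rules R_def b(2)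
        by (simp add: Suc b' theta_def power_add algebra_simps del: of_nat_Suc)
    qed
    moreover have "(mon i b :: 'a poly poly) \<in> homog k" by (rule mon_homog[OF b(1)])
    ultimately show ?thesis by blast
  next
    case False
    define a where "a = k - j"
    have a: "a + j = k" "i = a - 1 + CARD('a)" "a \<ge> 1" using False big ij k_ge_2 by (auto simp: a_def)
    define R :: "'a poly poly" where "R = (if j = 0 then 0 else cst2 (of_nat j) * mon (a - 1) (j - 1))"
    have "R \<in> homog (k - 2)"
      using a unfolding R_def by (auto intro!: homog_subspace mon_homog)
    moreover have "cst2 (of_nat k) * mon i j = Dq (mon a j) + theta * R"
    proof (cases j)
      case 0
      then show ?thesis using a unfolding Dq_rules R_def of_nat_k_sum[OF a(1), symmetric] by (simp add: cst2_simps)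
    next
      case (Suc j')
      obtain a' where a': "a = Suc a'" using a(3) by (cases a) auto
      show ?thesis
        unfolding of_nat_k_sum[OF a(1), symmetric] Dq_rules R_def a(2)
        by (simp add: Suc a' theta_def power_add algebra_simps del: of_nat_Suc)
    qed
    moreover have "(mon a j :: 'a poly poly) \<in> homog k" by (rule mon_homog[OF a(1)])
    ultimately show ?thesis by blast
  qed
  then have "cst2 (of_nat k) * mon i j \<in> exact_plus_theta" unfolding exact_plus_theta_def by blast
  then have "cst2 (inverse (of_nat k)) * (cst2 (of_nat k) * mon i j) \<in> exact_plus_theta" by (rule exact_plus_theta_closed)
  moreover have "cst2 (inverse (of_nat k)) * (cst2 (of_nat k) * mon i j) = (cst2 (inverse (of_nat k) * of_nat k) * mon i j :: 'a poly poly)"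
    by (simp only: cst2_simps(3) mult.assoc)
  moreover have "\<dots> = mon i j" using k_nonzero by (simp add: cst2_simps)
  ultimately show ?thesis by (simp only:)
qed

text \<open>
  The cokernel of \<open>\<theta>\<^sub>q\<close> is spanned by the monomials \<open>X\<^sup>i Y\<^sup>j\<close> with \<open>i, j < q\<close>.
\<close>

lemma exact_plus_thetaI:
  assumes F: "F \<in> homog (k + CARD('a) - 1)"
    and c: "\<And>i j. i + j = k + CARD('a) - 1 \<Longrightarrow> i < CARD('a) \<Longrightarrow> j < CARD('a) \<Longrightarrow> coeff2 F i j = 0"
  shows "F \<in> exact_plus_theta"
proof -
  have "(\<Sum>i\<in>A. cst2 (coeff2 F i (k + CARD('a) - 1 - i)) * mon i (k + CARD('a) - 1 - i)) \<in> exact_plus_theta"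
    if "A \<subseteq> {..k + CARD('a) - 1}" for A
    using finite_subset[OF that finite_atMost] that
  proof (induction A rule: finite_induct)
    case (insert i A)
    let ?j = "k + CARD('a) - 1 - i"
    have ij: "i + ?j = k + CARD('a) - 1" using insert card_gt_2 by auto
    have "cst2 (coeff2 F i ?j) * mon i ?j \<in> exact_plus_theta"
    proof (cases "i < CARD('a) \<and> ?j < CARD('a)")
      case True
      then show ?thesis using c[OF ij] by (simp add: cst2_simps exact_plus_theta_closed)
    next
      case False
      then show ?thesis using mon_exact_plus_theta[OF ij] by (intro exact_plus_theta_closed) auto
    qed
    then show ?case using insert by (simp add: exact_plus_theta_closed)
  qed (simp add: exact_plus_theta_closed)
  from this[OF subset_refl] show ?thesis using homog_as_sum[OF F] by simp
qed

text \<open>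
  By \<open>cyc_f_uv\<close> the function is, up to a constant, \<open>eps F\<close> divided by \<open>(u v)\<^sup>q\<close>. The coefficients of
  \<open>F\<close> at monomials with both exponents below \<open>q\<close> are its coefficients in \<open>idx_pole\<close>.
\<close>

lemma cyc_f_exact_imp:
  assumes F: "F \<in> homog (k + CARD('a) - 1)" and B: "cyc_f (eps F) crv_u crv_v \<in> B_O"
  shows "F \<in> exact_plus_theta"
proof (rule exact_plus_thetaI[OF F])
  let ?q = "int CARD('a)"
  fix i j :: nat assume ij: "i + j = k + CARD('a) - 1" "i < CARD('a)" "j < CARD('a)"
  have d: "?q \<le> int (k + CARD('a) - 1)" "int (k + CARD('a) - 1) \<le> ?q + ?q" using k_ge_2 k_less_q by auto
  have L: "eps F \<in> lspan (window TYPE('a) ?q)"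
  proof (rule subsetD[OF lspan_mono eps_homog[OF F, unfolded hom_crv_def]])
    show "{(int i, int j) | i j. i + j = k + CARD('a) - 1} \<subseteq> window TYPE('a) ?q" using d by (auto simp: window_def)
  qed
  have L': "mm (- ?q) (- ?q) * eps F \<in> lspan (window TYPE('a) (- ?q))"
    by (rule subsetD[OF lspan_mono lspan_shift[OF L]]) (auto simp: window_def)
  have "(int j - ?q, int i - ?q) \<notin> idx_u TYPE('a) \<union> idx_v TYPE('a)" using ij by (auto simp: idx_u_def idx_v_def)
  then have "lcoeff (- ?q) (cyc_f (eps F) crv_u crv_v) (int j - ?q, int i - ?q) = 0"
    using B unfolding B_O_eq lspan_iff_lcoeff[OF idx_split(1)] by blast
  then have "- inverse (of_nat k) * lcoeff (- ?q) (mm (- ?q) (- ?q) * eps F) (int j - ?q, int i - ?q) = 0"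
    unfolding cyc_f_uv lcoeff_scale[OF L'] .
  then have "lcoeff (- ?q) (mm (- ?q) (- ?q) * eps F) (int j - ?q, int i - ?q) = 0" using k_nonzero by simp
  then have "lcoeff ?q (eps F) (int j, int i) = 0"
    using lcoeff_shift[OF L, of "- ?q" "- ?q" "int j" "int i"] by simp
  then show "coeff2 F i j = 0" using lcoeff_eps[OF F d ij(1)] by simp
qed

lemma Dq_homog: "W \<in> homog k \<Longrightarrow> Dq (W :: 'a poly poly) \<in> homog (k + CARD('a) - 1)"
proof (induction W rule: homog_induct)
  case (mon c i j)
  have "cst2 (of_nat i) * mon (i - 1 + CARD('a)) j \<in> (homog (k + CARD('a) - 1) :: 'a poly poly set)"
    using mon by (cases i) (simp add: cst2_simps homog_subspace(1), intro homog_subspace(5) mon_homog, simp)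
  moreover have "cst2 (of_nat j) * mon i (j - 1 + CARD('a)) \<in> (homog (k + CARD('a) - 1) :: 'a poly poly set)"
    using mon by (cases j) (simp add: cst2_simps homog_subspace(1), intro homog_subspace(5) mon_homog, simp)
  ultimately have "Dq (mon i j) \<in> (homog (k + CARD('a) - 1) :: 'a poly poly set)"
    unfolding Dq_rules(5) by (rule homog_subspace(2))
  then show ?case unfolding Dq_rules(2) by (rule homog_subspace(5))
qed (auto simp: Dq_rules homog_subspace)

lemma cyc_eps_exact: "W \<in> homog k \<Longrightarrow> cyc (eps (Dq W)) \<in> B_dR"
  unfolding eps_Dq by (rule cyc_crv_der[OF eps_homog])

lemma cyc_eps_theta:
  "R \<in> homog (k - 2) \<Longrightarrow> (form (- eps R), form (- eps R), 0) - cyc (eps (theta * R)) \<in> B_dR"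
  using cyc_low_degree[OF eps_homog[of "cst2 (- 1) * R" "k - 2"]] homog_subspace(5)[of R "k - 2" "- 1"]
  by (simp add: eps_hom eps_theta eps_generators cst_simps)

lemma cyc_f_exact_iff:
  assumes F: "F \<in> homog (k + CARD('a) - 1)"
  shows "cyc_f (eps F) crv_u crv_v \<in> B_O \<longleftrightarrow> F \<in> exact_plus_theta"
proof
  show "cyc_f (eps F) crv_u crv_v \<in> B_O \<Longrightarrow> F \<in> exact_plus_theta" by (rule cyc_f_exact_imp[OF F])
  assume "F \<in> exact_plus_theta"
  then obtain W R where WR: "F = Dq W + theta * R" "W \<in> homog k" "R \<in> homog (k - 2)"
    unfolding exact_plus_theta_def by blast
  have "cyc_f (eps (Dq W)) crv_u crv_v \<in> B_O" "- cyc_f (eps (theta * R)) crv_u crv_v \<in> B_O"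
    using cyc_eps_exact[OF WR(2)] cyc_eps_theta[OF WR(3)] by (auto simp: cyc_def B_dR_def B_O_def)
  then have "cyc_f (eps (Dq W)) crv_u crv_v + cyc_f (eps (theta * R)) crv_u crv_v \<in> B_O"
    unfolding B_O_eq using lspan_subspace(2,5) by fastforce
  moreover have "cyc_f (eps F) crv_u crv_v = cyc_f (eps (Dq W)) crv_u crv_v + cyc_f (eps (theta * R)) crv_u crv_v"
    unfolding WR(1) eps_hom(2) cyc_f_def cyc_linear by simp
  ultimately show "cyc_f (eps F) crv_u crv_v \<in> B_O" by simp
qed

text \<open>
  If the class in \<open>H\<^sup>1(C, \<O>\<^sub>C)\<close> vanishes, then \<open>F = D W + \<theta>\<^sub>q R\<close>, and the de Rham class of \<open>F\<close> is the
  one of a global form. As global functions are constant, such a class vanishes only for the form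
  zero, which means \<open>R = 0\<close>.
\<close>

lemma cyc_exact_iff:
  assumes F: "F \<in> homog (k + CARD('a) - 1)"
  shows "cyc (eps F) \<in> B_dR \<longleftrightarrow> F \<in> Dq ` homog k"
proof
  assume B: "cyc (eps F) \<in> B_dR"
  then have "cyc_f (eps F) crv_u crv_v \<in> B_O" by (auto simp: cyc_def B_dR_def B_O_def)
  then obtain W R where WR: "F = Dq W + theta * R" "W \<in> homog k" "R \<in> homog (k - 2)"
    using cyc_f_exact_imp[OF F] unfolding exact_plus_theta_def by blast
  have "(form (- eps R), form (- eps R), 0) =
      ((form (- eps R), form (- eps R), 0) - cyc (eps (theta * R))) + (cyc (eps F) - cyc (eps (Dq W)))"
    unfolding WR(1) eps_hom(2) cyc_linear by simp
  then have "(form (- eps R), form (- eps R), 0) \<in> B_dR"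
    using B_dR_closed(2)[OF q_zero cyc_eps_theta[OF WR(3)] B_dR_closed(4)[OF q_zero B cyc_eps_exact[OF WR(2)]]] by simp
  then have "form (- eps R) = 0" by (rule form_exact_imp_zero[OF q_zero])
  then have "eps R = 0" using diff_coeff_form[OF q_zero, of "- eps R"] by (simp add: diff_coeff_rules[OF q_zero])
  then have "R = 0" by (rule eps_inj[OF WR(3)])
  then show "F \<in> Dq ` homog k" using WR by simp
qed (use cyc_eps_exact in auto)

end

section \<open>Short exact sequences\<close>

lemma gl2_homD:
  assumes "f \<in> gl2_hom M N"
  shows "m \<in> carrier M \<Longrightarrow> f m \<in> carrier N"
    "m \<in> carrier M \<Longrightarrow> m' \<in> carrier M \<Longrightarrow> f (m \<oplus>\<^bsub>M\<^esub> m') = f m \<oplus>\<^bsub>N\<^esub> f m'"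
    "m \<in> carrier M \<Longrightarrow> f (c \<odot>\<^bsub>M\<^esub> m) = c \<odot>\<^bsub>N\<^esub> f m"
    "g \<in> GL2 \<Longrightarrow> m \<in> carrier M \<Longrightarrow> f (act M g m) = act N g (f m)"
  using assms by (auto simp: gl2_hom_def)

lemma gl2_hom_zero:
  assumes M: "is_gl2_module M" and N: "is_gl2_module N" and f: "f \<in> gl2_hom M N"
  shows "f \<zero>\<^bsub>M\<^esub> = \<zero>\<^bsub>N\<^esub>"
proof -
  interpret M: Module.module ring_of_type_algebra M by (rule is_gl2_moduleD(1)[OF M])
  have "f (0 \<odot>\<^bsub>M\<^esub> \<zero>\<^bsub>M\<^esub>) = 0 \<odot>\<^bsub>N\<^esub> f \<zero>\<^bsub>M\<^esub>" by (rule gl2_homD(3)[OF f M.zero_closed])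
  then show ?thesis
    using vec_space_smult_zero(1)[OF is_gl2_moduleD(1)[OF M] M.zero_closed]
      vec_space_smult_zero(1)[OF is_gl2_moduleD(1)[OF N] gl2_homD(1)[OF f M.zero_closed]] by simp
qed

lemma coset_eq_self_iff:
  assumes M: "vec_space (M :: ('a::field, 'm, 'z) module_scheme)" and W: "sub_space M W" and x: "x \<in> carrier M"
  shows "W +>\<^bsub>M\<^esub> x = W \<longleftrightarrow> x \<in> W"
proof -
  interpret M: Module.module ring_of_type_algebra M by (rule M)
  have "W +>\<^bsub>M\<^esub> \<zero>\<^bsub>M\<^esub> = W" using lin_mapD(2)[OF lin_map_coset[OF M W]] by simp
  moreover have "\<ominus>\<^bsub>M\<^esub> \<zero>\<^bsub>M\<^esub> = \<zero>\<^bsub>M\<^esub>" by (metis M.l_neg M.r_zero M.zero_closed M.a_inv_closed)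
  ultimately show ?thesis
    using coset_eq_iff[OF M W x M.zero_closed] x by (simp only: a_minus_def M.r_zero)
qed

lemma
  assumes L: "is_gl2_module L" and M: "is_gl2_module M" and i: "i \<in> gl2_hom L M"
  shows sub_rep_image: "sub_rep M (i ` carrier L)"
    and short_exact_quot: "inj_on i (carrier L) \<Longrightarrow>
      short_exact L i M (\<lambda>x. (i ` carrier L) +>\<^bsub>M\<^esub> x) (quot_gl2_module M (i ` carrier L))"
proof -
  interpret L: Module.module ring_of_type_algebra L by (rule is_gl2_moduleD(1)[OF L])
  let ?W = "i ` carrier L"
  note L' = is_gl2_moduleD[OF L] and VL = vec_spaceD[OF is_gl2_moduleD(1)[OF L]] and i' = gl2_homD[OF i]
  have s: "sub_space M ?W"
    unfolding sub_space_def
  proof (intro conjI ballI allI)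
    show "\<zero>\<^bsub>M\<^esub> \<in> ?W" using gl2_hom_zero[OF L M i] L.zero_closed by (metis imageI)
    show "x \<oplus>\<^bsub>M\<^esub> y \<in> ?W" if "x \<in> ?W" "y \<in> ?W" for x y
      using that i'(2) L.add.m_closed by (auto intro: rev_image_eqI)
    show "c \<odot>\<^bsub>M\<^esub> x \<in> ?W" if "x \<in> ?W" for c x
      using that VL by (auto simp: i'(3)[symmetric])
  qed (use i'(1) in auto)
  show r: "sub_rep M ?W"
    unfolding sub_rep_def using s L'(2) by (auto simp: i'(4)[symmetric])
  assume inj: "inj_on i (carrier L)"
  note c = lin_mapD[OF lin_map_coset[OF is_gl2_moduleD(1)[OF M] s]]
  have "(\<lambda>x. ?W +>\<^bsub>M\<^esub> x) \<in> gl2_hom M (quot_gl2_module M ?W)"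
    unfolding gl2_hom_def using c quot_act_coset[OF M r] by (auto simp: quot_gl2_module_def)
  moreover have "?W = a_kernel M (quot_gl2_module M ?W) (\<lambda>x. ?W +>\<^bsub>M\<^esub> x)"
    unfolding a_kernel_def' using coset_eq_self_iff[OF is_gl2_moduleD(1)[OF M] s] i'(1)
    by (auto simp: quot_gl2_module_def)
  ultimately show "short_exact L i M (\<lambda>x. ?W +>\<^bsub>M\<^esub> x) (quot_gl2_module M ?W)"
    unfolding short_exact_def using L M i inj is_gl2_module_quot[OF M r] coset_onto[OF is_gl2_moduleD(1)[OF M] s]
    by (simp add: quot_gl2_module_def)
qed

text \<open>
  Elements of \<open>A'\<close> are lifted along \<open>f\<close>, and for the lifts the identities hold.
\<close>

lemma gl2_hom_descend:
  fixes A :: "('a::field, 'x) gl2_module" and A' :: "('a, 'y) gl2_module" and B :: "('a, 'z) gl2_module" and B' :: "('a, 'w) gl2_module"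
  assumes A: "is_gl2_module A" and f: "f \<in> gl2_hom A A'" "f ` carrier A = carrier A'"
    and h: "h \<in> gl2_hom A B" and f': "f' \<in> gl2_hom B B'" and sq: "\<And>x. x \<in> carrier A \<Longrightarrow> h' (f x) = f' (h x)"
  shows "h' \<in> gl2_hom A' B'"
proof -
  interpret A: Module.module ring_of_type_algebra A by (rule is_gl2_moduleD(1)[OF A])
  note fD = gl2_homD[OF f(1)] and hD = gl2_homD[OF h] and f'D = gl2_homD[OF f']
  note AD = is_gl2_moduleD[OF A] and VA = vec_spaceD[OF is_gl2_moduleD(1)[OF A]]
  have exA: "\<exists>x\<in>carrier A. y = f x" if "y \<in> carrier A'" for y using that f(2) by auto
  show ?thesis
    unfolding gl2_hom_def
  proof (intro CollectI conjI ballI allI subsetI)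
    fix y assume "y \<in> h' ` carrier A'"
    then obtain x where "x \<in> carrier A" "y = h' (f x)" unfolding f(2)[symmetric] by blast
    then show "y \<in> carrier B'" using sq hD(1) f'D(1) by simp
  next
    fix y z assume "y \<in> carrier A'" "z \<in> carrier A'"
    then obtain x w where x: "x \<in> carrier A" "y = f x" and w: "w \<in> carrier A" "z = f w" using exA by blast
    show "h' (y \<oplus>\<^bsub>A'\<^esub> z) = h' y \<oplus>\<^bsub>B'\<^esub> h' z"
      unfolding x(2) w(2) fD(2)[OF x(1) w(1), symmetric] sq[OF x(1)] sq[OF w(1)] sq[OF A.add.m_closed[OF x(1) w(1)]]
      using hD(2)[OF x(1) w(1)] f'D(2)[OF hD(1)[OF x(1)] hD(1)[OF w(1)]] by simp
  next
    fix d y assume "y \<in> carrier A'"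
    then obtain x where x: "x \<in> carrier A" "y = f x" using exA by blast
    then have dx: "d \<odot>\<^bsub>A\<^esub> x \<in> carrier A" using VA by blast
    show "h' (d \<odot>\<^bsub>A'\<^esub> y) = d \<odot>\<^bsub>B'\<^esub> h' y"
      unfolding x(2) fD(3)[OF x(1), symmetric] sq[OF x(1)] sq[OF dx] hD(3)[OF x(1)] f'D(3)[OF hD(1)[OF x(1)]] ..
  next
    fix g :: "'a ^ 2 ^ 2" and y assume g: "g \<in> GL2" and "y \<in> carrier A'"
    then obtain x where x: "x \<in> carrier A" "y = f x" using exA by blast
    show "h' (act A' g y) = act B' g (h' y)"
      unfolding x(2) fD(4)[OF g x(1), symmetric] sq[OF x(1)] sq[OF AD(2)[OF g x(1)]] hD(4)[OF g x(1)]
        f'D(4)[OF g hD(1)[OF x(1)]] ..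
  qed
qed

lemma short_exact_transport:
  assumes ex: "short_exact L i M p N"
    and mods: "is_gl2_module L'" "is_gl2_module M'" "is_gl2_module N'"
    and a: "\<alpha> \<in> gl2_iso L L'" and b: "\<beta> \<in> gl2_iso M M'" and c: "\<gamma> \<in> gl2_iso N N'"
    and ia: "\<And>x. x \<in> carrier L \<Longrightarrow> i' (\<alpha> x) = \<beta> (i x)" and pb: "\<And>y. y \<in> carrier M \<Longrightarrow> p' (\<beta> y) = \<gamma> (p y)"
  shows "short_exact L' i' M' p' N'"
proof -
  have e: "is_gl2_module L" "is_gl2_module M" "is_gl2_module N" "i \<in> gl2_hom L M" "p \<in> gl2_hom M N"
    "inj_on i (carrier L)" "i ` carrier L = a_kernel M N p" "p ` carrier M = carrier N"
    using ex by (auto simp: short_exact_def)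
  have hom: "\<alpha> \<in> gl2_hom L L'" "\<beta> \<in> gl2_hom M M'" "\<gamma> \<in> gl2_hom N N'"
    and bij: "bij_betw \<alpha> (carrier L) (carrier L')" "bij_betw \<beta> (carrier M) (carrier M')" "bij_betw \<gamma> (carrier N) (carrier N')"
    using a b c by (auto simp: gl2_iso_def)
  have onto: "\<alpha> ` carrier L = carrier L'" "\<beta> ` carrier M = carrier M'" "\<gamma> ` carrier N = carrier N'"
    and inj: "inj_on \<alpha> (carrier L)" "inj_on \<beta> (carrier M)" "inj_on \<gamma> (carrier N)"
    using bij by (auto simp: bij_betw_def)
  interpret L: Module.module ring_of_type_algebra L by (rule is_gl2_moduleD(1)[OF e(1)])
  interpret M: Module.module ring_of_type_algebra M by (rule is_gl2_moduleD(1)[OF e(2)])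
  interpret N: Module.module ring_of_type_algebra N by (rule is_gl2_moduleD(1)[OF e(3)])
  have i': "i' \<in> gl2_hom L' M'" by (rule gl2_hom_descend[OF e(1) hom(1) onto(1) e(4) hom(2) ia])
  have p': "p' \<in> gl2_hom M' N'" by (rule gl2_hom_descend[OF e(2) hom(2) onto(2) e(5) hom(3) pb])
  have inji: "inj_on i' (carrier L')"
  proof (rule inj_onI)
    fix x y assume xy: "x \<in> carrier L'" "y \<in> carrier L'" "i' x = i' y"
    obtain v w where vw: "v \<in> carrier L" "w \<in> carrier L" "x = \<alpha> v" "y = \<alpha> w"
      using xy(1,2) unfolding onto(1)[symmetric] by blast
    have "\<beta> (i v) = \<beta> (i w)" using xy(3) unfolding vw(3,4) ia[OF vw(1)] ia[OF vw(2)] .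
    then have "i v = i w" using inj_onD[OF inj(2)] gl2_homD(1)[OF e(4)] vw(1,2) by blast
    then have "v = w" by (rule inj_onD[OF e(6) _ vw(1,2)])
    then show "x = y" by (simp only: vw(3,4))
  qed
  have "i' ` carrier L' = \<beta> ` (i ` carrier L)"
    unfolding onto(1)[symmetric] image_image using ia by auto
  also have "\<dots> = a_kernel M' N' p'"
    unfolding e(7) a_kernel_def'
  proof (rule equalityI; rule subsetI)
    fix y assume "y \<in> \<beta> ` {x \<in> carrier M. p x = \<zero>\<^bsub>N\<^esub>}"
    then obtain x where "x \<in> carrier M" "p x = \<zero>\<^bsub>N\<^esub>" "y = \<beta> x" by blast
    then show "y \<in> {x \<in> carrier M'. p' x = \<zero>\<^bsub>N'\<^esub>}"
      using pb gl2_hom_zero[OF e(3) mods(3) hom(3)] gl2_homD(1)[OF hom(2)] by simp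
  next
    fix y assume "y \<in> {x \<in> carrier M'. p' x = \<zero>\<^bsub>N'\<^esub>}"
    then obtain x where x: "x \<in> carrier M" "y = \<beta> x" "p' y = \<zero>\<^bsub>N'\<^esub>" unfolding onto(2)[symmetric] by blast
    then have "\<gamma> (p x) = \<gamma> \<zero>\<^bsub>N\<^esub>" using pb gl2_hom_zero[OF e(3) mods(3) hom(3)] by simp
    then have "p x = \<zero>\<^bsub>N\<^esub>" using inj_onD[OF inj(3)] gl2_homD(1)[OF e(5) x(1)] N.zero_closed by blast
    then show "y \<in> \<beta> ` {x \<in> carrier M. p x = \<zero>\<^bsub>N\<^esub>}" using x by blast
  qed
  finally have ker: "i' ` carrier L' = a_kernel M' N' p'" .
  have "p' ` carrier M' = \<gamma> ` (p ` carrier M)"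
    unfolding onto(2)[symmetric] image_image using pb by auto
  then have "p' ` carrier M' = carrier N'" unfolding e(8) onto(3) .
  then show ?thesis unfolding short_exact_def using mods i' p' inji ker by blast
qed

section \<open>Comparison of the two sequences\<close>

context curve_setup
begin

abbreviation (input) SymV :: "('a, 'a poly poly) gl2_module" where "SymV \<equiv> Sym (k + (CARD('a) - 1))"

lemma deg_eq: "k + (CARD('a) - 1) = k + CARD('a) - 1"
  using card_gt_2 by simp

lemma p_zero_poly2: "of_nat p = (0 :: 'a poly poly)"
proof -
  have "cst2 (of_nat p :: 'a) = of_nat p" by (rule cst2_simps(8))
  then show ?thesis by (simp add: p_zero cst2_simps)
qed

lemma cst2_lin_power_q:
  "(cst2 a * varX + cst2 b * varY) ^ CARD('a) = cst2 (a :: 'a) * varX ^ CARD('a) + cst2 b * varY ^ CARD('a)"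
  by (simp add: frobenius_add[OF p_zero_poly2] power_mult_distrib flip: cst2_simps(7))

text \<open>
  Both sides are derivations along the action of \<open>g\<close>, and they agree on \<open>X\<close> and \<open>Y\<close> because the \<open>q\<close>-th
  power is linear over \<open>\<bbbF>\<close>.
\<close>

lemma act2_Dq: "act2 g (Dq W) = Dq (act2 g (W :: 'a poly poly))"
  unfolding Dq_eq_poly2_der
proof (rule derivation_poly2_eqI[of "act2 g" "\<lambda>W. act2 g (poly2_der CARD('a) W)" "\<lambda>W. poly2_der CARD('a) (act2 g W)"])
  show "is_derivation (act2 g) (\<lambda>W. act2 g (poly2_der CARD('a) W))"
    by (rule is_derivation_hom_left[OF is_derivation_poly2_der is_ring_hom_act2])
  show "is_derivation (act2 g) (\<lambda>W. poly2_der CARD('a) (act2 g W))"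
    by (rule is_derivation_hom_right[OF is_derivation_poly2_der is_ring_hom_act2])
qed (simp_all add: act2_hom act2_generators cst2_lin_power_q is_derivationD[OF is_derivation_poly2_der])

lemma act2_theta: "act2 g theta = cst2 (det g) * (theta :: 'a poly poly)"
proof -
  have w: "(cst2 a * x + cst2 c * y) * (cst2 b * x' + cst2 d * y') - (cst2 a * x' + cst2 c * y') * (cst2 b * x + cst2 d * y) =
     (cst2 a * cst2 d - cst2 b * cst2 c) * (x * y' - x' * y)" for a b c d :: 'a and x y x' y'
    by (simp add: algebra_simps)
  have "act2 g theta = cst2 (g$1$1 * g$2$2 - g$1$2 * g$2$1) * theta"
    unfolding theta_def act2_hom act2_generators cst2_lin_power_q w cst2_simps ..
  then show ?thesis unfolding det_2 .
qed

lemma sub_rep_exact: "sub_rep SymV (Dq ` carrier (Sym k :: ('a, 'a poly poly) gl2_module))"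
proof -
  have "Dq ` homog k \<subseteq> (homog (k + (CARD('a) - 1)) :: 'a poly poly set)"
    unfolding deg_eq using Dq_homog by blast
  moreover have "f + f' \<in> Dq ` homog k" if "f \<in> Dq ` homog k" "f' \<in> Dq ` homog k" for f f' :: "'a poly poly"
    using that by (auto intro!: imageI homog_subspace(2) simp flip: Dq_rules(1))
  moreover have "cst2 c * f \<in> Dq ` homog k" if "f \<in> Dq ` homog k" for f :: "'a poly poly" and c
    using that by (auto intro!: imageI homog_subspace(5) simp flip: Dq_rules(2))
  moreover have "act2 g f \<in> Dq ` homog k" if "f \<in> Dq ` homog k" for f :: "'a poly poly" and g
    using that by (auto intro!: imageI act2_homog simp: act2_Dq)
  moreover have "0 \<in> Dq ` (homog k :: 'a poly poly set)" using Dq_rules(3) homog_subspace(1) by (metis imageI)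
  ultimately show ?thesis by (auto simp: sub_rep_def sub_space_def)
qed

lemma sub_space_exact: "sub_space SymV (Dq ` carrier (Sym k :: ('a, 'a poly poly) gl2_module))"
  using sub_rep_exact by (simp add: sub_rep_def)

definition cls :: "'a poly poly \<Rightarrow> 'a poly poly set" where
  "cls F = Dq ` carrier (Sym k) +>\<^bsub>SymV\<^esub> F"

abbreviation (input) SymQ :: "('a, 'a poly poly set) gl2_module" where "SymQ \<equiv> Sym_mod_Dq k"

lemma is_gl2_module_SymQ: "is_gl2_module SymQ"
  unfolding Sym_mod_Dq_def by (rule is_gl2_module_quot[OF is_gl2_module_Sym sub_rep_exact])

lemma SymQ_simps:
  "carrier SymQ = a_rcosets\<^bsub>SymV\<^esub> (Dq ` carrier (Sym k))" "zero SymQ = Dq ` carrier (Sym k)"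
  "add SymQ = set_add SymV" "smult SymQ = smult (quot_module SymV (Dq ` carrier (Sym k)))"
  by (simp_all add: Sym_mod_Dq_def quot_gl2_module_def)

lemma lin_map_cls: "lin_map SymV SymQ cls"
  using lin_map_coset[OF vec_space_Sym sub_space_exact] by (simp add: lin_map_def SymQ_simps cls_def[abs_def])

lemma cls_rules:
  "F \<in> homog (k + CARD('a) - 1) \<Longrightarrow> cls F \<in> carrier SymQ" "cls 0 = \<zero>\<^bsub>SymQ\<^esub>"
  "F \<in> homog (k + CARD('a) - 1) \<Longrightarrow> G \<in> homog (k + CARD('a) - 1) \<Longrightarrow> cls (F + G) = cls F \<oplus>\<^bsub>SymQ\<^esub> cls G"
  "F \<in> homog (k + CARD('a) - 1) \<Longrightarrow> cls (cst2 c * F) = c \<odot>\<^bsub>SymQ\<^esub> cls F"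
  using lin_mapD[OF lin_map_cls] by (simp_all add: deg_eq)

lemma cls_onto: "cls ` homog (k + CARD('a) - 1) = carrier SymQ"
  using coset_onto[OF vec_space_Sym sub_space_exact] by (simp add: SymQ_simps cls_def[abs_def] deg_eq)

lemma cls_eq_iff:
  assumes "F \<in> homog (k + CARD('a) - 1)" "G \<in> homog (k + CARD('a) - 1)"
  shows "cls F = cls G \<longleftrightarrow> F - G \<in> Dq ` homog k"
proof -
  have "F \<ominus>\<^bsub>SymV\<^esub> G = F - G"
    using a_minus_type_module[of "\<lambda>c f. cst2 c * f" "homog (k + (CARD('a) - 1))" F G] assms
      vec_space_cong[OF _ _ _ _ vec_space_Sym[of "k + (CARD('a) - 1)", where 'a = 'a], of "type_module (\<lambda>c f. cst2 c * f) (homog (k + (CARD('a) - 1)))"]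
    by (simp add: a_minus_def a_inv_def m_inv_def deg_eq)
  then show ?thesis
    unfolding cls_def using coset_eq_iff[OF vec_space_Sym sub_space_exact, of F G] assms by (simp add: deg_eq)
qed

lemma act_SymQ: "g \<in> GL2 \<Longrightarrow> F \<in> homog (k + CARD('a) - 1) \<Longrightarrow> act SymQ g (cls F) = cls (act2 g F)"
  unfolding cls_def Sym_mod_Dq_def
  using quot_act_coset[OF is_gl2_module_Sym sub_rep_exact] by (simp add: quot_gl2_module_def deg_eq)

lemma theta_bar_eq: "theta_bar k f = cls (theta * f)"
  by (simp add: theta_bar_def cls_def)

lemma theta_bar_hom: "theta_bar k \<in> gl2_hom (twist 1 (Sym (k - 2) :: ('a, 'a poly poly) gl2_module)) SymQ"
  unfolding gl2_hom_def
proof (intro CollectI conjI ballI allI)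
  show "theta_bar k ` carrier (twist 1 (Sym (k - 2))) \<subseteq> carrier SymQ"
    using cls_rules(1)[OF theta_mult_homog] by (auto simp: theta_bar_eq)
next
  fix f f' :: "'a poly poly" assume f: "f \<in> carrier (twist 1 (Sym (k - 2)))" "f' \<in> carrier (twist 1 (Sym (k - 2)))"
  then show "theta_bar k (f \<oplus>\<^bsub>twist 1 (Sym (k - 2))\<^esub> f') = theta_bar k f \<oplus>\<^bsub>SymQ\<^esub> theta_bar k f'"
    using cls_rules(3)[OF theta_mult_homog theta_mult_homog, of f f'] by (simp add: theta_bar_eq distrib_left)
next
  fix c and f :: "'a poly poly" assume f: "f \<in> carrier (twist 1 (Sym (k - 2)))"
  then show "theta_bar k (c \<odot>\<^bsub>twist 1 (Sym (k - 2))\<^esub> f) = c \<odot>\<^bsub>SymQ\<^esub> theta_bar k f"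
    using cls_rules(4)[OF theta_mult_homog, of f c] by (simp add: theta_bar_eq mult.left_commute)
next
  fix g :: "'a ^ 2 ^ 2" and f :: "'a poly poly" assume g: "g \<in> GL2" and f: "f \<in> carrier (twist 1 (Sym (k - 2)))"
  then have "act SymQ g (cls (theta * f)) = cls (act2 g (theta * f))" by (intro act_SymQ theta_mult_homog) simp_all
  also have "act2 g (theta * f) = theta * (cst2 (det g) * act2 g f)"
    unfolding act2_hom(3) act2_theta by (simp only: mult_ac)
  finally show "theta_bar k (act (twist 1 (Sym (k - 2))) g f) = act SymQ g (theta_bar k f)"
    by (simp add: theta_bar_eq)
qed

text \<open>
  Read in cohomology, the assertion is that a nonzero global form has a nonzero de Rham class.
\<close>

lemma theta_exact_imp_zero:
  assumes R: "R \<in> homog (k - 2)" and e: "theta * R \<in> Dq ` homog k"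
  shows "R = (0 :: 'a poly poly)"
proof -
  have c: "cyc (eps (theta * R)) \<in> B_dR" using e cyc_eps_exact by auto
  have "(form (- eps R), form (- eps R), 0) \<in> B_dR"
    using B_dR_closed(2)[OF q_zero cyc_eps_theta[OF R] c] by (simp only: diff_add_cancel)
  then have "form (- eps R) = 0" by (rule form_exact_imp_zero[OF q_zero])
  then have "eps R = 0" using diff_coeff_form[OF q_zero, of "- eps R"] by (simp add: diff_coeff_rules[OF q_zero])
  then show ?thesis by (rule eps_inj[OF R])
qed

lemma theta_bar_inj: "inj_on (theta_bar k) (homog (k - 2) :: 'a poly poly set)"
proof (rule inj_onI)
  fix f f' :: "'a poly poly" assume f: "f \<in> homog (k - 2)" "f' \<in> homog (k - 2)" "theta_bar k f = theta_bar k f'"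
  then have "theta * (f - f') \<in> Dq ` homog k"
    unfolding theta_bar_eq cls_eq_iff[OF theta_mult_homog[OF f(1)] theta_mult_homog[OF f(2)]] by (simp add: right_diff_distrib)
  then show "f = f'" using theta_exact_imp_zero[OF homog_subspace(3)[OF f(1,2)]] by simp
qed

lemma short_exact_polynomials:
  "short_exact (twist 1 (Sym (k - 2)) :: ('a, 'a poly poly) gl2_module) (theta_bar k) SymQ (proj_coker k) (coker_theta k)"
  using short_exact_quot[OF is_gl2_module_twist[OF is_gl2_module_Sym] is_gl2_module_SymQ theta_bar_hom] theta_bar_inj
  by (simp add: proj_coker_def[abs_def] coker_theta_def)

subsection \<open>De Rham cohomology\<close>

definition cls_dR :: "'a poly poly \<Rightarrow> ('a, 'a) dR_cochain set" where
  "cls_dR F = B_dR +>\<^bsub>Z_dR\<^esub> cyc (eps F)"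

definition cls_O :: "'a poly poly \<Rightarrow> ('a, 'a) crv set" where
  "cls_O F = B_O +>\<^bsub>Z_O\<^esub> cyc_f (eps F) crv_u crv_v"

lemma eps_image: "eps ` homog d = hom_crv d"
  using eps_homog eps_homog_onto by blast

lemma weight_simps:
  "zero (H_dR_weight m :: ('a, ('a, 'a) dR_cochain set) module) = B_dR"
  "add (H_dR_weight m :: ('a, ('a, 'a) dR_cochain set) module) = set_add Z_dR"
  "smult (H_dR_weight m :: ('a, ('a, 'a) dR_cochain set) module) = smult (quot_module Z_dR B_dR)"
  "zero (H1_O_weight m :: ('a, ('a, 'a) crv set) module) = B_O"
  "add (H1_O_weight m :: ('a, ('a, 'a) crv set) module) = set_add Z_O"
  "smult (H1_O_weight m :: ('a, ('a, 'a) crv set) module) = smult (quot_module Z_O B_O)"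
  "zero (H0_weight m :: ('a, ('a, 'a) kaehler) module) = 0"
  "add (H0_weight m :: ('a, ('a, 'a) kaehler) module) = (+)"
  "smult (H0_weight m :: ('a, ('a, 'a) kaehler) module) = (\<lambda>c w. cst c \<bullet>\<^sub>K w)"
  unfolding H_dR_weight_def H1_O_weight_def H0_weight_def weight_part_simps by (simp_all add: H_dR_def H1_O_def H0_def)

lemma cls_dR_onto: "cls_dR ` homog (k + CARD('a) - 1) = carrier (H_dR_weight (- int k))"
  unfolding carrier_H_dR_weight eps_image[symmetric] image_image cls_dR_def[abs_def] ..

lemma cls_O_onto: "cls_O ` homog (k + CARD('a) - 1) = carrier (H1_O_weight (- int k))"
  unfolding carrier_H1_O_weight eps_image[symmetric] image_image cls_O_def[abs_def] ..

lemma lin_map_cls_dR: "lin_map SymV (H_dR_weight (- int k)) cls_dR"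
proof -
  note c = lin_mapD[OF lin_map_coset[OF vec_space_Z_dR[OF q_zero] sub_space_B_dR[OF q_zero]], unfolded quot_module_simps carrier_Z_dR add_Z_dR]
  have z: "cyc 0 = 0" using cyc_linear(3)[of 0 0] by simp
  have "\<zero>\<^bsub>Z_dR :: ('a, ('a, 'a) dR_cochain) module\<^esub> = 0" by (simp add: Z_dR_eq)
  then have "cls_dR 0 = B_dR" using c(2) by (simp add: cls_dR_def eps_hom z)
  moreover have "cls_dR (F + G) = cls_dR F <+>\<^bsub>Z_dR\<^esub> cls_dR G"
    if "F \<in> homog (k + CARD('a) - 1)" "G \<in> homog (k + CARD('a) - 1)" for F G
    using c(3)[OF cyc_cocycle[OF eps_homog[OF that(1)]] cyc_cocycle[OF eps_homog[OF that(2)]]]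
    by (simp add: cls_dR_def eps_hom cyc_linear)
  moreover have "cls_dR (cst2 e * F) = smult (quot_module Z_dR B_dR) e (cls_dR F)"
    if "F \<in> homog (k + CARD('a) - 1)" for F e
  proof -
    have "cyc (eps (cst2 e * F)) = scale_dR e (cyc (eps F))"
      by (simp add: eps_hom eps_generators cyc_linear(4)) (simp add: scale_dR_def cyc_def)
    then show ?thesis
      using lin_mapD(4)[OF lin_map_coset[OF vec_space_Z_dR[OF q_zero] sub_space_B_dR[OF q_zero]], of "cyc (eps F)" e]
        cyc_cocycle[OF eps_homog[OF that]] by (simp add: cls_dR_def carrier_Z_dR smult_Z_dR)
  qed
  ultimately show ?thesis
    unfolding lin_map_def weight_simps using cls_dR_onto by (auto simp: deg_eq)
qed

lemma lin_map_cls_O: "lin_map SymV (H1_O_weight (- int k)) cls_O"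
proof -
  have Z: "carrier (Z_O :: ('a, ('a, 'a) crv) module) = reg {crv_u, crv_v}" "add (Z_O :: ('a, ('a, 'a) crv) module) = (+)"
    "zero (Z_O :: ('a, ('a, 'a) crv) module) = 0" "smult (Z_O :: ('a, ('a, 'a) crv) module) = (\<lambda>c f. cst c * f)" by (simp_all add: Z_O_def)
  note c = lin_mapD[OF lin_map_coset[OF vec_space_Z_O sub_space_B_O[where 'a = 'a and 'e = 'a]], unfolded quot_module_simps Z]
  have f: "cyc_f 0 l m = 0" "cyc_f (G + G') l m = cyc_f G l m + cyc_f G' l m" "cyc_f (cst e * G) l m = cst e * cyc_f G l m"
    for G G' l m e
    using cyc_linear(1)[of _ 0 0] by (simp_all add: cyc_f_def cyc_linear right_diff_distrib)
  have "cls_O 0 = B_O"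
    using lin_mapD(2)[OF lin_map_coset[OF vec_space_Z_O sub_space_B_O[where 'a = 'a and 'e = 'a]]]
    by (simp add: cls_O_def eps_hom f Z)
  moreover have "cls_O (F + G) = cls_O F <+>\<^bsub>Z_O\<^esub> cls_O G"
    if "F \<in> homog (k + CARD('a) - 1)" "G \<in> homog (k + CARD('a) - 1)" for F G
    using c(3)[OF cyc_f_uv_reg[OF eps_homog[OF that(1)]] cyc_f_uv_reg[OF eps_homog[OF that(2)]]]
    by (simp add: cls_O_def eps_hom f)
  moreover have "cls_O (cst2 e * F) = smult (quot_module Z_O B_O) e (cls_O F)"
    if "F \<in> homog (k + CARD('a) - 1)" for F e
    using lin_mapD(4)[OF lin_map_coset[OF vec_space_Z_O sub_space_B_O], of "cyc_f (eps F) crv_u crv_v" e]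
      cyc_f_uv_reg[OF eps_homog[OF that]] by (simp add: cls_O_def Z eps_hom eps_generators f)
  ultimately show ?thesis
    unfolding lin_map_def weight_simps using cls_O_onto by (auto simp: deg_eq)
qed

lemma cls_dR_eq_zero_iff:
  assumes F: "F \<in> homog (k + CARD('a) - 1)"
  shows "cls_dR F = B_dR \<longleftrightarrow> F \<in> Dq ` homog k"
  unfolding cls_dR_def
  by (subst coset_eq_self_iff[OF vec_space_Z_dR[OF q_zero] sub_space_B_dR[OF q_zero]])
     (simp_all add: carrier_Z_dR cyc_cocycle[OF eps_homog[OF F]] cyc_exact_iff[OF F])

lemma cls_O_eq_zero_iff:
  assumes F: "F \<in> homog (k + CARD('a) - 1)"
  shows "cls_O F = B_O \<longleftrightarrow> F \<in> exact_plus_theta"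
  unfolding cls_O_def
  by (subst coset_eq_self_iff[OF vec_space_Z_O sub_space_B_O])
     (simp_all add: Z_O_def cyc_f_uv_reg[OF eps_homog[OF F]] cyc_f_exact_iff[OF F])

definition beta :: "'a poly poly set \<Rightarrow> ('a, 'a) dR_cochain set" where
  "beta = quot_lift cls_dR"

lemma vec_space_weights:
  "vec_space (H_dR_weight (- int k) :: ('a, ('a, 'a) dR_cochain set) module)"
  "vec_space (H1_O_weight (- int k) :: ('a, ('a, 'a) crv set) module)"
  using lin_map_onto_vec_space[OF vec_space_Sym lin_map_cls_dR] lin_map_onto_vec_space[OF vec_space_Sym lin_map_cls_O]
    cls_dR_onto cls_O_onto by (simp_all add: deg_eq)

lemma
  shows beta_cls: "F \<in> homog (k + CARD('a) - 1) \<Longrightarrow> beta (cls F) = cls_dR F"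
    and lin_map_beta: "lin_map SymQ (H_dR_weight (- int k)) beta"
    and bij_betw_beta: "bij_betw beta (carrier SymQ) (carrier (H_dR_weight (- int k)))"
proof -
  have ker: "lin_ker SymV (H_dR_weight (- int k)) cls_dR = Dq ` carrier (Sym k)"
    unfolding lin_ker_def weight_simps using cls_dR_eq_zero_iff Dq_homog by (auto simp: deg_eq)
  note Q = vec_space_Sym vec_space_weights(1) lin_map_cls_dR equalityD2[OF ker] sub_space_exact
  show "F \<in> homog (k + CARD('a) - 1) \<Longrightarrow> beta (cls F) = cls_dR F"
    using quot_lift_coset[OF Q] by (simp add: beta_def cls_def deg_eq)
  show "lin_map SymQ (H_dR_weight (- int k)) beta"
    using lin_map_quot_lift[OF Q] by (simp add: lin_map_def SymQ_simps beta_def)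
  show "bij_betw beta (carrier SymQ) (carrier (H_dR_weight (- int k)))"
    using bij_betw_quot_lift[OF Q _ equalityD1[OF ker]] cls_dR_onto by (simp add: SymQ_simps beta_def deg_eq)
qed

lemma pi_cls_dR: "pi_dR (cls_dR F) = cls_O F"
  unfolding cls_dR_def cls_O_def pi_dR_def cyc_def Z_dR_coset Z_O_coset by (auto simp: image_iff) blast+

lemma iota_form:
  assumes R: "R \<in> homog (k - 2)"
  shows "iota (form (- eps R)) = beta (theta_bar k R)"
proof -
  let ?x = "(form (- eps R), form (- eps R), 0) :: ('a, 'a) dR_cochain"
  note V = vec_spaceD[OF vec_space_Z_dR[OF q_zero]]
  have cy: "cyc (eps (theta * R)) \<in> cocycles_dR" by (rule cyc_cocycle[OF eps_homog[OF theta_mult_homog[OF R]]])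
  have "?x - cyc (eps (theta * R)) \<in> cocycles_dR" by (rule B_dR_closed(5)[OF q_zero cyc_eps_theta[OF R]])
  then have "(?x - cyc (eps (theta * R))) + cyc (eps (theta * R)) \<in> cocycles_dR"
    using cy abelian_monoid.a_closed[OF abelian_group.axioms(1)[OF conjunct1[OF V]]] by (metis carrier_Z_dR add_Z_dR)
  then have "iota (form (- eps R)) = cls_dR (theta * R)"
    unfolding iota_def cls_dR_def
    by (subst B_dR_coset_eq_iff[OF q_zero]) (simp_all add: carrier_Z_dR cy cyc_eps_theta[OF R])
  then show ?thesis by (simp add: theta_bar_eq beta_cls[OF theta_mult_homog[OF R]])
qed

definition gamma :: "'a poly poly set set \<Rightarrow> ('a, 'a) crv set" where
  "gamma = quot_lift (\<lambda>U. pi_dR (beta U))"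

abbreviation (input) Coker :: "('a, 'a poly poly set set) gl2_module" where "Coker \<equiv> coker_theta k"

lemma sub_rep_theta: "sub_rep SymQ (theta_bar k ` carrier (Sym (k - 2)))"
  using sub_rep_image[OF is_gl2_module_twist[OF is_gl2_module_Sym] is_gl2_module_SymQ theta_bar_hom] by simp

lemma Coker_simps:
  "carrier Coker = a_rcosets\<^bsub>SymQ\<^esub> (theta_bar k ` carrier (Sym (k - 2)))" "zero Coker = theta_bar k ` carrier (Sym (k - 2))"
  "add Coker = set_add SymQ" "smult Coker = smult (quot_module SymQ (theta_bar k ` carrier (Sym (k - 2))))"
  by (simp_all add: coker_theta_def quot_gl2_module_def)

lemma pi_beta_cls: "F \<in> homog (k + CARD('a) - 1) \<Longrightarrow> pi_dR (beta (cls F)) = cls_O F"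
  by (simp add: beta_cls pi_cls_dR)

lemma lin_map_pi_beta: "lin_map SymQ (H1_O_weight (- int k)) (\<lambda>U. pi_dR (beta U))"
  unfolding lin_map_def
proof (intro conjI ballI allI)
  note O = lin_mapD[OF lin_map_cls_O, unfolded Sym_simps deg_eq]
  show "(\<lambda>U. pi_dR (beta U)) ` carrier SymQ \<subseteq> carrier (H1_O_weight (- int k))"
    unfolding cls_onto[symmetric] using pi_beta_cls O(1) by auto
  show "pi_dR (beta \<zero>\<^bsub>SymQ\<^esub>) = \<zero>\<^bsub>H1_O_weight (- int k)\<^esub>"
    using pi_beta_cls[OF homog_subspace(1)] O(2) cls_rules(2) by simp
  fix U V assume "U \<in> carrier SymQ" "V \<in> carrier SymQ"
  then obtain F G where FG: "F \<in> homog (k + CARD('a) - 1)" "U = cls F" "G \<in> homog (k + CARD('a) - 1)" "V = cls G"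
    unfolding cls_onto[symmetric] by blast
  show "pi_dR (beta (U \<oplus>\<^bsub>SymQ\<^esub> V)) = pi_dR (beta U) \<oplus>\<^bsub>H1_O_weight (- int k)\<^esub> pi_dR (beta V)"
    unfolding FG(2,4) cls_rules(3)[OF FG(1,3), symmetric]
    using pi_beta_cls[OF FG(1)] pi_beta_cls[OF FG(3)] pi_beta_cls[OF homog_subspace(2)[OF FG(1,3)]] O(3)[OF FG(1,3)] by simp
next
  note O = lin_mapD[OF lin_map_cls_O, unfolded Sym_simps deg_eq]
  fix c U assume "U \<in> carrier SymQ"
  then obtain F where F: "F \<in> homog (k + CARD('a) - 1)" "U = cls F" unfolding cls_onto[symmetric] by blast
  show "pi_dR (beta (c \<odot>\<^bsub>SymQ\<^esub> U)) = c \<odot>\<^bsub>H1_O_weight (- int k)\<^esub> pi_dR (beta U)"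
    unfolding F(2) cls_rules(4)[OF F(1), symmetric]
    using pi_beta_cls[OF F(1)] pi_beta_cls[OF homog_subspace(5)[OF F(1)]] O(4)[OF F(1)] by simp
qed

lemma cls_theta_image_iff:
  assumes F: "F \<in> homog (k + CARD('a) - 1)"
  shows "cls F \<in> theta_bar k ` homog (k - 2) \<longleftrightarrow> F \<in> exact_plus_theta"
proof
  assume "cls F \<in> theta_bar k ` homog (k - 2)"
  then obtain R where R: "R \<in> homog (k - 2)" "cls F = cls (theta * R)" by (auto simp: theta_bar_eq)
  then obtain W where "W \<in> homog k" "F - theta * R = Dq W" using cls_eq_iff[OF F theta_mult_homog[OF R(1)]] by auto
  then have "F = Dq W + theta * R" by (simp add: diff_eq_eq)
  then show "F \<in> exact_plus_theta" unfolding exact_plus_theta_def using R \<open>W \<in> homog k\<close> by blast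
next
  assume "F \<in> exact_plus_theta"
  then obtain W R where *: "F = Dq W + theta * R" "W \<in> homog k" "R \<in> homog (k - 2)" unfolding exact_plus_theta_def by blast
  then have "cls F = theta_bar k R" unfolding theta_bar_eq cls_eq_iff[OF F theta_mult_homog[OF *(3)]] by simp
  then show "cls F \<in> theta_bar k ` homog (k - 2)" using *(3) by blast
qed

lemma
  shows gamma_proj: "U \<in> carrier SymQ \<Longrightarrow> gamma (proj_coker k U) = pi_dR (beta U)"
    and lin_map_gamma: "lin_map Coker (H1_O_weight (- int k)) gamma"
    and bij_betw_gamma: "bij_betw gamma (carrier Coker) (carrier (H1_O_weight (- int k)))"
proof -
  have ker: "lin_ker SymQ (H1_O_weight (- int k)) (\<lambda>U. pi_dR (beta U)) = theta_bar k ` carrier (Sym (k - 2))"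
  proof -
    have "U \<in> lin_ker SymQ (H1_O_weight (- int k)) (\<lambda>U. pi_dR (beta U)) \<longleftrightarrow> U \<in> theta_bar k ` homog (k - 2)"
      if "U \<in> carrier SymQ" for U
    proof -
      obtain F where F: "F \<in> homog (k + CARD('a) - 1)" "U = cls F" using \<open>U \<in> carrier SymQ\<close> unfolding cls_onto[symmetric] by blast
      show ?thesis
        unfolding F(2) lin_ker_def weight_simps mem_Collect_eq pi_beta_cls[OF F(1)] cls_O_eq_zero_iff[OF F(1)]
          cls_theta_image_iff[OF F(1)] using cls_rules(1)[OF F(1)] by simp
    qed
    moreover have "theta_bar k ` homog (k - 2) \<subseteq> carrier SymQ"
      using gl2_homD(1)[OF theta_bar_hom] by auto
    ultimately show ?thesis by (auto simp: lin_ker_def)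
  qed
  have W: "sub_space SymQ (theta_bar k ` carrier (Sym (k - 2)))" using sub_rep_theta by (simp add: sub_rep_def)
  note Q = is_gl2_moduleD(1)[OF is_gl2_module_SymQ] vec_space_weights(2) lin_map_pi_beta equalityD2[OF ker] W
  show "U \<in> carrier SymQ \<Longrightarrow> gamma (proj_coker k U) = pi_dR (beta U)"
    using quot_lift_coset[OF Q] by (simp add: gamma_def proj_coker_def)
  show "lin_map Coker (H1_O_weight (- int k)) gamma"
    using lin_map_quot_lift[OF Q] by (simp add: lin_map_def Coker_simps gamma_def)
  have "(\<lambda>U. pi_dR (beta U)) ` carrier SymQ = carrier (H1_O_weight (- int k))"
    unfolding cls_onto[symmetric] cls_O_onto[symmetric] image_image using pi_beta_cls by auto
  then show "bij_betw gamma (carrier Coker) (carrier (H1_O_weight (- int k)))"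
    using bij_betw_quot_lift[OF Q _ equalityD1[OF ker]] by (simp add: Coker_simps gamma_def)
qed

end

section \<open>Eigenvectors of the diagonal matrices\<close>

lemma sub_space_vimage:
  assumes M: "vec_space (M :: ('a::field, 'm, 'y) module_scheme)" and f: "lin_map M N f" and S: "sub_space N S"
  shows "sub_space M {x \<in> carrier M. f x \<in> S}"
proof -
  interpret M: Module.module ring_of_type_algebra M by (rule M)
  note f' = lin_mapD[OF f] and V = vec_spaceD[OF M]
  show ?thesis using S V by (auto simp: sub_space_def f')
qed

lemma diag2_nth:
  "diag2 x y $ 1 $ 1 = x" "diag2 x y $ 1 $ 2 = 0" "diag2 x y $ 2 $ 1 = 0" "diag2 x y $ 2 $ 2 = y"
  by (simp_all add: diag2_def)

lemma act2_diag2_mon: "act2 (diag2 x y) (cst2 c * mon i j) = cst2 (x ^ i * y ^ j) * (cst2 c * mon i j)"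
  by (simp add: act2_hom act2_generators diag2_nth power_mult_distrib cst2_simps mult_ac)

context curve_setup
begin

text \<open>
  The sign compensates the one in \<open>eps\<close>, so that the image under \<open>eps\<close> is \<open>u\<^sup>k\<^sup>-\<^sup>2\<^sup>-\<^sup>a v\<^sup>a\<close>.
\<close>

definition mon_low :: "int \<Rightarrow> 'a poly poly" where
  "mon_low a = cst2 ((- 1) ^ nat a) * mon (nat a) (k - 2 - nat a)"

text \<open>
  The factor is chosen such that the function of the cocycle is \<open>t\<^sub>1\<^sup>a t\<^sub>2\<^sup>q\<^sup>+\<^sup>1\<^sup>-\<^sup>k\<close>. The exponents are
  natural numbers for \<open>a\<close> in \<open>quot_range\<close>, where \<open>a\<close> is negative.
\<close>

definition mon_high :: "int \<Rightarrow> 'a poly poly" where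
  "mon_high a = cst2 (- of_nat k * (- 1) ^ nat (int CARD('a) + a)) * mon (nat (int CARD('a) + a)) (nat (int k - 1 - a))"

definition eigvec :: "int \<Rightarrow> 'a poly poly" where
  "eigvec a = (if a \<in> sub_range k then theta * mon_low a else mon_high a)"

lemma mon_low_homog: "a \<in> sub_range k \<Longrightarrow> mon_low a \<in> homog (k - 2)"
  unfolding mon_low_def by (intro homog_subspace(5) mon_homog) (auto simp: sub_range_def)

lemma mon_high_homog: "a \<in> quot_range CARD('a) k \<Longrightarrow> mon_high a \<in> homog (k + CARD('a) - 1)"
  unfolding mon_high_def using k_ge_2 by (intro homog_subspace(5) mon_homog) (auto simp: quot_range_def)

lemma ranges_disjoint: "a \<in> quot_range CARD('a) k \<Longrightarrow> a \<notin> sub_range k"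
  by (auto simp: sub_range_def quot_range_def)

lemma eigvec_homog: "a \<in> sub_range k \<union> quot_range CARD('a) k \<Longrightarrow> eigvec a \<in> homog (k + CARD('a) - 1)"
  using mon_high_homog[of a] theta_mult_homog[OF mon_low_homog, of a] by (auto simp: eigvec_def)

lemma powi_sub_range:
  assumes "a \<in> sub_range k" "x \<noteq> 0" "y \<noteq> (0 :: 'a)"
  shows "x * y * (x ^ nat a * y ^ (k - 2 - nat a)) = x powi (a + 1) * y powi (int k - a - 1)"
proof -
  have "x powi (a + 1) = x ^ Suc (nat a)" using assms(1) by (simp add: sub_range_def power_int_def nat_add_distrib)
  moreover have "nat (int k - a - 1) = Suc (k - 2 - nat a)" "0 \<le> int k - a - 1"
    using assms(1) by (auto simp: sub_range_def)
  then have "y powi (int k - a - 1) = y ^ Suc (k - 2 - nat a)" by (simp only: power_int_def if_True)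
  ultimately show ?thesis by (simp add: mult_ac)
qed

text \<open>
  The exponents \<open>q + a\<close> of \<open>X\<close> and \<open>a + 1\<close> of the prescribed eigenvalue agree by \<open>x\<^sup>q = x\<close>.
\<close>

lemma powi_quot_range:
  assumes "a \<in> quot_range CARD('a) k" "x \<noteq> 0" "y \<noteq> (0 :: 'a)"
  shows "x ^ nat (int CARD('a) + a) * y ^ nat (int k - 1 - a) = x powi (a + 1) * y powi (int k - a - 1)"
proof -
  have "x ^ nat (int CARD('a) + a) = x powi (int CARD('a) + a)" using assms(1) by (simp add: quot_range_def power_int_def)
  also have "\<dots> = x powi int CARD('a) * x powi a" using assms(2) by (simp add: power_int_add)
  also have "\<dots> = x powi (a + 1)" using assms(2) by (simp add: power_int_add mult.commute)
  finally have "x ^ nat (int CARD('a) + a) = x powi (a + 1)" .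
  moreover have "int k - 1 - a = int k - a - 1" "0 \<le> int k - a - 1" using assms(1) k_ge_2 by (auto simp: quot_range_def)
  then have "y ^ nat (int k - 1 - a) = y powi (int k - a - 1)" by (simp only: power_int_def if_True)
  ultimately show ?thesis by simp
qed

lemma act2_diag2_eigvec:
  assumes a: "a \<in> sub_range k \<union> quot_range CARD('a) k" and xy: "x \<noteq> 0" "y \<noteq> (0 :: 'a)"
  shows "act2 (diag2 x y) (eigvec a) = cst2 (x powi (a + 1) * y powi (int k - a - 1)) * eigvec a"
proof (cases "a \<in> sub_range k")
  case True
  have "act2 (diag2 x y) (mon_low a) = cst2 (x ^ nat a * y ^ (k - 2 - nat a)) * mon_low a"
    unfolding mon_low_def by (rule act2_diag2_mon)
  moreover have "act2 (diag2 x y) theta = cst2 (x * y) * theta"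
    unfolding act2_theta by (simp add: det_2 diag2_nth)
  ultimately have "act2 (diag2 x y) (theta * mon_low a) = cst2 (x * y * (x ^ nat a * y ^ (k - 2 - nat a))) * (theta * mon_low a)"
    unfolding act2_hom(3) by (simp only: cst2_simps(3) mult_ac)
  then show ?thesis using True powi_sub_range[OF True xy] by (simp add: eigvec_def)
next
  case False
  then have q: "a \<in> quot_range CARD('a) k" using a by simp
  have "act2 (diag2 x y) (mon_high a) = cst2 (x ^ nat (int CARD('a) + a) * y ^ nat (int k - 1 - a)) * mon_high a"
    unfolding mon_high_def by (rule act2_diag2_mon)
  then show ?thesis using False powi_quot_range[OF q xy] by (simp add: eigvec_def)
qed

lemma act2_diag2_mon_low:
  assumes a: "a \<in> sub_range k" and xy: "x \<noteq> 0" "y \<noteq> (0 :: 'a)"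
  shows "cst2 (det (diag2 x y)) * act2 (diag2 x y) (mon_low a) = cst2 (x powi (a + 1) * y powi (int k - a - 1)) * mon_low a"
proof -
  have "act2 (diag2 x y) (mon_low a) = cst2 (x ^ nat a * y ^ (k - 2 - nat a)) * mon_low a"
    unfolding mon_low_def by (rule act2_diag2_mon)
  moreover have "det (diag2 x y) = x * y" by (simp add: det_2 diag2_nth)
  ultimately show ?thesis unfolding powi_sub_range[OF a xy, symmetric] by (simp only: cst2_simps(3) mult.assoc)
qed

lemma minus_one_power_square: "(- 1) ^ m * (- 1) ^ m = (1 :: 'r::comm_ring_1)"
  by (simp flip: power_mult_distrib)

lemma mon_low_span:
  assumes S: "sub_space (Sym (k - 2)) S" and e: "mon_low ` sub_range k \<subseteq> S"
  shows "homog (k - 2) \<subseteq> S"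
proof (rule Sym_sub_space_eqI[OF S])
  fix i j assume ij: "i + j = k - 2"
  have "mon_low (int i) \<in> S" using e ij k_ge_2 by (auto simp: sub_range_def)
  moreover have "cst2 ((- 1) ^ i) * mon_low (int i) = mon i j"
  proof -
    have "nat (int i) = i" "k - 2 - i = j" using ij by auto
    then have "cst2 ((- 1) ^ i) * mon_low (int i) = cst2 ((- 1) ^ i * (- 1) ^ i) * mon i j"
      unfolding mon_low_def by (simp only: cst2_simps(3) mult.assoc)
    then show ?thesis unfolding minus_one_power_square by (simp add: cst2_simps)
  qed
  ultimately show "mon i j \<in> S" using S unfolding sub_space_def by (metis Sym_simps(4))
qed

text \<open>
  The monomials with an exponent at least \<open>q\<close> belong to \<open>D(V\<^sub>k) + \<theta>\<^sub>q V\<^sub>k\<^sub>-\<^sub>2\<close>, and the others are the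
  \<open>mon_high a\<close> up to a factor.
\<close>

lemma mon_high_span:
  assumes S: "sub_space SymV S" and D: "Dq ` homog k \<subseteq> S" and T: "\<And>R. R \<in> homog (k - 2) \<Longrightarrow> theta * R \<in> S"
    and e: "mon_high ` quot_range CARD('a) k \<subseteq> S"
  shows "homog (k + CARD('a) - 1) \<subseteq> S"
  unfolding deg_eq[symmetric]
proof (rule Sym_sub_space_eqI[OF S])
  have add: "f + g \<in> S" if "f \<in> S" "g \<in> S" for f g using S that by (simp add: sub_space_def)
  fix i j assume ij: "i + j = k + (CARD('a) - 1)"
  then have ij': "i + j = k + CARD('a) - 1" by (simp only: deg_eq)
  show "mon i j \<in> S"
  proof (cases "CARD('a) \<le> i \<or> CARD('a) \<le> j")
    case True
    have "exact_plus_theta \<subseteq> S" using D T by (auto simp: exact_plus_theta_def intro!: add)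
    then show ?thesis using mon_exact_plus_theta[OF ij' True] by blast
  next
    case False
    let ?a = "int i - int CARD('a)" and ?c = "- of_nat k * (- 1) ^ i :: 'a"
    have a: "?a \<in> quot_range CARD('a) k" using False ij' by (auto simp: quot_range_def)
    have ij'': "nat (int CARD('a) + ?a) = i" "nat (int k - 1 - ?a) = j" using ij' card_gt_2 by auto
    have c: "?c \<noteq> 0" using k_nonzero by simp
    have "cst2 (inverse ?c) * mon_high ?a \<in> S" using S e a by (auto simp: sub_space_def)
    moreover have "cst2 (inverse ?c) * mon_high ?a = cst2 (inverse ?c * ?c) * mon i j"
      unfolding mon_high_def ij'' by (simp only: cst2_simps(3) mult.assoc)
    moreover have "inverse ?c * ?c = 1" by (rule left_inverse[OF c])
    ultimately show ?thesis by (simp only: cst2_simps(1) mult_1)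
  qed
qed

section \<open>The prescribed bases\<close>

lemma diff_coeff_dt2: "diff_coeff (dK t2 :: ('a, 'a) kaehler) = - mm (int CARD('a) - 2) 0"
  unfolding diff_coeff_rules[OF q_zero] t2_eq crv_der_mm[OF q_zero] by simp

lemma diff_coeff_basis:
  "diff_coeff ((c * t1 powi a * t2 ^ m) \<bullet>\<^sub>K dK t2 :: ('a, 'a) kaehler) = - (c * mm (int CARD('a) - 2 - a - int m) a)"
proof -
  have "diff_coeff ((c * t1 powi a * t2 ^ m) \<bullet>\<^sub>K dK t2 :: ('a, 'a) kaehler) =
      c * mm (- 1) 1 powi a * mm (- 1) 0 ^ m * - mm (int CARD('a) - 2) 0"
    unfolding diff_coeff_rules(3)[OF q_zero] diff_coeff_dt2 unfolding t1_eq t2_eq ..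
  then show ?thesis unfolding mm_powi mm_power by (simp add: mult.assoc mm_mult algebra_simps)
qed

lemma eps_mon_low:
  assumes a: "a \<in> sub_range k"
  shows "eps (mon_low a) = mm (int k - 2 - a) a"
proof -
  have "int (k - 2 - nat a) = int k - 2 - a" "int (nat a) = a" using a by (auto simp: sub_range_def)
  then show ?thesis
    unfolding mon_low_def eps_mon mm_nat[symmetric] by (simp add: minus_one_power_square cst_simps)
qed

lemma basis_H0_eq:
  assumes a: "a \<in> sub_range k"
  shows "basis_H0 k a = form (- eps (mon_low a))"
proof -
  have "diff_coeff (basis_H0 k a :: ('a, 'a) kaehler) = - mm (int k - 2 - a) a"
    unfolding basis_H0_def using diff_coeff_basis[of 1 a "CARD('a) - k"] k_less_q by (simp add: of_nat_diff algebra_simps)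
  then show ?thesis
    unfolding kaehler_eq_iff[OF q_zero, of "basis_H0 k a"] diff_coeff_form[OF q_zero] eps_mon_low[OF a] .
qed

lemma eps_mon_high:
  assumes a: "a \<in> quot_range CARD('a) k"
  shows "eps (mon_high a) = - (of_nat k * mm (int k - 1 - a) (int CARD('a) + a))"
proof -
  have n: "int (nat (int k - 1 - a)) = int k - 1 - a" "int (nat (int CARD('a) + a)) = int CARD('a) + a"
    using a k_ge_2 by (auto simp: quot_range_def)
  have "- of_nat k * (- 1) ^ m * (- 1) ^ m = (- of_nat k :: 'a)" for m
    unfolding mult.assoc minus_one_power_square by simp
  then have "eps (mon_high a) = cst (- of_nat k) * mm (int k - 1 - a) (int CARD('a) + a)"
    unfolding mon_high_def eps_mon mm_nat[symmetric] n by (simp only:)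
  then show ?thesis by (simp add: cst_simps)
qed

lemma mm_inverse_uv: "inverse crv_u ^ m = mm (- int m) 0" "inverse crv_v ^ m = mm 0 (- int m)"
  by (simp_all add: mm_eqs mm_inverse mm_power)

lemma cyc_phi_mon_high:
  assumes a: "a \<in> quot_range CARD('a) k"
  shows "cyc_phi crv_u (eps (mon_high a)) = - mm (int k - a - int CARD('a)) (int CARD('a) + a)"
    "cyc_phi crv_v (eps (mon_high a)) = - mm (int k - 1 - a) (a + 1)"
proof -
  have q1: "int (CARD('a) - 1) = int CARD('a) - 1" using card_gt_2 by (simp add: of_nat_diff)
  have kk: "cst (inverse (of_nat k)) * (- (of_nat k * x) * y) = - (x * y)" for x y :: "('a, 'a) crv"
    using k_inverse[of "x * y"] by (simp add: mult.assoc)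
  show "cyc_phi crv_u (eps (mon_high a)) = - mm (int k - a - int CARD('a)) (int CARD('a) + a)"
    "cyc_phi crv_v (eps (mon_high a)) = - mm (int k - 1 - a) (a + 1)"
    unfolding cyc_phi_def eps_mon_high[OF a] kk mm_inverse_uv mm_mult q1 by (simp_all add: algebra_simps)
qed

text \<open>
  The function is a difference of two monomials, and so are the coefficients of the forms, because
  \<open>q = 0\<close> in \<open>\<bbbF>\<close>. In each case the two monomials are those of \<open>mm_relation\<close>, which replaces them by
  a single one.
\<close>

lemma cyc_mon_high:
  assumes a: "a \<in> quot_range CARD('a) k"
  shows "cyc (eps (mon_high a)) =
    ((- of_int a * t1 powi (int CARD('a) - 1 + a) * t2 ^ (CARD('a) - k)) \<bullet>\<^sub>K dK t2,
     (- of_int (a + 1 - int k) * t1 powi a * t2 ^ (CARD('a) - k)) \<bullet>\<^sub>K dK t2,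
     t1 powi a * t2 ^ (CARD('a) + 1 - k))"
proof -
  let ?q = "int CARD('a)" and ?G = "eps (mon_high a)"
  note phi = cyc_phi_mon_high[OF a] and G = eps_mon_high[OF a]
  have q0: "of_int ?q = (0 :: ('a, 'a) crv)" using q_zero_crv by simp
  have n: "int (CARD('a) - k) = ?q - int k" "int (CARD('a) + 1 - k) = ?q + 1 - int k"
    using k_less_q by (auto simp: of_nat_diff)
  have "cyc_f ?G crv_u crv_v = mm (int k - 1 - a - ?q) a"
    unfolding cyc_f_def phi mm_relation[of "int k - 1 - a - ?q" a] by (simp add: algebra_simps)
  also have "\<dots> = t1 powi a * t2 ^ (CARD('a) + 1 - k)"
    unfolding t1_eq t2_eq mm_powi mm_power mm_mult n by (simp add: algebra_simps)
  finally have 3: "cyc_f ?G crv_u crv_v = t1 powi a * t2 ^ (CARD('a) + 1 - k)" .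
  have d: "diff_coeff ((c * t1 powi b * t2 ^ (CARD('a) - k)) \<bullet>\<^sub>K dK t2 :: ('a, 'a) kaehler) =
     - (c * mm (int k - 2 - b) b)" for c b
    using diff_coeff_basis[of c b "CARD('a) - k"] unfolding n by (simp add: algebra_simps)
  have "diff_coeff (cyc_w ?G crv_u) = of_int a * mm (int k - 1 - a - ?q) (?q - 1 + a)"
  proof -
    have "diff_coeff (cyc_w ?G crv_u) =
        - (of_nat k * mm (int k - 1 - a) (?q + a)) +
        (of_int (int k - a - ?q) * mm (int k - 1 - a) (?q + a) + of_int (?q + a) * mm (int k - a - ?q) (?q + a - 1 + ?q))"
      unfolding cyc_w_def diff_coeff_form[OF q_zero] phi unfolding G crv_der_rules[OF q_zero] crv_der_mm[OF q_zero]
      by (simp add: algebra_simps)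
    also have "\<dots> = of_int a * (mm (int k - a - ?q) (?q + a - 1 + ?q) - mm (int k - 1 - a) (?q + a))"
      unfolding of_int_diff of_int_add q0 by (simp add: algebra_simps)
    also have "\<dots> = of_int a * mm (int k - 1 - a - ?q) (?q - 1 + a)"
      unfolding mm_relation[of "int k - 1 - a - ?q" "?q - 1 + a"] by (simp add: algebra_simps)
    finally show ?thesis .
  qed
  then have 1: "cyc_w ?G crv_u = (- of_int a * t1 powi (?q - 1 + a) * t2 ^ (CARD('a) - k)) \<bullet>\<^sub>K dK t2"
    unfolding kaehler_eq_iff[OF q_zero, of "cyc_w ?G crv_u"] d by (simp add: algebra_simps)
  have "diff_coeff (cyc_w ?G crv_v) = of_int (a + 1 - int k) * mm (int k - 2 - a) a"
  proof -
    have "diff_coeff (cyc_w ?G crv_v) =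
        - (of_nat k * mm (int k - 1 - a) (?q + a)) +
        (of_int (int k - 1 - a) * mm (int k - 2 - a + ?q) (a + 1) + of_int (a + 1) * mm (int k - 1 - a) (?q + a))"
      unfolding cyc_w_def diff_coeff_form[OF q_zero] phi unfolding G crv_der_rules[OF q_zero] crv_der_mm[OF q_zero]
      by (simp add: algebra_simps)
    also have "\<dots> = of_int (a + 1 - int k) * (mm (int k - 1 - a) (?q + a) - mm (int k - 2 - a + ?q) (a + 1))"
      by (simp add: algebra_simps)
    also have "\<dots> = of_int (a + 1 - int k) * mm (int k - 2 - a) a"
      unfolding mm_relation[of "int k - 2 - a" a] by (simp add: algebra_simps)
    finally show ?thesis .
  qed
  then have 2: "cyc_w ?G crv_v = (- of_int (a + 1 - int k) * t1 powi a * t2 ^ (CARD('a) - k)) \<bullet>\<^sub>K dK t2"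
    unfolding kaehler_eq_iff[OF q_zero, of "cyc_w ?G crv_v"] d by (simp only: mult_minus_left minus_minus)
  show ?thesis unfolding cyc_def 1 2 3 ..
qed

lemma beta_eigvec:
  assumes a: "a \<in> sub_range k \<union> quot_range CARD('a) k"
  shows "beta (cls (eigvec a)) = basis_H_dR k a"
proof (cases "a \<in> sub_range k")
  case True
  have "beta (cls (eigvec a)) = iota (basis_H0 k a)"
    unfolding basis_H0_eq[OF True] iota_form[OF mon_low_homog[OF True]] theta_bar_eq using True by (simp add: eigvec_def)
  then show ?thesis using True by (simp add: iota_def basis_H_dR_def basis_H0_def)
next
  case False
  then have q: "a \<in> quot_range CARD('a) k" using a by simp
  show ?thesis
    using False beta_cls[OF mon_high_homog[OF q]] by (simp add: eigvec_def cls_dR_def basis_H_dR_def cyc_mon_high[OF q])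
qed

lemma cls_O_mon_high:
  assumes a: "a \<in> quot_range CARD('a) k"
  shows "cls_O (mon_high a) = basis_H1_O k a"
  using cyc_mon_high[OF a] by (simp add: cls_O_def cyc_def basis_H1_O_def)

section \<open>The action of \<open>GL\<^sub>2\<close> on cohomology\<close>

definition alpha :: "'a poly poly \<Rightarrow> ('a, 'a) kaehler" where
  "alpha R = form (- eps R)"

lemma alpha_rules: "alpha 0 = 0" "alpha (R + R') = alpha R + alpha R'" "alpha (cst2 c * R) = cst c \<bullet>\<^sub>K alpha R"
proof -
  show "alpha 0 = 0" "alpha (R + R') = alpha R + alpha R'" by (simp_all add: alpha_def eps_hom form_rules)
  show "alpha (cst2 c * R) = cst c \<bullet>\<^sub>K alpha R"
    unfolding alpha_def eps_hom(3) eps_generators mult_minus_right[symmetric] by (rule form_rules(5))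
qed

lemma alpha_onto: "alpha ` homog (k - 2) = carrier (H0_weight (- int k))"
proof (rule equalityI; rule subsetI)
  fix w assume "w \<in> alpha ` homog (k - 2)"
  then obtain R where R: "R \<in> homog (k - 2)" "w = form (eps (- R))" by (auto simp: alpha_def eps_hom)
  then show "w \<in> carrier (H0_weight (- int k))"
    unfolding carrier_H0_weight using eps_homog[OF homog_subspace(4)[OF R(1)]] by blast
next
  fix w :: "('a, 'a) kaehler" assume "w \<in> carrier (H0_weight (- int k))"
  then obtain R where R: "R \<in> homog (k - 2)" "w = form (eps R)"
    unfolding carrier_H0_weight eps_image[symmetric] by blast
  then have "w = alpha (- R)" by (simp add: alpha_def eps_hom)
  then show "w \<in> alpha ` homog (k - 2)" using homog_subspace(4)[OF R(1)] by blast
qed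

lemma alpha_inj: "inj_on alpha (homog (k - 2))"
proof (rule inj_onI)
  fix R R' assume R: "R \<in> homog (k - 2)" "R' \<in> homog (k - 2)" "alpha R = alpha R'"
  then have "eps R = eps R'" using diff_coeff_form[OF q_zero] by (metis alpha_def neg_equal_iff_equal)
  then have "eps (R - R') = 0" by (simp add: eps_hom)
  then show "R = R'" using eps_inj[OF homog_subspace(3)[OF R(1,2)]] by simp
qed

abbreviation (input) Sub :: "('a, 'a poly poly) gl2_module" where "Sub \<equiv> twist 1 (Sym (k - 2))"

lemma is_gl2_module_Sub: "is_gl2_module Sub"
  by (rule is_gl2_module_twist[OF is_gl2_module_Sym])

lemma
  shows is_gl2_module_H0: "is_gl2_module (H0_k k :: ('a, ('a, 'a) kaehler) gl2_module)"
    and alpha_iso: "alpha \<in> gl2_iso Sub (H0_k k)"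
proof -
  have lin: "lin_map Sub (H0_weight (- int k)) alpha"
    unfolding lin_map_def weight_simps using alpha_onto by (auto simp: alpha_rules)
  have bij: "bij_betw alpha (carrier Sub) (carrier (H0_weight (- int k)))"
    using alpha_inj alpha_onto by (simp add: bij_betw_def)
  have sl2: "alpha (act Sub g R) = mapK (sl2_crv g) (alpha R)" if g: "g \<in> SL2" for g :: "'a ^ 2 ^ 2" and R
  proof -
    have "det g = 1" using g by (simp add: SL2_def)
    then have 1: "act Sub g R = act2 g R" by (simp add: cst2_simps)
    have "diff_coeff (alpha (act2 g R)) = diff_coeff (mapK (sl2_crv g) (alpha R))"
      unfolding sl2_mapK[OF g] alpha_def diff_coeff_form[OF q_zero] sl2_hom(5)[OF g] sl2_eps[OF g] ..
    then show ?thesis unfolding 1 kaehler_eq_iff[OF q_zero, of "alpha _"] .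
  qed
  have b: "mon_low a \<in> carrier Sub \<and> alpha (mon_low a) = basis_H0 k a" if "a \<in> sub_range k" for a
    using mon_low_homog[OF that] basis_H0_eq[OF that] by (simp add: alpha_def)
  have diag: "act Sub (diag2 x y) (mon_low a) = (x powi (a + 1) * y powi (int k - a - 1)) \<odot>\<^bsub>Sub\<^esub> mon_low a"
    if "a \<in> sub_range k" "x \<noteq> 0" "y \<noteq> 0" for a x y
    using act2_diag2_mon_low[OF that] by simp
  have span: "carrier Sub \<subseteq> S" if "sub_space Sub S" "mon_low ` sub_range k \<subseteq> S" for S
    using mon_low_span[of S] that by (simp add: sub_space_def)
  note E = is_gl2_module_Sub lin bij sl2 b diag span
  show "is_gl2_module (H0_k k :: ('a, ('a, 'a) kaehler) gl2_module)"
    unfolding H0_k_def by (rule is_gl2_module_extend_to_gl2[OF E])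
  show "alpha \<in> gl2_iso Sub (H0_k k)"
    unfolding H0_k_def by (rule gl2_iso_extend_to_gl2[OF E])
qed

lemma
  shows is_gl2_module_H_dR: "is_gl2_module (H_dR_k k :: ('a, ('a, 'a) dR_cochain set) gl2_module)"
    and beta_iso: "beta \<in> gl2_iso SymQ (H_dR_k k)"
proof -
  let ?A = "sub_range k \<union> quot_range CARD('a) k"
  have sl2: "beta (act SymQ g U) = sl2_dR g (beta U)" if g: "g \<in> SL2" and U: "U \<in> carrier SymQ" for g :: "'a ^ 2 ^ 2" and U
  proof -
    obtain F where F: "F \<in> homog (k + CARD('a) - 1)" "U = cls F" using U unfolding cls_onto[symmetric] by blast
    show ?thesis
      unfolding F(2) act_SymQ[OF SL2_GL2[OF g] F(1)] beta_cls[OF act2_homog[OF F(1)]] beta_cls[OF F(1)]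
        cls_dR_def sl2_dR_cyc[OF g eps_homog[OF F(1)]] sl2_eps[OF g] ..
  qed
  have b: "cls (eigvec a) \<in> carrier SymQ \<and> beta (cls (eigvec a)) = basis_H_dR k a" if "a \<in> ?A" for a
    using cls_rules(1)[OF eigvec_homog[OF that]] beta_eigvec[OF that] by simp
  have diag: "act SymQ (diag2 x y) (cls (eigvec a)) = (x powi (a + 1) * y powi (int k - a - 1)) \<odot>\<^bsub>SymQ\<^esub> cls (eigvec a)"
    if "a \<in> ?A" "x \<noteq> 0" "y \<noteq> 0" for a x y
    unfolding act_SymQ[OF diag2_GL2[OF that(2,3)] eigvec_homog[OF that(1)]] act2_diag2_eigvec[OF that]
    by (rule cls_rules(4)[OF eigvec_homog[OF that(1)]])
  have span: "carrier SymQ \<subseteq> S" if S: "sub_space SymQ S" and e: "(\<lambda>a. cls (eigvec a)) ` ?A \<subseteq> S" for S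
  proof -
    let ?S = "{F \<in> carrier SymV. cls F \<in> S}"
    have S': "sub_space SymV ?S" by (rule sub_space_vimage[OF vec_space_Sym lin_map_cls S])
    have z: "\<zero>\<^bsub>SymQ\<^esub> \<in> S" using S by (simp add: sub_space_def)
    have "Dq ` homog k \<subseteq> ?S"
    proof
      fix F :: "'a poly poly" assume F: "F \<in> Dq ` homog k"
      then have "F \<in> homog (k + CARD('a) - 1)" "cls F = cls 0"
        using Dq_homog cls_eq_iff[OF _ homog_subspace(1), of F] by auto
      then show "F \<in> ?S" using z by (simp add: cls_rules(2) deg_eq)
    qed
    moreover have "theta * R \<in> ?S" if R: "R \<in> homog (k - 2)" for R
    proof -
      have "sub_space (Sym (k - 2)) {R \<in> carrier (Sym (k - 2)). theta * R \<in> ?S}"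
        by (rule sub_space_vimage[OF vec_space_Sym _ S'])
           (use theta_mult_homog in \<open>auto simp: lin_map_def deg_eq distrib_left mult.left_commute\<close>)
      moreover have "mon_low ` sub_range k \<subseteq> {R \<in> carrier (Sym (k - 2)). theta * R \<in> ?S}"
      proof
        fix F assume "F \<in> mon_low ` sub_range k"
        then obtain a where a: "a \<in> sub_range k" "F = mon_low a" by blast
        then have "cls (theta * F) \<in> S" using e by (auto simp: eigvec_def dest: subsetD[where c = "cls (eigvec a)"])
        then show "F \<in> {R \<in> carrier (Sym (k - 2)). theta * R \<in> ?S}"
          using mon_low_homog[OF a(1)] theta_mult_homog[OF mon_low_homog[OF a(1)]] by (simp add: a(2) deg_eq)
      qed
      ultimately show ?thesis using mon_low_span R by blast
    qed
    moreover have "mon_high ` quot_range CARD('a) k \<subseteq> ?S"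
      using e mon_high_homog ranges_disjoint by (auto simp: deg_eq eigvec_def)
    ultimately have "homog (k + CARD('a) - 1) \<subseteq> ?S" by (intro mon_high_span[OF S'])
    then show ?thesis unfolding cls_onto[symmetric] by blast
  qed
  note E = is_gl2_module_SymQ lin_map_beta bij_betw_beta sl2 b diag span
  show "is_gl2_module (H_dR_k k :: ('a, ('a, 'a) dR_cochain set) gl2_module)"
    unfolding H_dR_k_def by (rule is_gl2_module_extend_to_gl2[OF E])
  show "beta \<in> gl2_iso SymQ (H_dR_k k)"
    unfolding H_dR_k_def by (rule gl2_iso_extend_to_gl2[OF E])
qed

lemma proj_coker_props:
  shows is_gl2_module_Coker: "is_gl2_module Coker" and proj_coker_hom: "proj_coker k \<in> gl2_hom SymQ Coker"
    and proj_coker_onto: "proj_coker k ` carrier SymQ = carrier Coker"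
    and proj_coker_theta: "R \<in> homog (k - 2) \<Longrightarrow> proj_coker k (theta_bar k R) = \<zero>\<^bsub>Coker\<^esub>"
proof -
  note ex = short_exact_polynomials[unfolded short_exact_def]
  show "is_gl2_module Coker" "proj_coker k \<in> gl2_hom SymQ Coker" "proj_coker k ` carrier SymQ = carrier Coker"
    using ex by blast+
  have "theta_bar k ` carrier Sub = a_kernel SymQ Coker (proj_coker k)" using ex by blast
  then show "R \<in> homog (k - 2) \<Longrightarrow> proj_coker k (theta_bar k R) = \<zero>\<^bsub>Coker\<^esub>"
    unfolding a_kernel_def' by auto
qed

lemma lin_map_proj_cls: "lin_map SymV Coker (\<lambda>F. proj_coker k (cls F))"
proof -
  note c = lin_mapD[OF lin_map_cls] and p = gl2_homD[OF proj_coker_hom]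
    and z = gl2_hom_zero[OF is_gl2_module_SymQ is_gl2_module_Coker proj_coker_hom]
  show ?thesis unfolding lin_map_def using c p z by (auto simp del: Sym_simps)
qed

lemma
  shows is_gl2_module_H1_O: "is_gl2_module (H1_O_k k :: ('a, ('a, 'a) crv set) gl2_module)"
    and gamma_iso: "gamma \<in> gl2_iso Coker (H1_O_k k)"
proof -
  let ?A = "quot_range CARD('a) k"
  note p = gl2_homD[OF proj_coker_hom]
  have sl2: "gamma (act Coker g T) = sl2_O g (gamma T)" if g: "g \<in> SL2" and T: "T \<in> carrier Coker" for g :: "'a ^ 2 ^ 2" and T
  proof -
    obtain U where U: "U \<in> carrier SymQ" "T = proj_coker k U" using T unfolding proj_coker_onto[symmetric] by blast
    obtain F where F: "F \<in> homog (k + CARD('a) - 1)" "U = cls F" using U(1) unfolding cls_onto[symmetric] by blast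
    note gG = SL2_GL2[OF g]
    have "gamma (act Coker g T) = cls_O (act2 g F)"
      unfolding U(2) p(4)[OF gG U(1), symmetric] gamma_proj[OF is_gl2_moduleD(2)[OF is_gl2_module_SymQ gG U(1)]]
      unfolding F(2) act_SymQ[OF gG F(1)] by (rule pi_beta_cls[OF act2_homog[OF F(1)]])
    also have "\<dots> = sl2_O g (cls_O F)"
      unfolding cls_O_def sl2_O_cyc[OF g eps_homog[OF F(1)]] sl2_eps[OF g] ..
    also have "cls_O F = gamma T"
      unfolding U(2) gamma_proj[OF U(1)] unfolding F(2) pi_beta_cls[OF F(1)] ..
    finally show ?thesis .
  qed
  have b: "proj_coker k (cls (mon_high a)) \<in> carrier Coker \<and> gamma (proj_coker k (cls (mon_high a))) = basis_H1_O k a"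
    if "a \<in> ?A" for a
    using p(1)[OF cls_rules(1)[OF mon_high_homog[OF that]]] gamma_proj[OF cls_rules(1)[OF mon_high_homog[OF that]]]
      pi_beta_cls[OF mon_high_homog[OF that]] cls_O_mon_high[OF that] by simp
  have diag: "act Coker (diag2 x y) (proj_coker k (cls (mon_high a))) =
      (x powi (a + 1) * y powi (int k - a - 1)) \<odot>\<^bsub>Coker\<^esub> proj_coker k (cls (mon_high a))"
    if "a \<in> ?A" "x \<noteq> 0" "y \<noteq> 0" for a x y
  proof -
    have e: "eigvec a = mon_high a" using ranges_disjoint[OF that(1)] by (simp add: eigvec_def)
    have a: "a \<in> sub_range k \<union> ?A" using that(1) by simp
    note h = mon_high_homog[OF that(1)] and d = diag2_GL2[OF that(2,3)]
    show ?thesis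
      unfolding p(4)[OF d cls_rules(1)[OF h], symmetric] act_SymQ[OF d h]
        act2_diag2_eigvec[OF a that(2,3), unfolded e] cls_rules(4)[OF h] by (rule p(3)[OF cls_rules(1)[OF h]])
  qed
  have span: "carrier Coker \<subseteq> S" if S: "sub_space Coker S" and e: "(\<lambda>a. proj_coker k (cls (mon_high a))) ` ?A \<subseteq> S" for S
  proof -
    let ?S = "{F \<in> carrier SymV. proj_coker k (cls F) \<in> S}"
    have S': "sub_space SymV ?S" by (rule sub_space_vimage[OF vec_space_Sym lin_map_proj_cls S])
    have z: "\<zero>\<^bsub>Coker\<^esub> \<in> S" using S by (simp add: sub_space_def)
    have z': "proj_coker k (cls 0) = \<zero>\<^bsub>Coker\<^esub>" using lin_mapD(2)[OF lin_map_proj_cls] by simp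
    have "Dq ` homog k \<subseteq> ?S"
    proof
      fix F :: "'a poly poly" assume F: "F \<in> Dq ` homog k"
      then have "F \<in> homog (k + CARD('a) - 1)" "cls F = cls 0"
        using Dq_homog cls_eq_iff[OF _ homog_subspace(1), of F] by auto
      then show "F \<in> ?S" using z z' by (simp add: deg_eq)
    qed
    moreover have "theta * R \<in> ?S" if R: "R \<in> homog (k - 2)" for R
      using theta_mult_homog[OF R] proj_coker_theta[OF R] z by (simp add: deg_eq theta_bar_eq)
    moreover have "mon_high ` ?A \<subseteq> ?S" using e mon_high_homog by (auto simp: deg_eq)
    ultimately have "homog (k + CARD('a) - 1) \<subseteq> ?S" by (intro mon_high_span[OF S'])
    then show ?thesis unfolding proj_coker_onto[symmetric] cls_onto[symmetric] by blast
  qed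
  note E = is_gl2_module_Coker lin_map_gamma bij_betw_gamma sl2 b diag span
  show "is_gl2_module (H1_O_k k :: ('a, ('a, 'a) crv set) gl2_module)"
    unfolding H1_O_k_def by (rule is_gl2_module_extend_to_gl2[OF E])
  show "gamma \<in> gl2_iso Coker (H1_O_k k)"
    unfolding H1_O_k_def by (rule gl2_iso_extend_to_gl2[OF E])
qed

lemma alpha_beta_square: "R \<in> carrier Sub \<Longrightarrow> iota (alpha R) = beta (theta_bar k R)"
  using iota_form by (simp add: alpha_def)

lemma short_exact_cohomology:
  "short_exact (H0_k k :: ('a, ('a, 'a) kaehler) gl2_module) iota (H_dR_k k) pi_dR (H1_O_k k)"
  by (rule short_exact_transport[OF short_exact_polynomials is_gl2_module_H0 is_gl2_module_H_dR is_gl2_module_H1_O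
        alpha_iso beta_iso gamma_iso]) (simp_all add: alpha_beta_square gamma_proj)

lemma isomorphic_sequences:
  "\<exists>\<alpha> \<beta> \<gamma>.
     \<alpha> \<in> gl2_iso (H0_k k :: ('a, ('a, 'a) kaehler) gl2_module) (twist 1 (Sym (k - 2))) \<and>
     \<beta> \<in> gl2_iso (H_dR_k k :: ('a, ('a, 'a) dR_cochain set) gl2_module) (Sym_mod_Dq k) \<and>
     \<gamma> \<in> gl2_iso (H1_O_k k :: ('a, ('a, 'a) crv set) gl2_module) (coker_theta k) \<and>
     (\<forall>\<omega>\<in>carrier (H0_k k). \<beta> (iota \<omega>) = theta_bar k (\<alpha> \<omega>)) \<and>
     (\<forall>\<xi>\<in>carrier (H_dR_k k). \<gamma> (pi_dR \<xi>) = proj_coker k (\<beta> \<xi>))"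
proof (intro exI conjI ballI)
  let ?a = "inv_into (carrier Sub) alpha" and ?b = "inv_into (carrier SymQ) beta" and ?c = "inv_into (carrier Coker) gamma"
  show "?a \<in> gl2_iso (H0_k k) Sub" by (rule gl2_iso_inv_into[OF is_gl2_module_Sub alpha_iso])
  show "?b \<in> gl2_iso (H_dR_k k) SymQ" by (rule gl2_iso_inv_into[OF is_gl2_module_SymQ beta_iso])
  show "?c \<in> gl2_iso (H1_O_k k) Coker" by (rule gl2_iso_inv_into[OF is_gl2_module_Coker gamma_iso])
  have bij: "bij_betw alpha (carrier Sub) (carrier (H0_k k))" "bij_betw beta (carrier SymQ) (carrier (H_dR_k k))"
    "bij_betw gamma (carrier Coker) (carrier (H1_O_k k))"
    using alpha_iso beta_iso gamma_iso by (auto simp: gl2_iso_def)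
  have inv: "?a (alpha R) = R" if "R \<in> carrier Sub" for R using bij(1) that by (simp add: bij_betw_def)
  have inv': "?b (beta U) = U" if "U \<in> carrier SymQ" for U using bij(2) that by (simp add: bij_betw_def)
  have inv'': "?c (gamma T) = T" if "T \<in> carrier Coker" for T using bij(3) that by (simp add: bij_betw_def)
  show "?b (iota \<omega>) = theta_bar k (?a \<omega>)" if \<omega>: "\<omega> \<in> carrier (H0_k k)" for \<omega> :: "('a, 'a) kaehler"
  proof -
    obtain R where R: "R \<in> carrier Sub" "\<omega> = alpha R" using \<omega> bij(1) by (auto simp: bij_betw_def)
    show ?thesis
      unfolding R(2) alpha_beta_square[OF R(1)] inv[OF R(1)] by (rule inv'[OF gl2_homD(1)[OF theta_bar_hom R(1)]])
  qed
  show "?c (pi_dR \<xi>) = proj_coker k (?b \<xi>)" if \<xi>: "\<xi> \<in> carrier (H_dR_k k)" for \<xi> :: "('a, 'a) dR_cochain set"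
  proof -
    obtain U where U: "U \<in> carrier SymQ" "\<xi> = beta U" using \<xi> bij(2) by (auto simp: bij_betw_def)
    show ?thesis
      unfolding U(2) gamma_proj[OF U(1), symmetric] inv'[OF U(1)] by (rule inv''[OF gl2_homD(1)[OF proj_coker_hom U(1)]])
  qed
qed

end

section \<open>The cokernel over the prime field\<close>

text \<open>
  The substitution of \<open>a x\<close> for \<open>x\<close>, where \<open>a\<close> is nonzero with \<open>a\<^sup>m \<noteq> 1\<close>, multiplies the sum by \<open>a\<^sup>m\<close>. For
  \<open>m = 0\<close> there are \<open>q\<close> summands \<open>1\<close>.
\<close>

lemma sum_powers_zero:
  assumes m: "m < CARD('a::{finite,field}) - 1" and q: "of_nat CARD('a) = (0 :: 'a)"
  shows "(\<Sum>x\<in>UNIV. x ^ m) = (0 :: 'a)"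
proof (cases "m = 0")
  case False
  have "\<exists>a :: 'a. a \<noteq> 0 \<and> a ^ m \<noteq> 1"
  proof (rule ccontr)
    assume "\<nexists>a :: 'a. a \<noteq> 0 \<and> a ^ m \<noteq> 1"
    then have sub: "UNIV - {0 :: 'a} \<subseteq> {x. poly (Polynomial.monom 1 m - 1) x = 0}" by (auto simp: poly_monom)
    have nz: "Polynomial.monom (1 :: 'a) m - 1 \<noteq> 0"
      using False by (metis Polynomial.degree_1 degree_monom_eq eq_iff_diff_eq_0 zero_neq_one)
    have "Polynomial.degree (Polynomial.monom (1 :: 'a) m - 1) \<le> m"
      by (intro degree_diff_le degree_monom_le) simp
    then have "card {x. poly (Polynomial.monom (1 :: 'a) m - 1) x = 0} \<le> m"
      using card_poly_roots_bound[OF nz] by simp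
    moreover have "card (UNIV - {0 :: 'a}) \<le> card {x. poly (Polynomial.monom (1 :: 'a) m - 1) x = 0}"
      by (rule card_mono[OF poly_roots_finite[OF nz] sub])
    ultimately show False using m by (simp add: card_Diff_singleton)
  qed
  then obtain a :: 'a where a: "a \<noteq> 0" "a ^ m \<noteq> 1" by blast
  have "(\<Sum>x\<in>UNIV. x ^ m) = (\<Sum>x\<in>UNIV. (a * x) ^ m)"
  proof (rule sum.reindex_bij_witness[of UNIV "\<lambda>x. a * x" "\<lambda>x. x / a"])
  qed (use a in auto)
  then have "(a ^ m - 1) * (\<Sum>x\<in>UNIV. x ^ m) = 0"
    by (simp add: power_mult_distrib left_diff_distrib flip: sum_distrib_left)
  then show ?thesis using a by simp
qed (use q in simp)

lemma sum_powers_top: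
  assumes q: "of_nat CARD('a) = (0 :: 'a)" and q2: "CARD('a) > 2"
    and unit: "\<And>x :: 'a. x ^ CARD('a) = x"
  shows "(\<Sum>x\<in>UNIV. x ^ (CARD('a) - 1)) = (- 1 :: 'a::{finite,field})"
proof -
  have e: "x ^ (CARD('a) - 1) = 1" if "x \<noteq> 0" for x :: 'a
  proof -
    have "x * x ^ (CARD('a) - 1) = x ^ CARD('a)" using q2 by (simp flip: power_Suc)
    then show ?thesis using unit[of x] that by simp
  qed
  have "(\<Sum>x\<in>UNIV. x ^ (CARD('a) - 1)) = (\<Sum>x\<in>UNIV - {0}. (x :: 'a) ^ (CARD('a) - 1))"
    using q2 by (intro sum.mono_neutral_right) (auto simp: zero_power)
  also have "\<dots> = (\<Sum>x\<in>UNIV - {0 :: 'a}. 1)" by (rule sum.cong) (auto simp: e simp del: One_nat_def)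
  also have "\<dots> = of_nat (CARD('a) - 1)" by (simp add: card_Diff_singleton)
  also have "\<dots> = of_nat CARD('a) - 1" using q2 by (simp add: of_nat_diff)
  finally show ?thesis using q by simp
qed

context curve_setup
begin

abbreviation (input) ev :: "'a \<Rightarrow> 'a \<Rightarrow> 'a poly poly \<Rightarrow> 'a" where
  "ev \<equiv> subst2 (\<lambda>c. c)"

text \<open>
  The form \<open>x Y - y X\<close> is invariant under \<open>SL\<^sub>2\<close> if \<open>(x, y)\<close> and \<open>(X, Y)\<close> are transformed in the same
  way, and so is the set of all \<open>(x, y)\<close>.
\<close>

definition delta :: "'a poly poly \<Rightarrow> 'a poly poly" where
  "delta F = (\<Sum>(x, y)\<in>UNIV. cst2 (ev x y F) * (cst2 x * varY - cst2 y * varX) ^ (CARD('a) - 1 - k))"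

lemma is_ring_hom_ev: "is_ring_hom (ev x y)"
  by (rule is_ring_hom_subst2) (simp add: is_ring_hom_def)

lemma ev_generators: "ev x y (cst2 c) = c" "ev x y varX = x" "ev x y varY = y"
  by (rule subst2_generators; simp add: is_ring_hom_def)+

lemmas ev_hom = is_ring_homD[OF is_ring_hom_ev]

lemma delta_rules:
  "delta 0 = 0" "delta (F + G) = delta F + delta G" "delta (F - G) = delta F - delta G"
  "delta (cst2 c * F) = cst2 c * delta F"
  by (simp_all add: delta_def ev_hom ev_generators cst2_simps case_prod_beta algebra_simps sum.distrib sum_subtractf sum_distrib_left)

text \<open>
  Both factors of the double sum are sums of powers with exponents adding up to \<open>2 (q - 1)\<close>, so
  that they do not vanish only if both exponents are \<open>q - 1\<close>.
\<close>

lemma double_power_sum: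
  assumes "a + b = 2 * (CARD('a) - 1)"
  shows "(\<Sum>x\<in>UNIV. x ^ a) * (\<Sum>y\<in>UNIV. y ^ b) = (if a = CARD('a) - 1 then 1 else 0 :: 'a)"
proof -
  consider "a = CARD('a) - 1" "b = CARD('a) - 1" | "a < CARD('a) - 1" | "b < CARD('a) - 1" "a \<noteq> CARD('a) - 1" using assms by linarith
  then show ?thesis
    by cases (simp_all add: sum_powers_zero[OF _ q_zero] sum_powers_top[OF q_zero card_gt_2 power_q] del: One_nat_def)
qed

lemma delta_mon:
  assumes ij: "i + j = k + CARD('a) - 1"
  shows "delta (mon i j) =
    (if k \<le> i \<and> k \<le> j then cst2 ((- 1) ^ (i - k) * of_nat ((CARD('a) - 1 - k) choose (i - k))) * mon (i - k) (j - k) else 0)"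
proof -
  let ?n = "CARD('a) - 1 - k"
  let ?c = "\<lambda>s. (- 1) ^ s * of_nat (?n choose s) :: 'a"
  have q: "k + ?n = CARD('a) - 1" using k_less_q by simp
  have t: "cst2 (ev x y (mon i j)) * (cst2 x * varY - cst2 y * varX) ^ ?n =
      (\<Sum>s\<le>?n. cst2 (?c s * (x ^ (i + (?n - s)) * y ^ (j + s))) * mon s (?n - s))" for x y
  proof -
    have "(cst2 x * varY - cst2 y * varX) ^ ?n = (cst2 (- y) * varX + cst2 x * varY) ^ ?n"
      by (simp add: cst2_simps)
    also have "\<dots> = (\<Sum>s\<le>?n. of_nat (?n choose s) * (cst2 (- y) * varX) ^ s * (cst2 x * varY) ^ (?n - s))"
      by (rule binomial_ring)
    also have "\<dots> = (\<Sum>s\<le>?n. cst2 (?c s * (x ^ (?n - s) * y ^ s)) * mon s (?n - s))"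
    proof (rule sum.cong[OF refl])
      fix s
      have "(- y) ^ s = (- 1) ^ s * y ^ s" by (rule power_minus)
      then have "of_nat (?n choose s) * (cst2 (- y) * varX) ^ s * (cst2 x * varY) ^ (?n - s) =
          cst2 (of_nat (?n choose s)) * (cst2 ((- 1) ^ s * y ^ s) * varX ^ s) * (cst2 (x ^ (?n - s)) * varY ^ (?n - s))"
        by (simp only: power_mult_distrib cst2_simps(8) flip: cst2_simps(7))
      also have "\<dots> = cst2 (?c s * (x ^ (?n - s) * y ^ s)) * mon s (?n - s)"
        by (simp only: cst2_simps(3) mult_ac)
      finally show "of_nat (?n choose s) * (cst2 (- y) * varX) ^ s * (cst2 x * varY) ^ (?n - s) =
          cst2 (?c s * (x ^ (?n - s) * y ^ s)) * mon s (?n - s)" .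
    qed
    finally have b: "(cst2 x * varY - cst2 y * varX) ^ ?n = (\<Sum>s\<le>?n. cst2 (?c s * (x ^ (?n - s) * y ^ s)) * mon s (?n - s))" .
    have e: "ev x y (mon i j) = x ^ i * y ^ j" by (simp only: ev_hom ev_generators)
    show ?thesis
      unfolding b e sum_distrib_left
      by (rule sum.cong) (simp_all only: cst2_simps(3) power_add mult_ac)
  qed
  have "delta (mon i j) = (\<Sum>s\<le>?n. \<Sum>(x, y)\<in>UNIV. cst2 (?c s * (x ^ (i + (?n - s)) * y ^ (j + s))) * mon s (?n - s))"
    unfolding delta_def t unfolding split_def by (rule sum.swap)
  also have "\<dots> = (\<Sum>s\<le>?n. cst2 (if i = k + s then ?c s else 0) * mon s (?n - s))"
  proof (rule sum.cong[OF refl])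
    fix s assume s: "s \<in> {..?n}"
    have ab: "i + (?n - s) + (j + s) = 2 * (CARD('a) - 1)" using s ij q k_less_q by auto
    have "(\<Sum>(x, y)\<in>UNIV. cst2 (?c s * (x ^ (i + (?n - s)) * y ^ (j + s))) * mon s (?n - s)) =
        cst2 (?c s * (\<Sum>(x, y)\<in>UNIV. x ^ (i + (?n - s)) * y ^ (j + s))) * mon s (?n - s)"
      by (simp only: cst2_sum sum_distrib_left sum_distrib_right split_def)
    also have "(\<Sum>(x, y)\<in>UNIV. x ^ (i + (?n - s)) * y ^ (j + s)) =
        (\<Sum>x\<in>UNIV. x ^ (i + (?n - s))) * (\<Sum>y\<in>UNIV. y ^ (j + s) :: 'a)"
      by (simp only: sum_product UNIV_Times_UNIV[symmetric] sum.cartesian_product)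
    also have "\<dots> = (if i = k + s then 1 else 0)"
      unfolding double_power_sum[OF ab] using s q by auto
    finally show "(\<Sum>(x, y)\<in>UNIV. cst2 (?c s * (x ^ (i + (?n - s)) * y ^ (j + s))) * mon s (?n - s)) =
        cst2 (if i = k + s then ?c s else 0) * mon s (?n - s)" by simp
  qed
  also have "\<dots> = (if k \<le> i \<and> k \<le> j then cst2 (?c (i - k)) * mon (i - k) (j - k) else 0)"
  proof (cases "k \<le> i \<and> k \<le> j")
    case True
    have "(\<Sum>s\<le>?n. cst2 (if i = k + s then ?c s else 0) * mon s (?n - s)) =
        (\<Sum>s\<in>{i - k}. cst2 (if i = k + s then ?c s else 0) * mon s (?n - s))"
      using True ij k_less_q by (intro sum.mono_neutral_right) (auto simp: cst2_simps)
    moreover have "?n - (i - k) = j - k" using True ij k_less_q by auto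
    ultimately show ?thesis using True by simp
  next
    case False
    then have "i \<noteq> k + s" if "s \<le> ?n" for s using that ij k_less_q by auto
    then have "(\<Sum>s\<le>?n. cst2 (if i = k + s then ?c s else 0) * mon s (?n - s)) = (0 :: 'a poly poly)"
      by (intro sum.neutral) (auto simp: cst2_simps)
    then show ?thesis unfolding if_not_P[OF False] .
  qed
  finally show ?thesis .
qed

lemma delta_homog: "F \<in> homog (k + CARD('a) - 1) \<Longrightarrow> delta F \<in> homog (CARD('a) - 1 - k)"
proof (induction F rule: homog_induct)
  case (mon c i j)
  show ?case
  proof (cases "k \<le> i \<and> k \<le> j")
    case True
    show ?thesis
      unfolding delta_rules delta_mon[OF mon] if_P[OF True] by (intro homog_subspace(5) mon_homog) (use mon True in auto)
  next
    case False
    show ?thesis unfolding delta_rules delta_mon[OF mon] if_not_P[OF False] by (simp add: homog_subspace(1))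
  qed
qed (simp_all add: delta_rules homog_subspace)

lemma coeff_delta:
  assumes F: "F \<in> homog (k + CARD('a) - 1)" and st: "s + t = CARD('a) - 1 - k"
  shows "coeff2 (delta F) s t = (- 1) ^ s * of_nat ((CARD('a) - 1 - k) choose s) * coeff2 F (s + k) (t + k)"
  using F
proof (induction F rule: homog_induct)
  case (mon c i j)
  show ?case
  proof (cases "k \<le> i \<and> k \<le> j")
    case True
    have d: "delta (cst2 c * mon i j) =
        cst2 (c * ((- 1) ^ (i - k) * of_nat ((CARD('a) - 1 - k) choose (i - k)))) * mon (i - k) (j - k)"
      unfolding delta_rules delta_mon[OF mon] using True by (simp only: cst2_simps(3) mult.assoc if_True simp_thms)
    have ij: "i - k = s \<and> j - k = t \<longleftrightarrow> i = s + k \<and> j = t + k" using True by auto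
    show ?thesis
      unfolding d coeff2_mon ij
      by (cases "i = s + k \<and> j = t + k"; simp only: if_True if_False simp_thms mult_zero_left mult_ac add_diff_cancel_right')
  next
    case False
    then show ?thesis unfolding delta_rules delta_mon[OF mon] coeff2_mon by auto
  qed
qed (simp_all add: delta_rules algebra_simps)

text \<open>
  The substitution \<open>(x, y) \<mapsto> (x, y) g\<close> in the sum, together with the invariance of the pairing
  \<open>x Y - y X\<close> up to the determinant.
\<close>

lemma delta_act2:
  assumes g: "g \<in> GL2"
  shows "delta (act2 g F) = cst2 (det g ^ k) * act2 g (delta F)"
proof -
  define a b c d where "a = g$1$1" and "b = g$1$2" and "c = g$2$1" and "d = g$2$2"
  have D: "det g = a * d - b * c" by (simp add: det_2 a_def b_def c_def d_def)
  have D0: "det g \<noteq> 0" using g by (simp add: GL2_def invertible_det_nz)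
  let ?n = "CARD('a) - 1 - k"
  define h where "h = (\<lambda>(x, y). (a * x + c * y, b * x + d * y))"
  have ev: "ev x y (act2 g F) = ev (a * x + c * y) (b * x + d * y) F" for x y
    by (rule ring_hom_poly2_eqI[OF is_ring_hom_comp[OF is_ring_hom_ev is_ring_hom_act2] is_ring_hom_ev])
       (simp_all add: ev_hom ev_generators act2_generators a_def b_def c_def d_def)
  have "inj h"
  proof (rule injI)
    fix v w assume vw: "h v = h w"
    obtain x y x' y' where e: "v = (x, y)" "w = (x', y')" by (cases v; cases w) auto
    have 1: "a * (x - x') + c * (y - y') = 0" "b * (x - x') + d * (y - y') = 0" using vw by (simp_all add: h_def e algebra_simps)
    have "det g * (x - x') = d * (a * (x - x') + c * (y - y')) - c * (b * (x - x') + d * (y - y'))"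
      "det g * (y - y') = a * (b * (x - x') + d * (y - y')) - b * (a * (x - x') + c * (y - y'))"
      by (simp_all add: D algebra_simps)
    then show "v = w" unfolding 1 using D0 by (simp add: e)
  qed
  then have bij: "bij_betw h UNIV UNIV" using finite_UNIV_inj_surj[OF finite] by (auto simp: bij_betw_def)
  have lin: "act2 g (cst2 x' * varY - cst2 y' * varX) = cst2 (det g) * (cst2 x * varY - cst2 y * varX)"
    if "(x', y') = h (x, y)" for x y x' y'
  proof -
    have "act2 g (cst2 x' * varY - cst2 y' * varX) = cst2 x' * (cst2 b * varX + cst2 d * varY) - cst2 y' * (cst2 a * varX + cst2 c * varY)"
      by (simp only: act2_hom act2_generators a_def b_def c_def d_def)
    then show ?thesis using that by (simp add: h_def D cst2_simps algebra_simps)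
  qed
  have "act2 g (delta F) = (\<Sum>v\<in>UNIV. cst2 (ev (fst v) (snd v) F) * act2 g (cst2 (fst v) * varY - cst2 (snd v) * varX) ^ ?n)"
    unfolding delta_def case_prod_beta by (simp only: act2_hom(9,3,7) act2_generators(1))
  also have "\<dots> = (\<Sum>v\<in>UNIV. cst2 (ev (fst (h v)) (snd (h v)) F) * act2 g (cst2 (fst (h v)) * varY - cst2 (snd (h v)) * varX) ^ ?n)"
    by (rule sum.reindex_bij_betw[OF bij, symmetric])
  also have "\<dots> = (\<Sum>v\<in>UNIV. cst2 (det g ^ ?n) * (cst2 (ev (fst v) (snd v) (act2 g F)) * (cst2 (fst v) * varY - cst2 (snd v) * varX) ^ ?n))"
  proof (rule sum.cong[OF refl])
    fix v :: "'a \<times> 'a"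
    have "cst2 (ev (fst (h v)) (snd (h v)) F) = cst2 (ev (fst v) (snd v) (act2 g F))"
      unfolding ev by (simp add: h_def case_prod_beta)
    moreover have "act2 g (cst2 (fst (h v)) * varY - cst2 (snd (h v)) * varX) = cst2 (det g) * (cst2 (fst v) * varY - cst2 (snd v) * varX)"
      by (rule lin) simp
    ultimately show "cst2 (ev (fst (h v)) (snd (h v)) F) * act2 g (cst2 (fst (h v)) * varY - cst2 (snd (h v)) * varX) ^ ?n =
        cst2 (det g ^ ?n) * (cst2 (ev (fst v) (snd v) (act2 g F)) * (cst2 (fst v) * varY - cst2 (snd v) * varX) ^ ?n)"
      by (simp only: power_mult_distrib cst2_simps(7) mult_ac)
  qed
  also have "\<dots> = cst2 (det g ^ ?n) * delta (act2 g F)"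
    unfolding delta_def case_prod_beta by (simp only: sum_distrib_left)
  finally have 1: "act2 g (delta F) = cst2 (det g ^ ?n) * delta (act2 g F)" .
  have "det g * det g ^ (k + ?n) = det g ^ CARD('a)" using k_less_q by (simp flip: power_Suc)
  then have "det g ^ k * det g ^ ?n = 1" using D0 by (simp add: power_add)
  then have "cst2 (det g ^ k) * (cst2 (det g ^ ?n) * f) = f" for f :: "'a poly poly"
    by (simp add: cst2_simps(1) flip: cst2_simps(3) mult.assoc)
  then show ?thesis unfolding 1 by simp
qed

text \<open>
  All monomials in \<open>D W\<close> and in \<open>\<theta>\<^sub>q R\<close> have an exponent which is at least \<open>q\<close>, and hence the other
  one is less than \<open>k\<close>.
\<close>

lemma delta_exact_plus_theta:
  assumes "F \<in> exact_plus_theta"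
  shows "delta F = 0"
proof -
  have big: "delta (mon i j) = 0" if "i + j = k + CARD('a) - 1" "CARD('a) \<le> i \<or> CARD('a) \<le> j" for i j
  proof -
    have "\<not> (k \<le> i \<and> k \<le> j)" using that card_gt_2 by auto
    then show ?thesis unfolding delta_mon[OF that(1)] by (rule if_not_P)
  qed
  have 1: "delta (Dq W) = 0" if "W \<in> homog k" for W
    using that
  proof (induction W rule: homog_induct)
    case (mon c i j)
    have i: "cst2 (of_nat i) * delta (mon (i - 1 + CARD('a)) j) = 0"
      using mon k_ge_2 by (cases i) (simp add: cst2_simps, subst big, auto)
    have j: "cst2 (of_nat j) * delta (mon i (j - 1 + CARD('a))) = 0"
      using mon k_ge_2 by (cases j) (simp add: cst2_simps, subst big, auto)
    show ?case unfolding Dq_rules delta_rules i j by simp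
  qed (simp_all add: Dq_rules delta_rules)
  have 2: "delta (theta * R) = 0" if "R \<in> homog (k - 2)" for R
    using that
  proof (induction R rule: homog_induct)
    case (mon c i j)
    have "theta * (cst2 c * mon i j) = cst2 c * (mon (i + CARD('a)) (j + 1) - mon (i + 1) (j + CARD('a)))"
      by (simp add: theta_def power_add algebra_simps)
    moreover have "delta (mon (i + CARD('a)) (j + 1)) = 0" "delta (mon (i + 1) (j + CARD('a))) = 0"
      by (rule big; use mon k_ge_2 in auto)+
    ultimately show ?case by (simp only: delta_rules diff_self mult_zero_right)
  qed (simp_all add: delta_rules distrib_left)
  show ?thesis using assms unfolding exact_plus_theta_def by (auto simp: delta_rules 1 2)
qed

text \<open>The binomial coefficients are units in characteristic \<open>p\<close> because their upper index is below \<open>p\<close>.\<close>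

lemma binomial_nonzero:
  assumes "CARD('a) = p" "s \<le> CARD('a) - 1 - k"
  shows "of_nat ((CARD('a) - 1 - k) choose s) \<noteq> (0 :: 'a)"
proof
  let ?n = "CARD('a) - 1 - k"
  assume "of_nat (?n choose s) = (0 :: 'a)"
  then have "p dvd ?n choose s" by (simp add: of_nat_eq_0_iff_char_dvd CHAR_eq)
  then have "p dvd fact ?n" using binomial_fact_lemma[OF assms(2)] by (metis dvd_mult)
  then have "p \<le> ?n" using prime_dvd_fact_iff[OF prime_p] by simp
  then show False using assms(1) k_ge_2 card_gt_2 by simp
qed

lemma delta_eq_zero_iff:
  assumes p: "CARD('a) = p" and F: "F \<in> homog (k + CARD('a) - 1)"
  shows "delta F = 0 \<longleftrightarrow> F \<in> exact_plus_theta"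
proof
  assume z: "delta F = 0"
  show "F \<in> exact_plus_theta"
  proof (rule exact_plus_thetaI[OF F])
    fix i j assume ij: "i + j = k + CARD('a) - 1" "i < CARD('a)" "j < CARD('a)"
    have st: "(i - k) + (j - k) = CARD('a) - 1 - k" and k: "i - k + k = i" "j - k + k = j" and s: "i - k \<le> CARD('a) - 1 - k"
      using ij by auto
    have "(- 1) ^ (i - k) * of_nat ((CARD('a) - 1 - k) choose (i - k)) * coeff2 F i j = 0"
      using coeff_delta[OF F st] unfolding z k by simp
    then show "coeff2 F i j = 0" using binomial_nonzero[OF p s] by simp
  qed
qed (rule delta_exact_plus_theta)

lemma delta_onto:
  assumes p: "CARD('a) = p"
  shows "delta ` homog (k + CARD('a) - 1) = homog (CARD('a) - 1 - k)"
proof (rule equalityI; rule subsetI)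
  fix P :: "'a poly poly" assume "P \<in> homog (CARD('a) - 1 - k)"
  then show "P \<in> delta ` homog (k + CARD('a) - 1)"
  proof (induction P rule: homog_induct)
    case zero
    show ?case using delta_rules(1) homog_subspace(1) by (metis imageI)
  next
    case (add f g)
    then obtain F G where FG: "F \<in> homog (k + CARD('a) - 1)" "G \<in> homog (k + CARD('a) - 1)" "f = delta F" "g = delta G" by blast
    then have "f + g = delta (F + G)" by (simp only: delta_rules)
    then show ?case using homog_subspace(2)[OF FG(1,2)] by blast
  next
    case (mon c s t)
    let ?e = "(- 1) ^ s * of_nat ((CARD('a) - 1 - k) choose s) :: 'a"
    have "?e \<noteq> 0" using binomial_nonzero[OF p, of s] mon by auto
    then have e: "c / ?e * ?e = c" by simp
    have ij: "(s + k) + (t + k) = k + CARD('a) - 1" using mon k_less_q by auto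
    have "delta (cst2 (c / ?e) * mon (s + k) (t + k)) = cst2 (c / ?e * ?e) * mon s t"
      unfolding delta_rules delta_mon[OF ij] by (simp only: cst2_simps(3) le_add2 simp_thms if_True add_diff_cancel_right' mult.assoc)
    then have "cst2 c * mon s t = delta (cst2 (c / ?e) * mon (s + k) (t + k))" unfolding e by (rule sym)
    moreover have "cst2 (c / ?e) * mon (s + k) (t + k) \<in> homog (k + CARD('a) - 1)"
      by (intro homog_subspace(5) mon_homog ij)
    ultimately show ?case by blast
  qed
qed (use delta_homog in blast)

lemma coker_iso_prime:
  assumes p: "CARD('a) = p"
  shows "\<exists>\<delta>. \<delta> \<in> gl2_iso (coker_theta k :: ('a, 'a poly poly set set) gl2_module) (twist k (Sym (CARD('a) - 1 - k)))"
proof -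
  let ?T = "twist k (Sym (CARD('a) - 1 - k)) :: ('a, 'a poly poly) gl2_module"
  have T: "is_gl2_module ?T" by (rule is_gl2_module_twist[OF is_gl2_module_Sym])
  note VT = is_gl2_moduleD(1)[OF T]
  have lin: "lin_map SymV ?T delta" unfolding lin_map_def using delta_homog by (auto simp: deg_eq delta_rules)
  have ker: "Dq ` carrier (Sym k) \<subseteq> lin_ker SymV ?T delta"
  proof
    fix F :: "'a poly poly" assume "F \<in> Dq ` carrier (Sym k)"
    then obtain W where W: "W \<in> homog k" "F = Dq W" by auto
    then have "F = Dq W + theta * 0" by simp
    then have "F \<in> exact_plus_theta" unfolding exact_plus_theta_def using W(1) homog_subspace(1) by blast
    then show "F \<in> lin_ker SymV ?T delta"
      using Dq_homog[OF W(1)] delta_exact_plus_theta by (simp add: lin_ker_def W(2) deg_eq)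
  qed
  define d1 where "d1 = quot_lift delta"
  note Q = vec_space_Sym VT lin ker sub_space_exact
  have d1: "d1 (cls F) = delta F" if "F \<in> homog (k + CARD('a) - 1)" for F
    using quot_lift_coset[OF Q] that by (simp add: d1_def cls_def deg_eq)
  have lin1: "lin_map SymQ ?T d1"
    using lin_map_quot_lift[OF Q] by (simp add: lin_map_def SymQ_simps d1_def)
  have ker1: "lin_ker SymQ ?T d1 = theta_bar k ` carrier (Sym (k - 2))"
  proof -
    have "U \<in> lin_ker SymQ ?T d1 \<longleftrightarrow> U \<in> theta_bar k ` homog (k - 2)" if U: "U \<in> carrier SymQ" for U
    proof -
      obtain F where F: "F \<in> homog (k + CARD('a) - 1)" "U = cls F" using U unfolding cls_onto[symmetric] by blast
      show ?thesis
        unfolding F(2) lin_ker_def mem_Collect_eq d1[OF F(1)] cls_theta_image_iff[OF F(1)] delta_eq_zero_iff[OF p F(1), symmetric]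
        using cls_rules(1)[OF F(1)] by simp
    qed
    moreover have "theta_bar k ` homog (k - 2) \<subseteq> carrier SymQ" using gl2_homD(1)[OF theta_bar_hom] by auto
    ultimately show ?thesis by (auto simp: lin_ker_def)
  qed
  have W: "sub_space SymQ (theta_bar k ` carrier (Sym (k - 2)))" using sub_rep_theta by (simp add: sub_rep_def)
  define d2 where "d2 = quot_lift d1"
  note Q1 = is_gl2_moduleD(1)[OF is_gl2_module_SymQ] VT lin1 equalityD2[OF ker1] W
  have d2: "d2 (proj_coker k U) = d1 U" if "U \<in> carrier SymQ" for U
    using quot_lift_coset[OF Q1 that] by (simp add: d2_def proj_coker_def)
  have lin2: "lin_map Coker ?T d2"
    using lin_map_quot_lift[OF Q1] by (simp add: lin_map_def Coker_simps d2_def)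
  have "d1 ` carrier SymQ = carrier ?T"
    unfolding cls_onto[symmetric] image_image using delta_onto[OF p] d1 by (simp cong: image_cong)
  then have bij: "bij_betw d2 (carrier Coker) (carrier ?T)"
    using bij_betw_quot_lift[OF Q1 _ equalityD1[OF ker1]] by (simp add: Coker_simps d2_def)
  have act: "d2 (act Coker g V) = act ?T g (d2 V)" if g: "g \<in> GL2" and V: "V \<in> carrier Coker" for g V
  proof -
    obtain U where U: "U \<in> carrier SymQ" "V = proj_coker k U" using V unfolding proj_coker_onto[symmetric] by blast
    obtain F where F: "F \<in> homog (k + CARD('a) - 1)" "U = cls F" using U(1) unfolding cls_onto[symmetric] by blast
    have "d2 (act Coker g V) = d1 (act SymQ g U)"
      unfolding U(2) gl2_homD(4)[OF proj_coker_hom g U(1), symmetric] by (rule d2[OF is_gl2_moduleD(2)[OF is_gl2_module_SymQ g U(1)]])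
    also have "\<dots> = delta (act2 g F)" unfolding F(2) act_SymQ[OF g F(1)] by (rule d1[OF act2_homog[OF F(1)]])
    also have "\<dots> = act ?T g (delta F)" unfolding delta_act2[OF g] by simp
    also have "delta F = d2 V" unfolding U(2) d2[OF U(1)] unfolding F(2) d1[OF F(1)] ..
    finally show ?thesis .
  qed
  have "d2 \<in> gl2_iso Coker ?T"
    unfolding gl2_iso_def gl2_hom_def using lin_mapD[OF lin2] bij act by blast
  then show ?thesis by blast
qed

end

theorem proposition4p1:
  fixes p q n k :: nat
  assumes "prime p" and "q = p ^ n" and "q > 2" and "CARD('a::{finite,field}) = q"
    and "2 \<le> k" and "k \<le> p - 1"
  shows "short_exact (H0_k k :: ('a, ('a, 'a) kaehler) gl2_module) iota (H_dR_k k) pi_dR (H1_O_k k) \<and>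
     short_exact (twist 1 (Sym (k - 2)) :: ('a, 'a poly poly) gl2_module) (theta_bar k)
       (Sym_mod_Dq k) (proj_coker k) (coker_theta k) \<and>
     (\<exists>\<alpha> \<beta> \<gamma>.
        \<alpha> \<in> gl2_iso (H0_k k :: ('a, ('a, 'a) kaehler) gl2_module) (twist 1 (Sym (k - 2))) \<and>
        \<beta> \<in> gl2_iso (H_dR_k k :: ('a, ('a, 'a) dR_cochain set) gl2_module) (Sym_mod_Dq k) \<and>
        \<gamma> \<in> gl2_iso (H1_O_k k :: ('a, ('a, 'a) crv set) gl2_module) (coker_theta k) \<and>
        (\<forall>\<omega>\<in>carrier (H0_k k). \<beta> (iota \<omega>) = theta_bar k (\<alpha> \<omega>)) \<and>
        (\<forall>\<xi>\<in>carrier (H_dR_k k). \<gamma> (pi_dR \<xi>) = proj_coker k (\<beta> \<xi>))) \<and>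
     (q = p \<longrightarrow>
        (\<exists>\<delta>. \<delta> \<in> gl2_iso (coker_theta k :: ('a, 'a poly poly set set) gl2_module)
               (twist k (Sym (q - 1 - k)))))"
proof -
  interpret curve_setup p n k "TYPE('a)" using assms by unfold_locales auto
  have "q = p \<longrightarrow> (\<exists>\<delta>. \<delta> \<in> gl2_iso (coker_theta k :: ('a, 'a poly poly set set) gl2_module) (twist k (Sym (q - 1 - k))))"
    using coker_iso_prime assms(4) by auto
  then show ?thesis using short_exact_cohomology short_exact_polynomials isomorphic_sequences by blast
qed

end
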